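(* Let $A_0:\Delta^*\times\Omega\to\mathbb R^{n\times n}$ and $A_1:[0,T]\times\Omega\to\mathbb R^{n\times n}$ be measurable and uniformly bounded, such that for any $t\in[0,T]$, $s\mapsto(A_0(t,s),A_1(s))$ is $\mathbb F$-progressively measurable on $[0,t]$, and for any $s\in[0,T)$, $t\mapsto A_0(t,s)$ is continuous on $[s,T]$. Consider the linear forward stochastic Volterra integral equation $$X(t)=\varphi(t)+\int_0^tA_0(t,s)X(s)ds+\int_0^tA_1(s)X(s)dW(s),\qquad t\in[0,T].\tag{E}$$ (i) Suppose $$A_0(t,s)\in\mathbb R^{n\times n}_+,\quad A_1(s)=0,\qquad\text{a.e. }(t,s)\in\Delta^*,\ \text{a.s.}$$ Then for any $\varphi(\cdot)\in L^2_{\mathbb F}(0,T;\mathbb R^n)$ with $\varphi(\cdot)\ge0$, equation (E) admits a unique solution $X(\cdot)\in L^2_{\mathbb F}(0,T;\mathbb R^n)$ and it satisfies $$X(t)\ge\varphi(t)\ge0,\qquad t\in[0,T].$$ (ii) Suppose $$A_0(t,s)\in\mathbb R^{n\times n}_{*+},\quad A_1(s)\in\mathbb R^{n\times n}_d,\qquad\text{a.e. }(t,s)\in\Delta^*,\ \text{a.s.}$$ Moreover, suppose there exists a continuous nondecreasing function $\rho:[0,T]\to[0,\infty)$ with $\rho(0)=0$ such that $$|A_0(t,s)-A_0(t',s)|\le\rho(|t-t'|),\qquad t,t'\in[0,T],\ s\in[0,t\wedge t'],\ \text{a.s.},$$ and $$A_0(\tau,s)-A_0(t,s)\in\mathbb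 R^{n\times n}_+,\qquad\forall\,0\le s\le t\le\tau\le T,\ \text{a.s.}$$ Then for any $\varphi(\cdot)\in C_{\mathbb F}([0,T];L^2(\Omega;\mathbb R^n))$ with $$\varphi(\tau)\ge\varphi(t)\ge0,\qquad\forall\,0\le t\le\tau\le T,\ \text{a.s.},$$ equation (E) admits a unique solution $X(\cdot)\in C_{\mathbb F}([0,T];L^2(\Omega;\mathbb R^n))$ and it satisfies $$X(t)\ge0,\qquad t\in[0,T],\ \text{a.s.}$$
   Context: $T>0$ and $n\ge1$ are fixed. $(\Omega,\mathcal F,\mathbb F,\mathbb P)$ is a complete filtered probability space carrying a one-dimensional standard Brownian motion $W(\cdot)$, and $\mathbb F=\{\mathcal F_t\}_{t\ge0}$ is the natural filtration of $W$ augmented by all $\mathbb P$-null sets. $\Delta^*=\{(t,s)\in[0,T]^2: t\ge s\}$. For $x,y\in\mathbb R^n$, $x\ge y$ means componentwise inequality. $\mathbb R^{n\times n}_+$ is the set of $n\times n$ real matrices with all entries nonnegative; $\mathbb R^{n\times n}_{*+}$ is the set of $n\times n$ real matrices whose off-diagonal entries are all nonnegative (no condition on the diagonal); $\mathbb R^{n\times n}_d$ is the set of diagonal $n\times n$ real matrices. $L^2_{\mathbb F}(0,T;\mathbb R^n)$ is the set of $\mathbb F$-adapted processes $X$ with $\mathbb E\int_0^T|X(t)|^2dt<\infty$; pointwise (in)equalities between elements of this space are understood for a.e. $t$, a.s. $C_{\mathbb F}([0,T];L^2(\Omega;\mathbb R^n))$ is the set of $\mathbb F$-adapted processes $X$ such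 that $t\mapsto X(t)$ is continuous from $[0,T]$ into $L^2(\Omega;\mathbb R^n)$ (so $\sup_t\mathbb E|X(t)|^2<\infty$). *)

theory Defs
  imports "HOL-Probability.Probability"
begin

subsection \<open>Brownian motion and its augmented natural filtration\<close>

definition natural_filtration :: "'a measure \<Rightarrow> (real \<Rightarrow> 'a \<Rightarrow> real) \<Rightarrow> real \<Rightarrow> 'a measure" where
  "natural_filtration M W t =
     sigma (space M) {W s -` B \<inter> space M | s B. 0 \<le> s \<and> s \<le> t \<and> B \<in> sets borel}"

text \<open>For a complete measure, \<open>null_sets M\<close> contains every subset of a null event.\<close>

definition augmented_filtration :: "'a measure \<Rightarrow> (real \<Rightarrow> 'a \<Rightarrow> real) \<Rightarrow> real \<Rightarrow> 'a measure" where
  "augmented_filtration M W t =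
     sigma (space M) (sets (natural_filtration M W t) \<union> null_sets M)"

definition standard_brownian_motion :: "'a measure \<Rightarrow> (real \<Rightarrow> 'a \<Rightarrow> real) \<Rightarrow> bool" where
  "standard_brownian_motion M W \<longleftrightarrow>
     (\<forall>t\<ge>0. W t \<in> borel_measurable M) \<and>
     (AE \<omega> in M. W 0 \<omega> = 0) \<and>
     (AE \<omega> in M. continuous_on {0..} (\<lambda>t. W t \<omega>)) \<and>
     (\<forall>s t. 0 \<le> s \<and> s < t \<longrightarrow>
        distributed M lborel (\<lambda>\<omega>. W t \<omega> - W s \<omega>) (normal_density 0 (sqrt (t - s))) \<and>
        prob_space.indep_set M (sets (natural_filtration M W s))
          {(\<lambda>\<omega>. W t \<omega> - W s \<omega>) -` B \<inter> space M | B. B \<in> sets borel})"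

subsection \<open>Spaces of processes\<close>

definition measurable_process ::
  "'a measure \<Rightarrow> real \<Rightarrow> (real \<Rightarrow> 'a \<Rightarrow> 'b::topological_space) \<Rightarrow> bool" where
  "measurable_process M T X \<longleftrightarrow>
     (\<lambda>(t, \<omega>). X t \<omega>) \<in> borel_measurable (restrict_space borel {0..T} \<Otimes>\<^sub>M M)"

definition adapted_process ::
  "'a measure \<Rightarrow> (real \<Rightarrow> 'a \<Rightarrow> real) \<Rightarrow> real \<Rightarrow> (real \<Rightarrow> 'a \<Rightarrow> 'b::topological_space) \<Rightarrow> bool" where
  "adapted_process M W T X \<longleftrightarrow>
     (\<forall>t\<in>{0..T}. X t \<in> borel_measurable (augmented_filtration M W t))"

definition progressive_process ::
  "'a measure \<Rightarrow> (real \<Rightarrow> 'a \<Rightarrow> real) \<Rightarrow> real \<Rightarrow> (real \<Rightarrow> 'a \<Rightarrow> 'b::topological_space) \<Rightarrow> bool" where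
  "progressive_process M W T X \<longleftrightarrow>
     (\<forall>t\<in>{0..T}. (\<lambda>(s, \<omega>). X s \<omega>)
        \<in> borel_measurable (restrict_space borel {0..t} \<Otimes>\<^sub>M augmented_filtration M W t))"

text \<open>Joint measurability is what gives \<open>E \<integral>\<^sub>0\<^sup>T |X(t)|\<^sup>2 dt\<close> a meaning; equality in this space
  is equality for almost every \<open>t\<close>, almost surely.\<close>

definition L2F :: "'a measure \<Rightarrow> (real \<Rightarrow> 'a \<Rightarrow> real) \<Rightarrow> real \<Rightarrow>
    (real \<Rightarrow> 'a \<Rightarrow> 'b::real_normed_vector) set" where
  "L2F M W T = {X. measurable_process M T X \<and> adapted_process M W T X \<and>
     (\<integral>\<^sup>+\<omega>. (\<integral>\<^sup>+t\<in>{0..T}. ennreal ((norm (X t \<omega>))\<^sup>2) \<partial>lborel) \<partial>M) < \<infinity>}"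

definition CF :: "'a measure \<Rightarrow> (real \<Rightarrow> 'a \<Rightarrow> real) \<Rightarrow> real \<Rightarrow>
    (real \<Rightarrow> 'a \<Rightarrow> 'b::real_normed_vector) set" where
  "CF M W T = {X. adapted_process M W T X \<and>
     (\<forall>t\<in>{0..T}. (\<integral>\<^sup>+\<omega>. ennreal ((norm (X t \<omega>))\<^sup>2) \<partial>M) < \<infinity>) \<and>
     (\<forall>t\<in>{0..T}. ((\<lambda>s. \<integral>\<^sup>+\<omega>. ennreal ((norm (X s \<omega> - X t \<omega>))\<^sup>2) \<partial>M) \<longlongrightarrow> 0)
        (at t within {0..T}))}"

subsection \<open>The Ito integral\<close>

text \<open>The data \<open>m, \<tau>, \<xi>\<close> encode \<open>\<Sum>i<m. \<xi> i 1\<^bsub>(\<tau> i, \<tau> (i + 1)]\<^esub>\<close> on \<open>[0, t]\<close>.\<close>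

definition elementary_data :: "'a measure \<Rightarrow> (real \<Rightarrow> 'a \<Rightarrow> real) \<Rightarrow> real \<Rightarrow>
    nat \<Rightarrow> (nat \<Rightarrow> real) \<Rightarrow> (nat \<Rightarrow> 'a \<Rightarrow> real) \<Rightarrow> bool" where
  "elementary_data M W t m \<tau> \<xi> \<longleftrightarrow>
     0 \<le> \<tau> 0 \<and> (\<forall>i<m. \<tau> i < \<tau> (Suc i)) \<and> \<tau> m \<le> t \<and>
     (\<forall>i<m. \<xi> i \<in> borel_measurable (augmented_filtration M W (\<tau> i)) \<and>
        (\<exists>C. \<forall>\<omega>\<in>space M. \<bar>\<xi> i \<omega>\<bar> \<le> C))"

definition elementary_process ::
  "nat \<Rightarrow> (nat \<Rightarrow> real) \<Rightarrow> (nat \<Rightarrow> 'a \<Rightarrow> real) \<Rightarrow> real \<Rightarrow> 'a \<Rightarrow> real" where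
  "elementary_process m \<tau> \<xi> s \<omega> = (\<Sum>i<m. \<xi> i \<omega> * indicator {\<tau> i<..\<tau> (Suc i)} s)"

definition elementary_integral :: "(real \<Rightarrow> 'a \<Rightarrow> real) \<Rightarrow>
    nat \<Rightarrow> (nat \<Rightarrow> real) \<Rightarrow> (nat \<Rightarrow> 'a \<Rightarrow> real) \<Rightarrow> 'a \<Rightarrow> real" where
  "elementary_integral W m \<tau> \<xi> \<omega> = (\<Sum>i<m. \<xi> i \<omega> * (W (\<tau> (Suc i)) \<omega> - W (\<tau> i) \<omega>))"

text \<open>\<open>has_ito_integral M W t H I\<close> means \<open>I = \<integral>\<^sub>0\<^sup>t H(s) dW(s)\<close> almost surely: by the Ito isometry,
  \<open>I\<close> is the limit in \<open>L\<^sup>2(\<Omega>)\<close> of the integrals of elementary processes converging to \<open>H\<close> in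
  \<open>L\<^sup>2([0, t] \<times> \<Omega>)\<close>, and it is determined up to a null set.\<close>

definition has_ito_integral :: "'a measure \<Rightarrow> (real \<Rightarrow> 'a \<Rightarrow> real) \<Rightarrow> real \<Rightarrow>
    (real \<Rightarrow> 'a \<Rightarrow> real) \<Rightarrow> ('a \<Rightarrow> real) \<Rightarrow> bool" where
  "has_ito_integral M W t H I \<longleftrightarrow>
     H \<in> L2F M W t \<and> I \<in> borel_measurable M \<and>
     (\<exists>m \<tau> \<xi>. (\<forall>k. elementary_data M W t (m k) (\<tau> k) (\<xi> k)) \<and>
        (\<lambda>k. \<integral>\<^sup>+\<omega>. (\<integral>\<^sup>+s\<in>{0..t}.
            ennreal ((H s \<omega> - elementary_process (m k) (\<tau> k) (\<xi> k) s \<omega>)\<^sup>2) \<partial>lborel) \<partial>M)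
          \<longlonglongrightarrow> 0 \<and>
        (\<lambda>k. \<integral>\<^sup>+\<omega>. ennreal ((I \<omega> - elementary_integral W (m k) (\<tau> k) (\<xi> k) \<omega>)\<^sup>2) \<partial>M)
          \<longlonglongrightarrow> 0)"

subsection \<open>The Volterra equation\<close>

definition Delta_star :: "real \<Rightarrow> (real \<times> real) set" where
  "Delta_star T = {(t, s). t \<in> {0..T} \<and> s \<in> {0..T} \<and> s \<le> t}"

definition nonneg_matrices :: "(real^'n^'n) set" where
  "nonneg_matrices = {A. \<forall>i j. 0 \<le> A $ i $ j}"

definition offdiag_nonneg_matrices :: "(real^'n^'n) set" where
  "offdiag_nonneg_matrices = {A. \<forall>i j. i \<noteq> j \<longrightarrow> 0 \<le> A $ i $ j}"

definition diagonal_matrices :: "(real^'n^'n) set" where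
  "diagonal_matrices = {A. \<forall>i j. i \<noteq> j \<longrightarrow> A $ i $ j = 0}"

definition admissible_coefficients :: "'a measure \<Rightarrow> (real \<Rightarrow> 'a \<Rightarrow> real) \<Rightarrow> real \<Rightarrow>
    (real \<Rightarrow> real \<Rightarrow> 'a \<Rightarrow> real^'n^'n) \<Rightarrow> (real \<Rightarrow> 'a \<Rightarrow> real^'n^'n) \<Rightarrow> bool" where
  "admissible_coefficients M W T A0 A1 \<longleftrightarrow>
     (\<lambda>((t, s), \<omega>). A0 t s \<omega>) \<in> borel_measurable (restrict_space borel (Delta_star T) \<Otimes>\<^sub>M M) \<and>
     measurable_process M T A1 \<and>
     (\<exists>K. \<forall>(t, s)\<in>Delta_star T. \<forall>\<omega>\<in>space M. norm (A0 t s \<omega>) \<le> K) \<and>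
     (\<exists>K. \<forall>s\<in>{0..T}. \<forall>\<omega>\<in>space M. norm (A1 s \<omega>) \<le> K) \<and>
     (\<forall>t\<in>{0..T}. progressive_process M W t (\<lambda>s \<omega>. (A0 t s \<omega>, A1 s \<omega>))) \<and>
     (\<forall>s\<in>{0..<T}. \<forall>\<omega>\<in>space M. continuous_on {s..T} (\<lambda>t. A0 t s \<omega>))"

text \<open>The equation at a fixed time \<open>t\<close>, almost surely; the stochastic integral of a vector-valued
  process is taken componentwise.\<close>

definition volterra_eq_at :: "'a measure \<Rightarrow> (real \<Rightarrow> 'a \<Rightarrow> real) \<Rightarrow>
    (real \<Rightarrow> real \<Rightarrow> 'a \<Rightarrow> real^'n^'n) \<Rightarrow> (real \<Rightarrow> 'a \<Rightarrow> real^'n^'n) \<Rightarrow>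
    (real \<Rightarrow> 'a \<Rightarrow> real^'n) \<Rightarrow> (real \<Rightarrow> 'a \<Rightarrow> real^'n) \<Rightarrow> real \<Rightarrow> bool" where
  "volterra_eq_at M W A0 A1 \<phi> X t \<longleftrightarrow>
     (\<exists>I. (\<forall>i. has_ito_integral M W t (\<lambda>s \<omega>. (A1 s \<omega> *v X s \<omega>) $ i) (\<lambda>\<omega>. I \<omega> $ i)) \<and>
        (AE \<omega> in M. X t \<omega> = \<phi> t \<omega> + (LINT s:{0..t}|lborel. A0 t s \<omega> *v X s \<omega>) + I \<omega>))"

definition L2F_solution :: "'a measure \<Rightarrow> (real \<Rightarrow> 'a \<Rightarrow> real) \<Rightarrow> real \<Rightarrow>
    (real \<Rightarrow> real \<Rightarrow> 'a \<Rightarrow> real^'n^'n) \<Rightarrow> (real \<Rightarrow> 'a \<Rightarrow> real^'n^'n) \<Rightarrow>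
    (real \<Rightarrow> 'a \<Rightarrow> real^'n) \<Rightarrow> (real \<Rightarrow> 'a \<Rightarrow> real^'n) \<Rightarrow> bool" where
  "L2F_solution M W T A0 A1 \<phi> X \<longleftrightarrow>
     X \<in> L2F M W T \<and> (AE t in lborel. t \<in> {0..T} \<longrightarrow> volterra_eq_at M W A0 A1 \<phi> X t)"

text \<open>A process in \<open>CF\<close> is only determined up to modification, and need not be jointly measurable;
  a solution has to be, for its integrals to make sense.\<close>

definition CF_solution :: "'a measure \<Rightarrow> (real \<Rightarrow> 'a \<Rightarrow> real) \<Rightarrow> real \<Rightarrow>
    (real \<Rightarrow> real \<Rightarrow> 'a \<Rightarrow> real^'n^'n) \<Rightarrow> (real \<Rightarrow> 'a \<Rightarrow> real^'n^'n) \<Rightarrow>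
    (real \<Rightarrow> 'a \<Rightarrow> real^'n) \<Rightarrow> (real \<Rightarrow> 'a \<Rightarrow> real^'n) \<Rightarrow> bool" where
  "CF_solution M W T A0 A1 \<phi> X \<longleftrightarrow>
     X \<in> CF M W T \<and> measurable_process M T X \<and>
     (\<forall>t\<in>{0..T}. volterra_eq_at M W A0 A1 \<phi> X t)"

end

theory Submission
  imports Defs
begin

text \<open>
  Write \<open>\<Gamma> X(t)\<close> for the right-hand side of the equation. It is linear with bounded coefficients, so
  \<open>E |\<Gamma> X(t) - \<Gamma> Y(t)|\<^sup>2 \<le> C \<integral>\<^sub>0\<^sup>t E |X - Y|\<^sup>2 ds\<close> (\<open>volt_dist\<close>). Measured with the weight \<open>e\<^sup>-\<^sup>4\<^sup>C\<^sup>t\<close>,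
  \<open>\<Gamma>\<close> contracts squared distances by the factor 1/4, and Picard iteration
  gives existence; uniqueness is Gronwall's lemma for the same inequality. The part of \<open>\<Gamma> X\<close> without
  the free term is mean square continuous, because the kernel is continuous in its first argument,
  and hence has a jointly measurable modification.

  All this rests on the Ito integral, which is given as a relation: a mean square limit of integrals
  of elementary processes. The isometry is proved for finite sums
  \<open>\<Sum> \<xi>\<^sub>i (W(b\<^sub>i) - W(a\<^sub>i))\<close> over intervals that may overlap (\<open>simple_isometry\<close>); the difference of
  two such sums is again one, so that no common refinement of partitions is ever formed, and
  uniqueness and continuity of the integral follow. Existence needs the density of elementary
  processes among adapted ones. A bounded adapted process is sampled at the left end points
  \<open>\<theta> + i h\<close>. A given \<open>\<theta>\<close> may be bad, but the average over \<open>\<theta>\<close> of the sampling error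
  is an average of translation errors, and translations are continuous in the mean
  (\<open>sampling_approximates\<close>). Evaluating at left end points keeps the sampled process adapted.

  Without noise and with a nonnegative kernel, let \<open>N\<close> be the componentwise negative part of \<open>X\<close>.
  Since \<open>X + N \<ge> 0\<close>, the equation gives \<open>X \<ge> \<phi> - \<integral> A0 N\<close>, hence \<open>|N(t)| \<le> |\<integral> A0 N|\<close>, and Gronwall's
  lemma yields \<open>N = 0\<close>; the same inequality then says \<open>X \<ge> \<phi>\<close> (\<open>comparison_without_noise\<close>).

  With noise, \<open>X\<close> is approximated by the Euler scheme
  \<open>Y\<^sub>k = \<phi>(\<tau>\<^sub>k) + \<Sum>j<k. (B\<^sub>k\<^sub>j + \<Delta>\<^sub>j D\<^sub>j) Y\<^sub>j\<close>, where \<open>B\<^sub>k\<^sub>j\<close> is the integral of \<open>A0(\<tau>\<^sub>k, \<cdot>)\<close> over the \<open>j\<close>-th cell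
  of the grid, \<open>D\<^sub>j\<close> the diagonal part of \<open>A1(\<tau>\<^sub>j)\<close>, and \<open>\<Delta>\<^sub>j\<close> the Brownian increment, replaced by 0 when
  it is large. As \<open>\<phi>\<close> and the kernel increase with time, passing from \<open>k\<close> to \<open>k + 1\<close> can
  decrease \<open>Y\<close> only through the new summand \<open>j = k\<close>. There the off-diagonal entries
  are nonnegative, and a fine grid and the truncation keep the two diagonal coefficients at or above \<open>-1/2\<close>;
  so \<open>Y\<^sub>k\<^sub>+\<^sub>1 \<ge> Y\<^sub>k - Y\<^sub>k/2 - Y\<^sub>k/2 = 0\<close> (\<open>euler_nonneg\<close>). The truncation is odd, so truncated increments stay centred
  and orthogonal, and it changes an increment over a cell of length \<open>h\<close> by \<open>O(h\<^sup>2)\<close> in mean square; a discrete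
  Gronwall argument shows that the scheme converges to \<open>X\<close> in mean square (\<open>euler_error\<close>). Thus \<open>X(t)\<close> is a
  mean square limit of nonnegative random vectors (\<open>comparison_with_noise\<close>).
\<close>

section \<open>Mean squares\<close>

text \<open>Values lie in \<open>ennreal\<close>, so that estimates can be chained before finiteness is known.\<close>

definition msq :: "'a measure \<Rightarrow> ('a \<Rightarrow> 'b::real_normed_vector) \<Rightarrow> ennreal" where
  "msq M f = (\<integral>\<^sup>+x. ennreal ((norm (f x))\<^sup>2) \<partial>M)"

lemma norm_sq_add_le: "(norm (x + y))\<^sup>2 \<le> 2 * (norm x)\<^sup>2 + 2 * (norm (y::'b::real_normed_vector))\<^sup>2"
proof -
  have "(norm (x + y))\<^sup>2 \<le> (norm x + norm y)\<^sup>2"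
    by (intro power_mono norm_triangle_ineq) auto
  also have "\<dots> \<le> 2 * (norm x)\<^sup>2 + 2 * (norm y)\<^sup>2"
    using sum_squares_bound[of "norm x" "norm y"] by (simp add: power2_sum)
  finally show ?thesis .
qed

lemma msq_cong_AE: "AE x in M. norm (f x) = norm (g x) \<Longrightarrow> msq M f = msq M g"
  unfolding msq_def by (intro nn_integral_cong_AE) auto

lemma msq_mono_AE: "AE x in M. norm (f x) \<le> norm (g x) \<Longrightarrow> msq M f \<le> msq M g"
  unfolding msq_def by (intro nn_integral_mono_AE) (auto intro!: ennreal_leI power_mono)

lemma msq_zero [simp]: "msq M (\<lambda>x. 0) = 0"
  by (simp add: msq_def)

lemma msq_minus_commute: "msq M (\<lambda>x. f x - g x) = msq M (\<lambda>x. g x - f x)"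
  by (simp add: msq_def norm_minus_commute)

lemma msq_add_le:
  fixes f g :: "'a \<Rightarrow> 'b::{real_normed_vector, second_countable_topology}"
  assumes [measurable]: "f \<in> borel_measurable M" "g \<in> borel_measurable M"
  shows "msq M (\<lambda>x. f x + g x) \<le> 2 * msq M f + 2 * msq M g"
proof -
  have "msq M (\<lambda>x. f x + g x) \<le> (\<integral>\<^sup>+x. 2 * ennreal ((norm (f x))\<^sup>2) + 2 * ennreal ((norm (g x))\<^sup>2) \<partial>M)"
    unfolding msq_def
    using norm_sq_add_le
    by (intro nn_integral_mono)
       (simp add: ennreal_mult'[symmetric] ennreal_plus[symmetric] ennreal_leI numeral_mult_ennreal del: ennreal_plus)
  also have "\<dots> = 2 * msq M f + 2 * msq M g"
    unfolding msq_def by (subst nn_integral_add) (auto simp: nn_integral_cmult)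
  finally show ?thesis .
qed

lemma msq_triangle:
  fixes f g h :: "'a \<Rightarrow> 'b::{real_normed_vector, second_countable_topology}"
  assumes "f \<in> borel_measurable M" "g \<in> borel_measurable M" "h \<in> borel_measurable M"
  shows "msq M (\<lambda>x. f x - h x) \<le> 2 * msq M (\<lambda>x. f x - g x) + 2 * msq M (\<lambda>x. g x - h x)"
  using msq_add_le[of "\<lambda>x. f x - g x" M "\<lambda>x. g x - h x"] assms by simp

lemma msq_eq_0_iff:
  fixes f :: "'a \<Rightarrow> 'b::{real_normed_vector, second_countable_topology}"
  assumes [measurable]: "f \<in> borel_measurable M"
  shows "msq M f = 0 \<longleftrightarrow> (AE x in M. f x = 0)"
  unfolding msq_def by (subst nn_integral_0_iff_AE) (auto simp: ennreal_eq_0_iff)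

lemma msq_cmult: "msq M (\<lambda>x. c *\<^sub>R f x) = ennreal (c\<^sup>2) * msq M f"
  if "f \<in> borel_measurable M" for f :: "'a \<Rightarrow> 'b::{real_normed_vector, second_countable_topology}"
  unfolding msq_def using that
  by (simp add: power_mult_distrib ennreal_mult nn_integral_cmult)

lemma measurable_vec_nth [measurable (raw)]:
  fixes f :: "'a \<Rightarrow> 'b::topological_space^'n"
  assumes "f \<in> borel_measurable M"
  shows "(\<lambda>x. f x $ i) \<in> borel_measurable M"
  using measurable_compose[OF assms borel_measurable_continuous_onI, of "\<lambda>x. x $ i"]
  by (simp add: continuous_on_component[OF continuous_on_id])

lemma norm_sq_vec: "(norm (x::real^'n))\<^sup>2 = (\<Sum>i\<in>UNIV. (x $ i)\<^sup>2)"
  by (simp add: power2_norm_eq_inner inner_vec_def) (simp add: power2_eq_square)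

lemma msq_vec:
  fixes f :: "'a \<Rightarrow> real^'n"
  assumes [measurable]: "f \<in> borel_measurable M"
  shows "msq M f = (\<Sum>i\<in>UNIV. msq M (\<lambda>x. f x $ i))"
  unfolding msq_def
  by (subst nn_integral_sum[symmetric]) (measurable, auto simp: norm_sq_vec)

lemma msq_component_le: "msq M (\<lambda>x. f x $ i) \<le> msq M f"
  unfolding msq_def
  by (intro nn_integral_mono ennreal_leI power_mono) (auto simp: Finite_Cartesian_Product.norm_nth_le component_le_norm_cart[simplified])

text \<open>Completeness of \<open>L\<^sup>2\<close> in the form in which it is used throughout: geometrically fast convergence
  in mean square forces almost sure convergence, and the limit is the pointwise \<open>lim\<close>. A limit given
  by such a formula inherits adaptedness and joint measurability from the sequence.\<close>

lemma msq_fast_Cauchy: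
  fixes f :: "nat \<Rightarrow> 'a \<Rightarrow> 'b::{banach, second_countable_topology}"
  assumes meas[measurable]: "\<And>n. f n \<in> borel_measurable M"
    and c: "c \<ge> 0"
    and fast: "\<And>n. msq M (\<lambda>x. f (Suc n) x - f n x) \<le> ennreal (c * (1/4) ^ n)"
  shows "AE x in M. (\<lambda>n. f n x) \<longlonglongrightarrow> lim (\<lambda>n. f n x)"
    and "msq M (\<lambda>x. f n x - lim (\<lambda>n. f n x)) \<le> ennreal (4 * c * (1/4) ^ n)"
proof -
  define d where "d n x = f (Suc n) x - f n x" for n x
  have [measurable]: "d n \<in> borel_measurable M" for n unfolding d_def by measurable
  \<comment> \<open>The weights \<open>2^n\<close> leave the expectations summable, with ratio 1/2, and bound the increments pointwise by a geometric sequence.\<close>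
  have "(\<integral>\<^sup>+x. (\<Sum>n. ennreal (2^n * (norm (d n x))\<^sup>2)) \<partial>M) = (\<Sum>n. \<integral>\<^sup>+x. ennreal (2^n * (norm (d n x))\<^sup>2) \<partial>M)"
    by (rule nn_integral_suminf) measurable
  also have "\<dots> = (\<Sum>n. ennreal (2^n) * msq M (d n))"
    by (simp add: ennreal_mult nn_integral_cmult msq_def)
  also have "\<dots> \<le> (\<Sum>n. ennreal (2^n) * ennreal (c * (1/4) ^ n))"
    using fast unfolding d_def by (intro suminf_le mult_left_mono) auto
  also have "\<dots> = (\<Sum>n. ennreal (c * (1/2) ^ n))"
    using c by (simp add: ennreal_mult[symmetric] power_mult_distrib[symmetric] mult.left_commute)
  also have "\<dots> < \<infinity>"
    using c summable_mult[OF summable_geometric[of "1/2::real"], of c]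
    by (subst suminf_ennreal2) auto
  finally have "AE x in M. (\<Sum>n. ennreal (2^n * (norm (d n x))\<^sup>2)) \<noteq> \<infinity>"
    by (intro nn_integral_PInf_AE) auto
  then have "AE x in M. convergent (\<lambda>n. f n x)"
  proof (eventually_elim)
    case (elim x)
    define B where "B = enn2real (\<Sum>n. ennreal (2^n * (norm (d n x))\<^sup>2))"
    have B: "B \<ge> 0" "(\<Sum>n. ennreal (2^n * (norm (d n x))\<^sup>2)) = ennreal B"
      unfolding B_def using elim ennreal_enn2real[of "\<Sum>n. ennreal (2^n * (norm (d n x))\<^sup>2)"]
      by (simp_all only: enn2real_nonneg infinity_ennreal_def less_top)
    have le: "norm (d n x) \<le> sqrt B * (sqrt (1/2))^n" for n
    proof -
      have "ennreal (2^n * (norm (d n x))\<^sup>2) \<le> ennreal B"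
        using sum_le_suminf[OF summableI, of "{n}" "\<lambda>n. ennreal (2^n * (norm (d n x))\<^sup>2)"]
        unfolding B(2) by simp
      then have "2^n * (norm (d n x))\<^sup>2 \<le> B" using B(1) by simp
      then have "(norm (d n x))\<^sup>2 \<le> B * (1/2)^n"
        by (simp add: field_simps power_divide)
      then have "norm (d n x) \<le> sqrt (B * (1/2)^n)"
        by (rule real_le_rsqrt)
      then show ?thesis by (simp add: real_sqrt_mult real_sqrt_power)
    qed
    have "sqrt (1/2) < (1::real)" by (rule real_less_lsqrt) auto
    then have "summable (\<lambda>n. sqrt B * (sqrt (1/2))^n)"
      by (intro summable_mult summable_geometric) simp
    then have "summable (\<lambda>n. d n x)"
      by (rule summable_comparison_test'[where N = 0]) (use le in auto)
    then have "convergent (\<lambda>n. \<Sum>i<n. d i x)" by (simp add: summable_iff_convergent)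
    moreover have "(\<Sum>i<n. d i x) = f n x - f 0 x" for n
      unfolding d_def by (rule sum_lessThan_telescope)
    ultimately have "convergent (\<lambda>n. f n x - f 0 x)" by simp
    then show ?case using convergent_diff_const_right_iff by blast
  qed
  then show ae: "AE x in M. (\<lambda>n. f n x) \<longlonglongrightarrow> lim (\<lambda>n. f n x)"
    by eventually_elim (simp add: convergent_LIMSEQ_iff)
  \<comment> \<open>The bound \<open>4 c\<close> reproduces itself in the induction: \<open>2 * 4 * c / 4 + 2 * c = 4 * c\<close>.\<close>
  have bound: "msq M (\<lambda>x. f (n + m) x - f n x) \<le> ennreal (4 * c * (1/4) ^ n)" for m n
  proof (induction m arbitrary: n)
    case (Suc m)
    have "msq M (\<lambda>x. f (n + Suc m) x - f n x) \<le>
      2 * msq M (\<lambda>x. f (Suc n + m) x - f (Suc n) x) + 2 * msq M (\<lambda>x. f (Suc n) x - f n x)"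
      using msq_triangle[of "f (n + Suc m)" M "f (Suc n)" "f n"] by simp
    also have "\<dots> \<le> 2 * ennreal (4 * c * (1/4) ^ Suc n) + 2 * ennreal (c * (1/4)^n)"
      by (intro add_mono mult_left_mono Suc fast) auto
    also have "\<dots> = ennreal (4 * c * (1/4) ^ n)"
      using c by (simp add: ennreal_plus[symmetric] numeral_mult_ennreal del: ennreal_plus)
    finally show ?case .
  qed (use c in simp)
  have "msq M (\<lambda>x. f n x - lim (\<lambda>n. f n x)) =
      (\<integral>\<^sup>+x. liminf (\<lambda>m. ennreal ((norm (f n x - f (n + m) x))\<^sup>2)) \<partial>M)"
    unfolding msq_def
  proof (rule nn_integral_cong_AE, use ae in eventually_elim)
    case (elim x)
    have "(\<lambda>m. f (n + m) x) \<longlonglongrightarrow> lim (\<lambda>n. f n x)"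
      using LIMSEQ_ignore_initial_segment[OF elim, of n] by (simp add: add.commute)
    then have "(\<lambda>m. ennreal ((norm (f n x - f (n + m) x))\<^sup>2)) \<longlonglongrightarrow> ennreal ((norm (f n x - lim (\<lambda>n. f n x)))\<^sup>2)"
      by (intro tendsto_intros)
    then show ?case by (intro lim_imp_Liminf[symmetric]) simp_all
  qed
  also have "\<dots> \<le> liminf (\<lambda>m. \<integral>\<^sup>+x. ennreal ((norm (f n x - f (n + m) x))\<^sup>2) \<partial>M)"
    by (rule nn_integral_liminf) measurable
  also have "\<dots> \<le> ennreal (4 * c * (1/4) ^ n)"
  proof (intro Liminf_le always_eventually allI)
    fix m
    show "(\<integral>\<^sup>+x. ennreal ((norm (f n x - f (n + m) x))\<^sup>2) \<partial>M) \<le> ennreal (4 * c * (1/4) ^ n)"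
      using bound[of n m] msq_minus_commute[of M "f (n + m)" "f n"] unfolding msq_def by simp
  qed simp
  finally show "msq M (\<lambda>x. f n x - lim (\<lambda>n. f n x)) \<le> ennreal (4 * c * (1/4) ^ n)" .
qed

text \<open>The Cauchy-Schwarz inequality against the indicator of \<open>I\<close>.\<close>

lemma msq_integral_le:
  fixes f :: "real \<Rightarrow> 'b::{banach, second_countable_topology}"
  assumes [measurable]: "f \<in> borel_measurable borel"
    and I: "I \<in> sets borel" "emeasure lborel I \<le> ennreal L"
  shows "ennreal ((norm (LINT s:I|lborel. f s))\<^sup>2) \<le> ennreal L * (\<integral>\<^sup>+s\<in>I. ennreal ((norm (f s))\<^sup>2) \<partial>lborel)"
proof (cases "set_integrable lborel I f")
  case True
  have [measurable]: "I \<in> sets borel" by fact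
  have "ennreal (norm (LINT s:I|lborel. f s)) \<le> (\<integral>\<^sup>+s. ennreal (norm (indicator I s *\<^sub>R f s)) \<partial>lborel)"
    unfolding set_lebesgue_integral_def
    using True unfolding set_integrable_def by (rule integral_norm_bound_ennreal)
  also have "\<dots> = (\<integral>\<^sup>+s. (ennreal (norm (f s)) * indicator I s) * indicator I s \<partial>lborel)"
    by (intro nn_integral_cong) (auto simp: indicator_def)
  finally have "(ennreal (norm (LINT s:I|lborel. f s)))\<^sup>2 \<le> (\<integral>\<^sup>+s. (ennreal (norm (f s)) * indicator I s) * indicator I s \<partial>lborel)\<^sup>2"
    by (rule power_mono) simp
  also have "\<dots> \<le> (\<integral>\<^sup>+s. (ennreal (norm (f s)) * indicator I s)\<^sup>2 \<partial>lborel) * (\<integral>\<^sup>+s. (indicator I s)\<^sup>2 \<partial>lborel)"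
    by (rule Cauchy_Schwarz_nn_integral) measurable
  also have "(\<integral>\<^sup>+s. (ennreal (norm (f s)) * indicator I s)\<^sup>2 \<partial>lborel) = (\<integral>\<^sup>+s\<in>I. ennreal ((norm (f s))\<^sup>2) \<partial>lborel)"
    by (intro nn_integral_cong) (auto simp: indicator_def ennreal_power)
  also have "(\<integral>\<^sup>+s. (indicator I s)\<^sup>2 \<partial>lborel) = (\<integral>\<^sup>+s. indicator I s \<partial>lborel)"
    by (intro nn_integral_cong) (auto simp: indicator_def)
  also have "\<dots> = emeasure lborel I" by simp
  finally have "(ennreal (norm (LINT s:I|lborel. f s)))\<^sup>2 \<le> (\<integral>\<^sup>+s\<in>I. ennreal ((norm (f s))\<^sup>2) \<partial>lborel) * emeasure lborel I" .
  also have "\<dots> \<le> (\<integral>\<^sup>+s\<in>I. ennreal ((norm (f s))\<^sup>2) \<partial>lborel) * ennreal L"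
    by (intro mult_left_mono I) simp
  finally show ?thesis by (simp add: ennreal_power mult.commute)
next
  case False
  then have "(LINT s:I|lborel. f s) = 0"
    unfolding set_lebesgue_integral_def set_integrable_def by (rule not_integrable_integral_eq)
  then show ?thesis by simp
qed

text \<open>An exponential weight makes the Volterra operator \<open>q \<mapsto> \<integral>\<^sub>0\<^sup>t q\<close> as small as desired: by Tonelli's
  theorem, \<open>q s\<close> is multiplied by \<open>\<integral>\<^sub>s\<^sup>\<infinity> e\<^sup>-\<^sup>l\<^sup>t dt = e\<^sup>-\<^sup>l\<^sup>s / l\<close>.\<close>

lemma volterra_weighted_bound:
  fixes q :: "real \<Rightarrow> ennreal"
  assumes [measurable]: "q \<in> borel_measurable borel" and l: "l > 0"
  shows "(\<integral>\<^sup>+t\<in>{0..T}. ennreal (exp (- l * t)) * (\<integral>\<^sup>+s\<in>{0..t}. q s \<partial>lborel) \<partial>lborel)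
    \<le> ennreal (1 / l) * (\<integral>\<^sup>+s\<in>{0..T}. ennreal (exp (- l * s)) * q s \<partial>lborel)"
proof -
  define k where "k t s = ennreal (exp (- l * t)) * q s * indicator {0..T} t * indicator {0..t} s" for t s :: real
  have [measurable]: "(\<lambda>(t, s). k t s) \<in> borel_measurable (borel \<Otimes>\<^sub>M borel)"
  proof -
    have "k t s = ennreal (exp (- l * t)) * q s * (if 0 \<le> t \<and> t \<le> T \<and> 0 \<le> s \<and> s \<le> t then 1 else 0)" for t s
      unfolding k_def by (auto simp: indicator_def)
    then show ?thesis by simp
  qed
  have 1: "(\<integral>\<^sup>+t\<in>{s..}. ennreal (exp (- l * t)) \<partial>lborel) = ennreal (exp (- l * s) / l)" for s
  proof -
    have "((\<lambda>t. - exp (- l * t) / l) \<longlongrightarrow> 0) at_top"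
    proof -
      have "filterlim (\<lambda>t. - (l * t)) at_bot at_top"
        using filterlim_tendsto_pos_mult_at_top[OF tendsto_const l filterlim_ident]
        by (simp add: filterlim_uminus_at_bot)
      then have "((\<lambda>t. exp (- (l * t))) \<longlongrightarrow> 0) at_top"
        by (rule filterlim_compose[OF exp_at_bot])
      then have "((\<lambda>t. - exp (- (l * t)) / l) \<longlongrightarrow> - 0 / l) at_top"
        using l by (intro tendsto_intros) auto
      then show ?thesis by simp
    qed
    then show ?thesis
      using l by (subst nn_integral_FTC_atLeast[of "\<lambda>t. exp (- l * t)" s "\<lambda>t. - exp (- l * t) / l" 0])
        (auto intro!: derivative_eq_intros)
  qed
  have "(\<integral>\<^sup>+t\<in>{0..T}. ennreal (exp (- l * t)) * (\<integral>\<^sup>+s\<in>{0..t}. q s \<partial>lborel) \<partial>lborel)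
    = (\<integral>\<^sup>+t. \<integral>\<^sup>+s. k t s \<partial>lborel \<partial>lborel)"
    unfolding k_def by (intro nn_integral_cong)
      (auto simp: nn_integral_cmult[symmetric] nn_integral_multc[symmetric] indicator_def intro!: nn_integral_cong)
  also have "\<dots> = (\<integral>\<^sup>+s. \<integral>\<^sup>+t. k t s \<partial>lborel \<partial>lborel)"
    by (rule lborel_pair.Fubini'[symmetric]) (simp cong: measurable_cong_sets)
  also have "\<dots> \<le> (\<integral>\<^sup>+s. (q s * indicator {0..T} s) * (\<integral>\<^sup>+t\<in>{s..}. ennreal (exp (- l * t)) \<partial>lborel) \<partial>lborel)"
  proof (rule nn_integral_mono)
    fix s
    have "(\<integral>\<^sup>+t. k t s \<partial>lborel) \<le> (\<integral>\<^sup>+t. (q s * indicator {0..T} s) * (ennreal (exp (- l * t)) * indicator {s..} t) \<partial>lborel)"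
      unfolding k_def by (intro nn_integral_mono) (auto simp: indicator_def mult.commute)
    then show "(\<integral>\<^sup>+t. k t s \<partial>lborel) \<le> (q s * indicator {0..T} s) * (\<integral>\<^sup>+t\<in>{s..}. ennreal (exp (- l * t)) \<partial>lborel)"
      by (subst (asm) nn_integral_cmult) auto
  qed
  also have "\<dots> = (\<integral>\<^sup>+s. ennreal (1 / l) * (ennreal (exp (- l * s)) * q s * indicator {0..T} s) \<partial>lborel)"
  proof (intro nn_integral_cong)
    fix s
    have "ennreal (exp (- l * s) / l) = ennreal (1 / l) * ennreal (exp (- l * s))"
      using l by (subst ennreal_mult[symmetric]) auto
    then show "(q s * indicator {0..T} s) * (\<integral>\<^sup>+t\<in>{s..}. ennreal (exp (- l * t)) \<partial>lborel)
        = ennreal (1 / l) * (ennreal (exp (- l * s)) * q s * indicator {0..T} s)"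
      unfolding 1 by (simp add: mult.commute mult.left_commute)
  qed
  also have "\<dots> = ennreal (1 / l) * (\<integral>\<^sup>+s\<in>{0..T}. ennreal (exp (- l * s)) * q s \<partial>lborel)"
    by (rule nn_integral_cmult) measurable
  finally show ?thesis .
qed

text \<open>With the weight \<open>e\<^sup>-\<^sup>2\<^sup>C\<^sup>t\<close> the inequality says that the weighted integral of \<open>q\<close> is at most half of
  itself; being finite, it vanishes.\<close>

lemma gronwall_zero:
  fixes q :: "real \<Rightarrow> ennreal"
  assumes [measurable]: "q \<in> borel_measurable borel" and fin: "(\<integral>\<^sup>+s\<in>{0..T}. q s \<partial>lborel) < \<infinity>"
    and C: "C > 0" and le: "AE t in lborel. t \<in> {0..T} \<longrightarrow> q t \<le> ennreal C * (\<integral>\<^sup>+s\<in>{0..t}. q s \<partial>lborel)"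
  shows "AE t in lborel. t \<in> {0..T} \<longrightarrow> q t = 0"
proof -
  define N where "N = (\<integral>\<^sup>+t\<in>{0..T}. ennreal (exp (- (2 * C) * t)) * q t \<partial>lborel)"
  have "N \<le> (\<integral>\<^sup>+t\<in>{0..T}. q t \<partial>lborel)"
    unfolding N_def
  proof (intro nn_integral_mono)
    fix t
    have "0 \<le> t \<Longrightarrow> ennreal (exp (- (2 * C) * t)) * q t \<le> 1 * q t"
      using C by (intro mult_right_mono) auto
    then show "ennreal (exp (- (2 * C) * t)) * q t * indicator {0..T} t \<le> q t * indicator {0..T} t"
      by (auto simp: indicator_def)
  qed
  then have Nfin: "N < \<infinity>" using fin by simp
  have m: "(\<lambda>t. \<integral>\<^sup>+s\<in>{0..t}. q s \<partial>lborel) \<in> borel_measurable borel"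
  proof -
    have "(\<lambda>(t, s). q s * (if 0 \<le> s \<and> s \<le> t then 1 else 0)) \<in> borel_measurable (borel \<Otimes>\<^sub>M lborel)"
      by measurable
    from lborel.borel_measurable_nn_integral_fst[OF this]
    show ?thesis by (simp add: indicator_def)
  qed
  have "N \<le> (\<integral>\<^sup>+t\<in>{0..T}. ennreal C * (ennreal (exp (- (2 * C) * t)) * (\<integral>\<^sup>+s\<in>{0..t}. q s \<partial>lborel)) \<partial>lborel)"
    unfolding N_def
  proof (rule nn_integral_mono_AE, use le in eventually_elim)
    case (elim t)
    show ?case
    proof (cases "t \<in> {0..T}")
      case True
      with elim have "ennreal (exp (- (2 * C) * t)) * q t \<le> ennreal (exp (- (2 * C) * t)) * (ennreal C * (\<integral>\<^sup>+s\<in>{0..t}. q s \<partial>lborel))"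
        by (intro mult_left_mono) auto
      with True show ?thesis by (simp add: mult.left_commute)
    qed simp
  qed
  also have "\<dots> = ennreal C * (\<integral>\<^sup>+t\<in>{0..T}. ennreal (exp (- (2 * C) * t)) * (\<integral>\<^sup>+s\<in>{0..t}. q s \<partial>lborel) \<partial>lborel)"
    using m by (subst nn_integral_cmult[symmetric]) (auto simp: mult.assoc)
  also have "\<dots> \<le> ennreal C * (ennreal (1 / (2 * C)) * N)"
    unfolding N_def using C by (intro mult_left_mono volterra_weighted_bound) auto
  also have "\<dots> = ennreal (1/2) * N"
    using C by (simp add: mult.assoc[symmetric] ennreal_mult[symmetric])
  finally have "N \<le> ennreal (1/2) * N" .
  then have "N = 0"
    using Nfin by (cases N) (auto simp: ennreal_mult[symmetric] ennreal_le_iff simp del: ennreal_half)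
  then have "AE t in lborel. ennreal (exp (- (2 * C) * t)) * q t * indicator {0..T} t = 0"
    unfolding N_def by (subst (asm) nn_integral_0_iff_AE) auto
  then show ?thesis by eventually_elim (auto simp: indicator_def)
qed

section \<open>The augmented filtration and Brownian increments\<close>

locale brownian_setting = prob_space M for M :: "'a measure" +
  fixes W :: "real \<Rightarrow> 'a \<Rightarrow> real"
  assumes complete_M: "complete_measure M" and bm: "standard_brownian_motion M W"
begin

abbreviation F :: "real \<Rightarrow> 'a measure" where "F t \<equiv> augmented_filtration M W t"

lemma W_measurable [measurable]: "0 \<le> t \<Longrightarrow> W t \<in> borel_measurable M"
  using bm unfolding standard_brownian_motion_def by auto

lemma sets_natural: "sets (natural_filtration M W t) =
    sigma_sets (space M) {W s -` B \<inter> space M | s B. 0 \<le> s \<and> s \<le> t \<and> B \<in> sets borel}"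
  unfolding natural_filtration_def by (rule sets_measure_of) auto

lemma space_natural [simp]: "space (natural_filtration M W t) = space M"
  unfolding natural_filtration_def by (rule space_measure_of) auto

lemma sets_natural_subset: "sets (natural_filtration M W t) \<subseteq> sets M"
  unfolding sets_natural
  by (rule sets.sigma_sets_subset) (auto intro!: measurable_sets[OF W_measurable])

lemma generators_in_Pow: "sets (natural_filtration M W t) \<union> null_sets M \<subseteq> Pow (space M)"
proof -
  have "sets (natural_filtration M W t) \<union> null_sets M \<subseteq> sets M"
    using sets_natural_subset null_setsD2 by blast
  then show ?thesis using sets.space_closed by blast
qed

lemma space_F [simp]: "space (F t) = space M"
  unfolding augmented_filtration_def by (rule space_measure_of[OF generators_in_Pow])

lemma sets_F: "sets (F t) = sigma_sets (space M) (sets (natural_filtration M W t) \<union> null_sets M)"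
  unfolding augmented_filtration_def by (rule sets_measure_of[OF generators_in_Pow])

lemma sets_F_subset: "sets (F t) \<subseteq> sets M"
  unfolding sets_F by (rule sets.sigma_sets_subset) (use sets_natural_subset in auto)

lemma sets_F_mono: assumes "s \<le> t" shows "sets (F s) \<subseteq> sets (F t)"
proof -
  have "sets (natural_filtration M W s) \<subseteq> sets (natural_filtration M W t)"
    unfolding sets_natural
  proof (intro sigma_sets_mono' subsetI)
    fix A assume "A \<in> {W r -` B \<inter> space M | r B. 0 \<le> r \<and> r \<le> s \<and> B \<in> sets borel}"
    then obtain r B where "A = W r -` B \<inter> space M" "0 \<le> r" "r \<le> s" "B \<in> sets borel" by blast
    with assms show "A \<in> {W s -` B \<inter> space M | s B. 0 \<le> s \<and> s \<le> t \<and> B \<in> sets borel}"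
      by (intro CollectI exI[of _ r] exI[of _ B]) auto
  qed
  then show ?thesis unfolding sets_F by (intro sigma_sets_mono') auto
qed

lemma measurable_F_mono: "f \<in> measurable (F s) N \<Longrightarrow> s \<le> t \<Longrightarrow> f \<in> measurable (F t) N"
  using sets_F_mono[of s t] by (auto simp: measurable_def)

lemma measurable_F_M: "f \<in> measurable (F s) N \<Longrightarrow> f \<in> measurable M N"
  using sets_F_subset[of s] by (auto simp: measurable_def)

lemma W_measurable_F: assumes "0 \<le> s" "s \<le> t" shows "W s \<in> borel_measurable (F t)"
proof (rule measurableI)
  fix B :: "real set" assume "B \<in> sets borel"
  then have "W s -` B \<inter> space M \<in> sets (natural_filtration M W t)"
    unfolding sets_natural using assms
    by (intro sigma_sets.Basic CollectI exI[of _ s] exI[of _ B] conjI refl) auto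
  then show "W s -` B \<inter> space (F t) \<in> sets (F t)"
    unfolding sets_F by auto
qed simp

lemma null_set_F: "N \<in> null_sets M \<Longrightarrow> N \<in> sets (F t)"
  unfolding sets_F by auto

text \<open>Completeness of the measure enters here: every subset of a null set belongs to every \<open>F t\<close>. Hence
  adaptedness is insensitive to modification, as Ito integrals, determined only up to null sets, require.\<close>

lemma measurable_F_AE_cong:
  assumes f: "f \<in> measurable (F t) N" and eq: "AE \<omega> in M. f \<omega> = g \<omega>"
    and g: "g \<in> space M \<rightarrow> space N"
  shows "g \<in> measurable (F t) N"
proof (rule measurableI)
  from eq obtain Z where Z: "{\<omega>\<in>space M. f \<omega> \<noteq> g \<omega>} \<subseteq> Z" "Z \<in> null_sets M"
    unfolding eventually_ae_filter by blast
  fix B assume B: "B \<in> sets N"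
  have "g -` B \<inter> Z \<inter> space M \<in> null_sets M"
    by (rule complete_measure.complete2[OF complete_M _ Z(2)]) blast
  then have "(f -` B \<inter> space (F t) - Z) \<union> (g -` B \<inter> Z \<inter> space M) \<in> sets (F t)"
    using measurable_sets[OF f B] null_set_F Z(2) by (intro sets.Un sets.Diff) auto
  also have "(f -` B \<inter> space (F t) - Z) \<union> (g -` B \<inter> Z \<inter> space M) = g -` B \<inter> space (F t)"
    using Z(1) by auto
  finally show "g -` B \<inter> space (F t) \<in> sets (F t)" .
qed (use g in auto)

lemma borel_measurable_F_AE_cong:
  "f \<in> borel_measurable (F t) \<Longrightarrow> AE \<omega> in M. f \<omega> = g \<omega> \<Longrightarrow> g \<in> borel_measurable (F t)"
  by (erule measurable_F_AE_cong) auto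

text \<open>Augmentation changes events only by null sets, so independence of the increments, assumed for the
  natural filtration, carries over to the augmented one.\<close>

lemma F_approx_natural:
  assumes "A \<in> sets (F t)"
  shows "\<exists>B\<in>sets (natural_filtration M W t). AE \<omega> in M. \<omega> \<in> A \<longleftrightarrow> \<omega> \<in> B"
  using assms unfolding sets_F
proof (induction rule: sigma_sets.induct)
  case (Basic A)
  then show ?case
  proof
    assume "A \<in> null_sets M"
    then have "AE \<omega> in M. \<omega> \<in> A \<longleftrightarrow> \<omega> \<in> {}" by (auto dest: AE_not_in)
    then show ?thesis by (intro bexI[of _ "{}"]) auto
  qed auto
next
  case (Compl A)
  then obtain B where B: "B \<in> sets (natural_filtration M W t)" "AE \<omega> in M. \<omega> \<in> A \<longleftrightarrow> \<omega> \<in> B" by blast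
  show ?case
  proof (intro bexI)
    show "AE \<omega> in M. \<omega> \<in> space M - A \<longleftrightarrow> \<omega> \<in> space M - B" using B(2) by eventually_elim auto
    show "space M - B \<in> sets (natural_filtration M W t)"
      using sets.compl_sets[OF B(1)] by simp
  qed
next
  case (Union A)
  then obtain B where B: "\<And>i. B i \<in> sets (natural_filtration M W t)"
      "\<And>i. AE \<omega> in M. \<omega> \<in> A i \<longleftrightarrow> \<omega> \<in> B i" by metis
  show ?case
  proof (intro bexI)
    have "AE \<omega> in M. \<forall>i. \<omega> \<in> A i \<longleftrightarrow> \<omega> \<in> B i" using B(2) by (simp add: AE_all_countable)
    then show "AE \<omega> in M. \<omega> \<in> (\<Union>i. A i) \<longleftrightarrow> \<omega> \<in> (\<Union>i. B i)" by eventually_elim auto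
    show "(\<Union>i. B i) \<in> sets (natural_filtration M W t)" using B(1) by auto
  qed
qed (auto intro!: bexI[of _ "{}"])

lemma indep_increment:
  assumes st: "0 \<le> s" "s < t" and f: "f \<in> borel_measurable (F s)"
  shows "indep_var borel f borel (\<lambda>\<omega>. W t \<omega> - W s \<omega>)"
proof -
  let ?D = "\<lambda>\<omega>. W t \<omega> - W s \<omega>"
  have [measurable]: "?D \<in> borel_measurable M" using st by (intro borel_measurable_diff W_measurable) auto
  have ind: "indep_set (sets (natural_filtration M W s)) {?D -` B \<inter> space M | B. B \<in> sets borel}"
    using bm st unfolding standard_brownian_motion_def by blast
  have "indep_set (sets (F s)) {?D -` B \<inter> space M | B. B \<in> sets borel}"
  proof (rule indep_setI)
    fix A C assume A: "A \<in> sets (F s)" and C: "C \<in> {?D -` B \<inter> space M | B. B \<in> sets borel}"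
    obtain B where B: "B \<in> sets (natural_filtration M W s)" "AE \<omega> in M. \<omega> \<in> A \<longleftrightarrow> \<omega> \<in> B"
      using F_approx_natural[OF A] by auto
    have [measurable]: "A \<in> sets M" "B \<in> sets M" "C \<in> sets M"
      using A B sets_F_subset sets_natural_subset C by (auto intro!: measurable_sets[of _ M])
    have "prob (A \<inter> C) = prob (B \<inter> C)"
      using B(2) by (intro finite_measure_eq_AE) auto
    also have "\<dots> = prob B * prob C"
      by (rule indep_setD[OF ind B(1) C])
    also have "prob B = prob A"
      using B(2) by (intro finite_measure_eq_AE) auto
    finally show "prob (A \<inter> C) = prob A * prob C" .
  qed (use sets_F_subset in \<open>auto intro!: measurable_sets[of _ M]\<close>)
  then have "indep_set (sigma_sets (space M) (sets (F s)))
      (sigma_sets (space M) {?D -` B \<inter> space M | B. B \<in> sets borel})"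
  proof (rule indep_set_sigma_sets)
    show "Int_stable (sets (F s))" by (auto simp: Int_stable_def)
    show "Int_stable {?D -` B \<inter> space M | B. B \<in> sets borel}"
    proof (rule Int_stableI)
      fix a b assume "a \<in> {?D -` B \<inter> space M | B. B \<in> sets borel}" "b \<in> {?D -` B \<inter> space M | B. B \<in> sets borel}"
      then obtain A B where "a = ?D -` A \<inter> space M" "b = ?D -` B \<inter> space M" "A \<in> sets borel" "B \<in> sets borel"
        by blast
      then show "a \<inter> b \<in> {?D -` B \<inter> space M | B. B \<in> sets borel}"
        by (intro CollectI exI[of _ "A \<inter> B"]) auto
    qed
  qed
  then have "indep_set (sigma_sets (space M) {f -` B \<inter> space M | B. B \<in> sets borel})
      (sigma_sets (space M) {?D -` B \<inter> space M | B. B \<in> sets borel})"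
    unfolding indep_set_def
    by (rule indep_sets_mono_sets)
       (use measurable_sets[OF f] in \<open>auto split: bool.split intro!: sigma_sets_mono'\<close>)
  then show ?thesis
    unfolding indep_var_eq using measurable_F_M[OF f] by simp
qed

lemma
  fixes f :: "'a \<Rightarrow> real" and g :: "real \<Rightarrow> real"
  assumes st: "0 \<le> s" "s < t" and f: "f \<in> borel_measurable (F s)" and fi: "integrable M f"
    and g: "g \<in> borel_measurable borel" and gi: "integrable M (\<lambda>\<omega>. g (W t \<omega> - W s \<omega>))"
  shows integrable_mult_increment: "integrable M (\<lambda>\<omega>. f \<omega> * g (W t \<omega> - W s \<omega>))"
    and expectation_mult_increment: "expectation (\<lambda>\<omega>. f \<omega> * g (W t \<omega> - W s \<omega>))
       = expectation f * expectation (\<lambda>\<omega>. g (W t \<omega> - W s \<omega>))"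
proof -
  have "indep_var borel (id \<circ> f) borel (g \<circ> (\<lambda>\<omega>. W t \<omega> - W s \<omega>))"
    by (rule indep_var_compose[OF indep_increment[OF st f]]) (use g in auto)
  then have i: "indep_var borel f borel (\<lambda>\<omega>. g (W t \<omega> - W s \<omega>))"
    by (simp add: comp_def)
  show "integrable M (\<lambda>\<omega>. f \<omega> * g (W t \<omega> - W s \<omega>))"
    by (rule indep_var_integrable[OF i fi gi])
  show "expectation (\<lambda>\<omega>. f \<omega> * g (W t \<omega> - W s \<omega>)) = expectation f * expectation (\<lambda>\<omega>. g (W t \<omega> - W s \<omega>))"
    by (rule indep_var_lebesgue_integral[OF i fi gi])
qed

lemma increment_distributed:
  "0 \<le> s \<Longrightarrow> s < t \<Longrightarrow> distributed M lborel (\<lambda>\<omega>. W t \<omega> - W s \<omega>) (normal_density 0 (sqrt (t - s)))"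
  using bm unfolding standard_brownian_motion_def by blast

lemma integrable_increment_power:
  assumes st: "0 \<le> s" "s < t" shows "integrable M (\<lambda>\<omega>. (W t \<omega> - W s \<omega>) ^ k)"
  using integrable_normal_moment[of "sqrt (t - s)" 0 k] st
    distributed_integrable[OF increment_distributed[OF st], of "\<lambda>x. x ^ k"] by simp

lemma expectation_increment:
  assumes st: "0 \<le> s" "s < t" shows "expectation (\<lambda>\<omega>. W t \<omega> - W s \<omega>) = 0"
  using integral_normal_moment_odd[of "sqrt (t - s)" 0 0] st
    distributed_integral[OF increment_distributed[OF st], of "\<lambda>x. x"] by simp

lemma expectation_increment_sq:
  assumes st: "0 \<le> s" "s < t" shows "expectation (\<lambda>\<omega>. (W t \<omega> - W s \<omega>)\<^sup>2) = t - s"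
  using integral_normal_moment_even[of "sqrt (t - s)" 0 1] st
    distributed_integral[OF increment_distributed[OF st], of "\<lambda>x. x\<^sup>2"] by simp

lemma expectation_increment_4:
  assumes st: "0 \<le> s" "s < t" shows "expectation (\<lambda>\<omega>. (W t \<omega> - W s \<omega>) ^ 4) = 3 * (t - s)\<^sup>2"
proof -
  have "(sqrt (t - s)) ^ 4 = (t - s)\<^sup>2"
  proof -
    have "(sqrt (t - s)) ^ (2 * 2) = ((sqrt (t - s))\<^sup>2)\<^sup>2" by (rule power_mult)
    then show ?thesis using st by simp
  qed
  then show ?thesis
  using integral_normal_moment_even[of "sqrt (t - s)" 0 2] st
    distributed_integral[OF increment_distributed[OF st], of "\<lambda>x. x^4"] by (simp add: fact_numeral power_divide)
qed

text \<open>Increments are symmetrically distributed. Truncated increments and truncation errors are odd functions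
  of increments, and hence centred.\<close>

lemma expectation_odd_increment:
  assumes st: "0 \<le> s" "s < t" and [measurable]: "g \<in> borel_measurable borel" and odd: "\<And>x. g (- x) = - g x"
  shows "expectation (\<lambda>\<omega>. g (W t \<omega> - W s \<omega>)) = (0::real)"
proof -
  define d where "d x = normal_density 0 (sqrt (t - s)) x * g x" for x
  have 1: "expectation (\<lambda>\<omega>. g (W t \<omega> - W s \<omega>)) = (\<integral>x. d x \<partial>lborel)"
    unfolding d_def by (rule distributed_integral[OF increment_distributed[OF st], symmetric]) auto
  note 1
  also have "(\<integral>x. d x \<partial>lborel) = \<bar>- 1\<bar> *\<^sub>R (\<integral>x. d (0 + (- 1) * x) \<partial>lborel)"
    by (rule lborel_integral_real_affine) auto
  also have "\<dots> = (\<integral>x. - d x \<partial>lborel)"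
    by (simp add: d_def odd normal_density_def)
  finally have "expectation (\<lambda>\<omega>. g (W t \<omega> - W s \<omega>)) = - (\<integral>x. d x \<partial>lborel)" by simp
  then show ?thesis using 1 by linarith
qed

end

section \<open>The Ito isometry\<close>

lemma integrable_mult_sq:
  fixes f g :: "'a \<Rightarrow> real"
  assumes [measurable]: "f \<in> borel_measurable M" "g \<in> borel_measurable M"
    and "integrable M (\<lambda>x. (f x)\<^sup>2)" "integrable M (\<lambda>x. (g x)\<^sup>2)"
  shows "integrable M (\<lambda>x. f x * g x)"
proof (rule Bochner_Integration.integrable_bound)
  show "integrable M (\<lambda>x. (f x)\<^sup>2 + (g x)\<^sup>2)" using assms by simp
  have "\<bar>u * v\<bar> \<le> u\<^sup>2 + v\<^sup>2" for u v :: real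
  proof -
    have "2 * (\<bar>u\<bar> * \<bar>v\<bar>) \<le> u\<^sup>2 + v\<^sup>2" using sum_squares_bound[of "\<bar>u\<bar>" "\<bar>v\<bar>"] by simp
    moreover have "0 \<le> \<bar>u\<bar> * \<bar>v\<bar>" by simp
    ultimately show ?thesis unfolding abs_mult by linarith
  qed
  then show "AE x in M. norm (f x * g x) \<le> norm ((f x)\<^sup>2 + (g x)\<^sup>2)"
    by simp
qed measurable

lemma msq_eq_integral:
  fixes f :: "'a \<Rightarrow> real"
  assumes "integrable M (\<lambda>x. (f x)\<^sup>2)"
  shows "msq M f = ennreal (\<integral>x. (f x)\<^sup>2 \<partial>M)"
  unfolding msq_def using assms by (simp add: nn_integral_eq_integral)

lemma integrable_sq_iff_msq:
  fixes f :: "'a \<Rightarrow> real"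
  assumes [measurable]: "f \<in> borel_measurable M"
  shows "integrable M (\<lambda>x. (f x)\<^sup>2) \<longleftrightarrow> msq M f < \<infinity>"
  unfolding integrable_iff_bounded msq_def by simp

lemma measurable_process_cut:
  fixes H :: "real \<Rightarrow> 'a \<Rightarrow> 'b::{real_normed_vector, second_countable_topology}"
  assumes "measurable_process N T H" "t \<le> T"
  shows "(\<lambda>z. indicator {0..t} (fst z) *\<^sub>R H (fst z) (snd z)) \<in> borel_measurable (lborel \<Otimes>\<^sub>M N)"
proof (cases "0 \<le> t")
  case True
  have "(\<lambda>z. (max 0 (min T (fst z)), snd z)) \<in> (lborel \<Otimes>\<^sub>M N) \<rightarrow>\<^sub>M (restrict_space borel {0..T} \<Otimes>\<^sub>M N)"
    using True assms(2) by (intro measurable_Pair measurable_restrict_space2) (auto simp: max_def min_def)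
  from measurable_compose[OF this assms(1)[unfolded measurable_process_def]]
  have [measurable]: "(\<lambda>z. H (max 0 (min T (fst z))) (snd z)) \<in> borel_measurable (lborel \<Otimes>\<^sub>M N)"
    by simp
  have eq: "indicator {0..t} (fst z) *\<^sub>R H (fst z) (snd z) = indicator {0..t} (fst z) *\<^sub>R H (max 0 (min T (fst z))) (snd z)" for z
  proof (cases "fst z \<in> {0..t}")
    case True
    then have "max 0 (min T (fst z)) = fst z" using assms(2) by auto
    then show ?thesis by simp
  qed simp
  show ?thesis unfolding eq by measurable
qed simp

context brownian_setting
begin

text \<open>The admissible random coefficients of a Brownian increment that starts at time \<open>t\<close>.\<close>

definition sqi :: "real \<Rightarrow> ('a \<Rightarrow> real) \<Rightarrow> bool" where
  "sqi t f \<longleftrightarrow> f \<in> borel_measurable (F t) \<and> integrable M (\<lambda>\<omega>. (f \<omega>)\<^sup>2)"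

lemma sqi_mono: "sqi s f \<Longrightarrow> s \<le> t \<Longrightarrow> sqi t f"
  unfolding sqi_def using measurable_F_mono by blast

lemma sqi_measurable: "sqi s f \<Longrightarrow> f \<in> borel_measurable M"
  unfolding sqi_def using measurable_F_M by blast

lemma sqi_integrable_mult: "sqi s f \<Longrightarrow> sqi t g \<Longrightarrow> integrable M (\<lambda>\<omega>. f \<omega> * g \<omega>)"
  by (rule integrable_mult_sq) (auto simp: sqi_measurable, auto simp: sqi_def)

lemma sqi_mult_increment:
  assumes "sqi s f" "0 \<le> s" "s \<le> t"
  shows "sqi t (\<lambda>\<omega>. f \<omega> * (W t \<omega> - W s \<omega>))"
proof (cases "s = t")
  case True
  then show ?thesis by (simp add: sqi_def)
next
  case False
  with assms have st: "s < t" by simp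
  have f: "f \<in> borel_measurable (F s)" "integrable M (\<lambda>\<omega>. (f \<omega>)\<^sup>2)"
    using assms by (auto simp: sqi_def)
  have "integrable M (\<lambda>\<omega>. (f \<omega>)\<^sup>2 * (W t \<omega> - W s \<omega>)\<^sup>2)"
    using f integrable_increment_power[OF assms(2) st, of 2]
    by (intro integrable_mult_increment[OF assms(2) st, of "\<lambda>\<omega>. (f \<omega>)\<^sup>2" "\<lambda>x. x\<^sup>2"]) auto
  moreover have "(\<lambda>\<omega>. f \<omega> * (W t \<omega> - W s \<omega>)) \<in> borel_measurable (F t)"
    using measurable_F_mono[OF f(1) assms(3)] W_measurable_F[of s t] W_measurable_F[of t t] assms
    by (intro borel_measurable_times borel_measurable_diff) auto
  ultimately show ?thesis by (simp add: sqi_def power_mult_distrib)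
qed

lemma increment_orthogonal:
  assumes X: "sqi s X" and Y: "sqi s Y" and st: "0 \<le> s" "s \<le> t"
  shows "has_bochner_integral M (\<lambda>\<omega>. X \<omega> * Y \<omega> * (W t \<omega> - W s \<omega>)) 0"
proof (cases "s = t")
  case False
  with st have st: "0 \<le> s" "s < t" by auto
  have m: "(\<lambda>\<omega>. X \<omega> * Y \<omega>) \<in> borel_measurable (F s)" using X Y by (auto simp: sqi_def)
  show ?thesis
    using integrable_mult_increment[OF st m sqi_integrable_mult[OF X Y], of "\<lambda>x. x"]
      expectation_mult_increment[OF st m sqi_integrable_mult[OF X Y], of "\<lambda>x. x"]
      integrable_increment_power[OF st, of 1] expectation_increment[OF st]
    by (simp add: has_bochner_integral_iff)
qed (simp add: has_bochner_integral_zero)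

lemma increment_sq:
  assumes X: "sqi s X" and Y: "sqi s Y" and st: "0 \<le> s" "s \<le> t"
  shows "has_bochner_integral M (\<lambda>\<omega>. X \<omega> * Y \<omega> * (W t \<omega> - W s \<omega>)\<^sup>2) (expectation (\<lambda>\<omega>. X \<omega> * Y \<omega>) * (t - s))"
proof (cases "s = t")
  case False
  with st have st: "0 \<le> s" "s < t" by auto
  have m: "(\<lambda>\<omega>. X \<omega> * Y \<omega>) \<in> borel_measurable (F s)" using X Y by (auto simp: sqi_def)
  show ?thesis
    using integrable_mult_increment[OF st m sqi_integrable_mult[OF X Y], of "\<lambda>x. x\<^sup>2"]
      expectation_mult_increment[OF st m sqi_integrable_mult[OF X Y], of "\<lambda>x. x\<^sup>2"]
      integrable_increment_power[OF st, of 2] expectation_increment_sq[OF st]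
    by (simp add: has_bochner_integral_iff)
qed (simp add: has_bochner_integral_zero)

text \<open>Cut both intervals at \<open>c\<close> and at \<open>min b d\<close>. Only the product of the two increments over the common piece
  contributes; every other product has a factor that is centred and independent of the rest.\<close>

lemma increments_product_aux:
  assumes X: "sqi a X" and Y: "sqi c Y" and ab: "0 \<le> a" "a \<le> b" and cd: "c \<le> d" and ac: "a \<le> c"
  shows "has_bochner_integral M (\<lambda>\<omega>. (X \<omega> * (W b \<omega> - W a \<omega>)) * (Y \<omega> * (W d \<omega> - W c \<omega>)))
    (expectation (\<lambda>\<omega>. X \<omega> * Y \<omega>) * measure lborel ({a<..b} \<inter> {c<..d}))"
proof (cases "b \<le> c")
  case True
  then have "sqi c (\<lambda>\<omega>. X \<omega> * (W b \<omega> - W a \<omega>))"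
    using sqi_mono sqi_mult_increment[OF X ab] by blast
  then have "has_bochner_integral M (\<lambda>\<omega>. (X \<omega> * (W b \<omega> - W a \<omega>)) * Y \<omega> * (W d \<omega> - W c \<omega>)) 0"
    using ab ac cd Y by (intro increment_orthogonal) auto
  moreover have e: "{a<..b} \<inter> {c<..d} = {}" using True by auto
  ultimately show ?thesis unfolding e by (simp add: mult.assoc)
next
  case False
  define m where "m = min b d"
  have m: "c \<le> m" "m \<le> b" "m \<le> d" "0 \<le> c" using False cd ab ac by (auto simp: m_def)
  have Xc: "sqi c X" using sqi_mono[OF X ac] .
  have 1: "has_bochner_integral M (\<lambda>\<omega>. (X \<omega> * (W c \<omega> - W a \<omega>)) * Y \<omega> * (W d \<omega> - W c \<omega>)) 0"
    using sqi_mult_increment[OF X ab(1) ac] Y m cd by (intro increment_orthogonal) auto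
  have 2: "has_bochner_integral M (\<lambda>\<omega>. X \<omega> * Y \<omega> * (W m \<omega> - W c \<omega>)\<^sup>2) (expectation (\<lambda>\<omega>. X \<omega> * Y \<omega>) * (m - c))"
    using Xc Y m by (intro increment_sq) auto
  have Xm: "sqi m (\<lambda>\<omega>. X \<omega> * (W m \<omega> - W c \<omega>))" and Ym: "sqi m Y"
    using sqi_mult_increment[OF Xc] sqi_mono[OF Y] m by auto
  have 3: "has_bochner_integral M (\<lambda>\<omega>. (X \<omega> * (W m \<omega> - W c \<omega>)) * Y \<omega> * (W d \<omega> - W m \<omega>)) 0"
    using Xm Ym m by (intro increment_orthogonal) auto
  have 4: "has_bochner_integral M (\<lambda>\<omega>. (X \<omega> * (W m \<omega> - W c \<omega>)) * Y \<omega> * (W b \<omega> - W m \<omega>)) 0"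
    using Xm Ym m by (intro increment_orthogonal) auto
  have 5: "(W b \<omega> - W m \<omega>) * (W d \<omega> - W m \<omega>) = 0" for \<omega>
    by (auto simp: m_def min_def)
  have "(X \<omega> * (W b \<omega> - W a \<omega>)) * (Y \<omega> * (W d \<omega> - W c \<omega>)) =
      (((X \<omega> * (W c \<omega> - W a \<omega>)) * Y \<omega> * (W d \<omega> - W c \<omega>) + X \<omega> * Y \<omega> * (W m \<omega> - W c \<omega>)\<^sup>2)
      + (X \<omega> * (W m \<omega> - W c \<omega>)) * Y \<omega> * (W d \<omega> - W m \<omega>))
      + (X \<omega> * (W m \<omega> - W c \<omega>)) * Y \<omega> * (W b \<omega> - W m \<omega>)" for \<omega>
  proof -
    have "(X \<omega> * (W b \<omega> - W a \<omega>)) * (Y \<omega> * (W d \<omega> - W c \<omega>)) =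
      (((X \<omega> * (W c \<omega> - W a \<omega>)) * Y \<omega> * (W d \<omega> - W c \<omega>) + X \<omega> * Y \<omega> * (W m \<omega> - W c \<omega>)\<^sup>2)
      + (X \<omega> * (W m \<omega> - W c \<omega>)) * Y \<omega> * (W d \<omega> - W m \<omega>))
      + (X \<omega> * (W m \<omega> - W c \<omega>)) * Y \<omega> * (W b \<omega> - W m \<omega>)
      + X \<omega> * Y \<omega> * ((W b \<omega> - W m \<omega>) * (W d \<omega> - W m \<omega>))"
      by (simp add: algebra_simps power2_eq_square)
    then show ?thesis unfolding 5 by simp
  qed
  moreover have "measure lborel ({a<..b} \<inter> {c<..d}) = m - c"
  proof -
    have "{a<..b} \<inter> {c<..d} = {c<..m}" using ac by (auto simp: m_def)
    then show ?thesis using m by simp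
  qed
  ultimately show ?thesis
    using has_bochner_integral_add[OF has_bochner_integral_add[OF has_bochner_integral_add[OF 1 2] 3] 4]
    by simp
qed

lemma increments_product:
  assumes X: "sqi a X" and Y: "sqi c Y" and ab: "0 \<le> a" "a \<le> b" and cd: "0 \<le> c" "c \<le> d"
  shows "has_bochner_integral M (\<lambda>\<omega>. (X \<omega> * (W b \<omega> - W a \<omega>)) * (Y \<omega> * (W d \<omega> - W c \<omega>)))
    (expectation (\<lambda>\<omega>. X \<omega> * Y \<omega>) * measure lborel ({a<..b} \<inter> {c<..d}))"
proof (cases "a \<le> c")
  case True
  then show ?thesis using increments_product_aux[OF X Y ab cd(2)] by simp
next
  case False
  then show ?thesis using increments_product_aux[OF Y X cd ab(2)]
    by (simp add: mult.commute Int_commute)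
qed

text \<open>In contrast to elementary data, the intervals may overlap and be degenerate, the index set is
  arbitrary, and the coefficients are merely square integrable. This makes the processes closed
  under subtraction by taking disjoint sums of index sets.\<close>

definition simple_data :: "'i set \<Rightarrow> ('i \<Rightarrow> real) \<Rightarrow> ('i \<Rightarrow> real) \<Rightarrow> ('i \<Rightarrow> 'a \<Rightarrow> real) \<Rightarrow> bool" where
  "simple_data I a b \<xi> \<longleftrightarrow> finite I \<and> (\<forall>i\<in>I. 0 \<le> a i \<and> a i \<le> b i \<and> sqi (a i) (\<xi> i))"

definition simple_process :: "'i set \<Rightarrow> ('i \<Rightarrow> real) \<Rightarrow> ('i \<Rightarrow> real) \<Rightarrow> ('i \<Rightarrow> 'a \<Rightarrow> real) \<Rightarrow> real \<Rightarrow> 'a \<Rightarrow> real" where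
  "simple_process I a b \<xi> s \<omega> = (\<Sum>i\<in>I. \<xi> i \<omega> * indicator {a i<..b i} s)"

definition simple_integral :: "'i set \<Rightarrow> ('i \<Rightarrow> real) \<Rightarrow> ('i \<Rightarrow> real) \<Rightarrow> ('i \<Rightarrow> 'a \<Rightarrow> real) \<Rightarrow> 'a \<Rightarrow> real" where
  "simple_integral I a b \<xi> \<omega> = (\<Sum>i\<in>I. \<xi> i \<omega> * (W (b i) \<omega> - W (a i) \<omega>))"

text \<open>Expand both squares into double sums and compare term by term, using \<open>increments_product\<close>.\<close>

lemma simple_isometry:
  assumes S: "simple_data I a b \<xi>"
  shows "msq M (simple_integral I a b \<xi>) = (\<integral>\<^sup>+s. msq M (simple_process I a b \<xi> s) \<partial>lborel)"
proof -
  have fin: "finite I" and S': "\<And>i. i \<in> I \<Longrightarrow> 0 \<le> a i" "\<And>i. i \<in> I \<Longrightarrow> a i \<le> b i" "\<And>i. i \<in> I \<Longrightarrow> sqi (a i) (\<xi> i)"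
    using S by (auto simp: simple_data_def)
  define c where "c i j = expectation (\<lambda>\<omega>. \<xi> i \<omega> * \<xi> j \<omega>)" for i j
  define v where "v = (\<Sum>i\<in>I. \<Sum>j\<in>I. c i j * measure lborel ({a i<..b i} \<inter> {a j<..b j}))"
  have "has_bochner_integral M (\<lambda>\<omega>. (simple_integral I a b \<xi> \<omega>)\<^sup>2) v"
    unfolding simple_integral_def power2_eq_square sum_product v_def c_def
    by (intro has_bochner_integral_sum increments_product S')
  then have L: "msq M (simple_integral I a b \<xi>) = ennreal v"
    by (subst msq_eq_integral) (auto simp: has_bochner_integral_iff)
  define p where "p s = (\<Sum>i\<in>I. \<Sum>j\<in>I. c i j * (indicator {a i<..b i} s * indicator {a j<..b j} s))" for s :: real
  have "has_bochner_integral M (\<lambda>\<omega>. (simple_process I a b \<xi> s \<omega>)\<^sup>2) (p s)" for s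
  proof -
    have "has_bochner_integral M (\<lambda>\<omega>. (\<xi> i \<omega> * \<xi> j \<omega>) * (indicator {a i<..b i} s * indicator {a j<..b j} s))
      (c i j * (indicator {a i<..b i} s * indicator {a j<..b j} s))" if "i \<in> I" "j \<in> I" for i j
      unfolding c_def using sqi_integrable_mult[OF S'(3)[OF that(1)] S'(3)[OF that(2)]]
      by (intro has_bochner_integral_mult_left) (simp add: has_bochner_integral_iff)
    then have "has_bochner_integral M (\<lambda>\<omega>. \<Sum>i\<in>I. \<Sum>j\<in>I. (\<xi> i \<omega> * \<xi> j \<omega>) * (indicator {a i<..b i} s * indicator {a j<..b j} s)) (p s)"
      unfolding p_def by (intro has_bochner_integral_sum)
    then show ?thesis
      by (simp add: simple_process_def power2_eq_square sum_product mult.assoc mult.left_commute)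
  qed
  then have p: "msq M (simple_process I a b \<xi> s) = ennreal (p s)" "0 \<le> p s" for s
    by (auto simp: has_bochner_integral_iff msq_eq_integral) (metis integral_nonneg_AE AE_I2 zero_le_power2)
  have "has_bochner_integral lborel p v"
    unfolding p_def v_def
  proof (intro has_bochner_integral_sum has_bochner_integral_mult_right)
    fix i j
    have "has_bochner_integral lborel (indicator ({a i<..b i} \<inter> {a j<..b j}) :: real \<Rightarrow> real) (measure lborel ({a i<..b i} \<inter> {a j<..b j}))"
    proof (rule has_bochner_integral_real_indicator)
      have "emeasure lborel ({a i<..b i} \<inter> {a j<..b j}) \<le> emeasure lborel {a i<..b i}"
        by (intro emeasure_mono) auto
      also have "\<dots> < \<infinity>" by (cases "a i \<le> b i") auto
      finally show "emeasure lborel ({a i<..b i} \<inter> {a j<..b j}) < \<infinity>" .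
    qed simp
    then show "has_bochner_integral lborel (\<lambda>s. indicator {a i<..b i} s * indicator {a j<..b j} s) (measure lborel ({a i<..b i} \<inter> {a j<..b j}))"
      unfolding indicator_inter_arith .
  qed
  then have "(\<integral>\<^sup>+s. ennreal (p s) \<partial>lborel) = ennreal v"
    using p(2) by (subst nn_integral_eq_integral) (auto simp: has_bochner_integral_iff)
  then show ?thesis by (simp add: L p(1))
qed

lemma simple_isometry_diff:
  assumes S: "simple_data I a b \<xi>" and S': "simple_data J c d \<eta>"
  shows "msq M (\<lambda>\<omega>. simple_integral I a b \<xi> \<omega> - simple_integral J c d \<eta> \<omega>)
    = (\<integral>\<^sup>+s. msq M (\<lambda>\<omega>. simple_process I a b \<xi> s \<omega> - simple_process J c d \<eta> s \<omega>) \<partial>lborel)"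
proof -
  have fin: "finite I" "finite J" using S S' by (auto simp: simple_data_def)
  let ?\<zeta> = "case_sum \<xi> (\<lambda>j \<omega>. - \<eta> j \<omega>)"
  have "simple_data (I <+> J) (case_sum a c) (case_sum b d) ?\<zeta>"
    using S S' by (auto simp: simple_data_def sqi_def)
  from simple_isometry[OF this] show ?thesis
    unfolding simple_integral_def[abs_def] simple_process_def[abs_def] sum.Plus[OF fin]
    by (simp add: sum_negf)
qed

section \<open>Mean square limits of simple integrals\<close>

text \<open>Processes are indexed by the whole real line, so that translation is available; those that
  live on \<open>[0, t]\<close> are extended by 0.\<close>

definition pmeas :: "(real \<Rightarrow> 'a \<Rightarrow> 'b::topological_space) \<Rightarrow> bool" where
  "pmeas G \<longleftrightarrow> (\<lambda>z. G (fst z) (snd z)) \<in> borel_measurable (lborel \<Otimes>\<^sub>M M)"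

definition psq :: "(real \<Rightarrow> 'a \<Rightarrow> 'b::real_normed_vector) \<Rightarrow> ennreal" where
  "psq G = msq (lborel \<Otimes>\<^sub>M M) (\<lambda>z. G (fst z) (snd z))"

lemma pmeas_section: "pmeas G \<Longrightarrow> G s \<in> borel_measurable M"
  unfolding pmeas_def
  using measurable_compose[OF measurable_Pair1'[of s lborel M], of "\<lambda>z. G (fst z) (snd z)" borel] by simp

lemma pmeas_path: "pmeas G \<Longrightarrow> \<omega> \<in> space M \<Longrightarrow> (\<lambda>s. G s \<omega>) \<in> borel_measurable borel"
  unfolding pmeas_def
  using measurable_compose[OF measurable_Pair2'[of \<omega> M lborel], of "\<lambda>z. G (fst z) (snd z)" borel] by simp

sublocale lM: pair_sigma_finite lborel M ..

lemma psq_time: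
  fixes G :: "real \<Rightarrow> 'a \<Rightarrow> 'b::{real_normed_vector, second_countable_topology}"
  assumes "pmeas G" shows "psq G = (\<integral>\<^sup>+s. msq M (G s) \<partial>lborel)"
  unfolding psq_def msq_def
  by (subst nn_integral_fst[symmetric]) (use assms in \<open>auto simp: pmeas_def\<close>)

lemma psq_space:
  fixes G :: "real \<Rightarrow> 'a \<Rightarrow> 'b::{real_normed_vector, second_countable_topology}"
  assumes "pmeas G" shows "psq G = (\<integral>\<^sup>+\<omega>. (\<integral>\<^sup>+s. ennreal ((norm (G s \<omega>))\<^sup>2) \<partial>lborel) \<partial>M)"
  unfolding psq_def msq_def
  by (subst lM.nn_integral_snd[symmetric]) (use assms in \<open>auto simp: pmeas_def split_beta'\<close>)

lemma psq_triangle: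
  fixes f g h :: "real \<Rightarrow> 'a \<Rightarrow> 'b::{real_normed_vector, second_countable_topology}"
  assumes "pmeas f" "pmeas g" "pmeas h"
  shows "psq (\<lambda>s \<omega>. f s \<omega> - h s \<omega>) \<le> 2 * psq (\<lambda>s \<omega>. f s \<omega> - g s \<omega>) + 2 * psq (\<lambda>s \<omega>. g s \<omega> - h s \<omega>)"
  unfolding psq_def using assms unfolding pmeas_def by (rule msq_triangle)

lemma psq_minus_commute: "psq (\<lambda>s \<omega>. f s \<omega> - g s \<omega>) = psq (\<lambda>s \<omega>. g s \<omega> - f s \<omega>)"
  unfolding psq_def by (rule msq_minus_commute)

lemma pmeas_simple: assumes "simple_data I a b \<xi>" shows "pmeas (simple_process I a b \<xi>)"
  unfolding pmeas_def simple_process_def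
proof (rule borel_measurable_sum)
  fix i assume "i \<in> I"
  then have [measurable]: "\<xi> i \<in> borel_measurable M" using assms by (auto simp: simple_data_def sqi_measurable)
  show "(\<lambda>z. \<xi> i (snd z) * indicator {a i<..b i} (fst z)) \<in> borel_measurable (lborel \<Otimes>\<^sub>M M)" by measurable
qed

lemma measurable_simple_integral: assumes "simple_data I a b \<xi>"
  shows "simple_integral I a b \<xi> \<in> borel_measurable M"
  unfolding simple_integral_def[abs_def]
  using assms by (intro borel_measurable_sum borel_measurable_times borel_measurable_diff W_measurable)
    (auto simp: simple_data_def sqi_measurable intro: order_trans)

text \<open>The Ito integral over the whole line. In this form, integrals up to different times and integrals of
  simple processes become comparable.\<close>

definition ito_lim :: "(real \<Rightarrow> 'a \<Rightarrow> real) \<Rightarrow> ('a \<Rightarrow> real) \<Rightarrow> bool" where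
  "ito_lim G J \<longleftrightarrow> pmeas G \<and> J \<in> borel_measurable M \<and>
    (\<exists>m a b \<xi>. (\<forall>k::nat. simple_data {..<m k :: nat} (a k) (b k) (\<xi> k)) \<and>
      (\<lambda>k. psq (\<lambda>s \<omega>. G s \<omega> - simple_process {..<m k} (a k) (b k) (\<xi> k) s \<omega>)) \<longlonglongrightarrow> 0 \<and>
      (\<lambda>k. msq M (\<lambda>\<omega>. J \<omega> - simple_integral {..<m k} (a k) (b k) (\<xi> k) \<omega>)) \<longlonglongrightarrow> 0)"

lemma ito_lim_simple:
  assumes "simple_data {..<m::nat} a b \<xi>"
  shows "ito_lim (simple_process {..<m} a b \<xi>) (simple_integral {..<m} a b \<xi>)"
  unfolding ito_lim_def
proof (intro conjI)
  show "\<exists>m' a' b' \<xi>'. (\<forall>k::nat. simple_data {..<m' k :: nat} (a' k) (b' k) (\<xi>' k)) \<and>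
      (\<lambda>k. psq (\<lambda>s \<omega>. simple_process {..<m} a b \<xi> s \<omega> - simple_process {..<m' k} (a' k) (b' k) (\<xi>' k) s \<omega>)) \<longlonglongrightarrow> 0 \<and>
      (\<lambda>k. msq M (\<lambda>\<omega>. simple_integral {..<m} a b \<xi> \<omega> - simple_integral {..<m' k} (a' k) (b' k) (\<xi>' k) \<omega>)) \<longlonglongrightarrow> 0"
    by (rule exI[of _ "\<lambda>_. m"], rule exI[of _ "\<lambda>_. a"], rule exI[of _ "\<lambda>_. b"], rule exI[of _ "\<lambda>_. \<xi>"])
       (use assms in \<open>auto simp: psq_def\<close>)
qed (use pmeas_simple[OF assms] measurable_simple_integral[OF assms] in auto)

text \<open>The isometry passes to limits. The factor 16 is the price of four applications of
  \<open>|x + y|\<^sup>2 \<le> 2 |x|\<^sup>2 + 2 |y|\<^sup>2\<close>.\<close>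

lemma ito_lim_dist:
  assumes GJ: "ito_lim G J" and GJ': "ito_lim G' J'"
  shows "msq M (\<lambda>\<omega>. J \<omega> - J' \<omega>) \<le> 16 * psq (\<lambda>s \<omega>. G s \<omega> - G' s \<omega>)"
proof -
  from GJ obtain m a b \<xi> where 1: "\<And>k::nat. simple_data {..<m k :: nat} (a k) (b k) (\<xi> k)"
      "(\<lambda>k. psq (\<lambda>s \<omega>. G s \<omega> - simple_process {..<m k} (a k) (b k) (\<xi> k) s \<omega>)) \<longlonglongrightarrow> 0"
      "(\<lambda>k. msq M (\<lambda>\<omega>. J \<omega> - simple_integral {..<m k} (a k) (b k) (\<xi> k) \<omega>)) \<longlonglongrightarrow> 0"
    and m1: "pmeas G" "J \<in> borel_measurable M"
    unfolding ito_lim_def by blast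
  from GJ' obtain m' a' b' \<xi>' where 2: "\<And>k::nat. simple_data {..<m' k :: nat} (a' k) (b' k) (\<xi>' k)"
      "(\<lambda>k. psq (\<lambda>s \<omega>. G' s \<omega> - simple_process {..<m' k} (a' k) (b' k) (\<xi>' k) s \<omega>)) \<longlonglongrightarrow> 0"
      "(\<lambda>k. msq M (\<lambda>\<omega>. J' \<omega> - simple_integral {..<m' k} (a' k) (b' k) (\<xi>' k) \<omega>)) \<longlonglongrightarrow> 0"
    and m2: "pmeas G'" "J' \<in> borel_measurable M"
    unfolding ito_lim_def by blast
  define S where "S k = simple_process {..<m k} (a k) (b k) (\<xi> k)" for k
  define S' where "S' k = simple_process {..<m' k} (a' k) (b' k) (\<xi>' k)" for k
  define I where "I k = simple_integral {..<m k} (a k) (b k) (\<xi> k)" for k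
  define I' where "I' k = simple_integral {..<m' k} (a' k) (b' k) (\<xi>' k)" for k
  have mS: "pmeas (S k)" "pmeas (S' k)" "I k \<in> borel_measurable M" "I' k \<in> borel_measurable M" for k
    using pmeas_simple[OF 1(1)] pmeas_simple[OF 2(1)] measurable_simple_integral[OF 1(1)] measurable_simple_integral[OF 2(1)]
    unfolding S_def S'_def I_def I'_def by auto
  have iso: "msq M (\<lambda>\<omega>. I k \<omega> - I' k \<omega>) = psq (\<lambda>s \<omega>. S k s \<omega> - S' k s \<omega>)" for k
    using simple_isometry_diff[OF 1(1) 2(1), of k k] psq_time[of "\<lambda>s \<omega>. S k s \<omega> - S' k s \<omega>"] mS[of k]
    unfolding S_def S'_def I_def I'_def by (simp add: pmeas_def)
  define P where "P = psq (\<lambda>s \<omega>. G s \<omega> - G' s \<omega>)"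
  have "msq M (\<lambda>\<omega>. J \<omega> - J' \<omega>) \<le> 2 * msq M (\<lambda>\<omega>. J \<omega> - I k \<omega>) +
     2 * (2 * (2 * psq (\<lambda>s \<omega>. G s \<omega> - S k s \<omega>) + 2 * (2 * P + 2 * psq (\<lambda>s \<omega>. G' s \<omega> - S' k s \<omega>)))
      + 2 * msq M (\<lambda>\<omega>. J' \<omega> - I' k \<omega>))" for k
  proof -
    have h2: "msq M (\<lambda>\<omega>. I k \<omega> - J' \<omega>) \<le> 2 * psq (\<lambda>s \<omega>. S k s \<omega> - S' k s \<omega>) + 2 * msq M (\<lambda>\<omega>. I' k \<omega> - J' \<omega>)"
      unfolding iso[symmetric] using m1 m2 mS by (intro msq_triangle)
    have "psq (\<lambda>s \<omega>. S k s \<omega> - S' k s \<omega>) \<le> 2 * psq (\<lambda>s \<omega>. S k s \<omega> - G s \<omega>) + 2 * psq (\<lambda>s \<omega>. G s \<omega> - S' k s \<omega>)"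
      using m1 m2 mS by (intro psq_triangle)
    also have "\<dots> \<le> 2 * psq (\<lambda>s \<omega>. S k s \<omega> - G s \<omega>) + 2 * (2 * P + 2 * psq (\<lambda>s \<omega>. G' s \<omega> - S' k s \<omega>))"
      unfolding P_def using m1 m2 mS by (intro add_left_mono mult_left_mono psq_triangle) auto
    finally have h3: "psq (\<lambda>s \<omega>. S k s \<omega> - S' k s \<omega>) \<le> 2 * psq (\<lambda>s \<omega>. S k s \<omega> - G s \<omega>) + 2 * (2 * P + 2 * psq (\<lambda>s \<omega>. G' s \<omega> - S' k s \<omega>))" .
    have "msq M (\<lambda>\<omega>. J \<omega> - J' \<omega>) \<le> 2 * msq M (\<lambda>\<omega>. J \<omega> - I k \<omega>) + 2 * msq M (\<lambda>\<omega>. I k \<omega> - J' \<omega>)"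
      using m1 m2 mS by (intro msq_triangle)
    also have "\<dots> \<le> 2 * msq M (\<lambda>\<omega>. J \<omega> - I k \<omega>) + 2 * (2 * (2 * psq (\<lambda>s \<omega>. S k s \<omega> - G s \<omega>) + 2 * (2 * P + 2 * psq (\<lambda>s \<omega>. G' s \<omega> - S' k s \<omega>)))
      + 2 * msq M (\<lambda>\<omega>. I' k \<omega> - J' \<omega>))"
      by (rule add_left_mono, rule mult_left_mono, rule order_trans[OF h2], rule add_right_mono, rule mult_left_mono[OF h3]) auto
    finally show ?thesis
      unfolding msq_minus_commute[of M "I' k" J'] psq_minus_commute[of "S k" G] .
  qed
  moreover have "(\<lambda>k. 2 * msq M (\<lambda>\<omega>. J \<omega> - I k \<omega>) +
     2 * (2 * (2 * psq (\<lambda>s \<omega>. G s \<omega> - S k s \<omega>) + 2 * (2 * P + 2 * psq (\<lambda>s \<omega>. G' s \<omega> - S' k s \<omega>)))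
      + 2 * msq M (\<lambda>\<omega>. J' \<omega> - I' k \<omega>))) \<longlonglongrightarrow> 2 * 0 + 2 * (2 * (2 * 0 + 2 * (2 * P + 2 * 0)) + 2 * 0)"
    using 1(2,3) 2(2,3) unfolding S_def S'_def I_def I'_def
    by (intro tendsto_intros tendsto_mult_ennreal) auto
  ultimately have "msq M (\<lambda>\<omega>. J \<omega> - J' \<omega>) \<le> 2 * 0 + 2 * (2 * (2 * 0 + 2 * (2 * P + 2 * 0)) + 2 * 0)"
    by (intro LIMSEQ_le_const) auto
  also have "\<dots> = 16 * P" by (simp add: mult.assoc[symmetric])
  finally show ?thesis unfolding P_def .
qed

section \<open>The given Ito integral as such a limit\<close>

definition cut :: "real \<Rightarrow> (real \<Rightarrow> 'a \<Rightarrow> 'b::real_normed_vector) \<Rightarrow> real \<Rightarrow> 'a \<Rightarrow> 'b" where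
  "cut t H s \<omega> = indicator {0..t} s *\<^sub>R H s \<omega>"

lemma pmeas_cut:
  fixes H :: "real \<Rightarrow> 'a \<Rightarrow> 'b::{real_normed_vector, second_countable_topology}"
  assumes "measurable_process M T H" "t \<le> T"
  shows "pmeas (cut t H)"
  unfolding pmeas_def cut_def using assms by (rule measurable_process_cut)

lemma psq_cut_space:
  fixes H :: "real \<Rightarrow> 'a \<Rightarrow> 'b::{real_normed_vector, second_countable_topology}"
  assumes "pmeas (cut t H)"
  shows "psq (cut t H) = (\<integral>\<^sup>+\<omega>. (\<integral>\<^sup>+s\<in>{0..t}. ennreal ((norm (H s \<omega>))\<^sup>2) \<partial>lborel) \<partial>M)"
  unfolding psq_space[OF assms] cut_def
  by (intro nn_integral_cong) (auto simp: indicator_def intro!: nn_integral_cong)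

lemma psq_cut_time:
  fixes H :: "real \<Rightarrow> 'a \<Rightarrow> 'b::{real_normed_vector, second_countable_topology}"
  assumes "pmeas (cut t H)"
  shows "psq (cut t H) = (\<integral>\<^sup>+s\<in>{0..t}. msq M (H s) \<partial>lborel)"
  unfolding psq_time[OF assms]
  by (intro nn_integral_cong) (auto simp: indicator_def cut_def[abs_def])

lemma elementary_data_increasing:
  assumes "elementary_data M W t m \<tau> \<xi>" "i \<le> j" "j \<le> m" shows "\<tau> i \<le> \<tau> j"
  using assms(2,3)
proof (induction j rule: dec_induct)
  case (step n)
  then show ?case using assms(1) unfolding elementary_data_def by (meson Suc_le_lessD less_imp_le order_trans)
qed simp

lemma elementary_data_simple:
  assumes E: "elementary_data M W t m \<tau> \<xi>"
  shows "simple_data {..<m} \<tau> (\<lambda>i. \<tau> (Suc i)) \<xi>"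
  unfolding simple_data_def
proof (intro conjI ballI)
  fix i assume i: "i \<in> {..<m}"
  have 0: "0 \<le> \<tau> 0" using E by (simp add: elementary_data_def)
  show "0 \<le> \<tau> i" using elementary_data_increasing[OF E, of 0 i] i 0 by auto
  show "\<tau> i \<le> \<tau> (Suc i)" using elementary_data_increasing[OF E, of i "Suc i"] i by auto
  have x: "\<xi> i \<in> borel_measurable (F (\<tau> i))" using E i by (auto simp: elementary_data_def)
  obtain C where C: "\<And>\<omega>. \<omega> \<in> space M \<Longrightarrow> \<bar>\<xi> i \<omega>\<bar> \<le> C" using E i unfolding elementary_data_def by blast
  have "integrable M (\<lambda>\<omega>. (\<xi> i \<omega>)\<^sup>2)"
  proof (rule integrable_const_bound[of _ "C\<^sup>2"])
    show "AE \<omega> in M. norm ((\<xi> i \<omega>)\<^sup>2) \<le> C\<^sup>2"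
      using C by (intro AE_I2) (metis abs_power2 power2_abs power_mono abs_ge_zero real_norm_def)
  qed (use measurable_F_M[OF x] in measurable)
  then show "sqi (\<tau> i) (\<xi> i)" using x by (simp add: sqi_def)
qed simp

lemma elementary_process_simple:
  "elementary_process m \<tau> \<xi> = simple_process {..<m} \<tau> (\<lambda>i. \<tau> (Suc i)) \<xi>"
  by (intro ext) (simp add: elementary_process_def simple_process_def)

lemma elementary_integral_simple:
  "elementary_integral W m \<tau> \<xi> = simple_integral {..<m} \<tau> (\<lambda>i. \<tau> (Suc i)) \<xi>"
  by (intro ext) (simp add: elementary_integral_def simple_integral_def)

lemma cut_elementary_process:
  assumes E: "elementary_data M W t m \<tau> \<xi>"
  shows "cut t (elementary_process m \<tau> \<xi>) = elementary_process m \<tau> \<xi>"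
proof (intro ext)
  fix s \<omega>
  have "\<tau> 0 \<ge> 0" "\<tau> m \<le> t" using E by (auto simp: elementary_data_def)
  then have "{\<tau> i<..\<tau> (Suc i)} \<subseteq> {0..t}" if "i < m" for i
    using elementary_data_increasing[OF E, of 0 i] elementary_data_increasing[OF E, of "Suc i" m] that by auto
  then show "cut t (elementary_process m \<tau> \<xi>) s \<omega> = elementary_process m \<tau> \<xi> s \<omega>"
    unfolding cut_def elementary_process_def by (cases "s \<in> {0..t}") (fastforce intro!: sum.neutral)+
qed

lemma psq_diff_elementary:
  assumes H: "measurable_process M t H" and E: "elementary_data M W t m \<tau> \<xi>"
  shows "(\<integral>\<^sup>+\<omega>. (\<integral>\<^sup>+s\<in>{0..t}. ennreal ((H s \<omega> - elementary_process m \<tau> \<xi> s \<omega>)\<^sup>2) \<partial>lborel) \<partial>M)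
    = psq (\<lambda>s \<omega>. cut t H s \<omega> - elementary_process m \<tau> \<xi> s \<omega>)"
proof -
  have eq: "(\<lambda>s \<omega>. cut t H s \<omega> - elementary_process m \<tau> \<xi> s \<omega>) = cut t (\<lambda>s \<omega>. H s \<omega> - elementary_process m \<tau> \<xi> s \<omega>)"
    by (subst cut_elementary_process[OF E, symmetric]) (auto simp: cut_def fun_eq_iff algebra_simps)
  have "pmeas (\<lambda>s \<omega>. cut t H s \<omega> - elementary_process m \<tau> \<xi> s \<omega>)"
    using pmeas_cut[OF H order_refl] pmeas_simple[OF elementary_data_simple[OF E]]
    unfolding pmeas_def elementary_process_simple by simp
  then show ?thesis unfolding eq by (subst psq_cut_space) auto
qed

lemma has_ito_integral_ito_lim:
  assumes "has_ito_integral M W t H I"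
  shows "ito_lim (cut t H) I"
proof -
  from assms obtain m \<tau> \<xi> where H: "H \<in> L2F M W t" and I: "I \<in> borel_measurable M"
    and E: "\<And>k. elementary_data M W t (m k) (\<tau> k) (\<xi> k)"
    and 1: "(\<lambda>k. \<integral>\<^sup>+\<omega>. (\<integral>\<^sup>+s\<in>{0..t}. ennreal ((H s \<omega> - elementary_process (m k) (\<tau> k) (\<xi> k) s \<omega>)\<^sup>2) \<partial>lborel) \<partial>M) \<longlonglongrightarrow> 0"
    and 2: "(\<lambda>k. \<integral>\<^sup>+\<omega>. ennreal ((I \<omega> - elementary_integral W (m k) (\<tau> k) (\<xi> k) \<omega>)\<^sup>2) \<partial>M) \<longlonglongrightarrow> 0"
    unfolding has_ito_integral_def by blast
  have mp: "measurable_process M t H" using H by (simp add: L2F_def)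
  show ?thesis
    unfolding ito_lim_def
  proof (intro conjI exI allI)
    show "pmeas (cut t H)" using mp by (rule pmeas_cut) simp
    show "simple_data {..<m k} (\<tau> k) (\<lambda>i. \<tau> k (Suc i)) (\<xi> k)" for k using E by (rule elementary_data_simple)
    show "(\<lambda>k. psq (\<lambda>s \<omega>. cut t H s \<omega> - simple_process {..<m k} (\<tau> k) (\<lambda>i. \<tau> k (Suc i)) (\<xi> k) s \<omega>)) \<longlonglongrightarrow> 0"
      using 1 psq_diff_elementary[OF mp E] unfolding elementary_process_simple by simp
    show "(\<lambda>k. msq M (\<lambda>\<omega>. I \<omega> - simple_integral {..<m k} (\<tau> k) (\<lambda>i. \<tau> k (Suc i)) (\<xi> k) \<omega>)) \<longlonglongrightarrow> 0"
      using 2 unfolding msq_def elementary_integral_simple by simp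
  qed (rule I)
qed

end

section \<open>Translations are continuous in the mean\<close>

lemma ennreal_tendsto_0I:
  assumes "\<And>e::real. e > 0 \<Longrightarrow> eventually (\<lambda>n. f n \<le> ennreal e) F"
  shows "(f \<longlongrightarrow> (0::ennreal)) F"
proof (rule order_tendstoI)
  fix a :: ennreal assume "0 < a"
  then obtain b where b: "0 < b" "b < a" using dense by blast
  then have "b < top" by (metis order.strict_trans2 top_greatest)
  then have eq: "ennreal (enn2real b) = b" by simp
  then have "0 < enn2real b" using b(1) by (simp add: enn2real_positive_iff \<open>b < top\<close>)
  from assms[OF this] show "eventually (\<lambda>n. f n < a) F"
    by eventually_elim (use b eq in auto)
qed simp

lemma ennreal_tendsto_0D:
  "(f \<longlongrightarrow> (0::ennreal)) F \<Longrightarrow> e > 0 \<Longrightarrow> eventually (\<lambda>n. f n < ennreal e) F"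
  by (rule order_tendstoD(2)) auto

lemma nn_integral_shift:
  fixes f :: "real \<Rightarrow> ennreal" assumes "f \<in> borel_measurable borel"
  shows "(\<integral>\<^sup>+s. f (s + u) \<partial>lborel) = (\<integral>\<^sup>+s. f s \<partial>lborel)"
  using nn_integral_real_affine[OF assms, of 1 u] by (simp add: add.commute)

text \<open>Translations are treated in \<open>L\<^sup>1\<close>; for bounded functions this controls the \<open>L\<^sup>2\<close> distance.\<close>

definition shift_dist :: "(real \<Rightarrow> 'b::real_normed_vector) \<Rightarrow> real \<Rightarrow> ennreal" where
  "shift_dist f u = (\<integral>\<^sup>+s. ennreal (norm (f (s + u) - f s)) \<partial>lborel)"

lemma shift_dist_add:
  fixes f g :: "real \<Rightarrow> 'b::{real_normed_vector, second_countable_topology}"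
  assumes [measurable]: "f \<in> borel_measurable borel" "g \<in> borel_measurable borel"
  shows "shift_dist (\<lambda>s. f s + g s) u \<le> shift_dist f u + shift_dist g u"
proof -
  have "shift_dist (\<lambda>s. f s + g s) u \<le> (\<integral>\<^sup>+s. ennreal (norm (f (s + u) - f s)) + ennreal (norm (g (s + u) - g s)) \<partial>lborel)"
    unfolding shift_dist_def
  proof (intro nn_integral_mono)
    fix s
    have "norm (f (s + u) + g (s + u) - (f s + g s)) \<le> norm (f (s + u) - f s) + norm (g (s + u) - g s)"
      by (metis add_diff_add norm_triangle_ineq)
    then show "ennreal (norm (f (s + u) + g (s + u) - (f s + g s))) \<le> ennreal (norm (f (s + u) - f s)) + ennreal (norm (g (s + u) - g s))"
      by (simp add: ennreal_plus[symmetric] del: ennreal_plus)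
  qed
  also have "\<dots> = shift_dist f u + shift_dist g u"
    unfolding shift_dist_def by (rule nn_integral_add) measurable
  finally show ?thesis .
qed

lemma shift_dist_le:
  fixes f :: "real \<Rightarrow> 'b::{real_normed_vector, second_countable_topology}"
  assumes [measurable]: "f \<in> borel_measurable borel"
  shows "shift_dist f u \<le> 2 * (\<integral>\<^sup>+s. ennreal (norm (f s)) \<partial>lborel)"
proof -
  have "shift_dist f u \<le> (\<integral>\<^sup>+s. ennreal (norm (f (s + u))) + ennreal (norm (f s)) \<partial>lborel)"
    unfolding shift_dist_def
    by (intro nn_integral_mono) (simp add: ennreal_plus[symmetric] norm_triangle_ineq4 del: ennreal_plus)
  also have "\<dots> = (\<integral>\<^sup>+s. ennreal (norm (f (s + u))) \<partial>lborel) + (\<integral>\<^sup>+s. ennreal (norm (f s)) \<partial>lborel)"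
    by (rule nn_integral_add) measurable
  also have "(\<integral>\<^sup>+s. ennreal (norm (f (s + u))) \<partial>lborel) = (\<integral>\<^sup>+s. ennreal (norm (f s)) \<partial>lborel)"
    by (rule nn_integral_shift[of "\<lambda>s. ennreal (norm (f s))"]) measurable
  finally show ?thesis by (simp add: mult_2)
qed

lemma shift_dist_approx:
  fixes f g :: "real \<Rightarrow> 'b::{real_normed_vector, second_countable_topology}"
  assumes [measurable]: "f \<in> borel_measurable borel" "g \<in> borel_measurable borel"
  shows "shift_dist f u \<le> shift_dist g u + 2 * (\<integral>\<^sup>+s. ennreal (norm (f s - g s)) \<partial>lborel)"
proof -
  have "shift_dist f u = shift_dist (\<lambda>s. g s + (f s - g s)) u" by simp
  also have "\<dots> \<le> shift_dist g u + shift_dist (\<lambda>s. f s - g s) u"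
    by (rule shift_dist_add) measurable
  also have "\<dots> \<le> shift_dist g u + 2 * (\<integral>\<^sup>+s. ennreal (norm (f s - g s)) \<partial>lborel)"
    by (intro add_left_mono shift_dist_le) measurable
  finally show ?thesis .
qed

text \<open>For an open set, a point that lies inside stays inside under small translations, so dominated
  convergence applies. Points outside are brought to this case by the reverse translation.\<close>

lemma shift_dist_open:
  fixes U :: "real set"
  assumes U: "open U" "emeasure lborel U < \<infinity>" and u: "u \<longlonglongrightarrow> 0"
  shows "(\<lambda>n. shift_dist (indicator U :: real \<Rightarrow> real) (u n)) \<longlonglongrightarrow> 0"
proof -
  have [measurable]: "U \<in> sets borel" using U by auto
  define d where "d v s = indicator U s * (1 - indicator U (s + v) :: ennreal)" for v s :: real
  have [measurable]: "d v \<in> borel_measurable borel" for v unfolding d_def by measurable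
  have lim: "(\<lambda>n. \<integral>\<^sup>+s. d (v n) s \<partial>lborel) \<longlonglongrightarrow> 0" if v: "v \<longlonglongrightarrow> 0" for v
  proof -
    have "(\<lambda>n. \<integral>\<^sup>+s. d (v n) s \<partial>lborel) \<longlonglongrightarrow> (\<integral>\<^sup>+(s::real). 0 \<partial>lborel)"
    proof (rule nn_integral_dominated_convergence[where w = "indicator U"])
      show "AE s in lborel. d (v j) s \<le> indicator U s" for j
        by (auto simp: d_def indicator_def)
      show "AE s in lborel. (\<lambda>i. d (v i) s) \<longlonglongrightarrow> 0"
      proof (rule AE_I2)
        fix s
        show "(\<lambda>i. d (v i) s) \<longlonglongrightarrow> 0"
        proof (cases "s \<in> U")
          case True
          have "(\<lambda>i. s + v i) \<longlonglongrightarrow> s" using tendsto_add[OF tendsto_const v, of s] by simp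
          then have "eventually (\<lambda>i. s + v i \<in> U) sequentially" using U(1) True by (rule topological_tendstoD)
          then have "eventually (\<lambda>i. d (v i) s = 0) sequentially" by eventually_elim (simp add: d_def)
          then show ?thesis by (rule tendsto_eventually)
        qed (simp add: d_def)
      qed
    qed (use U in auto)
    then show ?thesis by simp
  qed
  have "shift_dist (indicator U :: real \<Rightarrow> real) v = (\<integral>\<^sup>+s. d (- v) s \<partial>lborel) + (\<integral>\<^sup>+s. d v s \<partial>lborel)" for v
  proof -
    have "shift_dist (indicator U :: real \<Rightarrow> real) v = (\<integral>\<^sup>+s. d (- v) (s + v) + d v s \<partial>lborel)"
      unfolding shift_dist_def d_def by (intro nn_integral_cong) (auto simp: indicator_def)
    also have "\<dots> = (\<integral>\<^sup>+s. d (- v) (s + v) \<partial>lborel) + (\<integral>\<^sup>+s. d v s \<partial>lborel)"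
      by (rule nn_integral_add) measurable
    finally show ?thesis by (simp add: nn_integral_shift[of "d (- v)"])
  qed
  moreover have "(\<lambda>n. (\<integral>\<^sup>+s. d (- u n) s \<partial>lborel) + (\<integral>\<^sup>+s. d (u n) s \<partial>lborel)) \<longlonglongrightarrow> 0 + 0"
    using lim[of "\<lambda>n. - u n"] lim[OF u] tendsto_minus[OF u] by (intro tendsto_add) auto
  ultimately show ?thesis by simp
qed

text \<open>Approximation from indicators of open sets by outer regularity, linearity and \<open>L\<^sup>1\<close> limits.\<close>

lemma shift_dist_tendsto:
  fixes f :: "real \<Rightarrow> 'b::{banach, second_countable_topology}"
  assumes f: "integrable lborel f" and u: "u \<longlonglongrightarrow> 0"
  shows "(\<lambda>n. shift_dist f (u n)) \<longlonglongrightarrow> 0"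
  using f
proof (induction rule: integrable_induct)
  case (base A c)
  have [measurable]: "A \<in> sets borel" using base by simp
  have ind: "(\<lambda>n. shift_dist (indicator A :: real \<Rightarrow> real) (u n)) \<longlonglongrightarrow> 0"
  proof (rule ennreal_tendsto_0I)
    fix e :: real assume e: "e > 0"
    obtain U where U: "open U" "A \<subseteq> U" "emeasure lborel (U - A) < ennreal (e/4)"
      using outer_regular_lborel[of A "e/4"] e by auto
    have [measurable]: "U \<in> sets borel" using U by auto
    have "emeasure lborel U = emeasure lborel A + emeasure lborel (U - A)"
      using U(2) by (subst plus_emeasure) (auto intro!: arg_cong2[where f=emeasure])
    then have "emeasure lborel U < \<infinity>" using base U(3) by (auto simp: less_top[symmetric])
    from ennreal_tendsto_0D[OF shift_dist_open[OF U(1) this u], of "e/2"] e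
    have "eventually (\<lambda>n. shift_dist (indicator U :: real \<Rightarrow> real) (u n) < ennreal (e/2)) sequentially" by simp
    then show "eventually (\<lambda>n. shift_dist (indicator A :: real \<Rightarrow> real) (u n) \<le> ennreal e) sequentially"
    proof eventually_elim
      case (elim n)
      have "(\<integral>\<^sup>+s. ennreal (norm (indicator A s - indicator U s :: real)) \<partial>lborel) = (\<integral>\<^sup>+s. indicator (U - A) s \<partial>lborel)"
        using U(2) by (intro nn_integral_cong) (auto simp: indicator_def)
      also have "\<dots> \<le> ennreal (e/4)" using U(3) by simp
      finally have 1: "(\<integral>\<^sup>+s. ennreal (norm (indicator A s - indicator U s :: real)) \<partial>lborel) \<le> ennreal (e/4)" .
      have "shift_dist (indicator A :: real \<Rightarrow> real) (u n) \<le> shift_dist (indicator U :: real \<Rightarrow> real) (u n)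
          + 2 * (\<integral>\<^sup>+s. ennreal (norm (indicator A s - indicator U s :: real)) \<partial>lborel)"
        by (rule shift_dist_approx) measurable
      also have "\<dots> \<le> ennreal (e/2) + 2 * ennreal (e/4)"
        using elim 1 by (intro add_mono mult_left_mono) auto
      also have "\<dots> = ennreal e" using e by (simp add: numeral_mult_ennreal ennreal_plus[symmetric] del: ennreal_plus)
      finally show ?case .
    qed
  qed
  have "shift_dist (\<lambda>s. indicator A s *\<^sub>R c) v = ennreal (norm c) * shift_dist (indicator A :: real \<Rightarrow> real) v" for v
    unfolding shift_dist_def
    by (subst nn_integral_cmult[symmetric]) (auto simp: scaleR_left_diff_distrib[symmetric] ennreal_mult mult.commute intro!: nn_integral_cong)
  moreover have "(\<lambda>n. ennreal (norm c) * shift_dist (indicator A :: real \<Rightarrow> real) (u n)) \<longlonglongrightarrow> ennreal (norm c) * 0"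
    by (intro tendsto_mult_ennreal ind tendsto_const) auto
  ultimately show ?case by simp
next
  case (add f g)
  have "(\<lambda>n. shift_dist f (u n) + shift_dist g (u n)) \<longlonglongrightarrow> 0 + 0"
    by (intro tendsto_add add)
  then have lim: "(\<lambda>n. shift_dist f (u n) + shift_dist g (u n)) \<longlonglongrightarrow> 0" by simp
  have m: "f \<in> borel_measurable borel" "g \<in> borel_measurable borel" using add(1,2) by auto
  show ?case
    by (rule tendsto_sandwich[OF _ _ tendsto_const lim])
       (intro always_eventually allI shift_dist_add[OF m] zero_le)+
next
  case (lim f s)
  have [measurable]: "f \<in> borel_measurable borel" "s i \<in> borel_measurable borel" for i using lim(1,4) by auto
  have fin: "(\<integral>\<^sup>+x. ennreal (norm (f x)) \<partial>lborel) < \<infinity>" using lim(4) by (simp add: integrable_iff_bounded)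
  have "(\<lambda>i. \<integral>\<^sup>+x. ennreal (norm (f x - s i x)) \<partial>lborel) \<longlonglongrightarrow> (\<integral>\<^sup>+(x::real). 0 \<partial>lborel)"
  proof (rule nn_integral_dominated_convergence[where w = "\<lambda>x. 3 * ennreal (norm (f x))"])
    show "AE x in lborel. ennreal (norm (f x - s j x)) \<le> 3 * ennreal (norm (f x))" for j
    proof (rule AE_I2)
      fix x :: real
      have "norm (f x - s j x) \<le> norm (f x) + norm (s j x)" by (rule norm_triangle_ineq4)
      also have "\<dots> \<le> 3 * norm (f x)" using lim(3)[of x j] by simp
      finally show "ennreal (norm (f x - s j x)) \<le> 3 * ennreal (norm (f x))"
        by (simp add: numeral_mult_ennreal)
    qed
    show "(\<integral>\<^sup>+x. 3 * ennreal (norm (f x)) \<partial>lborel) < \<infinity>"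
      using fin by (subst nn_integral_cmult) (auto simp: ennreal_mult_less_top)
    show "AE x in lborel. (\<lambda>i. ennreal (norm (f x - s i x))) \<longlonglongrightarrow> 0"
    proof (rule AE_I2)
      fix x :: real
      have "(\<lambda>i. norm (f x - s i x)) \<longlonglongrightarrow> norm (f x - f x)" by (intro tendsto_intros lim(2)) simp
      then show "(\<lambda>i. ennreal (norm (f x - s i x))) \<longlonglongrightarrow> 0" using tendsto_ennrealI by fastforce
    qed
  qed measurable
  then have c: "(\<lambda>i. \<integral>\<^sup>+x. ennreal (norm (f x - s i x)) \<partial>lborel) \<longlonglongrightarrow> 0" by simp
  show ?case
  proof (rule ennreal_tendsto_0I)
    fix e :: real assume e: "e > 0"
    from eventually_happens'[OF _ ennreal_tendsto_0D[OF c, of "e/4"]] e obtain i where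
      i: "(\<integral>\<^sup>+x. ennreal (norm (f x - s i x)) \<partial>lborel) < ennreal (e/4)" by auto
    from ennreal_tendsto_0D[OF lim(5)[of i], of "e/2"] e
    have "eventually (\<lambda>n. shift_dist (s i) (u n) < ennreal (e/2)) sequentially" by simp
    then show "eventually (\<lambda>n. shift_dist f (u n) \<le> ennreal e) sequentially"
    proof eventually_elim
      case (elim n)
      have "shift_dist f (u n) \<le> shift_dist (s i) (u n) + 2 * (\<integral>\<^sup>+x. ennreal (norm (f x - s i x)) \<partial>lborel)"
        by (rule shift_dist_approx) measurable
      also have "\<dots> \<le> ennreal (e/2) + 2 * ennreal (e/4)"
        using elim i by (intro add_mono mult_left_mono) auto
      also have "\<dots> = ennreal e" using e by (simp add: numeral_mult_ennreal ennreal_plus[symmetric] del: ennreal_plus)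
      finally show ?case .
    qed
  qed
qed

lemma norm_sq_disjoint_sum:
  fixes x :: "'i \<Rightarrow> 'b::real_normed_vector"
  assumes "disjoint_family_on A I"
  shows "(norm (\<Sum>i\<in>I. indicator (A i) s *\<^sub>R x i))\<^sup>2 = (\<Sum>i\<in>I. indicator (A i) s * (norm (x i))\<^sup>2)"
proof (cases "finite I \<and> (\<exists>j\<in>I. s \<in> A j)")
  case True
  then obtain j where j: "finite I" "j \<in> I" "s \<in> A j" by auto
  then have n: "s \<notin> A i" if "i \<in> I - {j}" for i
    using assms that by (auto simp: disjoint_family_on_def)
  have "(\<Sum>i\<in>I. indicator (A i) s *\<^sub>R x i) = x j"
    using j n by (subst sum.remove[OF j(1,2)]) (auto intro!: sum.neutral)
  moreover have "(\<Sum>i\<in>I. indicator (A i) s * (norm (x i))\<^sup>2) = (norm (x j))\<^sup>2"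
    using j n by (subst sum.remove[OF j(1,2)]) (auto intro!: sum.neutral)
  ultimately show ?thesis by simp
next
  case False
  then show ?thesis
    by (cases "finite I") (auto simp: sum.neutral)
qed

section \<open>Density of elementary processes\<close>

context brownian_setting
begin

lemma pmeas_compose_add:
  fixes G :: "real \<Rightarrow> 'a \<Rightarrow> 'b::{real_normed_vector, second_countable_topology}"
  assumes "pmeas G"
  shows "(\<lambda>z. G (fst z + fst (snd z)) (snd (snd z))) \<in> borel_measurable (lborel \<Otimes>\<^sub>M (lborel \<Otimes>\<^sub>M M))"
    and "(\<lambda>z. G (fst z) (snd (snd z))) \<in> borel_measurable (lborel \<Otimes>\<^sub>M (lborel \<Otimes>\<^sub>M M))"
proof -
  have "(\<lambda>z. (fst z + fst (snd z), snd (snd z))) \<in> (lborel \<Otimes>\<^sub>M (lborel \<Otimes>\<^sub>M M)) \<rightarrow>\<^sub>M (lborel \<Otimes>\<^sub>M M)"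
    by measurable
  from measurable_compose[OF this assms[unfolded pmeas_def]]
  show "(\<lambda>z. G (fst z + fst (snd z)) (snd (snd z))) \<in> borel_measurable (lborel \<Otimes>\<^sub>M (lborel \<Otimes>\<^sub>M M))" by simp
  have "(\<lambda>z. (fst z, snd (snd z))) \<in> (lborel \<Otimes>\<^sub>M (lborel \<Otimes>\<^sub>M M)) \<rightarrow>\<^sub>M (lborel \<Otimes>\<^sub>M M)"
    by measurable
  from measurable_compose[OF this assms[unfolded pmeas_def]]
  show "(\<lambda>z. G (fst z) (snd (snd z))) \<in> borel_measurable (lborel \<Otimes>\<^sub>M (lborel \<Otimes>\<^sub>M M))" by simp
qed

lemma measurable_shift_msq:
  fixes G :: "real \<Rightarrow> 'a \<Rightarrow> 'b::{real_normed_vector, second_countable_topology}"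
  assumes "pmeas G"
  shows "(\<lambda>(r, u). msq M (\<lambda>\<omega>. G (r + u) \<omega> - G r \<omega>)) \<in> borel_measurable (lborel \<Otimes>\<^sub>M lborel)"
proof -
  have "(\<lambda>z. (fst (fst z), (snd (fst z), snd z))) \<in> ((lborel \<Otimes>\<^sub>M lborel) \<Otimes>\<^sub>M M) \<rightarrow>\<^sub>M (lborel \<Otimes>\<^sub>M (lborel \<Otimes>\<^sub>M M))"
    by measurable
  from measurable_compose[OF this pmeas_compose_add(1)[OF assms]] measurable_compose[OF this pmeas_compose_add(2)[OF assms]]
  have [measurable]: "(\<lambda>z. G (fst (fst z) + snd (fst z)) (snd z)) \<in> borel_measurable ((lborel \<Otimes>\<^sub>M lborel) \<Otimes>\<^sub>M M)"
    "(\<lambda>z. G (fst (fst z)) (snd z)) \<in> borel_measurable ((lborel \<Otimes>\<^sub>M lborel) \<Otimes>\<^sub>M M)"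
    by simp_all
  have "(\<lambda>z. ennreal ((norm (G (fst (fst z) + snd (fst z)) (snd z) - G (fst (fst z)) (snd z)))\<^sup>2)) \<in> borel_measurable ((lborel \<Otimes>\<^sub>M lborel) \<Otimes>\<^sub>M M)"
    by measurable
  from borel_measurable_nn_integral_fst[OF this]
  show ?thesis by (simp add: msq_def split_beta')
qed

text \<open>Path by path, boundedness reduces squares to \<open>L\<^sup>1\<close> distances; the paths are combined by dominated
  convergence.\<close>

lemma shift_msq_tendsto:
  fixes G :: "real \<Rightarrow> 'a \<Rightarrow> 'b::{banach, second_countable_topology}"
  assumes G: "pmeas G" and bd: "\<And>s \<omega>. \<omega> \<in> space M \<Longrightarrow> norm (G s \<omega>) \<le> R"
    and supp: "\<And>s \<omega>. s \<notin> {0..T} \<Longrightarrow> G s \<omega> = 0" and T: "0 \<le> T" and R: "0 \<le> R"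
    and u: "u \<longlonglongrightarrow> 0"
  shows "(\<lambda>n. \<integral>\<^sup>+r. msq M (\<lambda>\<omega>. G (r + u n) \<omega> - G r \<omega>) \<partial>lborel) \<longlonglongrightarrow> 0"
proof -
  have path: "(\<lambda>s. G s \<omega>) \<in> borel_measurable borel" if "\<omega> \<in> space M" for \<omega>
    using pmeas_path[OF G that] .
  have L1: "(\<integral>\<^sup>+s. ennreal (norm (G s \<omega>)) \<partial>lborel) \<le> ennreal (R * T)" if w: "\<omega> \<in> space M" for \<omega>
  proof -
    have "(\<integral>\<^sup>+s. ennreal (norm (G s \<omega>)) \<partial>lborel) \<le> (\<integral>\<^sup>+s. ennreal R * indicator {0..T} s \<partial>lborel)"
      using bd[OF w] supp by (intro nn_integral_mono) (auto simp: indicator_def ennreal_leI)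
    also have "\<dots> = ennreal (R * T)" using T R by (subst nn_integral_cmult) (auto simp: ennreal_mult)
    finally show ?thesis .
  qed
  have int: "integrable lborel (\<lambda>s. G s \<omega>)" if w: "\<omega> \<in> space M" for \<omega>
    unfolding integrable_iff_bounded using path[OF w] L1[OF w] by (auto simp: le_less_trans)
  have shm: "(\<lambda>\<omega>. shift_dist (\<lambda>s. G s \<omega>) v) \<in> borel_measurable M" for v
  proof -
    have "(\<lambda>z. (snd z + v, fst z)) \<in> (M \<Otimes>\<^sub>M lborel) \<rightarrow>\<^sub>M (lborel \<Otimes>\<^sub>M M)" "(\<lambda>z. (snd z, fst z)) \<in> (M \<Otimes>\<^sub>M lborel) \<rightarrow>\<^sub>M (lborel \<Otimes>\<^sub>M M)"
      by measurable
    from measurable_compose[OF this(1) G[unfolded pmeas_def]] measurable_compose[OF this(2) G[unfolded pmeas_def]]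
    have "(\<lambda>z. ennreal (norm (G (snd z + v) (fst z) - G (snd z) (fst z)))) \<in> borel_measurable (M \<Otimes>\<^sub>M lborel)"
      by simp
    from lborel.borel_measurable_nn_integral_fst[OF this] show ?thesis by (simp add: shift_dist_def)
  qed
  have bound: "(\<integral>\<^sup>+r. msq M (\<lambda>\<omega>. G (r + v) \<omega> - G r \<omega>) \<partial>lborel) \<le> ennreal (2 * R) * (\<integral>\<^sup>+\<omega>. shift_dist (\<lambda>s. G s \<omega>) v \<partial>M)" for v
  proof -
    have "(\<lambda>z. (fst z + v, snd z)) \<in> (lborel \<Otimes>\<^sub>M M) \<rightarrow>\<^sub>M (lborel \<Otimes>\<^sub>M M)" by measurable
    from measurable_compose[OF this G[unfolded pmeas_def]] have [measurable]:
      "(\<lambda>z. G (fst z + v) (snd z)) \<in> borel_measurable (lborel \<Otimes>\<^sub>M M)" by simp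
    have pm: "pmeas (\<lambda>r \<omega>. G (r + v) \<omega> - G r \<omega>)" using G by (simp add: pmeas_def)
    have "(\<integral>\<^sup>+r. msq M (\<lambda>\<omega>. G (r + v) \<omega> - G r \<omega>) \<partial>lborel) = (\<integral>\<^sup>+\<omega>. (\<integral>\<^sup>+s. ennreal ((norm (G (s + v) \<omega> - G s \<omega>))\<^sup>2) \<partial>lborel) \<partial>M)"
      using psq_time[OF pm] psq_space[OF pm] by simp
    also have "\<dots> \<le> (\<integral>\<^sup>+\<omega>. ennreal (2 * R) * shift_dist (\<lambda>s. G s \<omega>) v \<partial>M)"
    proof (rule nn_integral_mono)
      fix \<omega> assume w: "\<omega> \<in> space M"
      have [measurable]: "(\<lambda>s. G s \<omega>) \<in> borel_measurable borel" by (rule path[OF w])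
      have "(\<integral>\<^sup>+s. ennreal ((norm (G (s + v) \<omega> - G s \<omega>))\<^sup>2) \<partial>lborel) \<le> (\<integral>\<^sup>+s. ennreal (2 * R) * ennreal (norm (G (s + v) \<omega> - G s \<omega>)) \<partial>lborel)"
      proof (rule nn_integral_mono)
        fix s
        have "norm (G (s + v) \<omega> - G s \<omega>) \<le> norm (G (s + v) \<omega>) + norm (G s \<omega>)" by (rule norm_triangle_ineq4)
        also have "\<dots> \<le> 2 * R" using bd[OF w, of s] bd[OF w, of "s + v"] by simp
        finally show "ennreal ((norm (G (s + v) \<omega> - G s \<omega>))\<^sup>2) \<le> ennreal (2 * R) * ennreal (norm (G (s + v) \<omega> - G s \<omega>))"
          using R by (subst ennreal_mult[symmetric]) (auto simp: power2_eq_square intro!: mult_right_mono ennreal_leI)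
      qed
      also have "\<dots> = ennreal (2 * R) * shift_dist (\<lambda>s. G s \<omega>) v"
        unfolding shift_dist_def by (rule nn_integral_cmult) measurable
      finally show "(\<integral>\<^sup>+s. ennreal ((norm (G (s + v) \<omega> - G s \<omega>))\<^sup>2) \<partial>lborel) \<le> ennreal (2 * R) * shift_dist (\<lambda>s. G s \<omega>) v" .
    qed
    also have "\<dots> = ennreal (2 * R) * (\<integral>\<^sup>+\<omega>. shift_dist (\<lambda>s. G s \<omega>) v \<partial>M)"
      by (rule nn_integral_cmult[OF shm])
    finally show ?thesis .
  qed
  have "(\<lambda>n. \<integral>\<^sup>+\<omega>. shift_dist (\<lambda>s. G s \<omega>) (u n) \<partial>M) \<longlonglongrightarrow> (\<integral>\<^sup>+\<omega>. 0 \<partial>M)"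
  proof (rule nn_integral_dominated_convergence[where w = "\<lambda>_. 2 * ennreal (R * T)"])
    show "AE \<omega> in M. shift_dist (\<lambda>s. G s \<omega>) (u j) \<le> 2 * ennreal (R * T)" for j
    proof (rule AE_I2)
      fix \<omega> assume w: "\<omega> \<in> space M"
      show "shift_dist (\<lambda>s. G s \<omega>) (u j) \<le> 2 * ennreal (R * T)"
        using shift_dist_le[OF path[OF w]] L1[OF w] by (meson mult_left_mono order_trans zero_le)
    qed
    show "AE \<omega> in M. (\<lambda>i. shift_dist (\<lambda>s. G s \<omega>) (u i)) \<longlonglongrightarrow> 0"
      by (intro AE_I2 shift_dist_tendsto int u)
    show "(\<integral>\<^sup>+\<omega>. 2 * ennreal (R * T) \<partial>M) < \<infinity>"
      by (simp add: emeasure_space_1 ennreal_mult_less_top)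
  qed (auto simp: shm)
  then have "(\<lambda>n. ennreal (2 * R) * (\<integral>\<^sup>+\<omega>. shift_dist (\<lambda>s. G s \<omega>) (u n) \<partial>M)) \<longlonglongrightarrow> ennreal (2 * R) * 0"
    by (intro tendsto_mult_ennreal tendsto_const) auto
  then have lim: "(\<lambda>n. ennreal (2 * R) * (\<integral>\<^sup>+\<omega>. shift_dist (\<lambda>s. G s \<omega>) (u n) \<partial>M)) \<longlonglongrightarrow> 0" by simp
  show ?thesis
    by (rule tendsto_sandwich[OF _ _ tendsto_const lim]) (intro always_eventually allI bound zero_le)+
qed

definition grid_process :: "real \<Rightarrow> real \<Rightarrow> nat \<Rightarrow> (nat \<Rightarrow> 'a \<Rightarrow> 'b::real_normed_vector) \<Rightarrow> real \<Rightarrow> 'a \<Rightarrow> 'b" where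
  "grid_process \<theta> h m x s \<omega> = (\<Sum>i<m. indicator {\<theta> + real i * h<..\<theta> + real (Suc i) * h} s *\<^sub>R x i \<omega>)"

lemma grid_disjoint: "0 \<le> h \<Longrightarrow> disjoint_family_on (\<lambda>i. {\<theta> + real i * h<..\<theta> + real (Suc i) * h}) I"
proof (unfold disjoint_family_on_def, intro ballI impI)
  fix i j :: nat assume h: "0 \<le> h" and "i \<noteq> j"
  have *: "{\<theta> + real i * h<..\<theta> + real (Suc i) * h} \<inter> {\<theta> + real j * h<..\<theta> + real (Suc j) * h} = {}" if "i < j" for i j :: nat
  proof -
    have "real (Suc i) * h \<le> real j * h" using that h by (intro mult_right_mono) auto
    then show ?thesis by auto
  qed
  show "{\<theta> + real i * h<..\<theta> + real (Suc i) * h} \<inter> {\<theta> + real j * h<..\<theta> + real (Suc j) * h} = {}"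
    using *[of i j] *[of j i] \<open>i \<noteq> j\<close> by (cases "i < j") auto
qed

lemma grid_indicator:
  "0 \<le> h \<Longrightarrow> (\<Sum>i<m. indicator {\<theta> + real i * h<..\<theta> + real (Suc i) * h} s) = (indicator {\<theta><..\<theta> + real m * h} s :: real)"
proof (induction m)
  case (Suc m)
  define a where "a = real m * h"
  have a: "0 \<le> a" "real (Suc m) * h = a + h" using Suc(2) by (auto simp: a_def algebra_simps)
  have "indicator {\<theta><..\<theta> + a} s + indicator {\<theta> + a<..\<theta> + (a + h)} s = (indicator {\<theta><..\<theta> + (a + h)} s :: real)"
    using a(1) Suc(2) by (auto simp: indicator_def)
  then show ?case
    unfolding sum.lessThan_Suc Suc(1)[OF Suc(2)] a(2) a_def by simp
qed simp

text \<open>Letting \<open>\<theta>\<close> run through one cell and summing over the cells covers each point once.\<close>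

lemma nn_integral_grid:
  fixes f :: "real \<Rightarrow> ennreal"
  assumes [measurable]: "f \<in> borel_measurable borel" and h: "0 \<le> h"
  shows "(\<integral>\<^sup>+\<theta>\<in>{0<..h}. (\<Sum>i<m. f (\<theta> + real i * h)) \<partial>lborel) = (\<integral>\<^sup>+r\<in>{0<..real m * h}. f r \<partial>lborel)"
proof -
  have "(\<integral>\<^sup>+\<theta>\<in>{0<..h}. (\<Sum>i<m. f (\<theta> + real i * h)) \<partial>lborel) = (\<integral>\<^sup>+\<theta>. (\<Sum>i<m. f (\<theta> + real i * h) * indicator {0<..h} \<theta>) \<partial>lborel)"
    by (simp add: sum_distrib_right)
  also have "\<dots> = (\<Sum>i<m. \<integral>\<^sup>+\<theta>. f (\<theta> + real i * h) * indicator {0<..h} \<theta> \<partial>lborel)"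
    by (rule nn_integral_sum) measurable
  also have "\<dots> = (\<Sum>i<m. \<integral>\<^sup>+r. f r * indicator {0 + real i * h<..0 + real (Suc i) * h} r \<partial>lborel)"
  proof (rule sum.cong[OF refl])
    fix i
    have "(\<integral>\<^sup>+\<theta>. f (\<theta> + real i * h) * indicator {0<..h} \<theta> \<partial>lborel) = (\<integral>\<^sup>+\<theta>. f (\<theta> + real i * h) * indicator {0 + real i * h<..0 + real (Suc i) * h} (\<theta> + real i * h) \<partial>lborel)"
      by (intro nn_integral_cong) (auto simp: indicator_def algebra_simps)
    also have "\<dots> = (\<integral>\<^sup>+r. f r * indicator {0 + real i * h<..0 + real (Suc i) * h} r \<partial>lborel)"
      by (rule nn_integral_shift[of "\<lambda>r. f r * indicator {0 + real i * h<..0 + real (Suc i) * h} r"]) measurable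
    finally show "(\<integral>\<^sup>+\<theta>. f (\<theta> + real i * h) * indicator {0<..h} \<theta> \<partial>lborel) = (\<integral>\<^sup>+r. f r * indicator {0 + real i * h<..0 + real (Suc i) * h} r \<partial>lborel)" .
  qed
  also have "\<dots> = (\<integral>\<^sup>+r. (\<Sum>i<m. f r * indicator {0 + real i * h<..0 + real (Suc i) * h} r) \<partial>lborel)"
    by (rule nn_integral_sum[symmetric]) measurable
  also have "\<dots> = (\<integral>\<^sup>+r\<in>{0<..real m * h}. f r \<partial>lborel)"
  proof (rule nn_integral_cong)
    fix r
    have "(\<Sum>i<m. indicator {0 + real i * h<..0 + real (Suc i) * h} r :: ennreal) = ennreal (\<Sum>i<m. indicator {0 + real i * h<..0 + real (Suc i) * h} r)"
      by (subst sum_ennreal[symmetric]) (auto simp: ennreal_indicator)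
    also have "\<dots> = indicator {0<..real m * h} r"
      unfolding grid_indicator[OF h] by (simp add: ennreal_indicator)
    finally show "(\<Sum>i<m. f r * indicator {0 + real i * h<..0 + real (Suc i) * h} r) = f r * indicator {0<..real m * h} r"
      by (simp add: sum_distrib_left[symmetric])
  qed
  finally show ?thesis .
qed

lemma pmeas_grid_process:
  fixes x :: "nat \<Rightarrow> 'a \<Rightarrow> 'b::{real_normed_vector, second_countable_topology}"
  assumes "\<And>i. i < m \<Longrightarrow> x i \<in> borel_measurable M"
  shows "pmeas (grid_process \<theta> h m x)"
  unfolding pmeas_def grid_process_def
proof (rule borel_measurable_sum)
  fix i assume "i \<in> {..<m}"
  then have [measurable]: "x i \<in> borel_measurable M" using assms by simp
  show "(\<lambda>z. indicator {\<theta> + real i * h<..\<theta> + real (Suc i) * h} (fst z) *\<^sub>R x i (snd z)) \<in> borel_measurable (lborel \<Otimes>\<^sub>M M)"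
    by measurable
qed

lemma msq_grid:
  fixes x :: "nat \<Rightarrow> 'a \<Rightarrow> 'b::{real_normed_vector, second_countable_topology}"
  assumes x: "\<And>i. i < m \<Longrightarrow> x i \<in> borel_measurable M" and h: "0 \<le> h"
  shows "msq M (\<lambda>\<omega>. \<Sum>i<m. indicator {\<theta> + real i * h<..\<theta> + real (Suc i) * h} s *\<^sub>R x i \<omega>)
    = (\<Sum>i<m. msq M (x i) * indicator {\<theta> + real i * h<..\<theta> + real (Suc i) * h} s)"
proof -
  have "msq M (\<lambda>\<omega>. \<Sum>i<m. indicator {\<theta> + real i * h<..\<theta> + real (Suc i) * h} s *\<^sub>R x i \<omega>)
    = (\<integral>\<^sup>+\<omega>. (\<Sum>i<m. ennreal ((norm (x i \<omega>))\<^sup>2) * indicator {\<theta> + real i * h<..\<theta> + real (Suc i) * h} s) \<partial>M)"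
    unfolding msq_def norm_sq_disjoint_sum[OF grid_disjoint[OF h]]
    by (intro nn_integral_cong, subst sum_ennreal[symmetric]) (auto intro!: sum.cong simp: indicator_def)
  also have "\<dots> = (\<Sum>i<m. \<integral>\<^sup>+\<omega>. ennreal ((norm (x i \<omega>))\<^sup>2) * indicator {\<theta> + real i * h<..\<theta> + real (Suc i) * h} s \<partial>M)"
    using x by (intro nn_integral_sum) auto
  also have "\<dots> = (\<Sum>i<m. msq M (x i) * indicator {\<theta> + real i * h<..\<theta> + real (Suc i) * h} s)"
    unfolding msq_def using x by (intro sum.cong refl nn_integral_multc) auto
  finally show ?thesis .
qed

lemma psq_grid_process:
  fixes x :: "nat \<Rightarrow> 'a \<Rightarrow> 'b::{real_normed_vector, second_countable_topology}"
  assumes x: "\<And>i. i < m \<Longrightarrow> x i \<in> borel_measurable M" and h: "0 \<le> h"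
  shows "psq (grid_process \<theta> h m x) = (\<Sum>i<m. ennreal h * msq M (x i))"
proof -
  have "psq (grid_process \<theta> h m x) = (\<integral>\<^sup>+s. (\<Sum>i<m. msq M (x i) * indicator {\<theta> + real i * h<..\<theta> + real (Suc i) * h} s) \<partial>lborel)"
  proof -
    have "msq M (grid_process \<theta> h m x s) = (\<Sum>i<m. msq M (x i) * indicator {\<theta> + real i * h<..\<theta> + real (Suc i) * h} s)" for s
      unfolding grid_process_def[abs_def] using x h by (rule msq_grid)
    then show ?thesis by (simp add: psq_time[OF pmeas_grid_process[OF x]])
  qed
  also have "\<dots> = (\<Sum>i<m. \<integral>\<^sup>+s. msq M (x i) * indicator {\<theta> + real i * h<..\<theta> + real (Suc i) * h} s \<partial>lborel)"
    by (rule nn_integral_sum) measurable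
  also have "\<dots> = (\<Sum>i<m. ennreal h * msq M (x i))"
  proof (intro sum.cong refl)
    fix i
    have "\<theta> + real i * h \<le> \<theta> + real (Suc i) * h" "\<theta> + real (Suc i) * h - (\<theta> + real i * h) = h"
      using h by (auto simp: algebra_simps)
    then show "(\<integral>\<^sup>+s. msq M (x i) * indicator {\<theta> + real i * h<..\<theta> + real (Suc i) * h} s \<partial>lborel) = ennreal h * msq M (x i)"
      by (subst nn_integral_cmult_indicator) (auto simp: mult.commute)
  qed
  finally show ?thesis .
qed

text \<open>The error of sampling at \<open>\<theta> + i h\<close> is the sum over \<open>i\<close> of
  \<open>\<Phi> (\<theta> + i h)\<close>, where \<open>\<Phi> r\<close> is the error made on \<open>(r, r + h]\<close> by the constant value taken at \<open>r\<close>. Its average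
  over \<open>\<theta>\<close> in \<open>(0, h]\<close> is at most the average over \<open>v\<close> in \<open>(0, h]\<close> of the distance between the process and its translate
  by \<open>v\<close>, which is small once \<open>h\<close> is; so some \<open>\<theta>\<close> is good.

  With mesh \<open>T/(m + 1)\<close> the \<open>m\<close> cells fit into \<open>[0, T]\<close> for each such \<open>\<theta>\<close>, and leave out at most one mesh
  length at each end.\<close>

lemma sampling_approximates:
  fixes H :: "real \<Rightarrow> 'a \<Rightarrow> 'b::{banach, second_countable_topology}"
  assumes H: "pmeas (cut T H)" and T: "0 < T" and R: "0 \<le> R"
    and bd: "\<And>s \<omega>. s \<in> {0..T} \<Longrightarrow> \<omega> \<in> space M \<Longrightarrow> norm (H s \<omega>) \<le> R" and e: "0 < e"
  shows "\<exists>m0. \<forall>m\<ge>m0. \<exists>\<theta>. 0 < \<theta> \<and> \<theta> \<le> T / real (Suc m) \<and>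
    psq (\<lambda>s \<omega>. cut T H s \<omega> - grid_process \<theta> (T / real (Suc m)) m (\<lambda>i. H (\<theta> + real i * (T / real (Suc m)))) s \<omega>) \<le> ennreal e"
proof -
  define G where "G = cut T H"
  have G: "pmeas G" using H by (simp add: G_def)
  have Gbd: "norm (G s \<omega>) \<le> R" if "\<omega> \<in> space M" for s \<omega>
    using bd[OF _ that, of s] R by (auto simp: G_def cut_def indicator_def)
  have G0: "s \<notin> {0..T} \<Longrightarrow> G s \<omega> = 0" for s \<omega> by (simp add: G_def cut_def)
  have [measurable]: "G s \<in> borel_measurable M" for s by (rule pmeas_section[OF G])
  define \<delta> where "\<delta> = e / 8"
  have \<delta>: "\<delta> > 0" using e by (simp add: \<delta>_def)
  define q where "q v = (\<integral>\<^sup>+r. msq M (\<lambda>\<omega>. G (r + v) \<omega> - G r \<omega>) \<partial>lborel)" for v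
  have "q \<midarrow>0\<rightarrow> 0"
    unfolding LIMSEQ_SEQ_conv[symmetric] q_def
    by (intro allI impI, rule shift_msq_tendsto[OF G Gbd G0 less_imp_le[OF T] R]) auto
  from ennreal_tendsto_0D[OF this \<delta>] obtain d where d: "d > 0" "\<And>v. v \<noteq> 0 \<Longrightarrow> dist v 0 < d \<Longrightarrow> q v < ennreal \<delta>"
    unfolding eventually_at by auto
  define h0 where "h0 = min (d / 2) (e / (8 * R\<^sup>2 + 8))"
  have h0: "h0 > 0" using d e by (auto simp: h0_def intro!: divide_pos_pos add_nonneg_pos)
  obtain m0 :: nat where m0: "T / h0 < real m0" using reals_Archimedean2 by blast
  show ?thesis
  proof (intro exI[of _ m0] allI impI)
    fix m assume m: "m0 \<le> m"
    define h where "h = T / real (Suc m)"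
    have h: "0 < h" "h \<le> h0" "real (Suc m) * h = T"
    proof -
      show "0 < h" using T by (simp add: h_def)
      have "T / h0 < real (Suc m)" using m0 m by linarith
      then show "h \<le> h0" using h0 unfolding h_def by (simp add: field_simps)
      show "real (Suc m) * h = T" by (simp add: h_def)
    qed
    have mh: "real m * h = T - h" using h(3) by (simp add: algebra_simps)
    define \<Phi> where "\<Phi> r = (\<integral>\<^sup>+v\<in>{0<..h}. msq M (\<lambda>\<omega>. G (r + v) \<omega> - G r \<omega>) \<partial>lborel)" for r
    have k: "(\<lambda>(r, v). msq M (\<lambda>\<omega>. G (r + v) \<omega> - G r \<omega>) * indicator {0<..h} v) \<in> borel_measurable (lborel \<Otimes>\<^sub>M lborel)"
      using measurable_shift_msq[OF G] by (simp add: split_beta')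
    have [measurable]: "\<Phi> \<in> borel_measurable borel"
      unfolding \<Phi>_def using lborel.borel_measurable_nn_integral_fst[OF k] by simp
    have "(\<integral>\<^sup>+\<theta>\<in>{0<..h}. (\<Sum>i<m. \<Phi> (\<theta> + real i * h)) \<partial>lborel) = (\<integral>\<^sup>+r\<in>{0<..real m * h}. \<Phi> r \<partial>lborel)"
      using h by (intro nn_integral_grid) auto
    also have "\<dots> \<le> (\<integral>\<^sup>+r. \<Phi> r \<partial>lborel)"
      by (intro nn_integral_mono) (auto simp: indicator_def)
    also have "\<dots> = (\<integral>\<^sup>+v. \<integral>\<^sup>+r. msq M (\<lambda>\<omega>. G (r + v) \<omega> - G r \<omega>) * indicator {0<..h} v \<partial>lborel \<partial>lborel)"
      unfolding \<Phi>_def using k by (intro lborel_pair.Fubini'[symmetric]) simp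
    also have "\<dots> = (\<integral>\<^sup>+v\<in>{0<..h}. q v \<partial>lborel)"
    proof (rule nn_integral_cong)
      fix v
      have "(\<lambda>r. msq M (\<lambda>\<omega>. G (r + v) \<omega> - G r \<omega>)) \<in> borel_measurable lborel"
        using measurable_compose[OF measurable_Pair2'[of v lborel lborel] measurable_shift_msq[OF G]] by simp
      then show "(\<integral>\<^sup>+r. msq M (\<lambda>\<omega>. G (r + v) \<omega> - G r \<omega>) * indicator {0<..h} v \<partial>lborel) = q v * indicator {0<..h} v"
        unfolding q_def by (rule nn_integral_multc)
    qed
    also have "\<dots> \<le> (\<integral>\<^sup>+v. ennreal \<delta> * indicator {0<..h} v \<partial>lborel)"
    proof (rule nn_integral_mono)
      fix v
      show "q v * indicator {0<..h} v \<le> ennreal \<delta> * indicator {0<..h} v"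
      proof (cases "v \<in> {0<..h}")
        case True
        moreover have "h \<le> d / 2" using h(2) by (simp add: h0_def)
        ultimately have "v \<noteq> 0" "dist v 0 < d" using d(1) by (auto simp: dist_real_def)
        with d(2) True show ?thesis by (simp add: less_imp_le)
      qed simp
    qed
    also have "\<dots> = ennreal (\<delta> * h)"
      using h \<delta> by (subst nn_integral_cmult_indicator) (auto simp: ennreal_mult)
    finally have avg: "(\<integral>\<^sup>+\<theta>\<in>{0<..h}. (\<Sum>i<m. \<Phi> (\<theta> + real i * h)) \<partial>lborel) \<le> ennreal (\<delta> * h)" .
    \<comment> \<open>Not all \<open>\<theta>\<close> can exceed twice the average.\<close>
    have "\<exists>\<theta>\<in>{0<..h}. (\<Sum>i<m. \<Phi> (\<theta> + real i * h)) \<le> ennreal (2 * \<delta>)"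
    proof (rule ccontr)
      assume "\<not> ?thesis"
      then have "(\<integral>\<^sup>+\<theta>. ennreal (2 * \<delta>) * indicator {0<..h} \<theta> \<partial>lborel) \<le> (\<integral>\<^sup>+\<theta>\<in>{0<..h}. (\<Sum>i<m. \<Phi> (\<theta> + real i * h)) \<partial>lborel)"
        by (intro nn_integral_mono) (auto simp: indicator_def not_le intro: less_imp_le)
      also have "(\<integral>\<^sup>+\<theta>. ennreal (2 * \<delta>) * indicator {0<..h} \<theta> \<partial>lborel) = ennreal (2 * \<delta> * h)"
        using h \<delta> by (subst nn_integral_cmult_indicator) (auto simp: ennreal_mult)
      also note avg
      finally have "2 * \<delta> * h \<le> \<delta> * h" using h \<delta> by (subst (asm) ennreal_le_iff) auto
      then show False using h \<delta> by (simp add: mult_pos_pos)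
    qed
    then obtain \<theta> where \<theta>: "0 < \<theta>" "\<theta> \<le> h" and small: "(\<Sum>i<m. \<Phi> (\<theta> + real i * h)) \<le> ennreal (2 * \<delta>)" by auto
    \<comment> \<open>\<open>P1\<close> lives on the two uncovered ends, \<open>P2\<close> is the sampling error on the cells.\<close>
    define P1 where "P1 s \<omega> = (1 - indicator {\<theta><..\<theta> + real m * h} s) *\<^sub>R G s \<omega>" for s \<omega>
    define P2 where "P2 s \<omega> = (\<Sum>i<m. indicator {\<theta> + real i * h<..\<theta> + real (Suc i) * h} s *\<^sub>R (G s \<omega> - G (\<theta> + real i * h) \<omega>))" for s \<omega>
    have dec: "cut T H s \<omega> - grid_process \<theta> h m (\<lambda>i. H (\<theta> + real i * h)) s \<omega> = P1 s \<omega> + P2 s \<omega>" for s \<omega>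
    proof -
      have "H (\<theta> + real i * h) \<omega> = G (\<theta> + real i * h) \<omega>" if "i < m" for i
      proof -
        have "real i * h \<le> real m * h" "0 \<le> real i * h" using that h by (auto intro: mult_right_mono)
        moreover have "\<theta> + x \<in> {0..T}" if "x \<le> T - h" "0 \<le> x" for x using that \<theta> by auto
        ultimately have "\<theta> + real i * h \<in> {0..T}" unfolding mh by blast
        then show ?thesis unfolding G_def cut_def by (simp del: atLeastAtMost_iff)
      qed
      then have "grid_process \<theta> h m (\<lambda>i. H (\<theta> + real i * h)) s \<omega> = (\<Sum>i<m. indicator {\<theta> + real i * h<..\<theta> + real (Suc i) * h} s *\<^sub>R G (\<theta> + real i * h) \<omega>)"
        unfolding grid_process_def by (intro sum.cong) auto
      moreover have "P2 s \<omega> = indicator {\<theta><..\<theta> + real m * h} s *\<^sub>R G s \<omega> - (\<Sum>i<m. indicator {\<theta> + real i * h<..\<theta> + real (Suc i) * h} s *\<^sub>R G (\<theta> + real i * h) \<omega>)"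
        unfolding P2_def grid_indicator[OF less_imp_le[OF h(1)], symmetric] scaleR_sum_left
        by (simp only: scaleR_diff_right sum_subtractf)
      ultimately show ?thesis by (simp add: P1_def G_def scaleR_diff_left)
    qed
    have [measurable]: "(\<lambda>z. G (fst z) (snd z)) \<in> borel_measurable (lborel \<Otimes>\<^sub>M M)" using G by (simp add: pmeas_def)
    have mP1: "pmeas P1" unfolding pmeas_def P1_def by measurable
    have mP2: "pmeas P2" unfolding pmeas_def P2_def by measurable
    have "psq P1 \<le> (\<integral>\<^sup>+s. ennreal (R\<^sup>2) * indicator {0..h} s + ennreal (R\<^sup>2) * indicator {T - h..T} s \<partial>lborel)"
      unfolding psq_time[OF mP1]
    proof (rule nn_integral_mono)
      fix s
      have m1: "msq M (P1 s) \<le> ennreal (R\<^sup>2)"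
      proof -
        have "msq M (P1 s) \<le> (\<integral>\<^sup>+\<omega>. ennreal (R\<^sup>2) \<partial>M)"
          unfolding msq_def
        proof (intro nn_integral_mono ennreal_leI power_mono)
          fix \<omega> assume "\<omega> \<in> space M"
          then show "norm (P1 s \<omega>) \<le> R" using Gbd R by (auto simp: P1_def indicator_def)
        qed simp
        then show ?thesis by (simp add: emeasure_space_1)
      qed
      show "msq M (P1 s) \<le> ennreal (R\<^sup>2) * indicator {0..h} s + ennreal (R\<^sup>2) * indicator {T - h..T} s"
      proof (cases "s \<in> {0..h} \<or> s \<in> {T - h..T}")
        case True
        then show ?thesis using m1 by (auto simp: indicator_def add_increasing)
      next
        case False
        then have "P1 s \<omega> = 0" for \<omega>
          using G0[of s \<omega>] \<theta> mh h by (auto simp: P1_def indicator_def)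
        then have "P1 s = (\<lambda>_. 0)" by auto
        then show ?thesis by simp
      qed
    qed
    also have "\<dots> = ennreal (2 * h * R\<^sup>2)"
      using h R by (subst nn_integral_add) (auto simp: nn_integral_cmult_indicator ennreal_mult[symmetric] ennreal_plus[symmetric] simp del: ennreal_plus)
    finally have b1: "psq P1 \<le> ennreal (2 * h * R\<^sup>2)" .
    have "psq P2 = (\<integral>\<^sup>+s. (\<Sum>i<m. msq M (\<lambda>\<omega>. G s \<omega> - G (\<theta> + real i * h) \<omega>) * indicator {\<theta> + real i * h<..\<theta> + real (Suc i) * h} s) \<partial>lborel)"
    proof -
      have "msq M (P2 s) = (\<Sum>i<m. msq M (\<lambda>\<omega>. G s \<omega> - G (\<theta> + real i * h) \<omega>) * indicator {\<theta> + real i * h<..\<theta> + real (Suc i) * h} s)" for s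
        using msq_grid[of m "\<lambda>i \<omega>. G s \<omega> - G (\<theta> + real i * h) \<omega>" h \<theta> s] h(1)
        unfolding P2_def[abs_def] by simp
      then show ?thesis by (simp add: psq_time[OF mP2])
    qed
    also have "\<dots> = (\<Sum>i<m. \<integral>\<^sup>+s. msq M (\<lambda>\<omega>. G s \<omega> - G (\<theta> + real i * h) \<omega>) * indicator {\<theta> + real i * h<..\<theta> + real (Suc i) * h} s \<partial>lborel)"
    proof (rule nn_integral_sum)
      fix i
      have "pmeas (\<lambda>s \<omega>. G s \<omega> - G (\<theta> + real i * h) \<omega>)" unfolding pmeas_def by measurable
      then have "(\<lambda>z. ennreal ((norm (G (fst z) (snd z) - G (\<theta> + real i * h) (snd z)))\<^sup>2)) \<in> borel_measurable (lborel \<Otimes>\<^sub>M M)"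
        unfolding pmeas_def by measurable
      from borel_measurable_nn_integral_fst[OF this]
      have [measurable]: "(\<lambda>s. msq M (\<lambda>\<omega>. G s \<omega> - G (\<theta> + real i * h) \<omega>)) \<in> borel_measurable lborel"
        by (simp add: msq_def)
      show "(\<lambda>s. msq M (\<lambda>\<omega>. G s \<omega> - G (\<theta> + real i * h) \<omega>) * indicator {\<theta> + real i * h<..\<theta> + real (Suc i) * h} s) \<in> borel_measurable lborel"
        by measurable
    qed
    also have "\<dots> = (\<Sum>i<m. \<Phi> (\<theta> + real i * h))"
    proof (rule sum.cong[OF refl])
      fix i
      have "(\<lambda>z. ennreal ((norm (G (fst z) (snd z) - G (\<theta> + real i * h) (snd z)))\<^sup>2)) \<in> borel_measurable (lborel \<Otimes>\<^sub>M M)"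
        by measurable
      from borel_measurable_nn_integral_fst[OF this]
      have [measurable]: "(\<lambda>s. msq M (\<lambda>\<omega>. G s \<omega> - G (\<theta> + real i * h) \<omega>)) \<in> borel_measurable borel"
        by (simp add: msq_def)
      have "\<Phi> (\<theta> + real i * h) = (\<integral>\<^sup>+v. msq M (\<lambda>\<omega>. G (v + (\<theta> + real i * h)) \<omega> - G (\<theta> + real i * h) \<omega>) * indicator {\<theta> + real i * h<..\<theta> + real (Suc i) * h} (v + (\<theta> + real i * h)) \<partial>lborel)"
        unfolding \<Phi>_def by (intro nn_integral_cong) (auto simp: indicator_def algebra_simps)
      also have "\<dots> = (\<integral>\<^sup>+s. msq M (\<lambda>\<omega>. G s \<omega> - G (\<theta> + real i * h) \<omega>) * indicator {\<theta> + real i * h<..\<theta> + real (Suc i) * h} s \<partial>lborel)"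
        by (rule nn_integral_shift[of "\<lambda>s. msq M (\<lambda>\<omega>. G s \<omega> - G (\<theta> + real i * h) \<omega>) * indicator {\<theta> + real i * h<..\<theta> + real (Suc i) * h} s"]) measurable
      finally show "(\<integral>\<^sup>+s. msq M (\<lambda>\<omega>. G s \<omega> - G (\<theta> + real i * h) \<omega>) * indicator {\<theta> + real i * h<..\<theta> + real (Suc i) * h} s \<partial>lborel) = \<Phi> (\<theta> + real i * h)" ..
    qed
    finally have b2: "psq P2 \<le> ennreal (2 * \<delta>)" using small by simp
    have "psq (\<lambda>s \<omega>. cut T H s \<omega> - grid_process \<theta> h m (\<lambda>i. H (\<theta> + real i * h)) s \<omega>) \<le> 2 * psq P1 + 2 * psq P2"
      unfolding dec psq_def using mP1 mP2 unfolding pmeas_def by (rule msq_add_le)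
    also have "\<dots> \<le> 2 * ennreal (2 * h * R\<^sup>2) + 2 * ennreal (2 * \<delta>)"
      by (intro add_mono mult_left_mono b1 b2) auto
    also have "\<dots> = ennreal (4 * h * R\<^sup>2 + 4 * \<delta>)"
      using h \<delta> by (simp add: numeral_mult_ennreal ennreal_plus[symmetric] mult.assoc del: ennreal_plus)
    also have "\<dots> \<le> ennreal e"
    proof (rule ennreal_leI)
      have "h \<le> e / (8 * R\<^sup>2 + 8)" using h(2) by (simp add: h0_def)
      then have "h * (8 * R\<^sup>2 + 8) \<le> e" by (subst (asm) pos_le_divide_eq) (auto intro: add_nonneg_pos)
      then show "4 * h * R\<^sup>2 + 4 * \<delta> \<le> e" using h unfolding \<delta>_def by (simp add: algebra_simps)
    qed
    finally show "\<exists>\<theta>. 0 < \<theta> \<and> \<theta> \<le> T / real (Suc m) \<and>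
      psq (\<lambda>s \<omega>. cut T H s \<omega> - grid_process \<theta> (T / real (Suc m)) m (\<lambda>i. H (\<theta> + real i * (T / real (Suc m)))) s \<omega>) \<le> ennreal e"
      using \<theta> unfolding h_def by blast
  qed
qed

definition clip :: "real \<Rightarrow> 'b::real_normed_vector \<Rightarrow> 'b" where
  "clip R x = (if norm x \<le> R then x else 0)"

lemma norm_clip: "0 \<le> R \<Longrightarrow> norm (clip R x) \<le> R" "norm (clip R x) \<le> norm x"
  by (auto simp: clip_def)

lemma measurable_clip [measurable]: "clip R \<in> borel_measurable (borel :: 'b::{real_normed_vector, second_countable_topology} measure)"
  unfolding clip_def[abs_def] by measurable

lemma psq_clip_tendsto:
  fixes G :: "real \<Rightarrow> 'a \<Rightarrow> 'b::{real_normed_vector, second_countable_topology}"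
  assumes G: "pmeas G" and fin: "psq G < \<infinity>"
  shows "(\<lambda>k. psq (\<lambda>s \<omega>. G s \<omega> - clip (real k) (G s \<omega>))) \<longlonglongrightarrow> 0"
proof -
  have [measurable]: "(\<lambda>z. G (fst z) (snd z)) \<in> borel_measurable (lborel \<Otimes>\<^sub>M M)" using G by (simp add: pmeas_def)
  have "(\<lambda>k. \<integral>\<^sup>+z. ennreal ((norm (G (fst z) (snd z) - clip (real k) (G (fst z) (snd z))))\<^sup>2) \<partial>(lborel \<Otimes>\<^sub>M M))
    \<longlonglongrightarrow> (\<integral>\<^sup>+z. 0 \<partial>((lborel :: real measure) \<Otimes>\<^sub>M M))"
  proof (rule nn_integral_dominated_convergence[where M = "lborel \<Otimes>\<^sub>M M" and u' = "\<lambda>z. 0" and w = "\<lambda>z. ennreal ((norm (G (fst z) (snd z)))\<^sup>2)"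
      and u = "\<lambda>k z. ennreal ((norm (G (fst z) (snd z) - clip (real k) (G (fst z) (snd z))))\<^sup>2)"])
    show "AE z in lborel \<Otimes>\<^sub>M M. ennreal ((norm (G (fst z) (snd z) - clip (real j) (G (fst z) (snd z))))\<^sup>2) \<le> ennreal ((norm (G (fst z) (snd z)))\<^sup>2)" for j
      by (auto simp: clip_def)
    show "AE z in lborel \<Otimes>\<^sub>M M. (\<lambda>k. ennreal ((norm (G (fst z) (snd z) - clip (real k) (G (fst z) (snd z))))\<^sup>2)) \<longlonglongrightarrow> 0"
    proof (rule AE_I2)
      fix z
      have "eventually (\<lambda>k. norm (G (fst z) (snd z)) \<le> real k) sequentially"
        by (meson eventually_sequentiallyI le_trans nat_le_real_less of_nat_le_iff order_trans real_nat_ceiling_ge)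
      then have "eventually (\<lambda>k. ennreal ((norm (G (fst z) (snd z) - clip (real k) (G (fst z) (snd z))))\<^sup>2) = 0) sequentially"
        by eventually_elim (simp add: clip_def)
      then show "(\<lambda>k. ennreal ((norm (G (fst z) (snd z) - clip (real k) (G (fst z) (snd z))))\<^sup>2)) \<longlonglongrightarrow> 0"
        by (rule tendsto_eventually)
    qed
  qed (use fin in \<open>auto simp: psq_def msq_def\<close>)
  then show ?thesis by (simp add: psq_def msq_def)
qed

lemma L2F_D:
  fixes H :: "real \<Rightarrow> 'a \<Rightarrow> 'b::{real_normed_vector, second_countable_topology}"
  assumes "H \<in> L2F M W t"
  shows "measurable_process M t H" "adapted_process M W t H" "pmeas (cut t H)" "psq (cut t H) < \<infinity>"
proof -
  show 1: "measurable_process M t H" "adapted_process M W t H" using assms by (auto simp: L2F_def)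
  show 2: "pmeas (cut t H)" by (rule pmeas_cut[OF 1(1) order_refl])
  show "psq (cut t H) < \<infinity>" unfolding psq_cut_space[OF 2] using assms by (auto simp: L2F_def)
qed

text \<open>Clip the process to make it bounded, then sample it; both operations preserve adaptedness.\<close>

theorem elementary_dense:
  fixes H :: "real \<Rightarrow> 'a \<Rightarrow> 'b::{banach, second_countable_topology}"
  assumes H: "H \<in> L2F M W t" and t: "0 \<le> t" and e: "0 < e"
  shows "\<exists>\<theta> h m \<xi>. 0 \<le> \<theta> \<and> 0 < h \<and> \<theta> + real m * h \<le> t \<and>
    (\<forall>i<m. \<xi> i \<in> borel_measurable (F (\<theta> + real i * h)) \<and> (\<exists>C. \<forall>\<omega>\<in>space M. norm (\<xi> i \<omega>) \<le> C)) \<and>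
    psq (\<lambda>s \<omega>. cut t H s \<omega> - grid_process \<theta> h m \<xi> s \<omega>) \<le> ennreal e"
proof (cases "t = 0")
  case True
  have "psq (cut 0 H) = (\<integral>\<^sup>+s\<in>{0..0}. msq M (H s) \<partial>lborel)"
    using L2F_D(3)[OF H] True by (simp add: psq_cut_time)
  also have "\<dots> = (\<integral>\<^sup>+s. msq M (H 0) * indicator {0::real} s \<partial>lborel)"
    by (intro nn_integral_cong) (auto simp: indicator_def)
  also have "\<dots> = 0" by (subst nn_integral_cmult_indicator) auto
  finally have "psq (cut 0 H) = 0" .
  then show ?thesis using True by (intro exI[of _ 0] exI[of _ "1::real"] exI[of _ "0::nat"]) (auto simp: grid_process_def)
next
  case False
  with t have t: "0 < t" by simp
  note HD = L2F_D[OF H]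
  from ennreal_tendsto_0D[OF psq_clip_tendsto[OF HD(3,4)], of "e/4"] e
  have "eventually (\<lambda>k. psq (\<lambda>s \<omega>. cut t H s \<omega> - clip (real k) (cut t H s \<omega>)) < ennreal (e/4)) sequentially" by simp
  from eventually_happens'[OF sequentially_bot this]
  obtain k where k: "psq (\<lambda>s \<omega>. cut t H s \<omega> - clip (real k) (cut t H s \<omega>)) < ennreal (e/4)" by blast
  define K where "K s \<omega> = clip (real k) (H s \<omega>)" for s \<omega>
  have cutK: "cut t K = (\<lambda>s \<omega>. clip (real k) (cut t H s \<omega>))"
    by (auto simp: K_def cut_def fun_eq_iff clip_def indicator_def)
  have pK: "pmeas (cut t K)"
    using HD(3) unfolding cutK pmeas_def by measurable
  have "\<exists>m0. \<forall>m\<ge>m0. \<exists>\<theta>. 0 < \<theta> \<and> \<theta> \<le> t / real (Suc m) \<and>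
    psq (\<lambda>s \<omega>. cut t K s \<omega> - grid_process \<theta> (t / real (Suc m)) m (\<lambda>i. K (\<theta> + real i * (t / real (Suc m)))) s \<omega>) \<le> ennreal (e/4)"
    using e by (intro sampling_approximates[OF pK t, of "real k"]) (auto simp: K_def norm_clip)
  then obtain m \<theta> where \<theta>: "0 < \<theta>" "\<theta> \<le> t / real (Suc m)" and
    le: "psq (\<lambda>s \<omega>. cut t K s \<omega> - grid_process \<theta> (t / real (Suc m)) m (\<lambda>i. K (\<theta> + real i * (t / real (Suc m)))) s \<omega>) \<le> ennreal (e/4)"
    by blast
  define h where "h = t / real (Suc m)"
  have h: "0 < h" "real (Suc m) * h = t" using t by (auto simp: h_def)
  have mh: "real m * h = t - h" using h(2) by (simp add: algebra_simps)
  define \<xi> where "\<xi> i = K (\<theta> + real i * h)" for i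
  have \<xi>: "\<xi> i \<in> borel_measurable (F (\<theta> + real i * h))" if "i < m" for i
  proof -
    have "real i * h \<le> real m * h" "0 \<le> real i * h" using that h by (auto intro: mult_right_mono)
    moreover have "\<theta> + x \<in> {0..t}" if "x \<le> t - h" "0 \<le> x" for x
      using that \<theta> unfolding h_def[symmetric] by auto
    ultimately have "\<theta> + real i * h \<in> {0..t}" unfolding mh by blast
    then have [measurable]: "H (\<theta> + real i * h) \<in> borel_measurable (F (\<theta> + real i * h))"
      using HD(2) by (simp add: adapted_process_def)
    show ?thesis unfolding \<xi>_def K_def by measurable
  qed
  show ?thesis
  proof (intro exI conjI allI impI ballI)
    show "0 \<le> \<theta>" "0 < h" using \<theta> h by auto
    show "\<theta> + real m * h \<le> t" using mh \<theta> by (simp add: h_def)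
    show "\<xi> i \<in> borel_measurable (F (\<theta> + real i * h))" if "i < m" for i by (rule \<xi>[OF that])
    show "norm (\<xi> i \<omega>) \<le> real k" for i \<omega> unfolding \<xi>_def K_def by (intro norm_clip) simp
    have pg: "pmeas (grid_process \<theta> h m \<xi>)" by (rule pmeas_grid_process) (rule measurable_F_M[OF \<xi>])
    have "psq (\<lambda>s \<omega>. cut t H s \<omega> - grid_process \<theta> h m \<xi> s \<omega>) \<le> 2 * psq (\<lambda>s \<omega>. cut t H s \<omega> - cut t K s \<omega>)
      + 2 * psq (\<lambda>s \<omega>. cut t K s \<omega> - grid_process \<theta> h m \<xi> s \<omega>)"
      by (rule psq_triangle[OF HD(3) pK pg])
    also have "\<dots> \<le> 2 * ennreal (e/4) + 2 * ennreal (e/4)"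
    proof -
      have "\<xi> = (\<lambda>i. K (\<theta> + real i * h))" by (simp add: \<xi>_def fun_eq_iff)
      then have "psq (\<lambda>s \<omega>. cut t K s \<omega> - grid_process \<theta> h m \<xi> s \<omega>) \<le> ennreal (e/4)"
        using le unfolding h_def[symmetric] by simp
      moreover have "psq (\<lambda>s \<omega>. cut t H s \<omega> - cut t K s \<omega>) \<le> ennreal (e/4)" using k unfolding cutK by simp
      ultimately show ?thesis by (intro add_mono mult_left_mono) auto
    qed
    also have "\<dots> = ennreal e" using e by (simp add: numeral_mult_ennreal ennreal_plus[symmetric] del: ennreal_plus)
    finally show "psq (\<lambda>s \<omega>. cut t H s \<omega> - grid_process \<theta> h m \<xi> s \<omega>) \<le> ennreal e" .
  qed
qed

end

section \<open>Existence and adaptedness of the Ito integral\<close>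

lemma norm_matrix_vector_le: "norm (A *v x) \<le> norm A * norm (x :: real^'n)" for A :: "real^'n^'m"
proof -
  have "(norm (A *v x))\<^sup>2 = (\<Sum>i\<in>UNIV. ((A $ i) \<bullet> x)\<^sup>2)"
    by (simp add: norm_sq_vec matrix_vector_mul_component)
  also have "\<dots> \<le> (\<Sum>i\<in>UNIV. (norm (A $ i))\<^sup>2 * (norm x)\<^sup>2)"
  proof (rule sum_mono)
    fix i
    have "\<bar>(A $ i) \<bullet> x\<bar> \<le> norm (A $ i) * norm x" by (rule Cauchy_Schwarz_ineq2)
    then have "\<bar>(A $ i) \<bullet> x\<bar>\<^sup>2 \<le> (norm (A $ i) * norm x)\<^sup>2" by (intro power_mono) auto
    then show "((A $ i) \<bullet> x)\<^sup>2 \<le> (norm (A $ i))\<^sup>2 * (norm x)\<^sup>2" by (simp add: power_mult_distrib)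
  qed
  also have "\<dots> = (norm A * norm x)\<^sup>2"
    by (simp add: sum_distrib_right[symmetric] power_mult_distrib norm_vec_def L2_set_def sum_nonneg)
  finally show ?thesis by (rule power2_le_imp_le) simp
qed

lemma measurable_vec_lambda:
  fixes f :: "'a \<Rightarrow> real^'n"
  assumes "\<And>i. (\<lambda>x. f x $ i) \<in> borel_measurable M"
  shows "f \<in> borel_measurable M"
proof (subst borel_measurable_euclidean_space, intro ballI)
  fix b :: "real^'n" assume "b \<in> Basis"
  then obtain i where "b = axis i 1" by (auto simp: Basis_vec_def)
  then show "(\<lambda>x. f x \<bullet> b) \<in> borel_measurable M" using assms[of i] by (simp add: inner_axis)
qed

lemma measurable_matrix_vector [measurable (raw)]:
  fixes A :: "'a \<Rightarrow> real^'n^'m" and x :: "'a \<Rightarrow> real^'n"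
  assumes [measurable]: "A \<in> borel_measurable M" "x \<in> borel_measurable M"
  shows "(\<lambda>\<omega>. A \<omega> *v x \<omega>) \<in> borel_measurable M"
  by (rule measurable_vec_lambda) (simp add: matrix_vector_mult_def)

context brownian_setting
begin

text \<open>The integrals of fast approximating elementary processes converge almost surely, by the isometry,
  and their pointwise limit is adapted.\<close>

lemma adapted_ito_exists:
  assumes H: "H \<in> L2F M W t" and t: "0 \<le> t"
  shows "\<exists>I. has_ito_integral M W t H I \<and> I \<in> borel_measurable (F t)"
proof -
  note HD = L2F_D[OF H]
  have "\<exists>m \<tau> \<xi>. elementary_data M W t m \<tau> \<xi> \<and>
      psq (\<lambda>s \<omega>. cut t H s \<omega> - elementary_process m \<tau> \<xi> s \<omega>) \<le> ennreal ((1/4)^k)" for k :: nat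
  proof -
    obtain \<theta> h m \<xi> where *: "0 \<le> \<theta>" "0 < h" "\<theta> + real m * h \<le> t"
      "\<And>i. i < m \<Longrightarrow> \<xi> i \<in> borel_measurable (F (\<theta> + real i * h))"
      "\<And>i. i < m \<Longrightarrow> \<exists>C. \<forall>\<omega>\<in>space M. norm (\<xi> i \<omega>) \<le> C"
      "psq (\<lambda>s \<omega>. cut t H s \<omega> - grid_process \<theta> h m \<xi> s \<omega>) \<le> ennreal ((1/4)^k)"
    proof -
      have "(0::real) < (1/4)^k" by simp
      from elementary_dense[OF H t this] show ?thesis using that by blast
    qed
    have "elementary_data M W t m (\<lambda>i. \<theta> + real i * h) \<xi>"
      unfolding elementary_data_def using * by auto
    moreover have "elementary_process m (\<lambda>i. \<theta> + real i * h) \<xi> = grid_process \<theta> h m \<xi>"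
      by (auto simp: elementary_process_def grid_process_def fun_eq_iff mult.commute)
    ultimately show ?thesis using *(6) by metis
  qed
  then have "\<forall>k::nat. \<exists>m \<tau> \<xi>. elementary_data M W t m \<tau> \<xi> \<and>
      psq (\<lambda>s \<omega>. cut t H s \<omega> - elementary_process m \<tau> \<xi> s \<omega>) \<le> ennreal ((1/4)^k)" by blast
  from choice[OF this] obtain m where "\<forall>k::nat. \<exists>\<tau> \<xi>. elementary_data M W t (m k) \<tau> \<xi> \<and>
      psq (\<lambda>s \<omega>. cut t H s \<omega> - elementary_process (m k) \<tau> \<xi> s \<omega>) \<le> ennreal ((1/4)^k)" by blast
  from choice[OF this] obtain \<tau> where "\<forall>k::nat. \<exists>\<xi>. elementary_data M W t (m k) (\<tau> k) \<xi> \<and>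
      psq (\<lambda>s \<omega>. cut t H s \<omega> - elementary_process (m k) (\<tau> k) \<xi> s \<omega>) \<le> ennreal ((1/4)^k)" by blast
  from choice[OF this] obtain \<xi> where E: "\<And>k. elementary_data M W t (m k) (\<tau> k) (\<xi> k)"
    and le: "\<And>k. psq (\<lambda>s \<omega>. cut t H s \<omega> - elementary_process (m k) (\<tau> k) (\<xi> k) s \<omega>) \<le> ennreal ((1/4)^k)"
    by blast
  define S where "S k = elementary_process (m k) (\<tau> k) (\<xi> k)" for k
  define I where "I k = elementary_integral W (m k) (\<tau> k) (\<xi> k)" for k
  have pS: "pmeas (S k)" for k unfolding S_def elementary_process_simple by (rule pmeas_simple[OF elementary_data_simple[OF E]])
  have IM: "I k \<in> borel_measurable M" for k unfolding I_def elementary_integral_simple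
    by (rule measurable_simple_integral[OF elementary_data_simple[OF E]])
  have IF: "I k \<in> borel_measurable (F t)" for k
    unfolding I_def elementary_integral_def[abs_def]
  proof (intro borel_measurable_sum borel_measurable_times borel_measurable_diff)
    fix i assume i: "i \<in> {..<m k}"
    have 0: "0 \<le> \<tau> k 0" "\<tau> k (m k) \<le> t" using E[of k] by (auto simp: elementary_data_def)
    have 1: "\<tau> k 0 \<le> \<tau> k i" "\<tau> k i \<le> \<tau> k (Suc i)" "\<tau> k (Suc i) \<le> \<tau> k (m k)"
      using i by (auto intro!: elementary_data_increasing[OF E])
    show "\<xi> k i \<in> borel_measurable (F t)"
      using E[of k] i 0 1 by (auto simp: elementary_data_def intro: measurable_F_mono[of _ "\<tau> k i"])
    show "W (\<tau> k (Suc i)) \<in> borel_measurable (F t)" "W (\<tau> k i) \<in> borel_measurable (F t)"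
      using 0 1 by (auto intro!: W_measurable_F)
  qed
  have step: "msq M (\<lambda>\<omega>. I (Suc k) \<omega> - I k \<omega>) \<le> ennreal (4 * (1/4)^k)" for k
  proof -
    have "msq M (\<lambda>\<omega>. I (Suc k) \<omega> - I k \<omega>) = psq (\<lambda>s \<omega>. S (Suc k) s \<omega> - S k s \<omega>)"
      using simple_isometry_diff[OF elementary_data_simple[OF E[of "Suc k"]] elementary_data_simple[OF E[of k]]]
        psq_time[of "\<lambda>s \<omega>. S (Suc k) s \<omega> - S k s \<omega>"] pS
      unfolding S_def I_def elementary_process_simple elementary_integral_simple by (simp add: pmeas_def)
    also have "\<dots> \<le> 2 * psq (\<lambda>s \<omega>. S (Suc k) s \<omega> - cut t H s \<omega>) + 2 * psq (\<lambda>s \<omega>. cut t H s \<omega> - S k s \<omega>)"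
      by (rule psq_triangle[OF pS HD(3) pS])
    also have "\<dots> \<le> 2 * ennreal ((1/4)^Suc k) + 2 * ennreal ((1/4)^k)"
      using le[of k] le[of "Suc k"] psq_minus_commute[of "S (Suc k)" "cut t H"] unfolding S_def
      by (intro add_mono mult_left_mono) auto
    also have "\<dots> = ennreal (2 * (1/4)^Suc k + 2 * (1/4)^k)"
      by (simp add: numeral_mult_ennreal ennreal_plus[symmetric] del: ennreal_plus)
    also have "\<dots> \<le> ennreal (4 * (1/4)^k)" by (intro ennreal_leI) simp
    finally show ?thesis .
  qed
  define J where "J \<omega> = lim (\<lambda>k. I k \<omega>)" for \<omega>
  have JF: "J \<in> borel_measurable (F t)" unfolding J_def[abs_def] using IF by (rule borel_measurable_lim_metric)
  have JI: "msq M (\<lambda>\<omega>. I k \<omega> - J \<omega>) \<le> ennreal (4 * 4 * (1/4)^k)" for k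
    unfolding J_def by (rule msq_fast_Cauchy(2)[OF IM _ step]) simp
  have lim0: "(\<lambda>k. ennreal (c * (1/4)^k)) \<longlonglongrightarrow> 0" for c :: real
  proof -
    have "(\<lambda>k. c * (1/4)^k) \<longlonglongrightarrow> c * 0" by (intro tendsto_intros LIMSEQ_power_zero) auto
    then show ?thesis using tendsto_ennrealI by fastforce
  qed
  have "has_ito_integral M W t H J"
    unfolding has_ito_integral_def
  proof (intro conjI exI allI)
    show "elementary_data M W t (m k) (\<tau> k) (\<xi> k)" for k by (rule E)
    show "(\<lambda>k. \<integral>\<^sup>+\<omega>. (\<integral>\<^sup>+s\<in>{0..t}. ennreal ((H s \<omega> - elementary_process (m k) (\<tau> k) (\<xi> k) s \<omega>)\<^sup>2) \<partial>lborel) \<partial>M) \<longlonglongrightarrow> 0"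
      unfolding psq_diff_elementary[OF HD(1) E]
      by (rule tendsto_sandwich[OF _ _ tendsto_const lim0[of 1]]) (auto simp: le)
    show "(\<lambda>k. \<integral>\<^sup>+\<omega>. ennreal ((J \<omega> - elementary_integral W (m k) (\<tau> k) (\<xi> k) \<omega>)\<^sup>2) \<partial>M) \<longlonglongrightarrow> 0"
    proof (rule tendsto_sandwich[OF _ _ tendsto_const lim0[of 16]])
      show "eventually (\<lambda>k. (\<integral>\<^sup>+\<omega>. ennreal ((J \<omega> - elementary_integral W (m k) (\<tau> k) (\<xi> k) \<omega>)\<^sup>2) \<partial>M) \<le> ennreal (16 * (1/4)^k)) sequentially"
        using JI msq_minus_commute[of M J] unfolding msq_def I_def by simp
    qed simp
  qed (use H measurable_F_M[OF JF] in auto)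
  with JF show ?thesis by blast
qed

lemma ito_lim_unique: "ito_lim G J \<Longrightarrow> ito_lim G J' \<Longrightarrow> AE \<omega> in M. J \<omega> = J' \<omega>"
proof -
  assume a: "ito_lim G J" "ito_lim G J'"
  then have "msq M (\<lambda>\<omega>. J \<omega> - J' \<omega>) = 0" using ito_lim_dist[OF a] by (simp add: psq_def)
  moreover have "J \<in> borel_measurable M" "J' \<in> borel_measurable M" using a by (auto simp: ito_lim_def)
  ultimately show ?thesis by (simp add: msq_eq_0_iff)
qed

lemma has_ito_integral_adapted:
  assumes "has_ito_integral M W t H I" and t: "0 \<le> t"
  shows "I \<in> borel_measurable (F t)"
proof -
  have "H \<in> L2F M W t" using assms by (simp add: has_ito_integral_def)
  from adapted_ito_exists[OF this t] obtain J where J: "has_ito_integral M W t H J" "J \<in> borel_measurable (F t)" by blast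
  have "AE \<omega> in M. J \<omega> = I \<omega>"
    using has_ito_integral_ito_lim[OF J(1)] has_ito_integral_ito_lim[OF assms(1)] by (rule ito_lim_unique)
  then show ?thesis using J(2) borel_measurable_F_AE_cong by blast
qed

definition vec_ito :: "real \<Rightarrow> (real \<Rightarrow> 'a \<Rightarrow> real^'n) \<Rightarrow> ('a \<Rightarrow> real^'n) \<Rightarrow> bool" where
  "vec_ito t H I \<longleftrightarrow> (\<forall>i. has_ito_integral M W t (\<lambda>s \<omega>. H s \<omega> $ i) (\<lambda>\<omega>. I \<omega> $ i))"

lemma vec_ito_adapted: "vec_ito t H I \<Longrightarrow> 0 \<le> t \<Longrightarrow> I \<in> borel_measurable (F t)"
  unfolding vec_ito_def by (rule measurable_vec_lambda) (blast intro: has_ito_integral_adapted)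

lemma L2F_component:
  fixes H :: "real \<Rightarrow> 'a \<Rightarrow> real^'n"
  assumes H: "H \<in> L2F M W t" shows "(\<lambda>s \<omega>. H s \<omega> $ i) \<in> L2F M W t"
proof -
  note HD = L2F_D[OF H]
  have m: "measurable_process M t (\<lambda>s \<omega>. H s \<omega> $ i)"
    using HD(1) measurable_vec_nth[of "\<lambda>(s, \<omega>). H s \<omega>" _ i] unfolding measurable_process_def by (simp add: split_beta')
  have a: "adapted_process M W t (\<lambda>s \<omega>. H s \<omega> $ i)"
    using HD(2) unfolding adapted_process_def by (auto intro: measurable_vec_nth)
  have "cut t (\<lambda>s \<omega>. H s \<omega> $ i) = (\<lambda>s \<omega>. cut t H s \<omega> $ i)" by (auto simp: cut_def fun_eq_iff)
  then have "psq (cut t (\<lambda>s \<omega>. H s \<omega> $ i)) \<le> psq (cut t H)"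
    by (simp add: psq_def msq_component_le)
  then show ?thesis
    using HD(4) m a psq_cut_space[OF pmeas_cut[OF m order_refl]] unfolding L2F_def by auto
qed

lemma vec_ito_exists:
  fixes H :: "real \<Rightarrow> 'a \<Rightarrow> real^'n"
  assumes H: "H \<in> L2F M W t" and t: "0 \<le> t"
  shows "\<exists>I. vec_ito t H I"
proof -
  have "\<forall>i. \<exists>J. has_ito_integral M W t (\<lambda>s \<omega>. H s \<omega> $ i) J"
    using adapted_ito_exists[OF L2F_component[OF H] t] by blast
  then obtain J where J: "\<And>i. has_ito_integral M W t (\<lambda>s \<omega>. H s \<omega> $ i) (J i)" by metis
  then show ?thesis unfolding vec_ito_def by (intro exI[of _ "\<lambda>\<omega>. \<chi> i. J i \<omega>"]) simp
qed

definition vec_ito_lim :: "(real \<Rightarrow> 'a \<Rightarrow> real^'n) \<Rightarrow> ('a \<Rightarrow> real^'n) \<Rightarrow> bool" where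
  "vec_ito_lim G J \<longleftrightarrow> (\<forall>i. ito_lim (\<lambda>s \<omega>. G s \<omega> $ i) (\<lambda>\<omega>. J \<omega> $ i))"

lemma vec_ito_vec_ito_lim: "vec_ito t H I \<Longrightarrow> vec_ito_lim (cut t H) I"
  unfolding vec_ito_lim_def vec_ito_def
  using has_ito_integral_ito_lim[of t "\<lambda>s \<omega>. H s \<omega> $ i" for i] by (simp add: cut_def[abs_def])

lemma vec_ito_lim_dist:
  assumes a: "vec_ito_lim G J" "vec_ito_lim G' J'"
  shows "msq M (\<lambda>\<omega>. J \<omega> - J' \<omega>) \<le> 16 * psq (\<lambda>s \<omega>. G s \<omega> - G' s \<omega>)"
proof -
  have m: "J \<in> borel_measurable M" "J' \<in> borel_measurable M"
    using a by (auto intro!: measurable_vec_lambda simp: vec_ito_lim_def ito_lim_def)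
  have p: "(\<lambda>z. G (fst z) (snd z)) \<in> borel_measurable (lborel \<Otimes>\<^sub>M M)" "(\<lambda>z. G' (fst z) (snd z)) \<in> borel_measurable (lborel \<Otimes>\<^sub>M M)"
    using a by (auto intro!: measurable_vec_lambda simp: vec_ito_lim_def ito_lim_def pmeas_def)
  have "msq M (\<lambda>\<omega>. J \<omega> - J' \<omega>) = (\<Sum>i\<in>UNIV. msq M (\<lambda>\<omega>. J \<omega> $ i - J' \<omega> $ i))"
    using m by (subst msq_vec) auto
  also have "\<dots> \<le> (\<Sum>i\<in>UNIV. 16 * psq (\<lambda>s \<omega>. G s \<omega> $ i - G' s \<omega> $ i))"
    using a unfolding vec_ito_lim_def by (intro sum_mono ito_lim_dist) auto
  also have "\<dots> = 16 * psq (\<lambda>s \<omega>. G s \<omega> - G' s \<omega>)"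
    unfolding psq_def using p by (subst msq_vec) (auto simp: sum_distrib_left)
  finally show ?thesis .
qed

text \<open>The mean square limit agrees almost surely with the pointwise limit, which is adapted.\<close>

lemma msq_limit_adapted:
  fixes f :: "nat \<Rightarrow> 'a \<Rightarrow> 'b::{banach, second_countable_topology}"
  assumes f: "\<And>k. f k \<in> borel_measurable (F t)" and g: "g \<in> borel_measurable M"
    and le: "\<And>k. msq M (\<lambda>\<omega>. f k \<omega> - g \<omega>) \<le> ennreal (c * (1/4)^k)" and c: "0 \<le> c"
  shows "AE \<omega> in M. (\<lambda>k. f k \<omega>) \<longlonglongrightarrow> g \<omega>" and "g \<in> borel_measurable (F t)"
proof -
  have fM: "f k \<in> borel_measurable M" for k using f by (rule measurable_F_M)
  have step: "msq M (\<lambda>\<omega>. f (Suc k) \<omega> - f k \<omega>) \<le> ennreal (4 * c * (1/4)^k)" for k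
  proof -
    have "msq M (\<lambda>\<omega>. f (Suc k) \<omega> - f k \<omega>) \<le> 2 * msq M (\<lambda>\<omega>. f (Suc k) \<omega> - g \<omega>) + 2 * msq M (\<lambda>\<omega>. g \<omega> - f k \<omega>)"
      by (rule msq_triangle[OF fM g fM])
    also have "\<dots> \<le> 2 * ennreal (c * (1/4)^Suc k) + 2 * ennreal (c * (1/4)^k)"
      using le[of k] le[of "Suc k"] msq_minus_commute[of M g "f k"] by (intro add_mono mult_left_mono) auto
    also have "\<dots> = ennreal (2 * (c * (1/4)^Suc k) + 2 * (c * (1/4)^k))"
      using c by (simp add: numeral_mult_ennreal ennreal_plus[symmetric] del: ennreal_plus)
    also have "\<dots> \<le> ennreal (4 * c * (1/4)^k)" using c by (intro ennreal_leI) simp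
    finally show ?thesis .
  qed
  define l where "l \<omega> = lim (\<lambda>k. f k \<omega>)" for \<omega>
  have lF: "l \<in> borel_measurable (F t)" unfolding l_def[abs_def] using f by (rule borel_measurable_lim_metric)
  have conv: "AE \<omega> in M. (\<lambda>k. f k \<omega>) \<longlonglongrightarrow> l \<omega>"
    unfolding l_def using c by (intro msq_fast_Cauchy(1)[OF fM _ step]) simp
  have fl: "msq M (\<lambda>\<omega>. f k \<omega> - l \<omega>) \<le> ennreal (16 * c * (1/4)^k)" for k
    unfolding l_def using msq_fast_Cauchy(2)[OF fM _ step, of k] c by simp
  have "msq M (\<lambda>\<omega>. g \<omega> - l \<omega>) \<le> ennreal (34 * c * (1/4)^k)" for k
  proof -
    have "msq M (\<lambda>\<omega>. g \<omega> - l \<omega>) \<le> 2 * msq M (\<lambda>\<omega>. g \<omega> - f k \<omega>) + 2 * msq M (\<lambda>\<omega>. f k \<omega> - l \<omega>)"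
      by (rule msq_triangle[OF g fM measurable_F_M[OF lF]])
    also have "\<dots> \<le> 2 * ennreal (c * (1/4)^k) + 2 * ennreal (16 * c * (1/4)^k)"
      using le[of k] fl[of k] msq_minus_commute[of M g "f k"] by (intro add_mono mult_left_mono) auto
    also have "\<dots> = ennreal (34 * c * (1/4)^k)"
      using c by (simp add: numeral_mult_ennreal ennreal_plus[symmetric] del: ennreal_plus)
    finally show ?thesis .
  qed
  moreover have "(\<lambda>k. ennreal (34 * c * (1/4)^k)) \<longlonglongrightarrow> 0"
  proof -
    have "(\<lambda>k. 34 * c * (1/4)^k) \<longlonglongrightarrow> 34 * c * 0" by (intro tendsto_intros LIMSEQ_power_zero) auto
    then show ?thesis using tendsto_ennrealI by fastforce
  qed
  ultimately have "msq M (\<lambda>\<omega>. g \<omega> - l \<omega>) \<le> 0"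
    by (intro LIMSEQ_le_const[of _ 0]) auto
  then have eq: "AE \<omega> in M. g \<omega> = l \<omega>"
    using g measurable_F_M[OF lF] msq_eq_0_iff[of "\<lambda>\<omega>. g \<omega> - l \<omega>" M] by simp
  show "AE \<omega> in M. (\<lambda>k. f k \<omega>) \<longlonglongrightarrow> g \<omega>" using eq conv by eventually_elim simp
  have "AE \<omega> in M. l \<omega> = g \<omega>" using eq by eventually_elim simp
  then show "g \<in> borel_measurable (F t)" by (rule borel_measurable_F_AE_cong[OF lF])
qed

section \<open>Path integrals\<close>

definition supported :: "real \<Rightarrow> (real \<Rightarrow> 'a \<Rightarrow> 'b::real_normed_vector) \<Rightarrow> bool" where
  "supported T G \<longleftrightarrow> (\<forall>s \<omega>. s \<notin> {0..T} \<longrightarrow> G s \<omega> = 0)"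

lemma supported_cut: "t \<le> T \<Longrightarrow> supported T (cut t V)"
  by (auto simp: supported_def cut_def indicator_def)

lemma supported_diff: "supported T G \<Longrightarrow> supported T G' \<Longrightarrow> supported T (\<lambda>s \<omega>. G s \<omega> - G' s \<omega>)"
  by (auto simp: supported_def)

definition path_int :: "(real \<Rightarrow> 'a \<Rightarrow> 'b::{banach, second_countable_topology}) \<Rightarrow> 'a \<Rightarrow> 'b" where
  "path_int G \<omega> = (\<integral>s. G s \<omega> \<partial>lborel)"

lemma set_integral_path_int: "(LINT s:{0..t}|lborel. V s \<omega>) = path_int (cut t V) \<omega>"
  by (simp add: set_lebesgue_integral_def path_int_def cut_def)

lemma path_int_measurable:
  assumes "(\<lambda>z. G (fst z) (snd z)) \<in> borel_measurable (lborel \<Otimes>\<^sub>M N)"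
  shows "path_int G \<in> borel_measurable N"
proof -
  have "(\<lambda>z. (snd z, fst z)) \<in> (N \<Otimes>\<^sub>M lborel) \<rightarrow>\<^sub>M (lborel \<Otimes>\<^sub>M N)" by measurable
  from measurable_compose[OF this assms]
  have "(\<lambda>(\<omega>, s). G s \<omega>) \<in> borel_measurable (N \<Otimes>\<^sub>M lborel)" by (simp add: split_beta')
  then show ?thesis unfolding path_int_def[abs_def] by (rule lborel.borel_measurable_lebesgue_integral)
qed

lemma path_int_msq:
  assumes G: "pmeas G" and supp: "supported T G" and T: "0 \<le> T"
  shows "msq M (path_int G) \<le> ennreal T * psq G"
proof -
  have "msq M (path_int G) \<le> (\<integral>\<^sup>+\<omega>. ennreal T * (\<integral>\<^sup>+s. ennreal ((norm (G s \<omega>))\<^sup>2) \<partial>lborel) \<partial>M)"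
    unfolding msq_def
  proof (rule nn_integral_mono)
    fix \<omega> assume w: "\<omega> \<in> space M"
    have "path_int G \<omega> = (LINT s:{0..T}|lborel. G s \<omega>)"
      unfolding path_int_def set_lebesgue_integral_def
      using supp by (intro Bochner_Integration.integral_cong) (auto simp: indicator_def supported_def)
    then have "ennreal ((norm (path_int G \<omega>))\<^sup>2) \<le> ennreal T * (\<integral>\<^sup>+s\<in>{0..T}. ennreal ((norm (G s \<omega>))\<^sup>2) \<partial>lborel)"
      using T by (simp only:) (rule msq_integral_le[OF pmeas_path[OF G w]], auto)
    also have "\<dots> \<le> ennreal T * (\<integral>\<^sup>+s. ennreal ((norm (G s \<omega>))\<^sup>2) \<partial>lborel)"
      by (intro mult_left_mono nn_integral_mono) (auto simp: indicator_def)
    finally show "ennreal ((norm (path_int G \<omega>))\<^sup>2) \<le> ennreal T * (\<integral>\<^sup>+s. ennreal ((norm (G s \<omega>))\<^sup>2) \<partial>lborel)" .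
  qed
  also have "\<dots> = ennreal T * psq G"
  proof -
    have "(\<lambda>z. ennreal ((norm (G (snd z) (fst z)))\<^sup>2)) \<in> borel_measurable (M \<Otimes>\<^sub>M lborel)"
    proof -
      have "(\<lambda>z. (snd z, fst z)) \<in> (M \<Otimes>\<^sub>M lborel) \<rightarrow>\<^sub>M (lborel \<Otimes>\<^sub>M M)" by measurable
      from measurable_compose[OF this G[unfolded pmeas_def]] show ?thesis by simp
    qed
    from lborel.borel_measurable_nn_integral_fst[OF this]
    show ?thesis unfolding psq_space[OF G] by (intro nn_integral_cmult) simp
  qed
  finally show ?thesis .
qed

lemma path_integrable:
  fixes G :: "real \<Rightarrow> 'a \<Rightarrow> 'b::{banach, second_countable_topology}"
  assumes G: "pmeas G" and fin: "psq G < \<infinity>" and supp: "supported T G"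
  shows "AE \<omega> in M. integrable lborel (\<lambda>s. G s \<omega>)"
proof -
  have "(\<lambda>z. ennreal ((norm (G (snd z) (fst z)))\<^sup>2)) \<in> borel_measurable (M \<Otimes>\<^sub>M lborel)"
  proof -
    have "(\<lambda>z. (snd z, fst z)) \<in> (M \<Otimes>\<^sub>M lborel) \<rightarrow>\<^sub>M (lborel \<Otimes>\<^sub>M M)" by measurable
    from measurable_compose[OF this G[unfolded pmeas_def]] show ?thesis by simp
  qed
  from lborel.borel_measurable_nn_integral_fst[OF this]
  have "(\<lambda>\<omega>. \<integral>\<^sup>+s. ennreal ((norm (G s \<omega>))\<^sup>2) \<partial>lborel) \<in> borel_measurable M" by simp
  then have "AE \<omega> in M. (\<integral>\<^sup>+s. ennreal ((norm (G s \<omega>))\<^sup>2) \<partial>lborel) \<noteq> \<infinity>"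
    using fin unfolding psq_space[OF G] by (intro nn_integral_PInf_AE) auto
  then have "AE \<omega> in M. \<omega> \<in> space M \<longrightarrow> integrable lborel (\<lambda>s. G s \<omega>)"
  proof eventually_elim
    case (elim \<omega>)
    show ?case
    proof
      assume w: "\<omega> \<in> space M"
      have [measurable]: "(\<lambda>s. G s \<omega>) \<in> borel_measurable borel" by (rule pmeas_path[OF G w])
      have "integrable lborel (\<lambda>s. indicator {0..T} s + (norm (G s \<omega>))\<^sup>2)"
      proof (rule Bochner_Integration.integrable_add)
        show "integrable lborel (indicator {0..T} :: real \<Rightarrow> real)"
          by (cases "0 \<le> T") (auto intro!: integrable_real_indicator)
        show "integrable lborel (\<lambda>s. (norm (G s \<omega>))\<^sup>2)"
          using elim by (simp add: integrable_iff_bounded less_top)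
      qed
      then show "integrable lborel (\<lambda>s. G s \<omega>)"
      proof (rule Bochner_Integration.integrable_bound)
        show "AE s in lborel. norm (G s \<omega>) \<le> norm (indicator {0..T} s + (norm (G s \<omega>))\<^sup>2)"
        proof (rule AE_I2)
          fix s :: real
          have "norm (G s \<omega>) \<le> 1 + (norm (G s \<omega>))\<^sup>2"
          proof -
            have "2 * norm (G s \<omega>) \<le> 1 + (norm (G s \<omega>))\<^sup>2" using sum_squares_bound[of 1 "norm (G s \<omega>)"] by simp
            then show ?thesis using norm_ge_zero[of "G s \<omega>"] by linarith
          qed
          then show "norm (G s \<omega>) \<le> norm (indicator {0..T} s + (norm (G s \<omega>))\<^sup>2)"
            using supp[unfolded supported_def, rule_format, of s \<omega>] by (cases "s \<in> {0..T}") auto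
        qed
      qed measurable
    qed
  qed
  then show ?thesis using AE_space by eventually_elim simp
qed

lemma path_int_diff:
  fixes G :: "real \<Rightarrow> 'a \<Rightarrow> 'b::{banach, second_countable_topology}"
  assumes "pmeas G" "psq G < \<infinity>" "supported T G"
    and "pmeas G'" "psq G' < \<infinity>" "supported T G'"
  shows "AE \<omega> in M. path_int G \<omega> - path_int G' \<omega> = path_int (\<lambda>s \<omega>. G s \<omega> - G' s \<omega>) \<omega>"
  using path_integrable[OF assms(1,2,3)] path_integrable[OF assms(4,5,6)]
  by eventually_elim (simp add: path_int_def)

text \<open>The Bochner integral is additive only for integrable arguments, which is where the finiteness
  assumptions on both processes enter.\<close>

lemma path_int_dist:
  fixes G :: "real \<Rightarrow> 'a \<Rightarrow> 'b::{banach, second_countable_topology}"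
  assumes G: "pmeas G" "psq G < \<infinity>" "supported T G"
    and G': "pmeas G'" "psq G' < \<infinity>" "supported T G'" and T: "0 \<le> T"
  shows "msq M (\<lambda>\<omega>. path_int G \<omega> - path_int G' \<omega>) \<le> ennreal T * psq (\<lambda>s \<omega>. G s \<omega> - G' s \<omega>)"
proof -
  have "msq M (\<lambda>\<omega>. path_int G \<omega> - path_int G' \<omega>) = msq M (path_int (\<lambda>s \<omega>. G s \<omega> - G' s \<omega>))"
    using path_int_diff[OF G G'] by (intro msq_cong_AE) (auto elim: eventually_mono)
  also have "\<dots> \<le> ennreal T * psq (\<lambda>s \<omega>. G s \<omega> - G' s \<omega>)"
    using G G' T by (intro path_int_msq supported_diff) (auto simp: pmeas_def)
  finally show ?thesis .
qed

end

section \<open>Mean square continuous processes\<close>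

lemma measurable_processI:
  fixes G :: "real \<Rightarrow> 'a \<Rightarrow> 'b::{real_normed_vector, second_countable_topology}"
  assumes G: "(\<lambda>z. G (fst z) (snd z)) \<in> borel_measurable (lborel \<Otimes>\<^sub>M N)"
    and eq: "\<And>s \<omega>. s \<in> {0..t} \<Longrightarrow> \<omega> \<in> space N \<Longrightarrow> G s \<omega> = X s \<omega>"
  shows "measurable_process N t X"
proof -
  have "(\<lambda>z. z) \<in> (restrict_space borel {0..t} \<Otimes>\<^sub>M N) \<rightarrow>\<^sub>M (lborel \<Otimes>\<^sub>M N)"
  proof -
    have "(\<lambda>z. (fst z, snd z)) \<in> (restrict_space borel {0..t} \<Otimes>\<^sub>M N) \<rightarrow>\<^sub>M (lborel \<Otimes>\<^sub>M N)"
      by (intro measurable_Pair) (auto intro!: measurable_compose[OF measurable_fst measurable_restrict_space1])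
    then show ?thesis by simp
  qed
  from measurable_compose[OF this G]
  have "(\<lambda>z. G (fst z) (snd z)) \<in> borel_measurable (restrict_space borel {0..t} \<Otimes>\<^sub>M N)" .
  then show ?thesis unfolding measurable_process_def
    by (rule measurable_cong[THEN iffD1, rotated])
       (auto simp: space_pair_measure space_restrict_space eq)
qed

lemma Icc_subsequence:
  fixes u :: "nat \<Rightarrow> real"
  assumes "\<And>n. u n \<in> {a..b}"
  shows "\<exists>t r. t \<in> {a..b} \<and> strict_mono (r :: nat \<Rightarrow> nat) \<and> (\<lambda>n. u (r n)) \<longlonglongrightarrow> t"
proof -
  have "\<forall>f. (\<forall>n. f n \<in> {a..b}) \<longrightarrow> (\<exists>l\<in>{a..b}. \<exists>r. strict_mono (r :: nat \<Rightarrow> nat) \<and> (f \<circ> r) \<longlonglongrightarrow> l)"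
    using compact_imp_seq_compact[OF compact_Icc, of a b] unfolding seq_compact_def .
  from this[THEN spec, of u] assms show ?thesis unfolding comp_def by blast
qed

context brownian_setting
begin

lemma measurable_process_F_M: "measurable_process (F t) T X \<Longrightarrow> measurable_process M T X"
  unfolding measurable_process_def
proof -
  assume a: "(\<lambda>(t, \<omega>). X t \<omega>) \<in> borel_measurable (restrict_space borel {0..T} \<Otimes>\<^sub>M F t)"
  have "id \<in> M \<rightarrow>\<^sub>M F t" using sets_F_subset[of t] by (auto simp: measurable_def)
  then have "(\<lambda>z. (fst z, id (snd z))) \<in> (restrict_space borel {0..T} \<Otimes>\<^sub>M M) \<rightarrow>\<^sub>M (restrict_space borel {0..T} \<Otimes>\<^sub>M F t)"
    by measurable
  from measurable_compose[OF this a] show "(\<lambda>(t, \<omega>). X t \<omega>) \<in> borel_measurable (restrict_space borel {0..T} \<Otimes>\<^sub>M M)"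
    by (simp add: split_beta')
qed

lemma L2F_I:
  fixes H :: "real \<Rightarrow> 'a \<Rightarrow> 'b::{real_normed_vector, second_countable_topology}"
  assumes "measurable_process M t H" "adapted_process M W t H" "psq (cut t H) < \<infinity>"
  shows "H \<in> L2F M W t"
  using assms psq_cut_space[OF pmeas_cut[OF assms(1) order_refl]] by (simp add: L2F_def)

lemma psq_mono:
  assumes "\<And>s \<omega>. \<omega> \<in> space M \<Longrightarrow> norm (G s \<omega>) \<le> norm (G' s \<omega>)"
  shows "psq G \<le> psq G'"
  unfolding psq_def using assms by (intro msq_mono_AE AE_I2) (auto simp: space_pair_measure)

lemma L2F_mono:
  fixes H :: "real \<Rightarrow> 'a \<Rightarrow> 'b::{real_normed_vector, second_countable_topology}"
  assumes H: "H \<in> L2F M W T" and t: "t \<le> T"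
  shows "H \<in> L2F M W t"
proof (rule L2F_I)
  note HD = L2F_D[OF H]
  show "measurable_process M t H"
    by (rule measurable_processI[OF HD(3)[unfolded pmeas_def]]) (use t in \<open>auto simp: cut_def\<close>)
  show "adapted_process M W t H" using HD(2) t by (auto simp: adapted_process_def)
  have "psq (cut t H) \<le> psq (cut T H)" using t by (intro psq_mono) (auto simp: cut_def indicator_def)
  then show "psq (cut t H) < \<infinity>" using HD(4) by simp
qed

lemma CF_D:
  assumes "Z \<in> CF M W T"
  shows "adapted_process M W T Z" "t \<in> {0..T} \<Longrightarrow> msq M (Z t) < \<infinity>"
    "t \<in> {0..T} \<Longrightarrow> ((\<lambda>s. msq M (\<lambda>\<omega>. Z s \<omega> - Z t \<omega>)) \<longlongrightarrow> 0) (at t within {0..T})"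
    "t \<in> {0..T} \<Longrightarrow> Z t \<in> borel_measurable M"
  using assms by (auto simp: CF_def msq_def adapted_process_def intro: measurable_F_M)

lemma CF_sequence:
  assumes Z: "Z \<in> CF M W T" and u: "u \<longlonglongrightarrow> t" "\<And>n. u n \<in> {0..T}"
  shows "(\<lambda>n. msq M (\<lambda>\<omega>. Z (u n) \<omega> - Z t \<omega>)) \<longlonglongrightarrow> 0"
proof (rule ennreal_tendsto_0I)
  fix e :: real assume e: "e > 0"
  have t: "t \<in> {0..T}" using closed_sequentially[OF closed_atLeastAtMost] u by blast
  from ennreal_tendsto_0D[OF CF_D(3)[OF Z t] e]
  obtain d where d: "d > 0" "\<And>s. s \<in> {0..T} \<Longrightarrow> s \<noteq> t \<Longrightarrow> dist s t < d \<Longrightarrow> msq M (\<lambda>\<omega>. Z s \<omega> - Z t \<omega>) < ennreal e"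
    unfolding eventually_at by blast
  from u(1) d(1) have "eventually (\<lambda>n. dist (u n) t < d) sequentially" by (rule tendstoD)
  then show "eventually (\<lambda>n. msq M (\<lambda>\<omega>. Z (u n) \<omega> - Z t \<omega>) \<le> ennreal e) sequentially"
  proof eventually_elim
    case (elim n)
    then show ?case using d(2)[OF u(2)[of n]] by (cases "u n = t") (auto intro: less_imp_le)
  qed
qed

lemma CF_uniform:
  fixes Z :: "real \<Rightarrow> 'a \<Rightarrow> 'b::{real_normed_vector, second_countable_topology}"
  assumes Z: "Z \<in> CF M W T" and e: "e > 0"
  shows "\<exists>d>0. \<forall>s\<in>{0..T}. \<forall>t\<in>{0..T}. \<bar>s - t\<bar> < d \<longrightarrow> msq M (\<lambda>\<omega>. Z s \<omega> - Z t \<omega>) \<le> ennreal e"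
proof (rule ccontr)
  assume neg: "\<not> ?thesis"
  have "\<forall>n::nat. \<exists>p. fst p \<in> {0..T} \<and> snd p \<in> {0..T} \<and> \<bar>fst p - snd p\<bar> < 1 / real (Suc n) \<and> \<not> msq M (\<lambda>\<omega>. Z (fst p) \<omega> - Z (snd p) \<omega>) \<le> ennreal e"
  proof
    fix n :: nat
    have "1 / real (Suc n) > 0" by simp
    with neg obtain s t where "s \<in> {0..T}" "t \<in> {0..T}" "\<bar>s - t\<bar> < 1 / real (Suc n)" "\<not> msq M (\<lambda>\<omega>. Z s \<omega> - Z t \<omega>) \<le> ennreal e"
      by blast
    then show "\<exists>p. fst p \<in> {0..T} \<and> snd p \<in> {0..T} \<and> \<bar>fst p - snd p\<bar> < 1 / real (Suc n) \<and> \<not> msq M (\<lambda>\<omega>. Z (fst p) \<omega> - Z (snd p) \<omega>) \<le> ennreal e"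
      by (intro exI[of _ "(s, t)"]) simp
  qed
  from choice[OF this] obtain p where p: "\<And>n. fst (p n) \<in> {0..T}" "\<And>n. snd (p n) \<in> {0..T}"
      "\<And>n. \<bar>fst (p n) - snd (p n)\<bar> < 1 / real (Suc n)" "\<And>n. \<not> msq M (\<lambda>\<omega>. Z (fst (p n)) \<omega> - Z (snd (p n)) \<omega>) \<le> ennreal e"
    by blast
  obtain t r where tr: "t \<in> {0..T}" "strict_mono (r :: nat \<Rightarrow> nat)" and u: "(\<lambda>n. fst (p (r n))) \<longlonglongrightarrow> t"
    using Icc_subsequence[of "\<lambda>n. fst (p n)", OF p(1)] by blast
  have "(\<lambda>n. fst (p (r n)) - snd (p (r n))) \<longlonglongrightarrow> 0"
  proof (rule tendsto_rabs_zero_cancel, rule tendsto_sandwich[OF _ _ tendsto_const])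
    show "(\<lambda>n. 1 / real (Suc n)) \<longlonglongrightarrow> 0" by (rule lim_1_over_n[THEN LIMSEQ_Suc])
    show "eventually (\<lambda>n. \<bar>fst (p (r n)) - snd (p (r n))\<bar> \<le> 1 / real (Suc n)) sequentially"
    proof (intro always_eventually allI)
      fix n
      have "1 / real (Suc (r n)) \<le> 1 / real (Suc n)"
        using seq_suble[OF tr(2), of n] by (intro divide_left_mono) auto
      then show "\<bar>fst (p (r n)) - snd (p (r n))\<bar> \<le> 1 / real (Suc n)" using p(3)[of "r n"] by linarith
    qed
  qed auto
  from tendsto_diff[OF u this] have v: "(\<lambda>n. snd (p (r n))) \<longlonglongrightarrow> t" by simp
  have "(\<lambda>n. 2 * msq M (\<lambda>\<omega>. Z (fst (p (r n))) \<omega> - Z t \<omega>) + 2 * msq M (\<lambda>\<omega>. Z (snd (p (r n))) \<omega> - Z t \<omega>)) \<longlonglongrightarrow> 2 * 0 + 2 * 0"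
    by (intro tendsto_add tendsto_mult_ennreal tendsto_const CF_sequence[OF Z u] CF_sequence[OF Z v] p) auto
  then have "(\<lambda>n. 2 * msq M (\<lambda>\<omega>. Z (fst (p (r n))) \<omega> - Z t \<omega>) + 2 * msq M (\<lambda>\<omega>. Z (snd (p (r n))) \<omega> - Z t \<omega>)) \<longlonglongrightarrow> 0"
    by simp
  from eventually_happens'[OF sequentially_bot ennreal_tendsto_0D[OF this e]]
  obtain n where n: "2 * msq M (\<lambda>\<omega>. Z (fst (p (r n))) \<omega> - Z t \<omega>) + 2 * msq M (\<lambda>\<omega>. Z (snd (p (r n))) \<omega> - Z t \<omega>) < ennreal e"
    by blast
  have "msq M (\<lambda>\<omega>. Z (fst (p (r n))) \<omega> - Z (snd (p (r n))) \<omega>) \<le> 2 * msq M (\<lambda>\<omega>. Z (fst (p (r n))) \<omega> - Z t \<omega>) + 2 * msq M (\<lambda>\<omega>. Z t \<omega> - Z (snd (p (r n))) \<omega>)"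
    by (intro msq_triangle CF_D(4)[OF Z] p tr)
  also have "\<dots> \<le> ennreal e" using n unfolding msq_minus_commute[of M "Z t"] by simp
  finally show False using p(4)[of "r n"] by simp
qed

lemma CF_bounded:
  fixes Z :: "real \<Rightarrow> 'a \<Rightarrow> 'b::{real_normed_vector, second_countable_topology}"
  assumes Z: "Z \<in> CF M W T"
  shows "\<exists>B. \<forall>t\<in>{0..T}. msq M (Z t) \<le> ennreal B"
proof (rule ccontr)
  assume neg: "\<not> ?thesis"
  then have "\<forall>n::nat. \<exists>t. t \<in> {0..T} \<and> \<not> msq M (Z t) \<le> ennreal (real n)" by blast
  from choice[OF this] obtain u where u: "\<And>n. u n \<in> {0..T}" "\<And>n. \<not> msq M (Z (u n)) \<le> ennreal (real n)" by blast
  obtain t r where tr: "t \<in> {0..T}" "strict_mono (r :: nat \<Rightarrow> nat)" and v: "(\<lambda>n. u (r n)) \<longlonglongrightarrow> t"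
    using Icc_subsequence[of u, OF u(1)] by blast
  have "(0::real) < 1" by simp
  from ennreal_tendsto_0D[OF CF_sequence[OF Z v u(1)] this]
  have ev: "eventually (\<lambda>n. msq M (\<lambda>\<omega>. Z (u (r n)) \<omega> - Z t \<omega>) < 1) sequentially" by simp
  define B where "B = enn2real (2 + 2 * msq M (Z t))"
  have B: "2 + 2 * msq M (Z t) = ennreal B"
    unfolding B_def using CF_D(2)[OF Z tr(1)] by (simp add: less_top[symmetric] ennreal_mult_eq_top_iff)
  obtain N :: nat where N: "B \<le> real N" using real_arch_simple by blast
  from eventually_conj[OF ev eventually_ge_at_top[of N]]
  obtain n where n: "msq M (\<lambda>\<omega>. Z (u (r n)) \<omega> - Z t \<omega>) < 1" "N \<le> n"
    using eventually_happens'[OF sequentially_bot] by blast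
  have "msq M (Z (u (r n))) = msq M (\<lambda>\<omega>. (Z (u (r n)) \<omega> - Z t \<omega>) + Z t \<omega>)" by simp
  also have "\<dots> \<le> 2 * msq M (\<lambda>\<omega>. Z (u (r n)) \<omega> - Z t \<omega>) + 2 * msq M (Z t)"
    by (intro msq_add_le borel_measurable_diff CF_D(4)[OF Z] u tr)
  also have "\<dots> \<le> 2 * 1 + 2 * msq M (Z t)" using n(1) by (intro add_mono mult_left_mono) auto
  also have "\<dots> = ennreal B" using B by simp
  also have "\<dots> \<le> ennreal (real (r n))" using N n(2) seq_suble[OF tr(2), of n] by (intro ennreal_leI) linarith
  finally show False using u(2) by blast
qed

lemma CF_L2F:
  fixes Z :: "real \<Rightarrow> 'a \<Rightarrow> 'b::{real_normed_vector, second_countable_topology}"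
  assumes Z: "Z \<in> CF M W T" and m: "measurable_process M T Z" and T: "0 \<le> T"
  shows "Z \<in> L2F M W T"
proof (rule L2F_I[OF m])
  show "adapted_process M W T Z" using CF_D(1)[OF Z] .
  obtain B where B: "\<And>t. t \<in> {0..T} \<Longrightarrow> msq M (Z t) \<le> ennreal B" using CF_bounded[OF Z] by blast
  have "psq (cut T Z) \<le> (\<integral>\<^sup>+s. ennreal B * indicator {0..T} s \<partial>lborel)"
    unfolding psq_cut_time[OF pmeas_cut[OF m order_refl]] using B
    by (intro nn_integral_mono) (auto simp: indicator_def)
  also have "\<dots> < \<infinity>" using T by (subst nn_integral_cmult_indicator) (auto simp: ennreal_mult_less_top)
  finally show "psq (cut T Z) < \<infinity>" .
qed

lemma CF_modify:
  fixes Z Z' :: "real \<Rightarrow> 'a \<Rightarrow> 'b::{real_normed_vector, second_countable_topology}"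
  assumes Z: "Z \<in> CF M W T" and a: "adapted_process M W T Z'" and eq: "\<And>t. t \<in> {0..T} \<Longrightarrow> AE \<omega> in M. Z' t \<omega> = Z t \<omega>"
  shows "Z' \<in> CF M W T"
proof -
  have 1: "msq M (Z' t) = msq M (Z t)" if "t \<in> {0..T}" for t
    using eq[OF that] by (intro msq_cong_AE) auto
  have 2: "msq M (\<lambda>\<omega>. Z' s \<omega> - Z' t \<omega>) = msq M (\<lambda>\<omega>. Z s \<omega> - Z t \<omega>)" if "s \<in> {0..T}" "t \<in> {0..T}" for s t
    using eq[OF that(1)] eq[OF that(2)] by (intro msq_cong_AE) auto
  have "((\<lambda>s. msq M (\<lambda>\<omega>. Z' s \<omega> - Z' t \<omega>)) \<longlongrightarrow> 0) (at t within {0..T})" if "t \<in> {0..T}" for t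
    using CF_D(3)[OF Z that]
    by (rule Lim_transform_within[where d = 1]) (use that 2 in auto)
  then show ?thesis using a 1 CF_D(2)[OF Z] unfolding CF_def msq_def by auto
qed

lemma CF_add:
  fixes Y Z :: "real \<Rightarrow> 'a \<Rightarrow> 'b::{real_normed_vector, second_countable_topology}"
  assumes Y: "Y \<in> CF M W T" and Z: "Z \<in> CF M W T"
  shows "(\<lambda>t \<omega>. Y t \<omega> + Z t \<omega>) \<in> CF M W T"
proof -
  have "adapted_process M W T (\<lambda>t \<omega>. Y t \<omega> + Z t \<omega>)"
    using CF_D(1)[OF Y] CF_D(1)[OF Z] unfolding adapted_process_def by (blast intro: borel_measurable_add)
  moreover have "msq M (\<lambda>\<omega>. Y t \<omega> + Z t \<omega>) < \<infinity>" if t: "t \<in> {0..T}" for t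
  proof -
    have "msq M (\<lambda>\<omega>. Y t \<omega> + Z t \<omega>) \<le> 2 * msq M (Y t) + 2 * msq M (Z t)"
      by (intro msq_add_le CF_D(4)[OF Y t] CF_D(4)[OF Z t])
    also have "\<dots> < \<infinity>" using CF_D(2)[OF Y t] CF_D(2)[OF Z t] by (auto simp: ennreal_mult_less_top)
    finally show ?thesis .
  qed
  moreover have "((\<lambda>s. msq M (\<lambda>\<omega>. (Y s \<omega> + Z s \<omega>) - (Y t \<omega> + Z t \<omega>))) \<longlongrightarrow> 0) (at t within {0..T})" if t: "t \<in> {0..T}" for t
  proof -
    have le: "msq M (\<lambda>\<omega>. (Y s \<omega> + Z s \<omega>) - (Y t \<omega> + Z t \<omega>)) \<le> 2 * msq M (\<lambda>\<omega>. Y s \<omega> - Y t \<omega>) + 2 * msq M (\<lambda>\<omega>. Z s \<omega> - Z t \<omega>)"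
      if s: "s \<in> {0..T}" for s
    proof -
      have "(\<lambda>\<omega>. (Y s \<omega> + Z s \<omega>) - (Y t \<omega> + Z t \<omega>)) = (\<lambda>\<omega>. (Y s \<omega> - Y t \<omega>) + (Z s \<omega> - Z t \<omega>))"
        by (simp add: fun_eq_iff)
      then show ?thesis
        by (simp only:) (intro msq_add_le borel_measurable_diff CF_D(4)[OF Y] CF_D(4)[OF Z] s t)
    qed
    have "((\<lambda>s. 2 * msq M (\<lambda>\<omega>. Y s \<omega> - Y t \<omega>) + 2 * msq M (\<lambda>\<omega>. Z s \<omega> - Z t \<omega>)) \<longlongrightarrow> 2 * 0 + 2 * 0) (at t within {0..T})"
      by (intro tendsto_add tendsto_mult_ennreal tendsto_const CF_D(3)[OF Y t] CF_D(3)[OF Z t]) auto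
    then have lim: "((\<lambda>s. 2 * msq M (\<lambda>\<omega>. Y s \<omega> - Y t \<omega>) + 2 * msq M (\<lambda>\<omega>. Z s \<omega> - Z t \<omega>)) \<longlongrightarrow> 0) (at t within {0..T})"
      by simp
    show ?thesis
      by (rule tendsto_sandwich[OF _ _ tendsto_const lim]) (use le in \<open>auto simp: eventually_at_filter\<close>)
  qed
  ultimately show ?thesis unfolding CF_def msq_def by auto
qed

text \<open>Sample \<open>Z\<close> at the last point of a grid of mesh \<open>1 / n k\<close>. Each sampled process is jointly measurable, as a
  countable patchwork, and adapted, as it looks only at the past. By uniform mean square continuity the
  meshes can be chosen such that the sampled processes converge fast, hence almost surely at each time.\<close>

theorem CF_measurable_modification:
  fixes Z :: "real \<Rightarrow> 'a \<Rightarrow> 'b::{banach, second_countable_topology}"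
  assumes Z: "Z \<in> CF M W T"
  shows "\<exists>Z'. Z' \<in> CF M W T \<and> measurable_process M T Z' \<and> (\<forall>t\<in>{0..T}. AE \<omega> in M. Z' t \<omega> = Z t \<omega>)"
proof -
  have "\<forall>k::nat. \<exists>n::nat. n > 0 \<and> (\<forall>s\<in>{0..T}. \<forall>t\<in>{0..T}. \<bar>s - t\<bar> \<le> 1 / real n \<longrightarrow> msq M (\<lambda>\<omega>. Z s \<omega> - Z t \<omega>) \<le> ennreal ((1/4)^k))"
  proof
    fix k :: nat
    have "(0::real) < (1/4)^k" by simp
    from CF_uniform[OF Z this] obtain d where d: "d > 0"
      "\<And>s t. s \<in> {0..T} \<Longrightarrow> t \<in> {0..T} \<Longrightarrow> \<bar>s - t\<bar> < d \<Longrightarrow> msq M (\<lambda>\<omega>. Z s \<omega> - Z t \<omega>) \<le> ennreal ((1/4)^k)" by blast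
    obtain n :: nat where "n > 0" "1 / real n < d" using ex_inverse_of_nat_less[OF d(1)] by (auto simp: inverse_eq_divide)
    with d(2) show "\<exists>n::nat. n > 0 \<and> (\<forall>s\<in>{0..T}. \<forall>t\<in>{0..T}. \<bar>s - t\<bar> \<le> 1 / real n \<longrightarrow> msq M (\<lambda>\<omega>. Z s \<omega> - Z t \<omega>) \<le> ennreal ((1/4)^k))"
      by (intro exI[of _ n]) auto
  qed
  from choice[OF this] obtain n where n: "\<And>k. n k > 0"
    "\<And>k s t. s \<in> {0..T} \<Longrightarrow> t \<in> {0..T} \<Longrightarrow> \<bar>s - t\<bar> \<le> 1 / real (n k) \<Longrightarrow> msq M (\<lambda>\<omega>. Z s \<omega> - Z t \<omega>) \<le> ennreal ((1/4)^k)" by blast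
  define g where "g k t = real_of_int \<lfloor>t * real (n k)\<rfloor> / real (n k)" for k t
  have g: "g k t \<in> {0..T}" "g k t \<le> t" "\<bar>g k t - t\<bar> \<le> 1 / real (n k)" if "t \<in> {0..T}" for k t
  proof -
    have "real_of_int \<lfloor>t * real (n k)\<rfloor> \<le> t * real (n k)" by simp
    then show 1: "g k t \<le> t" unfolding g_def using n(1)[of k] by (simp add: pos_divide_le_eq)
    have "0 \<le> g k t" unfolding g_def using that by auto
    with 1 that show "g k t \<in> {0..T}" by auto
    have "t * real (n k) - 1 \<le> real_of_int \<lfloor>t * real (n k)\<rfloor>" by linarith
    then have "(t * real (n k) - 1) / real (n k) \<le> g k t" unfolding g_def by (intro divide_right_mono) auto
    moreover have "(t * real (n k) - 1) / real (n k) = t - 1 / real (n k)" using n(1)[of k] by (simp add: field_simps)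
    ultimately show "\<bar>g k t - t\<bar> \<le> 1 / real (n k)" using 1 by linarith
  qed
  define Zk where "Zk k t \<omega> = Z (g k t) \<omega>" for k t \<omega>
  define Z' where "Z' t \<omega> = lim (\<lambda>k. Zk k t \<omega>)" for t \<omega>
  have ZkF: "Zk k t \<in> borel_measurable (F t)" if t: "t \<in> {0..T}" for k t
  proof -
    have "Z (g k t) \<in> borel_measurable (F (g k t))" using CF_D(1)[OF Z] g[OF t] by (auto simp: adapted_process_def)
    then show ?thesis unfolding Zk_def using measurable_F_mono g(2)[OF t] by blast
  qed
  have adapted: "adapted_process M W T Z'"
    unfolding adapted_process_def Z'_def[abs_def] by (auto intro!: borel_measurable_lim_metric ZkF)
  have eq: "AE \<omega> in M. Z' t \<omega> = Z t \<omega>" if t: "t \<in> {0..T}" for t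
  proof -
    have "AE \<omega> in M. (\<lambda>k. Zk k t \<omega>) \<longlonglongrightarrow> Z t \<omega>"
      using ZkF[OF t] CF_D(4)[OF Z t] n(2)[OF g(1)[OF t] t g(3)[OF t]] unfolding Zk_def
      by (intro msq_limit_adapted(1)[where c = 1 and t = t]) auto
    then show ?thesis unfolding Z'_def by eventually_elim (rule limI)
  qed
  have "measurable_process M T Z'"
  proof (rule measurable_processI)
    \<comment> \<open>The last grid point is in \<open>{0..T}\<close> for \<open>t\<close> in \<open>{0..T}\<close>; the default value 0 makes the patchwork total.\<close>
    define Zm where "Zm k t \<omega> = (if g k t \<in> {0..T} then Z (g k t) \<omega> else 0)" for k t \<omega>
    define G where "G t \<omega> = lim (\<lambda>k. Zm k t \<omega>)" for t \<omega>
    have "(\<lambda>z. Zm k (fst z) (snd z)) \<in> borel_measurable (lborel \<Otimes>\<^sub>M M)" for k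
    proof -
      define f where "f j z = (if real_of_int j / real (n k) \<in> {0..T} then Z (real_of_int j / real (n k)) (snd z) else 0)" for j :: int and z :: "real \<times> 'a"
      have f: "f j \<in> borel_measurable (lborel \<Otimes>\<^sub>M M)" for j
      proof (cases "real_of_int j / real (n k) \<in> {0..T}")
        case True
        have [measurable]: "Z (real_of_int j / real (n k)) \<in> borel_measurable M" by (rule CF_D(4)[OF Z True])
        have "f j = (\<lambda>z. Z (real_of_int j / real (n k)) (snd z))" using True by (auto simp: f_def)
        then show ?thesis by simp
      next
        case False
        then have "f j = (\<lambda>_. 0)" unfolding f_def by (simp only: if_False)
        then show ?thesis by simp
      qed
      have "(\<lambda>z. f \<lfloor>fst z * real (n k)\<rfloor> z) \<in> borel_measurable (lborel \<Otimes>\<^sub>M M)"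
        by (rule measurable_compose_countable[OF f]) measurable
      then show ?thesis unfolding f_def Zm_def g_def .
    qed
    then show "(\<lambda>z. G (fst z) (snd z)) \<in> borel_measurable (lborel \<Otimes>\<^sub>M M)"
      unfolding G_def by (rule borel_measurable_lim_metric)
    show "G t \<omega> = Z' t \<omega>" if "t \<in> {0..T}" for t \<omega>
      using g(1)[OF that] by (simp add: G_def Z'_def Zm_def Zk_def)
  qed
  with CF_modify[OF Z adapted eq] eq show ?thesis by blast
qed

end

section \<open>The Volterra operator\<close>

locale volterra = brownian_setting M W for M :: "'a measure" and W :: "real \<Rightarrow> 'a \<Rightarrow> real" +
  fixes T :: real and A0 :: "real \<Rightarrow> real \<Rightarrow> 'a \<Rightarrow> real^'n^'n" and A1 :: "real \<Rightarrow> 'a \<Rightarrow> real^'n^'n"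
  assumes T_pos: "0 < T" and adm: "admissible_coefficients M W T A0 A1"
begin

lemma coefficients_bounded:
  "\<exists>K\<ge>0. (\<forall>t s \<omega>. 0 \<le> s \<longrightarrow> s \<le> t \<longrightarrow> t \<le> T \<longrightarrow> \<omega> \<in> space M \<longrightarrow> norm (A0 t s \<omega>) \<le> K) \<and>
    (\<forall>s\<in>{0..T}. \<forall>\<omega>\<in>space M. norm (A1 s \<omega>) \<le> K)"
proof -
  obtain K0 where K0: "\<forall>(t, s)\<in>Delta_star T. \<forall>\<omega>\<in>space M. norm (A0 t s \<omega>) \<le> K0"
    using adm unfolding admissible_coefficients_def by blast
  obtain K1 where K1: "\<forall>s\<in>{0..T}. \<forall>\<omega>\<in>space M. norm (A1 s \<omega>) \<le> K1"
    using adm unfolding admissible_coefficients_def by blast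
  show ?thesis
  proof (intro exI[of _ "max 0 (max K0 K1)"] conjI allI impI ballI)
    fix t s \<omega> assume "0 \<le> s" "s \<le> t" "t \<le> T" "\<omega> \<in> space M"
    then have "(t, s) \<in> Delta_star T" by (auto simp: Delta_star_def)
    with K0 \<open>\<omega> \<in> space M\<close> have "norm (A0 t s \<omega>) \<le> K0" by fastforce
    then show "norm (A0 t s \<omega>) \<le> max 0 (max K0 K1)" by simp
  next
    fix s \<omega> assume "s \<in> {0..T}" "\<omega> \<in> space M"
    then show "norm (A1 s \<omega>) \<le> max 0 (max K0 K1)" using K1 by (simp add: le_max_iff_disj)
  qed simp
qed

definition K :: real where
  "K = (SOME K. K \<ge> 0 \<and> (\<forall>t s \<omega>. 0 \<le> s \<longrightarrow> s \<le> t \<longrightarrow> t \<le> T \<longrightarrow> \<omega> \<in> space M \<longrightarrow> norm (A0 t s \<omega>) \<le> K) \<and>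
    (\<forall>s\<in>{0..T}. \<forall>\<omega>\<in>space M. norm (A1 s \<omega>) \<le> K))"

lemma K_props: "K \<ge> 0 \<and> (\<forall>t s \<omega>. 0 \<le> s \<longrightarrow> s \<le> t \<longrightarrow> t \<le> T \<longrightarrow> \<omega> \<in> space M \<longrightarrow> norm (A0 t s \<omega>) \<le> K) \<and>
    (\<forall>s\<in>{0..T}. \<forall>\<omega>\<in>space M. norm (A1 s \<omega>) \<le> K)"
  unfolding K_def by (rule someI_ex) (rule coefficients_bounded)

lemma K_nonneg: "0 \<le> K" and A0_le: "0 \<le> s \<Longrightarrow> s \<le> t \<Longrightarrow> t \<le> T \<Longrightarrow> \<omega> \<in> space M \<Longrightarrow> norm (A0 t s \<omega>) \<le> K"
  and A1_le: "s \<in> {0..T} \<Longrightarrow> \<omega> \<in> space M \<Longrightarrow> norm (A1 s \<omega>) \<le> K"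
  using K_props by auto

lemma measurable_compose_progressive:
  assumes "t \<in> {0..T}" "s \<in> {0..t}"
  shows "(\<lambda>(r, \<omega>). (A0 t r \<omega>, A1 r \<omega>)) \<in> borel_measurable (restrict_space borel {0..s} \<Otimes>\<^sub>M F s)"
  using adm assms unfolding admissible_coefficients_def progressive_process_def by blast

lemma A0_measurable_process_F: assumes t: "t \<in> {0..T}" shows "measurable_process (F t) t (A0 t)"
proof -
  have "(\<lambda>(r, \<omega>). (A0 t r \<omega>, A1 r \<omega>)) \<in> borel_measurable (restrict_space borel {0..t} \<Otimes>\<^sub>M F t)"
    using t by (intro measurable_compose_progressive) auto
  from measurable_compose[OF this borel_measurable_continuous_onI[OF continuous_on_fst[OF continuous_on_id]]]
  show ?thesis unfolding measurable_process_def by (simp add: split_beta')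
qed

lemma A0_measurable_process: "t \<in> {0..T} \<Longrightarrow> measurable_process M t (A0 t)"
  using A0_measurable_process_F measurable_process_F_M by blast

lemma A1_measurable_process: "measurable_process M T A1"
  using adm by (auto simp: admissible_coefficients_def)

lemma A1_adapted: "adapted_process M W T A1"
  unfolding adapted_process_def
proof
  fix t assume t: "t \<in> {0..T}"
  have "(\<lambda>(r, \<omega>). (A0 t r \<omega>, A1 r \<omega>)) \<in> borel_measurable (restrict_space borel {0..t} \<Otimes>\<^sub>M F t)"
    using t by (intro measurable_compose_progressive) auto
  from measurable_compose[OF this borel_measurable_continuous_onI[OF continuous_on_snd[OF continuous_on_id]]]
  have "(\<lambda>z. A1 (fst z) (snd z)) \<in> borel_measurable (restrict_space borel {0..t} \<Otimes>\<^sub>M F t)" by (simp add: split_beta')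
  from measurable_compose[OF measurable_Pair1'[of t] this] t
  show "A1 t \<in> borel_measurable (F t)" by (simp add: space_restrict_space)
qed

lemma cut_mult: "cut t (\<lambda>s \<omega>. B s \<omega> *v X s \<omega>) = (\<lambda>s \<omega>. cut t B s \<omega> *v cut t X s \<omega>)"
  by (auto simp: cut_def fun_eq_iff indicator_def)

lemma pmeas_mult:
  fixes B :: "real \<Rightarrow> 'a \<Rightarrow> real^'n^'n"
  assumes "pmeas B" "pmeas G" shows "pmeas (\<lambda>s \<omega>. B s \<omega> *v G s \<omega>)"
  using assms unfolding pmeas_def by (rule measurable_matrix_vector)

lemma psq_mult_le:
  fixes B :: "real \<Rightarrow> 'a \<Rightarrow> real^'n^'n"
  assumes B: "\<And>s \<omega>. \<omega> \<in> space M \<Longrightarrow> norm (B s \<omega>) \<le> k" and G: "pmeas G"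
  shows "psq (\<lambda>s \<omega>. B s \<omega> *v G s \<omega>) \<le> ennreal (k\<^sup>2) * psq G"
proof -
  have "psq (\<lambda>s \<omega>. B s \<omega> *v G s \<omega>) \<le> psq (\<lambda>s \<omega>. k *\<^sub>R G s \<omega>)"
  proof (rule psq_mono)
    fix s \<omega> assume w: "\<omega> \<in> space M"
    have "norm (B s \<omega> *v G s \<omega>) \<le> norm (B s \<omega>) * norm (G s \<omega>)" by (rule norm_matrix_vector_le)
    also have "\<dots> \<le> \<bar>k\<bar> * norm (G s \<omega>)" using B[OF w, of s] by (intro mult_right_mono) auto
    finally show "norm (B s \<omega> *v G s \<omega>) \<le> norm (k *\<^sub>R G s \<omega>)" by simp
  qed
  also have "\<dots> = ennreal (k\<^sup>2) * psq G"
    unfolding psq_def using G by (intro msq_cmult) (simp add: pmeas_def)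
  finally show ?thesis .
qed

lemma cut_A0: assumes t: "t \<in> {0..T}" shows "pmeas (cut t (A0 t))" "\<omega> \<in> space M \<Longrightarrow> norm (cut t (A0 t) s \<omega>) \<le> K"
proof -
  show "pmeas (cut t (A0 t))" by (rule pmeas_cut[OF A0_measurable_process[OF t] order_refl])
  show "norm (cut t (A0 t) s \<omega>) \<le> K" if "\<omega> \<in> space M"
    using A0_le[of s t \<omega>] K_nonneg t that by (auto simp: cut_def indicator_def)
qed

lemma cut_A1: assumes t: "t \<le> T" shows "pmeas (cut t A1)" "\<omega> \<in> space M \<Longrightarrow> norm (cut t A1 s \<omega>) \<le> K"
proof -
  show "pmeas (cut t A1)" by (rule pmeas_cut[OF A1_measurable_process t])
  show "norm (cut t A1 s \<omega>) \<le> K" if "\<omega> \<in> space M"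
    using A1_le[of s \<omega>] K_nonneg t that by (auto simp: cut_def indicator_def)
qed

abbreviation drift :: "real \<Rightarrow> (real \<Rightarrow> 'a \<Rightarrow> real^'n) \<Rightarrow> real \<Rightarrow> 'a \<Rightarrow> real^'n" where
  "drift t X \<equiv> cut t (\<lambda>s \<omega>. A0 t s \<omega> *v X s \<omega>)"

abbreviation noise :: "real \<Rightarrow> (real \<Rightarrow> 'a \<Rightarrow> real^'n) \<Rightarrow> real \<Rightarrow> 'a \<Rightarrow> real^'n" where
  "noise t X \<equiv> cut t (\<lambda>s \<omega>. A1 s \<omega> *v X s \<omega>)"

lemma drift_props:
  assumes X: "X \<in> L2F M W T" and t: "t \<in> {0..T}"
  shows "pmeas (drift t X)" "psq (drift t X) \<le> ennreal (K\<^sup>2) * psq (cut t X)" "psq (drift t X) < \<infinity>" "supported T (drift t X)"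
proof -
  have X': "X \<in> L2F M W t" by (rule L2F_mono[OF X]) (use t in auto)
  note XD = L2F_D[OF X']
  show "pmeas (drift t X)" unfolding cut_mult by (intro pmeas_mult cut_A0 XD t)
  show le: "psq (drift t X) \<le> ennreal (K\<^sup>2) * psq (cut t X)"
    unfolding cut_mult by (intro psq_mult_le cut_A0(2)[OF t] XD)
  also have "\<dots> < \<infinity>" using XD(4) by (simp add: ennreal_mult_less_top)
  finally show "psq (drift t X) < \<infinity>" .
  show "supported T (drift t X)" using t by (intro supported_cut) auto
qed

lemma noise_props:
  assumes X: "X \<in> L2F M W T" and t: "t \<le> T"
  shows "pmeas (noise t X)" "psq (noise t X) \<le> ennreal (K\<^sup>2) * psq (cut t X)" "psq (noise t X) < \<infinity>"
    "(\<lambda>s \<omega>. A1 s \<omega> *v X s \<omega>) \<in> L2F M W t"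
proof -
  have X': "X \<in> L2F M W t" by (rule L2F_mono[OF X]) (use t in auto)
  note XD = L2F_D[OF X']
  show p: "pmeas (noise t X)" unfolding cut_mult by (intro pmeas_mult cut_A1 XD t)
  show le: "psq (noise t X) \<le> ennreal (K\<^sup>2) * psq (cut t X)"
    unfolding cut_mult by (intro psq_mult_le cut_A1(2)[OF t] XD)
  also have "\<dots> < \<infinity>" using XD(4) by (simp add: ennreal_mult_less_top)
  finally show fin: "psq (noise t X) < \<infinity>" .
  show "(\<lambda>s \<omega>. A1 s \<omega> *v X s \<omega>) \<in> L2F M W t"
  proof (rule L2F_I[OF _ _ fin])
    show "measurable_process M t (\<lambda>s \<omega>. A1 s \<omega> *v X s \<omega>)"
      by (rule measurable_processI[OF p[unfolded pmeas_def]]) (auto simp: cut_def)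
    show "adapted_process M W t (\<lambda>s \<omega>. A1 s \<omega> *v X s \<omega>)"
      using A1_adapted XD(2) t unfolding adapted_process_def by (auto intro!: measurable_matrix_vector)
  qed
qed

text \<open>The variable \<open>z\<close> is a version of \<open>\<integral>\<^sub>0\<^sup>t A0(t,s) X(s) ds + \<integral>\<^sub>0\<^sup>t A1(s) X(s) dW(s)\<close>; a relation, since the Ito
  integral is determined only up to null sets.\<close>

definition volt :: "(real \<Rightarrow> 'a \<Rightarrow> real^'n) \<Rightarrow> ('a \<Rightarrow> real^'n) \<Rightarrow> real \<Rightarrow> bool" where
  "volt X z t \<longleftrightarrow> (\<exists>I. vec_ito t (\<lambda>s \<omega>. A1 s \<omega> *v X s \<omega>) I \<and> (AE \<omega> in M. z \<omega> = path_int (drift t X) \<omega> + I \<omega>))"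

lemma volterra_eq_at_iff: "volterra_eq_at M W A0 A1 \<phi> X t \<longleftrightarrow> volt X (\<lambda>\<omega>. X t \<omega> - \<phi> t \<omega>) t"
proof -
  have eq: "(LINT s:{0..t}|lborel. A0 t s \<omega> *v X s \<omega>) = path_int (drift t X) \<omega>" for \<omega>
    by (rule set_integral_path_int[where V = "\<lambda>s \<omega>. A0 t s \<omega> *v X s \<omega>"])
  show ?thesis
    unfolding volterra_eq_at_def volt_def vec_ito_def eq by (simp add: diff_eq_eq algebra_simps)
qed

lemma volt_cong_AE: "volt X z t \<Longrightarrow> AE \<omega> in M. z' \<omega> = z \<omega> \<Longrightarrow> volt X z' t"
proof -
  assume "volt X z t" and eq: "AE \<omega> in M. z' \<omega> = z \<omega>"
  then obtain I where I: "vec_ito t (\<lambda>s \<omega>. A1 s \<omega> *v X s \<omega>) I" "AE \<omega> in M. z \<omega> = path_int (drift t X) \<omega> + I \<omega>"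
    unfolding volt_def by blast
  from eq I(2) have "AE \<omega> in M. z' \<omega> = path_int (drift t X) \<omega> + I \<omega>" by eventually_elim simp
  with I(1) show "volt X z' t" unfolding volt_def by blast
qed

text \<open>The two times may differ: with \<open>X = Y\<close> this is the modulus of continuity in time, with \<open>t = t'\<close> the
  Lipschitz estimate in the process.\<close>

lemma volt_dist_general:
  assumes X: "X \<in> L2F M W T" and Y: "Y \<in> L2F M W T" and t: "t \<in> {0..T}" "t' \<in> {0..T}"
    and z: "volt X z t" "volt Y z' t'"
  shows "msq M (\<lambda>\<omega>. z \<omega> - z' \<omega>) \<le> ennreal (2 * T) * psq (\<lambda>s \<omega>. drift t X s \<omega> - drift t' Y s \<omega>)
    + 32 * psq (\<lambda>s \<omega>. noise t X s \<omega> - noise t' Y s \<omega>)"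
proof -
  obtain I where I: "vec_ito t (\<lambda>s \<omega>. A1 s \<omega> *v X s \<omega>) I" "AE \<omega> in M. z \<omega> = path_int (drift t X) \<omega> + I \<omega>"
    using z(1) unfolding volt_def by blast
  obtain I' where I': "vec_ito t' (\<lambda>s \<omega>. A1 s \<omega> *v Y s \<omega>) I'" "AE \<omega> in M. z' \<omega> = path_int (drift t' Y) \<omega> + I' \<omega>"
    using z(2) unfolding volt_def by blast
  note dX = drift_props[OF X t(1)] and dY = drift_props[OF Y t(2)]
  have m: "path_int (drift t X) \<in> borel_measurable M" "path_int (drift t' Y) \<in> borel_measurable M"
    using dX(1) dY(1) unfolding pmeas_def by (auto intro!: path_int_measurable)
  have mI: "I \<in> borel_measurable M" "I' \<in> borel_measurable M"
    using vec_ito_adapted[OF I(1)] vec_ito_adapted[OF I'(1)] t measurable_F_M by auto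
  have "msq M (\<lambda>\<omega>. z \<omega> - z' \<omega>) = msq M (\<lambda>\<omega>. (path_int (drift t X) \<omega> - path_int (drift t' Y) \<omega>) + (I \<omega> - I' \<omega>))"
    using I(2) I'(2) by (intro msq_cong_AE) (auto simp: algebra_simps)
  also have "\<dots> \<le> 2 * msq M (\<lambda>\<omega>. path_int (drift t X) \<omega> - path_int (drift t' Y) \<omega>) + 2 * msq M (\<lambda>\<omega>. I \<omega> - I' \<omega>)"
    using m mI by (intro msq_add_le) auto
  also have "\<dots> \<le> 2 * (ennreal T * psq (\<lambda>s \<omega>. drift t X s \<omega> - drift t' Y s \<omega>)) + 2 * (16 * psq (\<lambda>s \<omega>. noise t X s \<omega> - noise t' Y s \<omega>))"
    using T_pos by (intro add_mono mult_left_mono path_int_dist dX dY vec_ito_lim_dist vec_ito_vec_ito_lim I I') auto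
  also have "\<dots> = ennreal (2 * T) * psq (\<lambda>s \<omega>. drift t X s \<omega> - drift t' Y s \<omega>) + 32 * psq (\<lambda>s \<omega>. noise t X s \<omega> - noise t' Y s \<omega>)"
    using T_pos by (simp add: ennreal_mult mult.assoc[symmetric])
  finally show ?thesis .
qed

text \<open>The Lipschitz constant of \<open>volt_dist\<close>; the summand 1 makes it positive, so that it can be divided by.\<close>

definition C :: real where "C = 2 * T * K\<^sup>2 + 32 * K\<^sup>2 + 1"

lemma C_pos: "C > 0" using T_pos K_nonneg unfolding C_def by (auto intro!: add_nonneg_pos)

lemma volt_dist:
  assumes X: "X \<in> L2F M W T" and Y: "Y \<in> L2F M W T" and t: "t \<in> {0..T}"
    and z: "volt X z t" "volt Y z' t"
  shows "msq M (\<lambda>\<omega>. z \<omega> - z' \<omega>) \<le> ennreal C * psq (\<lambda>s \<omega>. cut t X s \<omega> - cut t Y s \<omega>)"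
proof -
  have XY: "X \<in> L2F M W t" "Y \<in> L2F M W t" using t by (auto intro!: L2F_mono[OF X] L2F_mono[OF Y])
  have p: "pmeas (\<lambda>s \<omega>. cut t X s \<omega> - cut t Y s \<omega>)"
    using L2F_D(3)[OF XY(1)] L2F_D(3)[OF XY(2)] by (simp add: pmeas_def)
  define P where "P = psq (\<lambda>s \<omega>. cut t X s \<omega> - cut t Y s \<omega>)"
  have d: "psq (\<lambda>s \<omega>. drift t X s \<omega> - drift t Y s \<omega>) \<le> ennreal (K\<^sup>2) * P"
    unfolding cut_mult matrix_vector_mult_diff_distrib[symmetric] P_def by (intro psq_mult_le cut_A0(2)[OF t] p)
  have n: "psq (\<lambda>s \<omega>. noise t X s \<omega> - noise t Y s \<omega>) \<le> ennreal (K\<^sup>2) * P"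
    unfolding cut_mult matrix_vector_mult_diff_distrib[symmetric] P_def using t by (intro psq_mult_le cut_A1(2) p) auto
  have "msq M (\<lambda>\<omega>. z \<omega> - z' \<omega>) \<le> ennreal (2 * T) * psq (\<lambda>s \<omega>. drift t X s \<omega> - drift t Y s \<omega>)
    + 32 * psq (\<lambda>s \<omega>. noise t X s \<omega> - noise t Y s \<omega>)"
    by (rule volt_dist_general[OF X Y t t z])
  also have "\<dots> \<le> ennreal (2 * T) * (ennreal (K\<^sup>2) * P) + 32 * (ennreal (K\<^sup>2) * P)"
    by (intro add_mono mult_left_mono d n) auto
  also have "\<dots> = ennreal (2 * T * K\<^sup>2 + 32 * K\<^sup>2) * P"
  proof -
    have "ennreal (2 * T) * (ennreal (K\<^sup>2) * P) = ennreal (2 * T * K\<^sup>2) * P"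
      using T_pos by (simp only: mult.assoc[symmetric] ennreal_mult[symmetric]) (simp add: ennreal_mult)
    moreover have "32 * (ennreal (K\<^sup>2) * P) = ennreal (32 * K\<^sup>2) * P"
      by (simp add: ennreal_mult mult.assoc)
    moreover have "ennreal (2 * T * K\<^sup>2 + 32 * K\<^sup>2) = ennreal (2 * T * K\<^sup>2) + ennreal (32 * K\<^sup>2)"
      using T_pos by (intro ennreal_plus) auto
    ultimately show ?thesis by (simp only: distrib_right)
  qed
  also have "\<dots> \<le> ennreal C * P"
    by (intro mult_right_mono ennreal_leI) (auto simp: C_def)
  finally show ?thesis unfolding P_def .
qed

text \<open>The process \<open>X\<close> is adapted and jointly measurable, but not necessarily progressively measurable, so its path
  integral is not obviously adapted. Elementary approximations of \<open>X\<close> are jointly measurable with respect to \<open>F t\<close>, and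
  the resulting adapted integrals converge fast in mean square.\<close>

lemma drift_adapted:
  assumes X: "X \<in> L2F M W T" and t: "t \<in> {0..T}"
  shows "path_int (drift t X) \<in> borel_measurable (F t)"
proof -
  have t0: "0 \<le> t" using t by simp
  have X': "X \<in> L2F M W t" by (rule L2F_mono[OF X]) (use t in auto)
  note XD = L2F_D[OF X']
  have dens: "\<forall>k::nat. \<exists>G. pmeas G \<and> supported t G \<and> (\<lambda>z. G (fst z) (snd z)) \<in> borel_measurable (lborel \<Otimes>\<^sub>M F t) \<and>
    psq (\<lambda>s \<omega>. G s \<omega> - cut t X s \<omega>) \<le> ennreal ((1/4)^k)"
  proof
    fix k :: nat
    have "(0::real) < (1/4)^k" by simp
    from elementary_dense[OF X' t0 this] obtain \<theta> h m \<xi> where *: "0 \<le> \<theta>" "0 < h" "\<theta> + real m * h \<le> t"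
      "\<And>i. i < m \<Longrightarrow> \<xi> i \<in> borel_measurable (F (\<theta> + real i * h))"
      "psq (\<lambda>s \<omega>. cut t X s \<omega> - grid_process \<theta> h m \<xi> s \<omega>) \<le> ennreal ((1/4)^k)" by blast
    have \<xi>: "\<xi> i \<in> borel_measurable (F t)" if "i < m" for i
    proof -
      have "real i * h \<le> real m * h" using that *(2) by (intro mult_right_mono) auto
      then have "\<theta> + real i * h \<le> t" using *(3) by linarith
      then show ?thesis using *(4)[OF that] measurable_F_mono by blast
    qed
    show "\<exists>G. pmeas G \<and> supported t G \<and> (\<lambda>z. G (fst z) (snd z)) \<in> borel_measurable (lborel \<Otimes>\<^sub>M F t) \<and>
      psq (\<lambda>s \<omega>. G s \<omega> - cut t X s \<omega>) \<le> ennreal ((1/4)^k)"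
    proof (intro exI[of _ "grid_process \<theta> h m \<xi>"] conjI)
      show "pmeas (grid_process \<theta> h m \<xi>)" using \<xi> by (intro pmeas_grid_process) (auto intro: measurable_F_M)
      show "(\<lambda>z. grid_process \<theta> h m \<xi> (fst z) (snd z)) \<in> borel_measurable (lborel \<Otimes>\<^sub>M F t)"
        unfolding grid_process_def
      proof (rule borel_measurable_sum)
        fix i assume "i \<in> {..<m}"
        then have [measurable]: "\<xi> i \<in> borel_measurable (F t)" using \<xi> by simp
        show "(\<lambda>z. indicator {\<theta> + real i * h<..\<theta> + real (Suc i) * h} (fst z) *\<^sub>R \<xi> i (snd z)) \<in> borel_measurable (lborel \<Otimes>\<^sub>M F t)"
          by measurable
      qed
      show "psq (\<lambda>s \<omega>. grid_process \<theta> h m \<xi> s \<omega> - cut t X s \<omega>) \<le> ennreal ((1/4)^k)"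
        using *(5) unfolding psq_minus_commute[of "cut t X"] .
      show "supported t (grid_process \<theta> h m \<xi>)"
        unfolding supported_def grid_process_def
      proof (intro allI impI sum.neutral ballI)
        fix s \<omega> i assume s: "s \<notin> {0..t}" and "i \<in> {..<m}"
        then have "real (Suc i) * h \<le> real m * h" using *(2) by (intro mult_right_mono) auto
        moreover have "0 \<le> real i * h" using *(2) by simp
        ultimately have "{\<theta> + real i * h<..\<theta> + real (Suc i) * h} \<subseteq> {0..t}" using *(1,3) by auto
        then show "indicator {\<theta> + real i * h<..\<theta> + real (Suc i) * h} s *\<^sub>R \<xi> i \<omega> = 0"
          using s by (subst indicator_simps(2)) (blast, rule scaleR_zero_left)
      qed
    qed
  qed
  from choice[OF dens] obtain G where G: "\<And>k. pmeas (G k)" "\<And>k. supported t (G k)"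
    "\<And>k. (\<lambda>z. G k (fst z) (snd z)) \<in> borel_measurable (lborel \<Otimes>\<^sub>M F t)"
    "\<And>k::nat. psq (\<lambda>s \<omega>. G k s \<omega> - cut t X s \<omega>) \<le> ennreal ((1/4)^k)" by blast
  define D where "D k s \<omega> = cut t (A0 t) s \<omega> *v G k s \<omega>" for k s \<omega>
  have DF: "path_int (D k) \<in> borel_measurable (F t)" for k
  proof (rule path_int_measurable)
    have [measurable]: "(\<lambda>z. cut t (A0 t) (fst z) (snd z)) \<in> borel_measurable (lborel \<Otimes>\<^sub>M F t)"
      unfolding cut_def by (rule measurable_process_cut[OF A0_measurable_process_F[OF t] order_refl])
    show "(\<lambda>z. D k (fst z) (snd z)) \<in> borel_measurable (lborel \<Otimes>\<^sub>M F t)"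
      unfolding D_def using G(3) by measurable
  qed
  note dX = drift_props[OF X t]
  have Dp: "pmeas (D k)" for k unfolding D_def by (intro pmeas_mult cut_A0 t G)
  have Ds: "supported T (D k)" for k using t by (auto simp: supported_def D_def cut_def indicator_def)
  have Dd: "psq (\<lambda>s \<omega>. D k s \<omega> - drift t X s \<omega>) \<le> ennreal (K\<^sup>2 * (1/4)^k)" for k
  proof -
    have "psq (\<lambda>s \<omega>. D k s \<omega> - drift t X s \<omega>) \<le> ennreal (K\<^sup>2) * psq (\<lambda>s \<omega>. G k s \<omega> - cut t X s \<omega>)"
      unfolding D_def cut_mult matrix_vector_mult_diff_distrib[symmetric]
      using G(1)[of k] XD(3) by (intro psq_mult_le cut_A0(2)[OF t]) (auto simp: pmeas_def)
    also have "\<dots> \<le> ennreal (K\<^sup>2) * ennreal ((1/4)^k)" by (intro mult_left_mono G) auto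
    also have "\<dots> = ennreal (K\<^sup>2 * (1/4)^k)" by (simp add: ennreal_mult)
    finally show ?thesis .
  qed
  have Dfin: "psq (D k) < \<infinity>" for k
  proof -
    have "psq (D k) = psq (\<lambda>s \<omega>. (D k s \<omega> - drift t X s \<omega>) + drift t X s \<omega>)" by simp
    also have "\<dots> \<le> 2 * psq (\<lambda>s \<omega>. D k s \<omega> - drift t X s \<omega>) + 2 * psq (drift t X)"
      unfolding psq_def using Dp[of k] dX(1) unfolding pmeas_def by (intro msq_add_le) auto
    also have "\<dots> < \<infinity>" using Dd[of k] dX(3) by (auto simp: ennreal_mult_less_top intro: le_less_trans)
    finally show ?thesis .
  qed
  show ?thesis
  proof (rule msq_limit_adapted(2)[OF DF])
    show "path_int (drift t X) \<in> borel_measurable M" using dX(1) unfolding pmeas_def by (rule path_int_measurable)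
    show "0 \<le> T * K\<^sup>2" using T_pos by simp
    fix k
    have "msq M (\<lambda>\<omega>. path_int (D k) \<omega> - path_int (drift t X) \<omega>) \<le> ennreal T * psq (\<lambda>s \<omega>. D k s \<omega> - drift t X s \<omega>)"
      using T_pos by (intro path_int_dist Dp Dfin Ds dX) auto
    also have "\<dots> \<le> ennreal T * ennreal (K\<^sup>2 * (1/4)^k)" by (intro mult_left_mono Dd) auto
    also have "\<dots> = ennreal (T * K\<^sup>2 * (1/4)^k)" using T_pos by (simp add: ennreal_mult mult.assoc)
    finally show "msq M (\<lambda>\<omega>. path_int (D k) \<omega> - path_int (drift t X) \<omega>) \<le> ennreal (T * K\<^sup>2 * (1/4)^k)" .
  qed
qed

lemma volt_exists:
  assumes X: "X \<in> L2F M W T" and t: "t \<in> {0..T}"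
  shows "\<exists>z. volt X z t \<and> z \<in> borel_measurable (F t)"
proof -
  have t': "0 \<le> t" "t \<le> T" using t by auto
  obtain I where I: "vec_ito t (\<lambda>s \<omega>. A1 s \<omega> *v X s \<omega>) I"
    using vec_ito_exists[OF noise_props(4)[OF X t'(2)] t'(1)] by blast
  show ?thesis
  proof (intro exI conjI)
    show "volt X (\<lambda>\<omega>. path_int (drift t X) \<omega> + I \<omega>) t" unfolding volt_def using I by auto
    show "(\<lambda>\<omega>. path_int (drift t X) \<omega> + I \<omega>) \<in> borel_measurable (F t)"
      by (intro borel_measurable_add drift_adapted[OF X t] vec_ito_adapted[OF I t'(1)])
  qed
qed

lemma volt_measurable: assumes X: "X \<in> L2F M W T" and t: "t \<in> {0..T}" and z: "volt X z t"
  shows "z \<in> borel_measurable (F t)"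
proof -
  have t': "0 \<le> t" "t \<le> T" using t by auto
  obtain I where I: "vec_ito t (\<lambda>s \<omega>. A1 s \<omega> *v X s \<omega>) I" "AE \<omega> in M. z \<omega> = path_int (drift t X) \<omega> + I \<omega>"
    using z unfolding volt_def by blast
  have "(\<lambda>\<omega>. path_int (drift t X) \<omega> + I \<omega>) \<in> borel_measurable (F t)"
    by (intro borel_measurable_add drift_adapted[OF X t] vec_ito_adapted[OF I(1) t'(1)])
  moreover have "AE \<omega> in M. path_int (drift t X) \<omega> + I \<omega> = z \<omega>" using I(2) by eventually_elim simp
  ultimately show ?thesis by (rule borel_measurable_F_AE_cong)
qed

text \<open>The exceptional time \<open>t\<close> is a null set; it is the end point of the integration interval, where the
  kernel, extended by 0, may jump.\<close>

lemma psq_dominated_tendsto: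
  fixes G :: "nat \<Rightarrow> real \<Rightarrow> 'a \<Rightarrow> 'b::{real_normed_vector, second_countable_topology}"
  assumes G: "\<And>n. pmeas (G n)" and D: "pmeas D" "psq D < \<infinity>"
    and le: "\<And>n s \<omega>. \<omega> \<in> space M \<Longrightarrow> norm (G n s \<omega>) \<le> norm (D s \<omega>)"
    and lim: "\<And>s \<omega>. \<omega> \<in> space M \<Longrightarrow> s \<noteq> t \<Longrightarrow> (\<lambda>n. G n s \<omega>) \<longlonglongrightarrow> 0"
  shows "(\<lambda>n. psq (G n)) \<longlonglongrightarrow> 0"
proof -
  have [measurable]: "(\<lambda>z. G n (fst z) (snd z)) \<in> borel_measurable (lborel \<Otimes>\<^sub>M M)" "(\<lambda>z. D (fst z) (snd z)) \<in> borel_measurable (lborel \<Otimes>\<^sub>M M)" for n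
    using G D by (auto simp: pmeas_def)
  have ne: "AE z in (lborel :: real measure) \<Otimes>\<^sub>M M. fst z \<noteq> t"
  proof (rule lM.AE_pair_measure)
    show "{z \<in> space (lborel \<Otimes>\<^sub>M M). fst z \<noteq> t} \<in> sets (lborel \<Otimes>\<^sub>M M)" by measurable
    have "AE s in (lborel :: real measure). s \<noteq> t" by (rule AE_lborel_singleton)
    then show "AE x in (lborel :: real measure). AE y in M. fst (x, y) \<noteq> t" by eventually_elim simp
  qed
  have "(\<lambda>n. \<integral>\<^sup>+z. ennreal ((norm (G n (fst z) (snd z)))\<^sup>2) \<partial>(lborel \<Otimes>\<^sub>M M)) \<longlonglongrightarrow> (\<integral>\<^sup>+z. 0 \<partial>((lborel :: real measure) \<Otimes>\<^sub>M M))"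
  proof (rule nn_integral_dominated_convergence[where w = "\<lambda>z. ennreal ((norm (D (fst z) (snd z)))\<^sup>2)"])
    show "AE z in lborel \<Otimes>\<^sub>M M. ennreal ((norm (G j (fst z) (snd z)))\<^sup>2) \<le> ennreal ((norm (D (fst z) (snd z)))\<^sup>2)" for j
      using le by (intro AE_I2 ennreal_leI power_mono) (auto simp: space_pair_measure)
    show "(\<integral>\<^sup>+z. ennreal ((norm (D (fst z) (snd z)))\<^sup>2) \<partial>(lborel \<Otimes>\<^sub>M M)) < \<infinity>"
      using D(2) by (simp add: psq_def msq_def)
    show "AE z in lborel \<Otimes>\<^sub>M M. (\<lambda>i. ennreal ((norm (G i (fst z) (snd z)))\<^sup>2)) \<longlonglongrightarrow> 0"
      using ne AE_space
    proof eventually_elim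
      case (elim z)
      have "(\<lambda>i. (norm (G i (fst z) (snd z)))\<^sup>2) \<longlonglongrightarrow> (norm (0::'b))\<^sup>2"
        using elim by (intro tendsto_intros lim) (auto simp: space_pair_measure)
      then show ?case using tendsto_ennrealI by fastforce
    qed
  qed measurable
  then show ?thesis by (simp add: psq_def msq_def)
qed

lemma psq_diff_mono: "t \<le> T \<Longrightarrow> psq (\<lambda>s \<omega>. cut t X s \<omega> - cut t Y s \<omega>) \<le> psq (\<lambda>s \<omega>. cut T X s \<omega> - cut T Y s \<omega>)"
  by (rule psq_mono) (auto simp: cut_def indicator_def)

lemma psq_diff_time:
  fixes X Y :: "real \<Rightarrow> 'a \<Rightarrow> 'b::{real_normed_vector, second_countable_topology}"
  assumes X: "X \<in> L2F M W T" and Y: "Y \<in> L2F M W T" and t: "t \<le> T"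
  shows "psq (\<lambda>s \<omega>. cut t X s \<omega> - cut t Y s \<omega>) = (\<integral>\<^sup>+s\<in>{0..t}. msq M (\<lambda>\<omega>. cut T X s \<omega> - cut T Y s \<omega>) \<partial>lborel)"
    and "(\<lambda>s. msq M (\<lambda>\<omega>. cut T X s \<omega> - cut T Y s \<omega>)) \<in> borel_measurable borel"
proof -
  have p: "pmeas (\<lambda>s \<omega>. cut t X s \<omega> - cut t Y s \<omega>)" if "t \<le> T" for t
    using pmeas_cut[OF L2F_D(1)[OF X] that] pmeas_cut[OF L2F_D(1)[OF Y] that] by (simp add: pmeas_def)
  show "psq (\<lambda>s \<omega>. cut t X s \<omega> - cut t Y s \<omega>) = (\<integral>\<^sup>+s\<in>{0..t}. msq M (\<lambda>\<omega>. cut T X s \<omega> - cut T Y s \<omega>) \<partial>lborel)"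
    unfolding psq_time[OF p[OF t]] using t
    by (intro nn_integral_cong) (auto simp: cut_def[abs_def] indicator_def)
  have "(\<lambda>z. ennreal ((norm (cut T X (fst z) (snd z) - cut T Y (fst z) (snd z)))\<^sup>2)) \<in> borel_measurable (lborel \<Otimes>\<^sub>M M)"
    using p[OF order_refl] unfolding pmeas_def by measurable
  from borel_measurable_nn_integral_fst[OF this]
  show "(\<lambda>s. msq M (\<lambda>\<omega>. cut T X s \<omega> - cut T Y s \<omega>)) \<in> borel_measurable borel" by (simp add: msq_def)
qed

lemma L2F_add:
  fixes X Y :: "real \<Rightarrow> 'a \<Rightarrow> 'b::{real_normed_vector, second_countable_topology}"
  assumes X: "X \<in> L2F M W T" and Y: "Y \<in> L2F M W T"
  shows "(\<lambda>s \<omega>. X s \<omega> + Y s \<omega>) \<in> L2F M W T"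
proof (rule L2F_I)
  note XD = L2F_D[OF X] and YD = L2F_D[OF Y]
  have eq: "cut T (\<lambda>s \<omega>. X s \<omega> + Y s \<omega>) = (\<lambda>s \<omega>. cut T X s \<omega> + cut T Y s \<omega>)"
    by (auto simp: cut_def fun_eq_iff scaleR_add_right)
  have m: "(\<lambda>z. cut T X (fst z) (snd z)) \<in> borel_measurable (lborel \<Otimes>\<^sub>M M)" "(\<lambda>z. cut T Y (fst z) (snd z)) \<in> borel_measurable (lborel \<Otimes>\<^sub>M M)"
    using XD(3) YD(3) by (auto simp: pmeas_def)
  show "measurable_process M T (\<lambda>s \<omega>. X s \<omega> + Y s \<omega>)"
    by (rule measurable_processI[OF borel_measurable_add[OF m]]) (auto simp: cut_def)
  show "adapted_process M W T (\<lambda>s \<omega>. X s \<omega> + Y s \<omega>)"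
    using XD(2) YD(2) unfolding adapted_process_def by (blast intro: borel_measurable_add)
  have "psq (\<lambda>s \<omega>. cut T X s \<omega> + cut T Y s \<omega>) \<le> 2 * psq (cut T X) + 2 * psq (cut T Y)"
    unfolding psq_def using m by (rule msq_add_le)
  also have "\<dots> < \<infinity>" using XD(4) YD(4) by (auto simp: ennreal_mult_less_top)
  finally show "psq (cut T (\<lambda>s \<omega>. X s \<omega> + Y s \<omega>)) < \<infinity>" unfolding eq .
qed

lemma matrix_vector_tendsto:
  fixes A :: "nat \<Rightarrow> real^'n^'n"
  assumes "A \<longlonglongrightarrow> B" shows "(\<lambda>k. A k *v x) \<longlonglongrightarrow> B *v x"
proof -
  have "(\<lambda>k. A k *v x - B *v x) \<longlonglongrightarrow> 0"
  proof (rule Lim_null_comparison)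
    show "eventually (\<lambda>k. norm (A k *v x - B *v x) \<le> norm (A k - B) * norm x) sequentially"
      by (intro always_eventually allI) (simp add: matrix_vector_mult_diff_rdistrib[symmetric] norm_matrix_vector_le)
    have "(\<lambda>k. norm (A k - B) * norm x) \<longlonglongrightarrow> norm (B - B) * norm x" by (intro tendsto_intros assms)
    then show "(\<lambda>k. norm (A k - B) * norm x) \<longlonglongrightarrow> 0" by simp
  qed
  then show ?thesis by (rule LIM_zero_cancel)
qed

lemma vec_ito_lim_zero: "vec_ito_lim (\<lambda>s \<omega>. 0) (\<lambda>\<omega>. 0)"
proof -
  have "ito_lim (\<lambda>s \<omega>. 0) (\<lambda>\<omega>. 0)"
    using ito_lim_simple[of 0 "\<lambda>_. 0" "\<lambda>_. 0" "\<lambda>_ _. 0"] by (simp add: simple_data_def simple_process_def[abs_def] simple_integral_def[abs_def])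
  then show ?thesis by (simp add: vec_ito_lim_def)
qed

lemma volt_msq_finite:
  assumes X: "X \<in> L2F M W T" and t: "t \<in> {0..T}" and z: "volt X z t"
  shows "msq M z < \<infinity>"
proof -
  obtain I where I: "vec_ito t (\<lambda>s \<omega>. A1 s \<omega> *v X s \<omega>) I" "AE \<omega> in M. z \<omega> = path_int (drift t X) \<omega> + I \<omega>"
    using z unfolding volt_def by blast
  note dX = drift_props[OF X t]
  have m: "path_int (drift t X) \<in> borel_measurable M" "I \<in> borel_measurable M"
    using dX(1) vec_ito_adapted[OF I(1)] t measurable_F_M unfolding pmeas_def by (auto intro!: path_int_measurable)
  have "msq M z = msq M (\<lambda>\<omega>. path_int (drift t X) \<omega> + I \<omega>)" using I(2) by (intro msq_cong_AE) auto
  also have "\<dots> \<le> 2 * msq M (path_int (drift t X)) + 2 * msq M I" by (rule msq_add_le[OF m])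
  also have "\<dots> < \<infinity>"
  proof -
    have 1: "msq M (path_int (drift t X)) \<le> ennreal T * psq (drift t X)"
      using T_pos by (intro path_int_msq dX) auto
    have 2: "msq M I \<le> 16 * psq (noise t X)"
      using vec_ito_lim_dist[OF vec_ito_vec_ito_lim[OF I(1)] vec_ito_lim_zero] by simp
    have "psq (noise t X) < \<infinity>" using noise_props(3)[OF X, of t] t by auto
    then have "16 * psq (noise t X) < \<infinity>" by (simp add: ennreal_mult_less_top)
    moreover have "ennreal T * psq (drift t X) < \<infinity>" using dX(3) by (simp add: ennreal_mult_less_top)
    ultimately have "msq M I < \<infinity>" "msq M (path_int (drift t X)) < \<infinity>"
      using 1 2 by (auto intro: le_less_trans)
    then show ?thesis by (auto simp: ennreal_mult_less_top)
  qed
  finally show ?thesis .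
qed

text \<open>For \<open>r < t\<close> eventually \<open>r < u k\<close>, and the kernel is continuous in its first argument; for
  \<open>t < r\<close> both sides are eventually 0.\<close>

lemma drift_sequence:
  assumes w: "\<omega> \<in> space M" and u: "u \<longlonglongrightarrow> t" "\<And>k. u k \<in> {0..T}" and t: "t \<in> {0..T}" and r: "r \<noteq> t"
  shows "(\<lambda>k. drift (u k) X r \<omega> - drift t X r \<omega>) \<longlonglongrightarrow> 0" and "(\<lambda>k. noise (u k) X r \<omega> - noise t X r \<omega>) \<longlonglongrightarrow> 0"
proof -
  consider "r < 0" | "0 \<le> r" "r < t" | "t < r" using r by linarith
  then have "(\<lambda>k. drift (u k) X r \<omega>) \<longlonglongrightarrow> drift t X r \<omega> \<and> (\<lambda>k. noise (u k) X r \<omega>) \<longlonglongrightarrow> noise t X r \<omega>"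
  proof cases
    case 1
    then show ?thesis by (simp add: cut_def)
  next
    case 2
    have ev: "eventually (\<lambda>k. r < u k) sequentially" using u(1) 2(2) by (rule order_tendstoD(1))
    have cont: "continuous_on {r..T} (\<lambda>t. A0 t r \<omega>)"
      using adm 2 t w unfolding admissible_coefficients_def by auto
    \<comment> \<open>The sequence is moved into \<open>{r..T}\<close>, the domain of continuity; this changes finitely many terms only.\<close>
    define v where "v k = max r (u k)" for k
    have v: "v \<longlonglongrightarrow> t"
    proof -
      have "(\<lambda>k. max r (u k)) \<longlonglongrightarrow> max r t" by (intro tendsto_intros u)
      then show ?thesis using 2 by (simp add: v_def[abs_def] max_def)
    qed
    have "(\<lambda>k. A0 (v k) r \<omega>) \<longlonglongrightarrow> A0 t r \<omega>"
      using 2 t u(2) by (intro continuous_on_tendsto_compose[OF cont v]) (auto simp: v_def)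
    then have lim: "(\<lambda>k. A0 (v k) r \<omega> *v X r \<omega>) \<longlonglongrightarrow> A0 t r \<omega> *v X r \<omega>" by (rule matrix_vector_tendsto)
    have "eventually (\<lambda>k. A0 (v k) r \<omega> *v X r \<omega> = drift (u k) X r \<omega>) sequentially"
      using ev by eventually_elim (use 2 in \<open>auto simp: cut_def v_def max_def\<close>)
    from Lim_transform_eventually[OF lim this] have d: "(\<lambda>k. drift (u k) X r \<omega>) \<longlonglongrightarrow> drift t X r \<omega>"
      using 2 by (simp add: cut_def)
    have "eventually (\<lambda>k. noise (u k) X r \<omega> = noise t X r \<omega>) sequentially"
      using ev by eventually_elim (use 2 in \<open>auto simp: cut_def\<close>)
    with d show ?thesis by (auto intro: tendsto_eventually)
  next
    case 3
    have ev: "eventually (\<lambda>k. u k < r) sequentially" using u(1) 3 by (rule order_tendstoD(2))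
    then have "eventually (\<lambda>k. drift (u k) X r \<omega> = drift t X r \<omega>) sequentially" "eventually (\<lambda>k. noise (u k) X r \<omega> = noise t X r \<omega>) sequentially"
      by (eventually_elim, use 3 in \<open>simp add: cut_def\<close>)+
    then show ?thesis by (auto intro: tendsto_eventually)
  qed
  then show "(\<lambda>k. drift (u k) X r \<omega> - drift t X r \<omega>) \<longlonglongrightarrow> 0" "(\<lambda>k. noise (u k) X r \<omega> - noise t X r \<omega>) \<longlonglongrightarrow> 0"
    by (auto intro: LIM_zero)
qed

text \<open>Versions chosen separately for each time form a mean square continuous process, which is then
  replaced by a jointly measurable modification.\<close>

lemma volt_process:
  assumes X: "X \<in> L2F M W T"
  shows "\<exists>Z. Z \<in> CF M W T \<and> measurable_process M T Z \<and> (\<forall>t\<in>{0..T}. volt X (Z t) t)"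
proof -
  have "\<forall>t. \<exists>z. t \<in> {0..T} \<longrightarrow> volt X z t" using volt_exists[OF X] by blast
  from choice[OF this] obtain z where z: "\<And>t. t \<in> {0..T} \<Longrightarrow> volt X (z t) t" by blast
  have a: "adapted_process M W T z"
    unfolding adapted_process_def using volt_measurable[OF X _ z] by blast
  have fin: "msq M (z t) < \<infinity>" if "t \<in> {0..T}" for t by (rule volt_msq_finite[OF X that z[OF that]])
  have cont: "((\<lambda>s. msq M (\<lambda>\<omega>. z s \<omega> - z t \<omega>)) \<longlongrightarrow> 0) (at t within {0..T})" if t: "t \<in> {0..T}" for t
    unfolding tendsto_at_iff_sequentially
  proof (intro allI impI)
    fix u assume "\<forall>i. u i \<in> {0..T} - {t}" and u: "u \<longlonglongrightarrow> t"
    then have uT: "u i \<in> {0..T}" for i by blast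
    define D where "D s \<omega> = (2 * K) *\<^sub>R cut T X s \<omega>" for s \<omega>
    note XD = L2F_D[OF X]
    have Dp: "pmeas D" using XD(3) unfolding pmeas_def D_def by simp
    have "psq D = ennreal ((2 * K)\<^sup>2) * psq (cut T X)"
      unfolding psq_def D_def using XD(3) unfolding pmeas_def by (rule msq_cmult)
    then have Df: "psq D < \<infinity>" using XD(4) by (simp add: ennreal_mult_less_top)
    have bound: "norm (cut t' (\<lambda>s \<omega>. B s \<omega> *v X s \<omega>) s \<omega>) \<le> K * norm (cut T X s \<omega>)"
      if "t' \<in> {0..T}" "norm (cut t' B s \<omega>) \<le> K" for t' B s \<omega>
    proof -
      have "norm (cut t' (\<lambda>s \<omega>. B s \<omega> *v X s \<omega>) s \<omega>) \<le> norm (cut t' B s \<omega>) * norm (cut t' X s \<omega>)"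
        unfolding cut_mult by (rule norm_matrix_vector_le)
      also have "\<dots> \<le> K * norm (cut T X s \<omega>)"
        using that K_nonneg by (intro mult_mono) (auto simp: cut_def indicator_def)
      finally show ?thesis .
    qed
    have dom: "norm (x - y) \<le> norm (D s \<omega>)" if "norm x \<le> K * norm (cut T X s \<omega>)" "norm y \<le> K * norm (cut T X s \<omega>)" for x y s \<omega>
      using norm_triangle_ineq4[of x y] that K_nonneg by (simp add: D_def)
    have d: "(\<lambda>k. psq (\<lambda>s \<omega>. drift (u k) X s \<omega> - drift t X s \<omega>)) \<longlonglongrightarrow> 0"
    proof (rule psq_dominated_tendsto[OF _ Dp Df])
      show "pmeas (\<lambda>s \<omega>. drift (u k) X s \<omega> - drift t X s \<omega>)" for k
        using drift_props(1)[OF X uT] drift_props(1)[OF X t] by (simp add: pmeas_def)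
      show "norm (drift (u k) X s \<omega> - drift t X s \<omega>) \<le> norm (D s \<omega>)" if "\<omega> \<in> space M" for k s \<omega>
        by (intro dom bound uT t cut_A0(2) that)
      show "(\<lambda>k. drift (u k) X s \<omega> - drift t X s \<omega>) \<longlonglongrightarrow> 0" if "\<omega> \<in> space M" "s \<noteq> t" for s \<omega>
        by (rule drift_sequence(1)[OF that(1) u uT t that(2)])
    qed
    have n: "(\<lambda>k. psq (\<lambda>s \<omega>. noise (u k) X s \<omega> - noise t X s \<omega>)) \<longlonglongrightarrow> 0"
    proof (rule psq_dominated_tendsto[OF _ Dp Df])
      have le: "u k \<le> T" "t \<le> T" for k using uT[of k] t by auto
      show "pmeas (\<lambda>s \<omega>. noise (u k) X s \<omega> - noise t X s \<omega>)" for k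
        using noise_props(1)[OF X le(1)] noise_props(1)[OF X le(2)] by (simp add: pmeas_def)
      show "norm (noise (u k) X s \<omega> - noise t X s \<omega>) \<le> norm (D s \<omega>)" if "\<omega> \<in> space M" for k s \<omega>
        by (intro dom bound uT t cut_A1(2) le that)
      show "(\<lambda>k. noise (u k) X s \<omega> - noise t X s \<omega>) \<longlonglongrightarrow> 0" if "\<omega> \<in> space M" "s \<noteq> t" for s \<omega>
        by (rule drift_sequence(2)[OF that(1) u uT t that(2)])
    qed
    have "(\<lambda>k. ennreal (2 * T) * psq (\<lambda>s \<omega>. drift (u k) X s \<omega> - drift t X s \<omega>) + 32 * psq (\<lambda>s \<omega>. noise (u k) X s \<omega> - noise t X s \<omega>)) \<longlonglongrightarrow> ennreal (2 * T) * 0 + 32 * 0"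
      by (intro tendsto_add tendsto_mult_ennreal tendsto_const d n) auto
    then have lim: "(\<lambda>k. ennreal (2 * T) * psq (\<lambda>s \<omega>. drift (u k) X s \<omega> - drift t X s \<omega>) + 32 * psq (\<lambda>s \<omega>. noise (u k) X s \<omega> - noise t X s \<omega>)) \<longlonglongrightarrow> 0"
      by simp
    show "((\<lambda>s. msq M (\<lambda>\<omega>. z s \<omega> - z t \<omega>)) \<circ> u) \<longlonglongrightarrow> 0"
      unfolding comp_def
      by (rule tendsto_sandwich[OF _ _ tendsto_const lim])
         (intro always_eventually allI zero_le volt_dist_general[OF X X uT t z[OF uT] z[OF t]])+
  qed
  have CFz: "z \<in> CF M W T" using a fin cont unfolding CF_def msq_def by auto
  from CF_measurable_modification[OF CFz] obtain Z where Z: "Z \<in> CF M W T" "measurable_process M T Z"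
    "\<And>t. t \<in> {0..T} \<Longrightarrow> AE \<omega> in M. Z t \<omega> = z t \<omega>" by blast
  then show ?thesis using volt_cong_AE[OF z] by blast
qed

section \<open>Existence and uniqueness\<close>

lemma volt_AE_eq:
  assumes X: "X \<in> L2F M W T" and Y: "Y \<in> L2F M W T" and eq: "psq (\<lambda>s \<omega>. cut T X s \<omega> - cut T Y s \<omega>) = 0"
    and t: "t \<in> {0..T}" and z: "volt X z t" "volt Y z' t"
  shows "AE \<omega> in M. z \<omega> = z' \<omega>"
proof -
  have "msq M (\<lambda>\<omega>. z \<omega> - z' \<omega>) \<le> ennreal C * psq (\<lambda>s \<omega>. cut t X s \<omega> - cut t Y s \<omega>)"
    by (rule volt_dist[OF X Y t z])
  also have "\<dots> \<le> ennreal C * 0"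
    using psq_diff_mono[of t X Y] t eq by (intro mult_left_mono) auto
  finally have "msq M (\<lambda>\<omega>. z \<omega> - z' \<omega>) = 0" by simp
  moreover have "(\<lambda>\<omega>. z \<omega> - z' \<omega>) \<in> borel_measurable M"
    using volt_measurable[OF X t z(1)] volt_measurable[OF Y t z(2)] measurable_F_M by (blast intro: borel_measurable_diff)
  ultimately show ?thesis by (simp add: msq_eq_0_iff)
qed

text \<open>Picard iteration, with the free term \<open>\<phi>\<close> kept apart. The remainder \<open>Z\<close> is mean square
  continuous even when \<open>\<phi>\<close> is not, so that one construction serves both for \<open>\<phi>\<close> in \<open>L2F\<close> and for \<open>\<phi>\<close> in \<open>CF\<close>.\<close>

theorem volterra_solution_exists:
  assumes \<phi>: "\<phi> \<in> L2F M W T"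
  shows "\<exists>Z. Z \<in> CF M W T \<and> measurable_process M T Z \<and> (\<lambda>t \<omega>. \<phi> t \<omega> + Z t \<omega>) \<in> L2F M W T \<and>
    (\<forall>t\<in>{0..T}. volt (\<lambda>t \<omega>. \<phi> t \<omega> + Z t \<omega>) (Z t) t)"
proof -
  have "\<forall>X. \<exists>Z. X \<in> L2F M W T \<longrightarrow> Z \<in> CF M W T \<and> measurable_process M T Z \<and> (\<forall>t\<in>{0..T}. volt X (Z t) t)"
    using volt_process by blast
  from choice[OF this] obtain V where V: "\<And>X. X \<in> L2F M W T \<Longrightarrow> V X \<in> CF M W T"
    "\<And>X. X \<in> L2F M W T \<Longrightarrow> measurable_process M T (V X)" "\<And>X t. X \<in> L2F M W T \<Longrightarrow> t \<in> {0..T} \<Longrightarrow> volt X (V X t) t" by blast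
  define \<Gamma> where "\<Gamma> X t \<omega> = \<phi> t \<omega> + V X t \<omega>" for X t \<omega>
  have \<Gamma>: "\<Gamma> X \<in> L2F M W T" if "X \<in> L2F M W T" for X
    unfolding \<Gamma>_def[abs_def] using T_pos by (intro L2F_add \<phi> CF_L2F V that) auto
  have \<Gamma>_dist: "msq M (\<lambda>\<omega>. cut T (\<Gamma> X) t \<omega> - cut T (\<Gamma> Y) t \<omega>) \<le> ennreal C * psq (\<lambda>s \<omega>. cut t X s \<omega> - cut t Y s \<omega>)"
    if X: "X \<in> L2F M W T" and Y: "Y \<in> L2F M W T" and t: "t \<in> {0..T}" for X Y t
  proof -
    have "msq M (\<lambda>\<omega>. cut T (\<Gamma> X) t \<omega> - cut T (\<Gamma> Y) t \<omega>) = msq M (\<lambda>\<omega>. V X t \<omega> - V Y t \<omega>)"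
      using t by (simp add: cut_def \<Gamma>_def)
    also have "\<dots> \<le> ennreal C * psq (\<lambda>s \<omega>. cut t X s \<omega> - cut t Y s \<omega>)"
      by (intro volt_dist X Y t V)
    finally show ?thesis .
  qed
  define Xs where "Xs n = (\<Gamma> ^^ n) \<phi>" for n
  have Xs0: "Xs 0 = \<phi>" and XsS: "Xs (Suc n) = \<Gamma> (Xs n)" for n by (auto simp: Xs_def)
  have Xs: "Xs n \<in> L2F M W T" for n by (induction n) (auto simp: Xs0 XsS \<phi> \<Gamma>)
  define q where "q n t = msq M (\<lambda>\<omega>. cut T (Xs (Suc n)) t \<omega> - cut T (Xs n) t \<omega>)" for n t
  have qm [measurable]: "q n \<in> borel_measurable borel" for n
    unfolding q_def[abs_def] by (rule psq_diff_time(2)[OF Xs Xs order_refl])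
  have qd: "psq (\<lambda>s \<omega>. cut t (Xs (Suc n)) s \<omega> - cut t (Xs n) s \<omega>) = (\<integral>\<^sup>+s\<in>{0..t}. q n s \<partial>lborel)" if "t \<le> T" for t n
    unfolding q_def by (rule psq_diff_time(1)[OF Xs Xs that])
  \<comment> \<open>The weight makes the squared distance of successive iterates decrease by the factor 1/4, as \<open>msq_fast_Cauchy\<close> requires.\<close>
  define l where "l = 4 * C"
  have l: "l > 0" using C_pos by (simp add: l_def)
  define N where "N n = (\<integral>\<^sup>+t\<in>{0..T}. ennreal (exp (- l * t)) * q n t \<partial>lborel)" for n
  have exp_le: "ennreal (exp (- l * t)) * x \<le> x" if "0 \<le> t" for t x
  proof -
    have "ennreal (exp (- l * t)) * x \<le> 1 * x" using l that by (intro mult_right_mono) auto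
    then show ?thesis by simp
  qed
  have m0: "(\<lambda>t. \<integral>\<^sup>+s\<in>{0..t}. q n s \<partial>lborel) \<in> borel_measurable borel" for n
  proof -
    have "(\<lambda>(t, s). q n s * (if 0 \<le> s \<and> s \<le> t then 1 else 0)) \<in> borel_measurable (borel \<Otimes>\<^sub>M lborel)"
      by measurable
    from lborel.borel_measurable_nn_integral_fst[OF this]
    show ?thesis by (simp add: indicator_def)
  qed
  have NS: "N (Suc n) \<le> ennreal (1/4) * N n" for n
  proof -
    have "N (Suc n) \<le> (\<integral>\<^sup>+t. ennreal C * (ennreal (exp (- l * t)) * (\<integral>\<^sup>+s\<in>{0..t}. q n s \<partial>lborel) * indicator {0..T} t) \<partial>lborel)"
      unfolding N_def
    proof (rule nn_integral_mono)
      fix t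
      show "ennreal (exp (- l * t)) * q (Suc n) t * indicator {0..T} t
        \<le> ennreal C * (ennreal (exp (- l * t)) * (\<integral>\<^sup>+s\<in>{0..t}. q n s \<partial>lborel) * indicator {0..T} t)"
      proof (cases "t \<in> {0..T}")
        case True
        then have "q (Suc n) t \<le> ennreal C * (\<integral>\<^sup>+s\<in>{0..t}. q n s \<partial>lborel)"
          using \<Gamma>_dist[OF Xs[of "Suc n"] Xs[of n] True] qd[of t n] unfolding q_def XsS by simp
        then have "ennreal (exp (- l * t)) * q (Suc n) t \<le> ennreal (exp (- l * t)) * (ennreal C * (\<integral>\<^sup>+s\<in>{0..t}. q n s \<partial>lborel))"
          by (intro mult_left_mono) auto
        with True show ?thesis by (simp add: mult.left_commute)
      qed simp
    qed
    also have "\<dots> = ennreal C * (\<integral>\<^sup>+t\<in>{0..T}. ennreal (exp (- l * t)) * (\<integral>\<^sup>+s\<in>{0..t}. q n s \<partial>lborel) \<partial>lborel)"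
      using m0 by (intro nn_integral_cmult) auto
    also have "\<dots> \<le> ennreal C * (ennreal (1 / l) * N n)"
      unfolding N_def by (intro mult_left_mono volterra_weighted_bound qm l) auto
    also have "\<dots> = ennreal (1/4) * N n"
    proof -
      have "ennreal C * ennreal (1 / l) = ennreal (1/4)"
        using C_pos by (subst ennreal_mult[symmetric]) (auto simp: l_def)
      then show ?thesis by (simp only: mult.assoc[symmetric])
    qed
    finally show ?thesis .
  qed
  have "N 0 \<le> psq (\<lambda>s \<omega>. cut T (Xs (Suc 0)) s \<omega> - cut T (Xs 0) s \<omega>)"
    unfolding N_def qd[OF order_refl] using exp_le by (intro nn_integral_mono) (auto simp: indicator_def)
  also have "\<dots> \<le> 2 * psq (cut T (Xs (Suc 0))) + 2 * psq (cut T (Xs 0))"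
    using psq_triangle[of "cut T (Xs (Suc 0))" "\<lambda>_ _. 0" "cut T (Xs 0)"] L2F_D(3)[OF Xs]
    by (simp add: pmeas_def psq_def msq_def)
  also have "\<dots> < \<infinity>" using L2F_D(4)[OF Xs] by (auto simp: ennreal_mult_less_top)
  finally have "N 0 < top" by simp
  then obtain c where c: "c \<ge> 0" "N 0 = ennreal c" by (cases "N 0") auto
  have Nn: "N n \<le> ennreal (c * (1/4)^n)" for n
  proof (induction n)
    case (Suc n)
    have "N (Suc n) \<le> ennreal (1/4) * ennreal (c * (1/4)^n)"
      using NS[of n] mult_left_mono[OF Suc, of "ennreal (1/4)"] by (auto intro: order_trans)
    also have "\<dots> = ennreal (c * (1/4)^Suc n)" using c(1) by (subst ennreal_mult[symmetric]) (auto simp: mult_ac)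
    finally show ?case .
  qed (simp add: c)
  define c' where "c' = exp (l * T) * c"
  have c': "c' \<ge> 0" using c by (simp add: c'_def)
  have step: "psq (\<lambda>s \<omega>. cut T (Xs (Suc n)) s \<omega> - cut T (Xs n) s \<omega>) \<le> ennreal (c' * (1/4)^n)" for n
  proof -
    have "psq (\<lambda>s \<omega>. cut T (Xs (Suc n)) s \<omega> - cut T (Xs n) s \<omega>) \<le> (\<integral>\<^sup>+t. ennreal (exp (l * T)) * (ennreal (exp (- l * t)) * q n t * indicator {0..T} t) \<partial>lborel)"
      unfolding qd[OF order_refl]
    proof (rule nn_integral_mono)
      fix t
      show "q n t * indicator {0..T} t \<le> ennreal (exp (l * T)) * (ennreal (exp (- l * t)) * q n t * indicator {0..T} t)"
      proof (cases "t \<in> {0..T}")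
        case True
        have "1 * q n t \<le> ennreal (exp (l * T) * exp (- l * t)) * q n t"
        proof (rule mult_right_mono)
          have "0 \<le> l * (T - t)" using True l by (intro mult_nonneg_nonneg) auto
          then have "1 \<le> exp (l * T) * exp (- l * t)" by (simp add: exp_add[symmetric] algebra_simps)
          then show "1 \<le> ennreal (exp (l * T) * exp (- l * t))" by simp
        qed simp
        with True show ?thesis by (simp add: ennreal_mult mult.assoc)
      qed simp
    qed
    also have "\<dots> = ennreal (exp (l * T)) * N n" unfolding N_def by (intro nn_integral_cmult) measurable
    also have "\<dots> \<le> ennreal (exp (l * T)) * ennreal (c * (1/4)^n)" by (intro mult_left_mono Nn) auto
    also have "\<dots> = ennreal (c' * (1/4)^n)" using c(1) by (subst ennreal_mult[symmetric]) (auto simp: c'_def mult_ac)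
    finally show ?thesis .
  qed
  define f where "f n z = cut T (Xs n) (fst z) (snd z)" for n and z :: "real \<times> 'a"
  have fm: "f n \<in> borel_measurable (lborel \<Otimes>\<^sub>M M)" for n
    using L2F_D(3)[OF Xs[of n]] unfolding f_def[abs_def] pmeas_def .
  define X where "X s \<omega> = lim (\<lambda>n. Xs n s \<omega>)" for s \<omega>
  have limf: "lim (\<lambda>n. f n z) = cut T X (fst z) (snd z)" for z
    by (cases "fst z \<in> {0..T}") (simp_all add: f_def X_def cut_def)
  have fast: "msq (lborel \<Otimes>\<^sub>M M) (\<lambda>z. f (Suc n) z - f n z) \<le> ennreal (c' * (1/4)^n)" for n
    using step[of n] unfolding psq_def f_def by simp
  have conv: "psq (\<lambda>s \<omega>. cut T (Xs n) s \<omega> - cut T X s \<omega>) \<le> ennreal (4 * c' * (1/4)^n)" for n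
    using msq_fast_Cauchy(2)[OF fm c' fast, of n] unfolding limf unfolding psq_def f_def by simp
  have pX: "pmeas (cut T X)"
    using borel_measurable_lim_metric[of f, OF fm] unfolding limf pmeas_def .
  have X: "X \<in> L2F M W T"
  proof (rule L2F_I)
    show "measurable_process M T X"
      by (rule measurable_processI[OF pX[unfolded pmeas_def]]) (auto simp: cut_def)
    show "adapted_process M W T X"
      unfolding adapted_process_def X_def[abs_def]
      using L2F_D(2)[OF Xs] unfolding adapted_process_def by (auto intro!: borel_measurable_lim_metric)
    have "psq (cut T X) = psq (\<lambda>s \<omega>. cut T X s \<omega> - 0)" by simp
    also have "\<dots> \<le> 2 * psq (\<lambda>s \<omega>. cut T X s \<omega> - cut T (Xs 0) s \<omega>) + 2 * psq (\<lambda>s \<omega>. cut T (Xs 0) s \<omega> - 0)"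
      using pX L2F_D(3)[OF Xs] by (intro psq_triangle) (auto simp: pmeas_def)
    also have "\<dots> < \<infinity>"
      using conv[of 0] L2F_D(4)[OF Xs[of 0]] psq_minus_commute[of "cut T X" "cut T (Xs 0)"]
      by (auto simp: ennreal_mult_less_top intro: le_less_trans)
    finally show "psq (cut T X) < \<infinity>" .
  qed
  \<comment> \<open>\<open>X\<close> is a fixed point of \<open>\<Gamma>\<close> up to a null set of times and outcomes.\<close>
  have fixed: "psq (\<lambda>s \<omega>. cut T X s \<omega> - cut T (\<Gamma> X) s \<omega>) \<le> ennreal ((2 + 8 * C * T) * c' * (1/4)^n)" for n
  proof -
    have "psq (\<lambda>s \<omega>. cut T (\<Gamma> (Xs n)) s \<omega> - cut T (\<Gamma> X) s \<omega>) \<le> (\<integral>\<^sup>+t. ennreal (C * (4 * c' * (1/4)^n)) * indicator {0..T} t \<partial>lborel)"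
      unfolding psq_diff_time(1)[OF \<Gamma>[OF Xs] \<Gamma>[OF X] order_refl]
    proof (rule nn_integral_mono)
      fix t
      show "msq M (\<lambda>\<omega>. cut T (\<Gamma> (Xs n)) t \<omega> - cut T (\<Gamma> X) t \<omega>) * indicator {0..T} t \<le> ennreal (C * (4 * c' * (1/4)^n)) * indicator {0..T} t"
      proof (cases "t \<in> {0..T}")
        case True
        have "msq M (\<lambda>\<omega>. cut T (\<Gamma> (Xs n)) t \<omega> - cut T (\<Gamma> X) t \<omega>) \<le> ennreal C * psq (\<lambda>s \<omega>. cut t (Xs n) s \<omega> - cut t X s \<omega>)"
          by (rule \<Gamma>_dist[OF Xs X True])
        also have "\<dots> \<le> ennreal C * ennreal (4 * c' * (1/4)^n)"
          using True by (intro mult_left_mono order_trans[OF psq_diff_mono conv]) auto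
        also have "\<dots> = ennreal (C * (4 * c' * (1/4)^n))" using C_pos c' by (subst ennreal_mult) auto
        finally show ?thesis using True by simp
      qed simp
    qed
    also have "\<dots> = ennreal (C * (4 * c' * (1/4)^n) * T)"
      using T_pos C_pos c' by (subst nn_integral_cmult_indicator) (auto simp: ennreal_mult)
    finally have 1: "psq (\<lambda>s \<omega>. cut T (\<Gamma> (Xs n)) s \<omega> - cut T (\<Gamma> X) s \<omega>) \<le> ennreal (C * (4 * c' * (1/4)^n) * T)" .
    have "psq (\<lambda>s \<omega>. cut T X s \<omega> - cut T (\<Gamma> X) s \<omega>) \<le> 2 * psq (\<lambda>s \<omega>. cut T X s \<omega> - cut T (Xs (Suc n)) s \<omega>)
        + 2 * psq (\<lambda>s \<omega>. cut T (\<Gamma> (Xs n)) s \<omega> - cut T (\<Gamma> X) s \<omega>)"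
      unfolding XsS using pX L2F_D(3)[OF \<Gamma>[OF Xs]] L2F_D(3)[OF \<Gamma>[OF X]] by (intro psq_triangle)
    also have "\<dots> \<le> 2 * ennreal (4 * c' * (1/4)^Suc n) + 2 * ennreal (C * (4 * c' * (1/4)^n) * T)"
      using conv[of "Suc n"] psq_minus_commute[of "cut T X" "cut T (Xs (Suc n))"] 1 by (intro add_mono mult_left_mono) auto
    also have "\<dots> = ennreal (2 * (4 * c' * (1/4)^Suc n) + 2 * (C * (4 * c' * (1/4)^n) * T))"
      using T_pos C_pos c' by (simp add: numeral_mult_ennreal ennreal_plus[symmetric] del: ennreal_plus)
    also have "2 * (4 * c' * (1/4)^Suc n) + 2 * (C * (4 * c' * (1/4)^n) * T) = (2 + 8 * C * T) * c' * (1/4)^n"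
      by (simp add: algebra_simps)
    finally show ?thesis .
  qed
  have "(\<lambda>n. (2 + 8 * C * T) * c' * (1/4)^n) \<longlonglongrightarrow> (2 + 8 * C * T) * c' * 0" by (intro tendsto_intros LIMSEQ_power_zero) auto
  then have "(\<lambda>n. ennreal ((2 + 8 * C * T) * c' * (1/4)^n)) \<longlonglongrightarrow> 0" using tendsto_ennrealI by fastforce
  then have eq0: "psq (\<lambda>s \<omega>. cut T X s \<omega> - cut T (\<Gamma> X) s \<omega>) \<le> 0"
    by (rule LIMSEQ_le_const) (use fixed in auto)
  \<comment> \<open>Replacing \<open>X\<close> by \<open>\<Gamma> X = \<phi> + V X\<close> gives the equation at every time, with the continuous remainder \<open>V X\<close>.\<close>
  have "volt (\<Gamma> X) (V X t) t" if t: "t \<in> {0..T}" for t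
  proof -
    obtain z where z: "volt (\<Gamma> X) z t" using volt_exists[OF \<Gamma>[OF X] t] by blast
    have "AE \<omega> in M. V X t \<omega> = z \<omega>"
      using eq0 by (intro volt_AE_eq[OF X \<Gamma>[OF X] _ t V(3)[OF X t] z]) simp
    then show ?thesis by (rule volt_cong_AE[OF z])
  qed
  then show ?thesis using V(1,2)[OF X] \<Gamma>[OF X] unfolding \<Gamma>_def[abs_def] by blast
qed

theorem volterra_solution_unique:
  assumes X: "X \<in> L2F M W T" and Y: "Y \<in> L2F M W T"
    and eqX: "AE t in lborel. t \<in> {0..T} \<longrightarrow> volt X (\<lambda>\<omega>. X t \<omega> - \<phi> t \<omega>) t"
    and eqY: "AE t in lborel. t \<in> {0..T} \<longrightarrow> volt Y (\<lambda>\<omega>. Y t \<omega> - \<phi> t \<omega>) t"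
  shows "psq (\<lambda>s \<omega>. cut T X s \<omega> - cut T Y s \<omega>) = 0"
    and "AE t in lborel. t \<in> {0..T} \<longrightarrow> (AE \<omega> in M. X t \<omega> = Y t \<omega>)"
proof -
  define q where "q t = msq M (\<lambda>\<omega>. cut T X t \<omega> - cut T Y t \<omega>)" for t
  have qm: "q \<in> borel_measurable borel" unfolding q_def[abs_def] by (rule psq_diff_time(2)[OF X Y order_refl])
  have qd: "psq (\<lambda>s \<omega>. cut t X s \<omega> - cut t Y s \<omega>) = (\<integral>\<^sup>+s\<in>{0..t}. q s \<partial>lborel)" if "t \<le> T" for t
    unfolding q_def by (rule psq_diff_time(1)[OF X Y that])
  have "psq (\<lambda>s \<omega>. cut T X s \<omega> - cut T Y s \<omega>) \<le> 2 * psq (cut T X) + 2 * psq (cut T Y)"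
    using psq_triangle[of "cut T X" "\<lambda>_ _. 0" "cut T Y"] L2F_D(3)[OF X] L2F_D(3)[OF Y]
    by (simp add: pmeas_def psq_def msq_def)
  also have "\<dots> < \<infinity>" using L2F_D(4)[OF X] L2F_D(4)[OF Y] by (auto simp: ennreal_mult_less_top)
  finally have fin: "(\<integral>\<^sup>+s\<in>{0..T}. q s \<partial>lborel) < \<infinity>" using qd[OF order_refl] by simp
  have "AE t in lborel. t \<in> {0..T} \<longrightarrow> q t \<le> ennreal C * (\<integral>\<^sup>+s\<in>{0..t}. q s \<partial>lborel)"
    using eqX eqY
  proof eventually_elim
    case (elim t)
    show ?case
    proof
      assume t: "t \<in> {0..T}"
      have "q t = msq M (\<lambda>\<omega>. (X t \<omega> - \<phi> t \<omega>) - (Y t \<omega> - \<phi> t \<omega>))"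
        using t by (simp add: q_def cut_def)
      also have "\<dots> \<le> ennreal C * psq (\<lambda>s \<omega>. cut t X s \<omega> - cut t Y s \<omega>)"
        using elim t by (intro volt_dist X Y) auto
      finally show "q t \<le> ennreal C * (\<integral>\<^sup>+s\<in>{0..t}. q s \<partial>lborel)" using qd[of t] t by simp
    qed
  qed
  then have q0: "AE t in lborel. t \<in> {0..T} \<longrightarrow> q t = 0"
    by (rule gronwall_zero[OF qm fin C_pos])
  show "psq (\<lambda>s \<omega>. cut T X s \<omega> - cut T Y s \<omega>) = 0"
    unfolding qd[OF order_refl] using q0 qm
    by (subst nn_integral_0_iff_AE) (auto elim!: eventually_mono simp: indicator_def)
  show "AE t in lborel. t \<in> {0..T} \<longrightarrow> (AE \<omega> in M. X t \<omega> = Y t \<omega>)"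
    using q0
  proof eventually_elim
    case (elim t)
    show ?case
    proof
      assume t: "t \<in> {0..T}"
      have m: "X t \<in> borel_measurable M" "Y t \<in> borel_measurable M"
        using L2F_D(2)[OF X] L2F_D(2)[OF Y] t measurable_F_M unfolding adapted_process_def by blast+
      have "msq M (\<lambda>\<omega>. X t \<omega> - Y t \<omega>) = 0" using elim t by (simp add: q_def cut_def)
      then show "AE \<omega> in M. X t \<omega> = Y t \<omega>" using m by (subst (asm) msq_eq_0_iff) auto
    qed
  qed
qed

end

section \<open>Comparison without noise\<close>

definition neg_part :: "real^'n \<Rightarrow> real^'n" where
  "neg_part x = (\<chi> i. max 0 (- x $ i))"

lemma neg_part_component [simp]: "neg_part x $ i = max 0 (- x $ i)"
  by (simp add: neg_part_def)

lemma norm_vec_mono: "(\<And>i. \<bar>x $ i\<bar> \<le> \<bar>y $ i\<bar>) \<Longrightarrow> norm x \<le> norm (y :: real^'n)"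
  by (rule power2_le_imp_le) (auto simp: norm_sq_vec intro!: sum_mono abs_le_square_iff[THEN iffD1])

lemma norm_neg_part_le: "norm (neg_part x) \<le> norm x"
  by (rule norm_vec_mono) auto

lemma measurable_neg_part [measurable]: "neg_part \<in> borel_measurable borel"
  by (rule measurable_vec_lambda) simp

text \<open>Lebesgue measure on the plane is the product measure; on each side, sections of a null set are null.\<close>

lemma AE_lborel_pairD:
  fixes P :: "real \<times> real \<Rightarrow> bool"
  assumes "AE z in lborel. P z"
  shows "AE t in lborel. AE s in lborel. P (t, s)" and "AE s in lborel. AE t in lborel. P (t, s)"
proof -
  have 1: "AE z in lborel \<Otimes>\<^sub>M lborel. P z" unfolding lborel_prod by (rule assms)
  then show "AE t in lborel. AE s in lborel. P (t, s)" by (rule lborel_pair.AE_pair)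
  from 1 obtain N where N: "N \<in> null_sets (lborel \<Otimes>\<^sub>M lborel)" "{z. \<not> P z} \<subseteq> N"
    unfolding eventually_ae_filter by (auto simp: space_pair_measure)
  have "AE z in lborel \<Otimes>\<^sub>M lborel. z \<notin> N" using N(1) by (rule AE_not_in)
  moreover have "{z \<in> space (lborel \<Otimes>\<^sub>M lborel). z \<notin> N} \<in> sets (lborel \<Otimes>\<^sub>M lborel)"
  proof -
    have "{z \<in> space (lborel \<Otimes>\<^sub>M lborel). z \<notin> N} = space (lborel \<Otimes>\<^sub>M lborel) - N" by auto
    then show ?thesis using sets.compl_sets[OF null_setsD2[OF N(1)]] by (simp only:)
  qed
  ultimately have a: "AE t in lborel. AE s in lborel. (t, s) \<notin> N"
    and b: "{z \<in> space (lborel \<Otimes>\<^sub>M lborel). (fst z, snd z) \<notin> N} \<in> sets (lborel \<Otimes>\<^sub>M lborel)"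
    by (auto intro: lborel_pair.AE_pair)
  have "AE s in lborel. AE t in lborel. (t, s) \<notin> N"
    using lborel_pair.AE_commute[of "\<lambda>t s. (t, s) \<notin> N", OF b] a by (rule iffD1)
  moreover have "P z" if "z \<notin> N" for z using that N(2) by blast
  ultimately show "AE s in lborel. AE t in lborel. P (t, s)"
    by (auto elim!: eventually_mono)
qed

context volterra
begin

lemma nonneg_path_int:
  fixes G :: "real \<Rightarrow> 'a \<Rightarrow> real^'n"
  assumes G: "pmeas G" "psq G < \<infinity>" "supported T G" and nn: "AE \<omega> in M. AE s in lborel. 0 \<le> G s \<omega>"
  shows "AE \<omega> in M. 0 \<le> path_int G \<omega>"
  using path_integrable[OF G] nn
proof eventually_elim
  case (elim \<omega>)
  have "path_int G \<omega> $ i = (\<integral>s. G s \<omega> $ i \<partial>lborel)" for i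
    unfolding path_int_def using integral_bounded_linear[OF bounded_linear_vec_nth elim(1), of i] by simp
  moreover have "(\<integral>s. G s \<omega> $ i \<partial>lborel) \<ge> 0" for i
    using elim(2) by (intro integral_nonneg_AE) (auto elim!: eventually_mono simp: less_eq_vec_def)
  ultimately show ?case by (simp add: less_eq_vec_def)
qed

text \<open>The coefficients are controlled for almost every time, almost surely; path integrals need the
  quantifiers in the other order.\<close>

lemma AE_time_space_commute:
  fixes G :: "real \<Rightarrow> 'a \<Rightarrow> 'b::{real_normed_vector, second_countable_topology}"
  assumes G: "pmeas G" and Q: "{x. Q x} \<in> sets borel" and ae: "AE s in lborel. AE \<omega> in M. Q (G s \<omega>)"
  shows "AE \<omega> in M. AE s in lborel. Q (G s \<omega>)"
proof -
  have "{z \<in> space (lborel \<Otimes>\<^sub>M M). Q (G (fst z) (snd z))} = (\<lambda>z. G (fst z) (snd z)) -` {x. Q x} \<inter> space (lborel \<Otimes>\<^sub>M M)"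
    by auto
  also have "\<dots> \<in> sets (lborel \<Otimes>\<^sub>M M)" using G Q unfolding pmeas_def by (rule measurable_sets)
  finally show ?thesis using lM.AE_commute[of "\<lambda>s \<omega>. Q (G s \<omega>)"] ae by simp
qed

lemma borel_nonneg_vec: "{x :: real^'n. 0 \<le> x} \<in> sets borel"
proof -
  have "{x :: real^'n. 0 \<le> x} = (\<Inter>i. {x. 0 \<le> x $ i})" by (auto simp: less_eq_vec_def)
  moreover have "closed (\<Inter>i. {x :: real^'n. 0 \<le> x $ i})"
    by (intro closed_INT ballI closed_Collect_le continuous_intros)
  ultimately show ?thesis by simp
qed

lemma matrix_vector_nonneg:
  assumes "A \<in> nonneg_matrices" "0 \<le> x" shows "0 \<le> A *v (x :: real^'n)"
  using assms by (auto simp: nonneg_matrices_def less_eq_vec_def matrix_vector_mult_def intro!: sum_nonneg)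

text \<open>Gronwall's lemma for the mean square of the negative part \<open>N\<close> of \<open>X\<close>, as \<open>X + N \<ge> 0\<close>
  and the kernel is nonnegative.\<close>

theorem comparison_without_noise:
  assumes coeff: "AE (t, s) in lborel. (t, s) \<in> Delta_star T \<longrightarrow> (AE \<omega> in M. A0 t s \<omega> \<in> nonneg_matrices \<and> A1 s \<omega> = 0)"
    and X: "X \<in> L2F M W T"
    and \<phi>0: "AE t in lborel. t \<in> {0..T} \<longrightarrow> (AE \<omega> in M. 0 \<le> \<phi> t \<omega>)"
    and eq: "AE t in lborel. t \<in> {0..T} \<longrightarrow> volt X (\<lambda>\<omega>. X t \<omega> - \<phi> t \<omega>) t"
  shows "AE t in lborel. t \<in> {0..T} \<longrightarrow> (AE \<omega> in M. \<phi> t \<omega> \<le> X t \<omega> \<and> 0 \<le> \<phi> t \<omega>)"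
proof -
  note XD = L2F_D[OF X]
  have A0_nn: "AE t in lborel. AE s in lborel. t \<in> {0..T} \<longrightarrow> s \<in> {0..t} \<longrightarrow> (AE \<omega> in M. A0 t s \<omega> \<in> nonneg_matrices \<and> A1 s \<omega> = 0)"
    using AE_lborel_pairD(1)[OF coeff] by (auto elim!: eventually_mono simp: Delta_star_def)
  define N where "N s \<omega> = neg_part (X s \<omega>)" for s \<omega>
  have cutN: "cut t N = (\<lambda>s \<omega>. neg_part (cut t X s \<omega>))" for t
    by (auto simp: cut_def N_def fun_eq_iff indicator_def vec_eq_iff)
  have N: "N \<in> L2F M W T"
  proof (rule L2F_I)
    have m: "(\<lambda>z. cut T N (fst z) (snd z)) \<in> borel_measurable (lborel \<Otimes>\<^sub>M M)"
      using XD(3) unfolding cutN pmeas_def by measurable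
    show "measurable_process M T N" by (rule measurable_processI[OF m]) (auto simp: cut_def)
    show "adapted_process M W T N"
      using XD(2) unfolding adapted_process_def N_def[abs_def] by auto
    have "psq (cut T N) \<le> psq (cut T X)" unfolding cutN by (rule psq_mono) (rule norm_neg_part_le)
    then show "psq (cut T N) < \<infinity>" using XD(4) by simp
  qed
  note ND = L2F_D[OF N]
  have XN: "(\<lambda>s \<omega>. X s \<omega> + N s \<omega>) \<in> L2F M W T" by (rule L2F_add[OF X N])
  have noise0: "AE \<omega> in M. I \<omega> = 0" if t: "t \<in> {0..T}" and good: "AE s in lborel. s \<in> {0..t} \<longrightarrow> (AE \<omega> in M. A0 t s \<omega> \<in> nonneg_matrices \<and> A1 s \<omega> = 0)"
    and I: "vec_ito t (\<lambda>s \<omega>. A1 s \<omega> *v X s \<omega>) I" for t I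
  proof -
    have tT: "t \<le> T" using t by simp
    note nz = noise_props[OF X tT]
    have "psq (noise t X) = (\<integral>\<^sup>+s. 0 \<partial>(lborel :: real measure))"
      unfolding psq_time[OF nz(1)]
    proof (rule nn_integral_cong_AE, use good in eventually_elim)
      case (elim s)
      have "AE \<omega> in M. noise t X s \<omega> = 0"
      proof (cases "s \<in> {0..t}")
        case True
        with elim have "AE \<omega> in M. A1 s \<omega> = 0" by auto
        then show ?thesis by eventually_elim (simp add: cut_def)
      qed (simp add: cut_def)
      then have "msq M (noise t X s) = msq M (\<lambda>_. 0 :: real^'n)" by (intro msq_cong_AE) auto
      then show ?case by simp
    qed
    then have "psq (noise t X) = 0" by simp
    then have "msq M I = 0"
      using vec_ito_lim_dist[OF vec_ito_vec_ito_lim[OF I] vec_ito_lim_zero] by simp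
    moreover have "I \<in> borel_measurable M" using vec_ito_adapted[OF I] t measurable_F_M by auto
    ultimately show ?thesis by (simp add: msq_eq_0_iff)
  qed
  \<comment> \<open>This inequality is used twice: to show that \<open>N\<close> vanishes, and then with \<open>N = 0\<close>.\<close>
  have lower: "AE t in lborel. t \<in> {0..T} \<longrightarrow> (AE \<omega> in M. \<phi> t \<omega> - path_int (drift t N) \<omega> \<le> X t \<omega>)"
    using eq A0_nn
  proof eventually_elim
    case (elim t)
    show ?case
    proof
      assume t: "t \<in> {0..T}"
      from elim(1) t obtain I where I: "vec_ito t (\<lambda>s \<omega>. A1 s \<omega> *v X s \<omega>) I"
        and Xt: "AE \<omega> in M. X t \<omega> - \<phi> t \<omega> = path_int (drift t X) \<omega> + I \<omega>"
        unfolding volt_def by blast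
      have good: "AE s in lborel. s \<in> {0..t} \<longrightarrow> (AE \<omega> in M. A0 t s \<omega> \<in> nonneg_matrices \<and> A1 s \<omega> = 0)"
        using elim(2) t by simp
      note dS = drift_props[OF XN t] and dX = drift_props[OF X t] and dN = drift_props[OF N t]
      have "AE s in lborel. AE \<omega> in M. 0 \<le> drift t (\<lambda>s \<omega>. X s \<omega> + N s \<omega>) s \<omega>"
        using good
      proof eventually_elim
        case (elim s)
        show ?case
        proof (cases "s \<in> {0..t}")
          case True
          with elim have "AE \<omega> in M. A0 t s \<omega> \<in> nonneg_matrices" by auto
          then show ?thesis
          proof eventually_elim
            case (elim \<omega>)
            have "0 \<le> X s \<omega> + N s \<omega>" by (auto simp: N_def less_eq_vec_def)
            from matrix_vector_nonneg[OF elim this] True show ?case by (simp add: cut_def)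
          qed
        qed (simp add: cut_def)
      qed
      from nonneg_path_int[OF dS(1,3,4) AE_time_space_commute[OF dS(1) borel_nonneg_vec this]]
      have "AE \<omega> in M. 0 \<le> path_int (drift t (\<lambda>s \<omega>. X s \<omega> + N s \<omega>)) \<omega>" .
      moreover have "AE \<omega> in M. path_int (drift t (\<lambda>s \<omega>. X s \<omega> + N s \<omega>)) \<omega> - path_int (drift t N) \<omega> = path_int (drift t X) \<omega>"
      proof -
        have "(\<lambda>s \<omega>. drift t (\<lambda>s \<omega>. X s \<omega> + N s \<omega>) s \<omega> - drift t N s \<omega>) = drift t X"
          by (auto simp: cut_def fun_eq_iff matrix_vector_right_distrib scaleR_add_right)
        then show ?thesis using path_int_diff[OF dS(1,3,4) dN(1,3,4)] by simp
      qed
      ultimately show "AE \<omega> in M. \<phi> t \<omega> - path_int (drift t N) \<omega> \<le> X t \<omega>"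
        using Xt noise0[OF t good I]
      proof eventually_elim
        case (elim \<omega>)
        have "X t \<omega> - \<phi> t \<omega> = path_int (drift t (\<lambda>s \<omega>. X s \<omega> + N s \<omega>)) \<omega> - path_int (drift t N) \<omega>"
          using elim(2-4) by simp
        from arg_cong[OF this, of "\<lambda>v. v $ i" for i]
        have *: "X t \<omega> $ i - \<phi> t \<omega> $ i = path_int (drift t (\<lambda>s \<omega>. X s \<omega> + N s \<omega>)) \<omega> $ i - path_int (drift t N) \<omega> $ i" for i
          by simp
        have **: "0 \<le> path_int (drift t (\<lambda>s \<omega>. X s \<omega> + N s \<omega>)) \<omega> $ i" for i
          using elim(1) by (simp add: less_eq_vec_def)
        show ?case
          unfolding less_eq_vec_def
        proof
          fix i
          show "(\<phi> t \<omega> - path_int (drift t N) \<omega>) $ i \<le> X t \<omega> $ i"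
            using *[of i] **[of i] by simp
        qed
      qed
    qed
  qed
  define q where "q s = msq M (cut T N s)" for s
  have qm: "q \<in> borel_measurable borel"
  proof -
    have "(\<lambda>z. ennreal ((norm (cut T N (fst z) (snd z)))\<^sup>2)) \<in> borel_measurable (lborel \<Otimes>\<^sub>M M)"
      using ND(3) unfolding pmeas_def by measurable
    from borel_measurable_nn_integral_fst[OF this] show ?thesis by (simp add: q_def[abs_def] msq_def)
  qed
  have qd: "psq (cut t N) = (\<integral>\<^sup>+s\<in>{0..t}. q s \<partial>lborel)" if "t \<le> T" for t
    unfolding psq_cut_time[OF pmeas_cut[OF ND(1) that]] q_def using that
    by (intro nn_integral_cong) (auto simp: indicator_def cut_def[abs_def])
  have dN: "msq M (path_int (drift t N)) \<le> ennreal (T * K\<^sup>2) * (\<integral>\<^sup>+s\<in>{0..t}. q s \<partial>lborel)" if t: "t \<in> {0..T}" for t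
  proof -
    note d = drift_props[OF N t]
    have "msq M (path_int (drift t N)) \<le> ennreal T * psq (drift t N)" using T_pos by (intro path_int_msq d) auto
    also have "\<dots> \<le> ennreal T * (ennreal (K\<^sup>2) * psq (cut t N))" by (intro mult_left_mono d) auto
    also have "\<dots> = ennreal (T * K\<^sup>2) * (\<integral>\<^sup>+s\<in>{0..t}. q s \<partial>lborel)"
      using T_pos t qd[of t] by (simp add: ennreal_mult mult.assoc)
    finally show ?thesis .
  qed
  have "AE t in lborel. t \<in> {0..T} \<longrightarrow> q t \<le> ennreal (T * K\<^sup>2 + 1) * (\<integral>\<^sup>+s\<in>{0..t}. q s \<partial>lborel)"
    using lower \<phi>0
  proof eventually_elim
    case (elim t)
    show ?case
    proof
      assume t: "t \<in> {0..T}"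
      have "AE \<omega> in M. norm (N t \<omega>) \<le> norm (path_int (drift t N) \<omega>)"
        using elim(1)[rule_format, OF t] elim(2)[rule_format, OF t]
      proof eventually_elim
        case (elim \<omega>)
        show ?case
        proof (rule norm_vec_mono)
          fix i
          have "\<phi> t \<omega> $ i - path_int (drift t N) \<omega> $ i \<le> X t \<omega> $ i" "0 \<le> \<phi> t \<omega> $ i"
            using elim by (auto simp: less_eq_vec_def)
          then show "\<bar>N t \<omega> $ i\<bar> \<le> \<bar>path_int (drift t N) \<omega> $ i\<bar>" by (auto simp: N_def)
        qed
      qed
      then have "msq M (N t) \<le> msq M (path_int (drift t N))" by (rule msq_mono_AE)
      moreover have "q t = msq M (N t)" using t by (simp add: q_def cut_def[abs_def])
      ultimately have "q t \<le> ennreal (T * K\<^sup>2) * (\<integral>\<^sup>+s\<in>{0..t}. q s \<partial>lborel)"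
        using dN[OF t] by simp
      also have "\<dots> \<le> ennreal (T * K\<^sup>2 + 1) * (\<integral>\<^sup>+s\<in>{0..t}. q s \<partial>lborel)"
        by (intro mult_right_mono ennreal_leI) auto
      finally show "q t \<le> ennreal (T * K\<^sup>2 + 1) * (\<integral>\<^sup>+s\<in>{0..t}. q s \<partial>lborel)" .
    qed
  qed
  moreover have "T * K\<^sup>2 + 1 > 0" using T_pos by (intro add_nonneg_pos) auto
  moreover have "(\<integral>\<^sup>+s\<in>{0..T}. q s \<partial>lborel) < \<infinity>" using ND(4) qd[OF order_refl] by simp
  ultimately have "AE t in lborel. t \<in> {0..T} \<longrightarrow> q t = 0" using gronwall_zero[OF qm] by blast
  then have q0: "(\<integral>\<^sup>+s\<in>{0..T}. q s \<partial>lborel) = 0"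
    using qm by (subst nn_integral_0_iff_AE) (auto elim!: eventually_mono simp: indicator_def)
  show ?thesis
    using lower \<phi>0
  proof eventually_elim
    case (elim t)
    show ?case
    proof
      assume t: "t \<in> {0..T}"
      have "(\<integral>\<^sup>+s\<in>{0..t}. q s \<partial>lborel) \<le> (\<integral>\<^sup>+s\<in>{0..T}. q s \<partial>lborel)"
        using t by (intro nn_integral_mono) (auto simp: indicator_def)
      then have "(\<integral>\<^sup>+s\<in>{0..t}. q s \<partial>lborel) = 0" using q0 by simp
      then have "msq M (path_int (drift t N)) = 0" using dN[OF t] by simp
      moreover have "path_int (drift t N) \<in> borel_measurable M"
        using drift_adapted[OF N t] by (rule measurable_F_M)
      ultimately have "AE \<omega> in M. path_int (drift t N) \<omega> = 0" by (simp add: msq_eq_0_iff)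
      with elim(1)[rule_format, OF t] elim(2)[rule_format, OF t]
      show "AE \<omega> in M. \<phi> t \<omega> \<le> X t \<omega> \<and> 0 \<le> \<phi> t \<omega>" by eventually_elim simp
    qed
  qed
qed

end

section \<open>The truncated Euler scheme\<close>

text \<open>Course-of-values recursion: the Volterra structure makes each value depend on all earlier ones.\<close>

fun course_sum :: "(nat \<Rightarrow> 'b::comm_monoid_add) \<Rightarrow> (nat \<Rightarrow> nat \<Rightarrow> 'b \<Rightarrow> 'b) \<Rightarrow> nat \<Rightarrow> 'b" where
  "course_sum g f k = g k + (\<Sum>j<k. f k j (course_sum g f j))"

declare course_sum.simps [simp del]

definition diag_part :: "real^'n^'n \<Rightarrow> real^'n^'n" where
  "diag_part A = (\<chi> i j. if i = j then A $ i $ j else 0)"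

lemma diag_part_vector: "(diag_part A *v x) $ i = A $ i $ i * x $ i"
  by (simp add: diag_part_def matrix_vector_mult_def if_distrib[of "\<lambda>a. a * b" for b] sum.delta cong: if_cong)

lemma diag_part_diagonal: "A \<in> diagonal_matrices \<Longrightarrow> diag_part A = A"
  by (auto simp: diag_part_def diagonal_matrices_def vec_eq_iff)

lemma norm_diag_part_le: "norm (diag_part A) \<le> norm A"
proof (rule power2_le_imp_le)
  have sq: "(norm B)\<^sup>2 = (\<Sum>i\<in>UNIV. (norm (B $ i))\<^sup>2)" for B :: "real^'n^'n"
    by (simp add: norm_vec_def L2_set_def sum_nonneg)
  have "norm (diag_part A $ i) \<le> norm (A $ i)" for i
    by (rule norm_vec_mono) (simp add: diag_part_def)
  then show "(norm (diag_part A))\<^sup>2 \<le> (norm A)\<^sup>2"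
    unfolding sq by (intro sum_mono power_mono) auto
qed simp

lemma entry_le_norm: "\<bar>A $ i $ j\<bar> \<le> norm (A :: real^'n^'n)"
  by (rule order_trans[OF component_le_norm_cart Finite_Cartesian_Product.norm_nth_le])

lemma measurable_mat_lambda:
  fixes f :: "'a \<Rightarrow> real^'n^'m"
  assumes "\<And>i j. (\<lambda>x. f x $ i $ j) \<in> borel_measurable M"
  shows "f \<in> borel_measurable M"
proof (subst borel_measurable_euclidean_space, intro ballI)
  fix b :: "real^'n^'m" assume "b \<in> Basis"
  then obtain i u where b: "b = axis i u" "u \<in> Basis" by (auto simp: Basis_vec_def)
  have "(\<lambda>x. f x $ i) \<in> borel_measurable M" using assms by (rule measurable_vec_lambda)
  then have "(\<lambda>x. f x $ i \<bullet> u) \<in> borel_measurable M" by measurable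
  then show "(\<lambda>x. f x \<bullet> b) \<in> borel_measurable M" by (simp add: b inner_axis)
qed

lemma measurable_diag_part [measurable]: "diag_part \<in> borel_measurable borel"
  by (rule measurable_mat_lambda) (simp add: diag_part_def if_distrib cong: if_cong)

text \<open>Setting large values to 0 is odd, so a truncated symmetric increment remains centred.\<close>

definition trunc :: "real \<Rightarrow> real \<Rightarrow> real" where
  "trunc c x = (if \<bar>x\<bar> \<le> c then x else 0)"

lemma measurable_trunc [measurable]: "trunc c \<in> borel_measurable borel"
  unfolding trunc_def[abs_def] by measurable

lemma discrete_gronwall:
  fixes e :: "nat \<Rightarrow> ennreal"
  assumes a: "0 \<le> a" and b: "0 \<le> b"
    and le: "\<And>k. k \<le> m \<Longrightarrow> e k \<le> ennreal a * (\<Sum>j<k. e j) + ennreal b"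
  shows "k \<le> m \<Longrightarrow> e k \<le> ennreal (b * (1 + a) ^ k)"
proof (induction k rule: less_induct)
  case (less k)
  have geo: "a * (\<Sum>j<k. b * (1 + a) ^ j) + b = b * (1 + a) ^ k"
  proof (induction k)
    case (Suc k)
    have "a * (\<Sum>j<Suc k. b * (1 + a) ^ j) + b = (a * (\<Sum>j<k. b * (1 + a) ^ j) + b) + a * (b * (1 + a) ^ k)"
      by (simp add: algebra_simps)
    then show ?case unfolding Suc by (simp add: algebra_simps)
  qed simp
  have "e k \<le> ennreal a * (\<Sum>j<k. e j) + ennreal b" using le less(2) .
  also have "\<dots> \<le> ennreal a * (\<Sum>j<k. ennreal (b * (1 + a) ^ j)) + ennreal b"
    using less by (intro add_right_mono mult_left_mono sum_mono) auto
  also have "(\<Sum>j<k. ennreal (b * (1 + a) ^ j)) = ennreal (\<Sum>j<k. b * (1 + a) ^ j)"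
    using a b by (intro sum_ennreal) auto
  also have "ennreal a * \<dots> + ennreal b = ennreal (a * (\<Sum>j<k. b * (1 + a) ^ j) + b)"
  proof -
    have "0 \<le> (\<Sum>j<k. b * (1 + a) ^ j)" using a b by (intro sum_nonneg) auto
    then show ?thesis using a b by (simp only: ennreal_mult ennreal_plus mult_nonneg_nonneg)
  qed
  finally show ?case unfolding geo .
qed

context brownian_setting
begin

lemma orthogonal_increments_real:
  fixes f :: "nat \<Rightarrow> 'a \<Rightarrow> real"
  assumes \<tau>: "0 \<le> \<tau> 0" "\<And>j. j < k \<Longrightarrow> \<tau> j < \<tau> (Suc j)" and f: "\<And>j. j < k \<Longrightarrow> sqi (\<tau> j) (f j)"
    and g: "g \<in> borel_measurable borel" "\<And>x. g (- x) = - g x"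
    and gW: "\<And>j. j < k \<Longrightarrow> integrable M (\<lambda>\<omega>. (g (W (\<tau> (Suc j)) \<omega> - W (\<tau> j) \<omega>))\<^sup>2)"
    and v: "\<And>j. j < k \<Longrightarrow> expectation (\<lambda>\<omega>. (g (W (\<tau> (Suc j)) \<omega> - W (\<tau> j) \<omega>))\<^sup>2) \<le> v"
  shows "sqi (\<tau> k) (\<lambda>\<omega>. \<Sum>j<k. g (W (\<tau> (Suc j)) \<omega> - W (\<tau> j) \<omega>) * f j \<omega>) \<and>
    expectation (\<lambda>\<omega>. (\<Sum>j<k. g (W (\<tau> (Suc j)) \<omega> - W (\<tau> j) \<omega>) * f j \<omega>)\<^sup>2) \<le> v * (\<Sum>j<k. expectation (\<lambda>\<omega>. (f j \<omega>)\<^sup>2))"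
  using \<tau>(2) f gW v
proof (induction k)
  case 0
  then show ?case by (simp add: sqi_def)
next
  case (Suc k)
  define S where "S \<omega> = (\<Sum>j<k. g (W (\<tau> (Suc j)) \<omega> - W (\<tau> j) \<omega>) * f j \<omega>)" for \<omega>
  define D where "D \<omega> = W (\<tau> (Suc k)) \<omega> - W (\<tau> k) \<omega>" for \<omega>
  have IH: "sqi (\<tau> k) S" "expectation (\<lambda>\<omega>. (S \<omega>)\<^sup>2) \<le> v * (\<Sum>j<k. expectation (\<lambda>\<omega>. (f j \<omega>)\<^sup>2))"
    using Suc.IH Suc.prems unfolding S_def by auto
  have \<tau>k: "0 \<le> \<tau> k"
  proof -
    have "0 \<le> \<tau> j" if "j \<le> k" for j using that
    proof (induction j)
      case (Suc j)
      then show ?case using Suc.prems \<open>\<And>j. j < Suc k \<Longrightarrow> \<tau> j < \<tau> (Suc j)\<close>[of j] by simp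
    qed (rule \<tau>(1))
    then show ?thesis by simp
  qed
  have lt: "\<tau> k < \<tau> (Suc k)" using Suc.prems(1) by simp
  have fk: "sqi (\<tau> k) (f k)" using Suc.prems(2) by simp
  have gk: "integrable M (\<lambda>\<omega>. (g (D \<omega>))\<^sup>2)" unfolding D_def using Suc.prems(3) by simp
  have Dm [measurable]: "D \<in> borel_measurable M" unfolding D_def[abs_def]
    using \<tau>k lt by (intro borel_measurable_diff W_measurable) auto
  have gD: "integrable M (\<lambda>\<omega>. g (D \<omega>))"
    by (rule square_integrable_imp_integrable[OF _ gk]) (use g in measurable)
  have fF: "f k \<in> borel_measurable (F (\<tau> k))" "integrable M (\<lambda>\<omega>. (f k \<omega>)\<^sup>2)" using fk by (auto simp: sqi_def)
  have SF: "S \<in> borel_measurable (F (\<tau> k))" "integrable M (\<lambda>\<omega>. (S \<omega>)\<^sup>2)" using IH(1) by (auto simp: sqi_def)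
  have Sf: "integrable M (\<lambda>\<omega>. S \<omega> * f k \<omega>)" by (rule sqi_integrable_mult[OF IH(1) fk])
  have cross: "integrable M (\<lambda>\<omega>. S \<omega> * f k \<omega> * g (D \<omega>))" "expectation (\<lambda>\<omega>. S \<omega> * f k \<omega> * g (D \<omega>)) = 0"
  proof -
    have m: "(\<lambda>\<omega>. S \<omega> * f k \<omega>) \<in> borel_measurable (F (\<tau> k))" using SF fF by measurable
    show "integrable M (\<lambda>\<omega>. S \<omega> * f k \<omega> * g (D \<omega>))"
      using integrable_mult_increment[OF \<tau>k lt m Sf g(1)] gD unfolding D_def by simp
    show "expectation (\<lambda>\<omega>. S \<omega> * f k \<omega> * g (D \<omega>)) = 0"
      using expectation_mult_increment[OF \<tau>k lt m Sf g(1)] gD expectation_odd_increment[OF \<tau>k lt g] unfolding D_def by simp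
  qed
  have sq: "integrable M (\<lambda>\<omega>. (f k \<omega>)\<^sup>2 * (g (D \<omega>))\<^sup>2)"
    "expectation (\<lambda>\<omega>. (f k \<omega>)\<^sup>2 * (g (D \<omega>))\<^sup>2) = expectation (\<lambda>\<omega>. (f k \<omega>)\<^sup>2) * expectation (\<lambda>\<omega>. (g (D \<omega>))\<^sup>2)"
  proof -
    have m: "(\<lambda>\<omega>. (f k \<omega>)\<^sup>2) \<in> borel_measurable (F (\<tau> k))" "(\<lambda>x. (g x)\<^sup>2) \<in> borel_measurable borel"
      using fF g by measurable
    show "integrable M (\<lambda>\<omega>. (f k \<omega>)\<^sup>2 * (g (D \<omega>))\<^sup>2)"
      using integrable_mult_increment[OF \<tau>k lt m(1) fF(2) m(2)] gk unfolding D_def by simp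
    show "expectation (\<lambda>\<omega>. (f k \<omega>)\<^sup>2 * (g (D \<omega>))\<^sup>2) = expectation (\<lambda>\<omega>. (f k \<omega>)\<^sup>2) * expectation (\<lambda>\<omega>. (g (D \<omega>))\<^sup>2)"
      using expectation_mult_increment[OF \<tau>k lt m(1) fF(2) m(2)] gk unfolding D_def by simp
  qed
  have eq: "(S \<omega> + g (D \<omega>) * f k \<omega>)\<^sup>2 = (S \<omega>)\<^sup>2 + 2 * (S \<omega> * f k \<omega> * g (D \<omega>)) + (f k \<omega>)\<^sup>2 * (g (D \<omega>))\<^sup>2" for \<omega>
    by (simp add: power2_eq_square algebra_simps)
  have int: "integrable M (\<lambda>\<omega>. (S \<omega> + g (D \<omega>) * f k \<omega>)\<^sup>2)"
    unfolding eq using SF(2) cross(1) sq(1) by (intro Bochner_Integration.integrable_add integrable_mult_right) auto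
  have "expectation (\<lambda>\<omega>. (S \<omega> + g (D \<omega>) * f k \<omega>)\<^sup>2) = expectation (\<lambda>\<omega>. (S \<omega>)\<^sup>2) + expectation (\<lambda>\<omega>. (f k \<omega>)\<^sup>2) * expectation (\<lambda>\<omega>. (g (D \<omega>))\<^sup>2)"
    unfolding eq using SF(2) cross sq by simp
  also have "\<dots> \<le> v * (\<Sum>j<k. expectation (\<lambda>\<omega>. (f j \<omega>)\<^sup>2)) + expectation (\<lambda>\<omega>. (f k \<omega>)\<^sup>2) * v"
    using Suc.prems(4)[of k] unfolding D_def by (intro add_mono IH mult_left_mono) auto
  also have "\<dots> = v * (\<Sum>j<Suc k. expectation (\<lambda>\<omega>. (f j \<omega>)\<^sup>2))" by (simp add: algebra_simps)
  finally have le: "expectation (\<lambda>\<omega>. (S \<omega> + g (D \<omega>) * f k \<omega>)\<^sup>2) \<le> v * (\<Sum>j<Suc k. expectation (\<lambda>\<omega>. (f j \<omega>)\<^sup>2))" .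
  have "(\<lambda>\<omega>. S \<omega> + g (D \<omega>) * f k \<omega>) \<in> borel_measurable (F (\<tau> (Suc k)))"
  proof -
    have [measurable]: "S \<in> borel_measurable (F (\<tau> (Suc k)))" "f k \<in> borel_measurable (F (\<tau> (Suc k)))"
      using SF(1) fF(1) lt by (auto intro: measurable_F_mono)
    have [measurable]: "D \<in> borel_measurable (F (\<tau> (Suc k)))"
      unfolding D_def[abs_def] using \<tau>k lt by (intro borel_measurable_diff W_measurable_F) auto
    show ?thesis using g(1) by measurable
  qed
  with int le show ?case by (simp add: sqi_def S_def D_def)
qed

lemma msq_component_sqi:
  fixes f :: "'a \<Rightarrow> real^'n"
  assumes "f \<in> borel_measurable (F t)" "msq M f < \<infinity>" shows "sqi t (\<lambda>\<omega>. f \<omega> $ i)"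
proof -
  have m: "(\<lambda>\<omega>. f \<omega> $ i) \<in> borel_measurable (F t)" using assms(1) by (rule measurable_vec_nth)
  have "msq M (\<lambda>\<omega>. f \<omega> $ i) < \<infinity>" using msq_component_le assms(2) by (rule le_less_trans)
  then show ?thesis using m integrable_sq_iff_msq[OF measurable_F_M[OF m]] by (simp add: sqi_def)
qed

text \<open>Odd functions of successive increments, multiplied by coefficients known at the start of the
  increment, are orthogonal, so mean squares add up without a factor \<open>k\<close>.\<close>

lemma orthogonal_increments:
  fixes f :: "nat \<Rightarrow> 'a \<Rightarrow> real^'n"
  assumes \<tau>: "0 \<le> \<tau> 0" "\<And>j. j < k \<Longrightarrow> \<tau> j < \<tau> (Suc j)"
    and f: "\<And>j. j < k \<Longrightarrow> f j \<in> borel_measurable (F (\<tau> j))" "\<And>j. j < k \<Longrightarrow> msq M (f j) < \<infinity>"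
    and g: "g \<in> borel_measurable borel" "\<And>x. g (- x) = - g x"
    and gW: "\<And>j. j < k \<Longrightarrow> integrable M (\<lambda>\<omega>. (g (W (\<tau> (Suc j)) \<omega> - W (\<tau> j) \<omega>))\<^sup>2)"
    and v: "\<And>j. j < k \<Longrightarrow> expectation (\<lambda>\<omega>. (g (W (\<tau> (Suc j)) \<omega> - W (\<tau> j) \<omega>))\<^sup>2) \<le> v" and v0: "0 \<le> v"
  shows "(\<lambda>\<omega>. \<Sum>j<k. g (W (\<tau> (Suc j)) \<omega> - W (\<tau> j) \<omega>) *\<^sub>R f j \<omega>) \<in> borel_measurable (F (\<tau> k))"
    and "msq M (\<lambda>\<omega>. \<Sum>j<k. g (W (\<tau> (Suc j)) \<omega> - W (\<tau> j) \<omega>) *\<^sub>R f j \<omega>) \<le> ennreal v * (\<Sum>j<k. msq M (f j))"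
proof -
  let ?S = "\<lambda>\<omega>. \<Sum>j<k. g (W (\<tau> (Suc j)) \<omega> - W (\<tau> j) \<omega>) *\<^sub>R f j \<omega>"
  have sq: "sqi (\<tau> j) (\<lambda>\<omega>. f j \<omega> $ i)" if "j < k" for i j using f that by (intro msq_component_sqi)
  have fM: "f j \<in> borel_measurable M" if "j < k" for j using f(1)[OF that] by (rule measurable_F_M)
  have *: "sqi (\<tau> k) (\<lambda>\<omega>. ?S \<omega> $ i)" "expectation (\<lambda>\<omega>. (?S \<omega> $ i)\<^sup>2) \<le> v * (\<Sum>j<k. expectation (\<lambda>\<omega>. (f j \<omega> $ i)\<^sup>2))" for i
    using orthogonal_increments_real[of \<tau> k "\<lambda>j \<omega>. f j \<omega> $ i", OF \<tau> sq g gW v] by (auto simp: sum_component)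
  show m: "?S \<in> borel_measurable (F (\<tau> k))"
    using *(1) by (intro measurable_vec_lambda) (auto simp: sqi_def)
  have "msq M ?S = (\<Sum>i\<in>UNIV. msq M (\<lambda>\<omega>. ?S \<omega> $ i))" by (rule msq_vec[OF measurable_F_M[OF m]])
  also have "\<dots> \<le> (\<Sum>i\<in>UNIV. ennreal v * (\<Sum>j<k. msq M (\<lambda>\<omega>. f j \<omega> $ i)))"
  proof (rule sum_mono)
    fix i
    have "msq M (\<lambda>\<omega>. ?S \<omega> $ i) = ennreal (expectation (\<lambda>\<omega>. (?S \<omega> $ i)\<^sup>2))"
      using *(1)[of i] by (intro msq_eq_integral) (simp add: sqi_def)
    also have "\<dots> \<le> ennreal (v * (\<Sum>j<k. expectation (\<lambda>\<omega>. (f j \<omega> $ i)\<^sup>2)))" using *(2) by (rule ennreal_leI)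
    also have "\<dots> = ennreal v * (\<Sum>j<k. ennreal (expectation (\<lambda>\<omega>. (f j \<omega> $ i)\<^sup>2)))"
      using v0 by (simp add: ennreal_mult sum_nonneg)
    also have "(\<Sum>j<k. ennreal (expectation (\<lambda>\<omega>. (f j \<omega> $ i)\<^sup>2))) = (\<Sum>j<k. msq M (\<lambda>\<omega>. f j \<omega> $ i))"
      using sq by (intro sum.cong refl msq_eq_integral[symmetric]) (simp add: sqi_def)
    finally show "msq M (\<lambda>\<omega>. ?S \<omega> $ i) \<le> ennreal v * (\<Sum>j<k. msq M (\<lambda>\<omega>. f j \<omega> $ i))" .
  qed
  also have "\<dots> = ennreal v * (\<Sum>j<k. \<Sum>i\<in>UNIV. msq M (\<lambda>\<omega>. f j \<omega> $ i))"
    by (subst sum.swap) (simp add: sum_distrib_left)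
  also have "(\<Sum>j<k. \<Sum>i\<in>UNIV. msq M (\<lambda>\<omega>. f j \<omega> $ i)) = (\<Sum>j<k. msq M (f j))"
    using fM by (intro sum.cong refl msq_vec[symmetric]) auto
  finally show "msq M ?S \<le> ennreal v * (\<Sum>j<k. msq M (f j))" .
qed

text \<open>The squared truncation error of \<open>x\<close> is at most \<open>x\<^sup>4 / c\<^sup>2\<close>, as it vanishes for \<open>\<bar>x\<bar> \<le> c\<close>. The fourth moment of an
  increment makes its expectation quadratic in the length of the interval.\<close>

lemma trunc_increment:
  assumes st: "0 \<le> s" "s < t" and c: "0 < c"
  shows "integrable M (\<lambda>\<omega>. (trunc c (W t \<omega> - W s \<omega>))\<^sup>2)"
    and "expectation (\<lambda>\<omega>. (trunc c (W t \<omega> - W s \<omega>))\<^sup>2) \<le> t - s"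
    and "integrable M (\<lambda>\<omega>. (trunc c (W t \<omega> - W s \<omega>) - (W t \<omega> - W s \<omega>))\<^sup>2)"
    and "expectation (\<lambda>\<omega>. (trunc c (W t \<omega> - W s \<omega>) - (W t \<omega> - W s \<omega>))\<^sup>2) \<le> 3 * (t - s)\<^sup>2 / c\<^sup>2"
proof -
  have [measurable]: "(\<lambda>\<omega>. W t \<omega> - W s \<omega>) \<in> borel_measurable M"
    using st by (intro borel_measurable_diff W_measurable) auto
  note i2 = integrable_increment_power[OF st, of 2] and i4 = integrable_increment_power[OF st, of 4]
  have le2: "(trunc c x)\<^sup>2 \<le> x\<^sup>2" for x by (simp add: trunc_def)
  have le4: "(trunc c x - x)\<^sup>2 \<le> x ^ 4 / c\<^sup>2" for x
  proof (cases "\<bar>x\<bar> \<le> c")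
    case False
    then have "c\<^sup>2 \<le> x\<^sup>2" using c by (intro abs_le_square_iff[THEN iffD1]) auto
    then have "x\<^sup>2 * c\<^sup>2 \<le> x\<^sup>2 * x\<^sup>2" by (intro mult_left_mono) auto
    then have "x\<^sup>2 \<le> x ^ 4 / c\<^sup>2" using c by (simp add: pos_le_divide_eq power2_eq_square power4_eq_xxxx mult.assoc)
    then show ?thesis using False by (simp add: trunc_def)
  qed (simp add: trunc_def)
  show i: "integrable M (\<lambda>\<omega>. (trunc c (W t \<omega> - W s \<omega>))\<^sup>2)"
    by (rule Bochner_Integration.integrable_bound[OF i2]) (use le2 in auto)
  have i4': "integrable M (\<lambda>\<omega>. (W t \<omega> - W s \<omega>) ^ 4 / c\<^sup>2)" using i4 by simp
  show j: "integrable M (\<lambda>\<omega>. (trunc c (W t \<omega> - W s \<omega>) - (W t \<omega> - W s \<omega>))\<^sup>2)"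
    by (rule Bochner_Integration.integrable_bound[OF i4']) (use le4 in auto)
  have "expectation (\<lambda>\<omega>. (trunc c (W t \<omega> - W s \<omega>))\<^sup>2) \<le> expectation (\<lambda>\<omega>. (W t \<omega> - W s \<omega>)\<^sup>2)"
    using le2 by (intro integral_mono i i2)
  then show "expectation (\<lambda>\<omega>. (trunc c (W t \<omega> - W s \<omega>))\<^sup>2) \<le> t - s"
    by (simp add: expectation_increment_sq[OF st])
  have "expectation (\<lambda>\<omega>. (trunc c (W t \<omega> - W s \<omega>) - (W t \<omega> - W s \<omega>))\<^sup>2) \<le> expectation (\<lambda>\<omega>. (W t \<omega> - W s \<omega>) ^ 4 / c\<^sup>2)"
    using le4 by (intro integral_mono j i4')
  then show "expectation (\<lambda>\<omega>. (trunc c (W t \<omega> - W s \<omega>) - (W t \<omega> - W s \<omega>))\<^sup>2) \<le> 3 * (t - s)\<^sup>2 / c\<^sup>2"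
    by (simp add: expectation_increment_4[OF st])
qed

end

lemma bounded_linear_matrix_vector: "bounded_linear (\<lambda>A :: real^'n^'m. A *v x)"
  by (rule bounded_linear_intro[where K = "norm x"])
     (simp_all add: matrix_vector_mult_add_rdistrib scaleR_matrix_vector_assoc norm_matrix_vector_le)

lemma msq_le_mult:
  fixes f g :: "'a \<Rightarrow> 'b::{real_normed_vector, second_countable_topology}"
  assumes g: "g \<in> borel_measurable M" and le: "\<And>\<omega>. \<omega> \<in> space M \<Longrightarrow> norm (f \<omega>) \<le> L * norm (g \<omega>)"
  shows "msq M f \<le> ennreal (L\<^sup>2) * msq M g"
proof -
  have "msq M f \<le> msq M (\<lambda>\<omega>. L *\<^sub>R g \<omega>)"
  proof (intro msq_mono_AE AE_I2)
    fix \<omega> assume "\<omega> \<in> space M"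
    then have "norm (f \<omega>) \<le> L * norm (g \<omega>)" by (rule le)
    also have "\<dots> \<le> \<bar>L\<bar> * norm (g \<omega>)" by (intro mult_right_mono) auto
    finally show "norm (f \<omega>) \<le> norm (L *\<^sub>R g \<omega>)" by simp
  qed
  then show ?thesis using msq_cmult[OF g] by simp
qed

lemma msq_sum_finite:
  fixes f :: "nat \<Rightarrow> 'a \<Rightarrow> 'b::{real_normed_vector, second_countable_topology}"
  assumes "\<And>j. j < k \<Longrightarrow> f j \<in> borel_measurable M" "\<And>j. j < k \<Longrightarrow> msq M (f j) < \<infinity>"
  shows "msq M (\<lambda>\<omega>. \<Sum>j<k. f j \<omega>) < \<infinity>"
  using assms
proof (induction k)
  case (Suc k)
  have "msq M (\<lambda>\<omega>. \<Sum>j<Suc k. f j \<omega>) \<le> 2 * msq M (\<lambda>\<omega>. \<Sum>j<k. f j \<omega>) + 2 * msq M (f k)"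
    unfolding sum.lessThan_Suc using Suc.prems by (intro msq_add_le borel_measurable_sum) auto
  also have "\<dots> < \<infinity>" using Suc by (auto simp: ennreal_mult_less_top)
  finally show ?case .
qed simp

lemma msq_add4_le:
  fixes f1 f2 f3 f4 :: "'a \<Rightarrow> 'b::{real_normed_vector, second_countable_topology}"
  assumes [measurable]: "f1 \<in> borel_measurable M" "f2 \<in> borel_measurable M" "f3 \<in> borel_measurable M" "f4 \<in> borel_measurable M"
  shows "msq M (\<lambda>\<omega>. (f1 \<omega> + f2 \<omega>) + (f3 \<omega> + f4 \<omega>)) \<le> 4 * (msq M f1 + msq M f2 + (msq M f3 + msq M f4))"
proof -
  have "msq M (\<lambda>\<omega>. (f1 \<omega> + f2 \<omega>) + (f3 \<omega> + f4 \<omega>)) \<le> 2 * msq M (\<lambda>\<omega>. f1 \<omega> + f2 \<omega>) + 2 * msq M (\<lambda>\<omega>. f3 \<omega> + f4 \<omega>)"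
    by (rule msq_add_le) measurable
  also have "\<dots> \<le> 2 * (2 * msq M f1 + 2 * msq M f2) + 2 * (2 * msq M f3 + 2 * msq M f4)"
    by (intro add_mono mult_left_mono msq_add_le) auto
  also have "\<dots> = 4 * (msq M f1 + msq M f2 + (msq M f3 + msq M f4))"
    by (simp add: distrib_left mult.assoc[symmetric])
  finally show ?thesis .
qed

text \<open>The scheme is compared with a given solution \<open>X\<close> on the grid \<open>\<theta>, \<theta> + h, \<dots>, \<theta> + m h\<close>. The parameter \<open>c\<close> is
  the level at which increments are truncated; it stays fixed while the grid is refined.\<close>

locale euler_scheme = volterra M W T A0 A1
  for M :: "'a measure" and W :: "real \<Rightarrow> 'a \<Rightarrow> real" and T :: real
    and A0 :: "real \<Rightarrow> real \<Rightarrow> 'a \<Rightarrow> real^'n^'n" and A1 :: "real \<Rightarrow> 'a \<Rightarrow> real^'n^'n" +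
  fixes \<phi> X :: "real \<Rightarrow> 'a \<Rightarrow> real^'n" and \<theta> h c :: real and m :: nat
  assumes \<phi>: "\<phi> \<in> CF M W T" and X: "X \<in> CF M W T" and X_measurable: "measurable_process M T X"
    and X_eq: "\<And>t. t \<in> {0..T} \<Longrightarrow> volt X (\<lambda>\<omega>. X t \<omega> - \<phi> t \<omega>) t"
    and \<theta>: "0 \<le> \<theta>" and h: "0 < h" and grid_end: "\<theta> + real m * h \<le> T" and c: "0 < c"
begin

definition \<tau> :: "nat \<Rightarrow> real" where "\<tau> k = \<theta> + real k * h"

lemma \<tau>_less: "\<tau> j < \<tau> (Suc j)" using h by (simp add: \<tau>_def algebra_simps)

lemma \<tau>_mono: "j \<le> k \<Longrightarrow> \<tau> j \<le> \<tau> k" using h by (auto simp: \<tau>_def intro: mult_right_mono)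

lemma \<tau>_nonneg: "0 \<le> \<tau> k" using h \<theta> by (simp add: \<tau>_def)

lemma \<tau>_in: "k \<le> m \<Longrightarrow> \<tau> k \<in> {0..T}"
  using \<tau>_nonneg[of k] \<tau>_mono[of k m] grid_end by (auto simp: \<tau>_def)

definition cell :: "nat \<Rightarrow> real set" where "cell j = {\<tau> j<..\<tau> (Suc j)}"

lemma cell_length: "emeasure lborel (cell j) = ennreal h"
  using \<tau>_less[of j] by (simp add: cell_def) (simp add: \<tau>_def algebra_simps)

lemma cell_measurable [measurable]: "cell j \<in> sets borel" by (simp add: cell_def)

lemma grid_process_cell: "grid_process \<theta> h k x s \<omega> = (\<Sum>j<k. indicator (cell j) s *\<^sub>R x j \<omega>)"
  by (simp add: grid_process_def cell_def \<tau>_def)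

lemma grid_process_restrict:
  assumes "k \<le> m"
  shows "grid_process \<theta> h k x s \<omega> = (if s \<le> \<tau> k then grid_process \<theta> h m x s \<omega> else 0)"
proof (cases "s \<le> \<tau> k")
  case True
  have "(\<Sum>j<k. indicator (cell j) s *\<^sub>R x j \<omega>) = (\<Sum>j<m. indicator (cell j) s *\<^sub>R x j \<omega>)"
  proof (rule sum.mono_neutral_left)
    show "\<forall>j\<in>{..<m} - {..<k}. indicator (cell j) s *\<^sub>R x j \<omega> = 0"
    proof
      fix j assume "j \<in> {..<m} - {..<k}"
      then have "\<tau> k \<le> \<tau> j" by (intro \<tau>_mono) auto
      then show "indicator (cell j) s *\<^sub>R x j \<omega> = 0" using True by (auto simp: cell_def)
    qed
  qed (use assms in auto)
  then show ?thesis using True by (simp add: grid_process_cell)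
next
  case False
  have "(\<Sum>j<k. indicator (cell j) s *\<^sub>R x j \<omega>) = 0"
  proof (rule sum.neutral, intro ballI)
    fix j assume "j \<in> {..<k}"
    then have "\<tau> (Suc j) \<le> \<tau> k" by (intro \<tau>_mono) auto
    then show "indicator (cell j) s *\<^sub>R x j \<omega> = 0" using False by (auto simp: cell_def)
  qed
  then show ?thesis using False by (simp add: grid_process_cell)
qed

lemma cell_subset: "j < m \<Longrightarrow> cell j \<subseteq> {0..T}"
  using \<tau>_in[of j] \<tau>_in[of "Suc j"] by (auto simp: cell_def)

definition dW :: "nat \<Rightarrow> 'a \<Rightarrow> real" where "dW j \<omega> = W (\<tau> (Suc j)) \<omega> - W (\<tau> j) \<omega>"

text \<open>The diagonal part is taken at each grid point because \<open>A1\<close> is diagonal only for almost every time, and a grid point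
  may be exceptional.\<close>

definition a :: "nat \<Rightarrow> 'a \<Rightarrow> real^'n^'n" where "a j \<omega> = diag_part (A1 (\<tau> j) \<omega>)"

definition kern :: "nat \<Rightarrow> nat \<Rightarrow> real \<Rightarrow> 'a \<Rightarrow> real^'n^'n" where
  "kern k j s \<omega> = indicator (cell j) s *\<^sub>R cut (\<tau> k) (A0 (\<tau> k)) s \<omega>"

definition B :: "nat \<Rightarrow> nat \<Rightarrow> 'a \<Rightarrow> real^'n^'n" where "B k j = path_int (kern k j)"

text \<open>The kernel is integrated exactly, not sampled: it is merely measurable in its second argument, and
  assumptions valid for almost every time enter through the integral.\<close>

definition Y :: "nat \<Rightarrow> 'a \<Rightarrow> real^'n" where
  "Y k \<omega> = course_sum (\<lambda>k. \<phi> (\<tau> k) \<omega>) (\<lambda>k j y. B k j \<omega> *v y + trunc c (dW j \<omega>) *\<^sub>R (a j \<omega> *v y)) k"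

lemma Y_eq: "Y k \<omega> = \<phi> (\<tau> k) \<omega> + (\<Sum>j<k. B k j \<omega> *v Y j \<omega> + trunc c (dW j \<omega>) *\<^sub>R (a j \<omega> *v Y j \<omega>))"
  unfolding Y_def by (subst course_sum.simps) simp

lemma kern_measurable_F: "k \<le> m \<Longrightarrow> (\<lambda>z. kern k j (fst z) (snd z)) \<in> borel_measurable (lborel \<Otimes>\<^sub>M F (\<tau> k))"
proof -
  assume k: "k \<le> m"
  have [measurable]: "(\<lambda>z. cut (\<tau> k) (A0 (\<tau> k)) (fst z) (snd z)) \<in> borel_measurable (lborel \<Otimes>\<^sub>M F (\<tau> k))"
    unfolding cut_def by (rule measurable_process_cut[OF A0_measurable_process_F[OF \<tau>_in[OF k]] order_refl])
  show ?thesis unfolding kern_def by measurable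
qed

lemma kern_measurable: "k \<le> m \<Longrightarrow> pmeas (kern k j)"
  using cut_A0(1)[OF \<tau>_in, of k] unfolding pmeas_def kern_def by measurable

lemma kern_le: "k \<le> m \<Longrightarrow> \<omega> \<in> space M \<Longrightarrow> norm (kern k j s \<omega>) \<le> K * indicator (cell j) s"
  using cut_A0(2)[OF \<tau>_in, of k \<omega> s] by (auto simp: kern_def indicator_def)

lemma integrable_cell: "integrable lborel (\<lambda>s. K * indicator (cell j) s :: real)"
  using cell_length[of j] by (intro integrable_mult_right integrable_real_indicator) auto

lemma kern_integrable:
  assumes k: "k \<le> m" and w: "\<omega> \<in> space M" shows "integrable lborel (\<lambda>s. kern k j s \<omega>)"
proof (rule Bochner_Integration.integrable_bound[OF integrable_cell[of j]])
  show "(\<lambda>s. kern k j s \<omega>) \<in> borel_measurable lborel" using pmeas_path[OF kern_measurable[OF k] w] by simp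
  show "AE s in lborel. norm (kern k j s \<omega>) \<le> norm (K * indicator (cell j) s :: real)"
    using kern_le[OF k w] K_nonneg by (intro AE_I2) (simp add: abs_mult)
qed

lemma B_measurable: "k \<le> m \<Longrightarrow> B k j \<in> borel_measurable (F (\<tau> k))"
  unfolding B_def by (rule path_int_measurable[OF kern_measurable_F])

lemma B_le: assumes k: "k \<le> m" and w: "\<omega> \<in> space M" shows "norm (B k j \<omega>) \<le> K * h"
proof -
  have "norm (B k j \<omega>) \<le> (\<integral>s. norm (kern k j s \<omega>) \<partial>lborel)"
    unfolding B_def path_int_def by (rule integral_norm_bound)
  also have "\<dots> \<le> (\<integral>s. K * indicator (cell j) s \<partial>lborel)"
    using kern_le[OF k w] by (intro integral_mono integrable_norm kern_integrable k w integrable_cell)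
  also have "\<dots> = K * h" using cell_length[of j] h by (simp add: measure_def)
  finally show ?thesis .
qed

lemma a_measurable: "j \<le> m \<Longrightarrow> a j \<in> borel_measurable (F (\<tau> j))"
proof -
  assume "j \<le> m"
  then have [measurable]: "A1 (\<tau> j) \<in> borel_measurable (F (\<tau> j))"
    using A1_adapted \<tau>_in unfolding adapted_process_def by blast
  show ?thesis unfolding a_def[abs_def] by measurable
qed

lemma a_le: "j \<le> m \<Longrightarrow> \<omega> \<in> space M \<Longrightarrow> norm (a j \<omega>) \<le> K"
  unfolding a_def by (rule order_trans[OF norm_diag_part_le A1_le[OF \<tau>_in]])

lemma a_mult_le: "j \<le> m \<Longrightarrow> \<omega> \<in> space M \<Longrightarrow> norm (a j \<omega> *v y) \<le> K * norm y"
  by (rule order_trans[OF norm_matrix_vector_le mult_right_mono[OF a_le]]) auto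

lemma dW_measurable: "dW j \<in> borel_measurable (F (\<tau> (Suc j)))" "dW j \<in> borel_measurable M"
proof -
  show "dW j \<in> borel_measurable (F (\<tau> (Suc j)))"
    unfolding dW_def[abs_def] using \<tau>_nonneg \<tau>_less[of j] by (intro borel_measurable_diff W_measurable_F) (auto intro: less_imp_le)
  then show "dW j \<in> borel_measurable M" by (rule measurable_F_M)
qed

lemma X_adapted: "j \<le> m \<Longrightarrow> X (\<tau> j) \<in> borel_measurable (F (\<tau> j))"
  using CF_D(1)[OF X] \<tau>_in unfolding adapted_process_def by blast

lemma Y_adapted: "k \<le> m \<Longrightarrow> Y k \<in> borel_measurable (F (\<tau> k)) \<and> msq M (Y k) < \<infinity>"
proof (induction k rule: less_induct)
  case (less k)
  have \<phi>k: "\<phi> (\<tau> k) \<in> borel_measurable (F (\<tau> k))" "msq M (\<phi> (\<tau> k)) < \<infinity>"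
    using CF_D(1,2)[OF \<phi>] \<tau>_in[OF less(2)] unfolding adapted_process_def by blast+
  have Yj: "Y j \<in> borel_measurable (F (\<tau> k))" "msq M (Y j) < \<infinity>" if "j < k" for j
    using less that \<tau>_mono[of j k] by (auto intro: measurable_F_mono)
  define f where "f j \<omega> = B k j \<omega> *v Y j \<omega> + trunc c (dW j \<omega>) *\<^sub>R (a j \<omega> *v Y j \<omega>)" for j \<omega>
  have fF: "f j \<in> borel_measurable (F (\<tau> k))" if j: "j < k" for j
  proof -
    have "\<tau> (Suc j) \<le> \<tau> k" "\<tau> j \<le> \<tau> k" using j by (auto intro: \<tau>_mono)
    then have [measurable]: "dW j \<in> borel_measurable (F (\<tau> k))" "a j \<in> borel_measurable (F (\<tau> k))"
      using dW_measurable(1)[of j] a_measurable[of j] j less(2) by (auto intro: measurable_F_mono)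
    note [measurable] = B_measurable[OF less(2), of j] Yj(1)[OF j]
    show ?thesis unfolding f_def[abs_def] by measurable
  qed
  have ff: "msq M (f j) < \<infinity>" if j: "j < k" for j
  proof -
    have "msq M (f j) \<le> ennreal ((K * h + c * K)\<^sup>2) * msq M (Y j)"
    proof (rule msq_le_mult[OF measurable_F_M[OF Yj(1)[OF j]]])
      fix \<omega> assume w: "\<omega> \<in> space M"
      have "norm (f j \<omega>) \<le> norm (B k j \<omega> *v Y j \<omega>) + norm (trunc c (dW j \<omega>) *\<^sub>R (a j \<omega> *v Y j \<omega>))"
        unfolding f_def by (rule norm_triangle_ineq)
      also have "norm (B k j \<omega> *v Y j \<omega>) \<le> K * h * norm (Y j \<omega>)"
        by (rule order_trans[OF norm_matrix_vector_le mult_right_mono[OF B_le[OF less(2) w]]]) auto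
      also have "norm (trunc c (dW j \<omega>) *\<^sub>R (a j \<omega> *v Y j \<omega>)) \<le> c * (K * norm (Y j \<omega>))"
        unfolding norm_scaleR using c a_mult_le[of j \<omega> "Y j \<omega>"] j less(2) w
        by (intro mult_mono) (auto simp: trunc_def)
      finally show "norm (f j \<omega>) \<le> (K * h + c * K) * norm (Y j \<omega>)" by (simp add: algebra_simps)
    qed
    also have "\<dots> < \<infinity>" using Yj(2)[OF j] by (simp add: ennreal_mult_less_top)
    finally show ?thesis .
  qed
  have Yk: "Y k = (\<lambda>\<omega>. \<phi> (\<tau> k) \<omega> + (\<Sum>j<k. f j \<omega>))" unfolding f_def by (rule ext) (rule Y_eq)
  have sm: "(\<lambda>\<omega>. \<Sum>j<k. f j \<omega>) \<in> borel_measurable (F (\<tau> k))" using fF by (intro borel_measurable_sum) auto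
  have "msq M (Y k) \<le> 2 * msq M (\<phi> (\<tau> k)) + 2 * msq M (\<lambda>\<omega>. \<Sum>j<k. f j \<omega>)"
    unfolding Yk by (intro msq_add_le measurable_F_M[OF \<phi>k(1)] measurable_F_M[OF sm])
  also have "\<dots> < \<infinity>"
  proof -
    have "msq M (\<lambda>\<omega>. \<Sum>j<k. f j \<omega>) < \<infinity>" by (rule msq_sum_finite[OF measurable_F_M[OF fF] ff])
    then show ?thesis using \<phi>k(2) by (auto simp: ennreal_mult_less_top)
  qed
  finally show ?case unfolding Yk using \<phi>k(1) sm by (auto intro: borel_measurable_add)
qed

lemma Y_measurable: "k \<le> m \<Longrightarrow> Y k \<in> borel_measurable M"
  using Y_adapted measurable_F_M by blast

lemma X_grid_measurable: "k \<le> m \<Longrightarrow> X (\<tau> k) \<in> borel_measurable M"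
  using X_adapted measurable_F_M by blast

lemma drift_sum:
  assumes k: "k \<le> m" and w: "\<omega> \<in> space M"
  shows "(\<Sum>j<k. B k j \<omega> *v Y j \<omega>) = path_int (\<lambda>s \<omega>. cut (\<tau> k) (A0 (\<tau> k)) s \<omega> *v grid_process \<theta> h k Y s \<omega>) \<omega>"
proof -
  have lin: "A *v (\<Sum>j<k. r j *\<^sub>R y j) = (\<Sum>j<k. (r j *\<^sub>R A) *v y j)" for A :: "real^'n^'n" and r y
    by (induction k) (simp_all add: matrix_vector_right_distrib scaleR_matrix_vector_assoc matrix_vector_mult_scaleR)
  have "path_int (\<lambda>s \<omega>. cut (\<tau> k) (A0 (\<tau> k)) s \<omega> *v grid_process \<theta> h k Y s \<omega>) \<omega> = (\<integral>s. (\<Sum>j<k. kern k j s \<omega> *v Y j \<omega>) \<partial>lborel)"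
    unfolding path_int_def grid_process_cell lin kern_def ..
  also have "\<dots> = (\<Sum>j<k. \<integral>s. kern k j s \<omega> *v Y j \<omega> \<partial>lborel)"
    by (intro Bochner_Integration.integral_sum integrable_bounded_linear[OF bounded_linear_matrix_vector] kern_integrable k w)
  also have "\<dots> = (\<Sum>j<k. B k j \<omega> *v Y j \<omega>)"
    unfolding B_def path_int_def
    by (intro sum.cong refl integral_bounded_linear[OF bounded_linear_matrix_vector] kern_integrable k w)
  finally show ?thesis ..
qed

definition e :: "nat \<Rightarrow> ennreal" where "e j = msq M (\<lambda>\<omega>. Y j \<omega> - X (\<tau> j) \<omega>)"

abbreviation "gX \<equiv> \<lambda>k. grid_process \<theta> h k (\<lambda>j. X (\<tau> j))"
abbreviation "gaX \<equiv> \<lambda>k. grid_process \<theta> h k (\<lambda>j \<omega>. a j \<omega> *v X (\<tau> j) \<omega>)"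

lemma X_L2F: "X \<in> L2F M W T" using T_pos by (intro CF_L2F X X_measurable) auto

lemma YX_measurable: "j \<le> m \<Longrightarrow> (\<lambda>\<omega>. Y j \<omega> - X (\<tau> j) \<omega>) \<in> borel_measurable (F (\<tau> j))"
  using Y_adapted X_adapted by (blast intro: borel_measurable_diff)

lemma e_finite: "j \<le> m \<Longrightarrow> e j < \<infinity>"
proof -
  assume j: "j \<le> m"
  have "e j \<le> 2 * msq M (Y j) + 2 * msq M (X (\<tau> j))"
    using msq_triangle[of "Y j" M "\<lambda>_. 0" "X (\<tau> j)"] Y_adapted[OF j] X_adapted[OF j] measurable_F_M
    unfolding e_def by (auto simp: msq_def)
  also have "\<dots> < \<infinity>" using Y_adapted[OF j] CF_D(2)[OF X \<tau>_in[OF j]] by (auto simp: ennreal_mult_less_top)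
  finally show ?thesis .
qed

text \<open>The errors at the grid points, spread over their cells, plus the error of freezing \<open>X\<close> on the cells.\<close>

lemma grid_error:
  assumes k: "k \<le> m"
  shows "psq (\<lambda>s \<omega>. grid_process \<theta> h k Y s \<omega> - cut (\<tau> k) X s \<omega>) \<le>
    2 * (ennreal h * (\<Sum>j<k. e j)) + 2 * psq (\<lambda>s \<omega>. gX m s \<omega> - cut T X s \<omega>)"
proof -
  have pY: "pmeas (grid_process \<theta> h k Y)" using Y_measurable k by (intro pmeas_grid_process) auto
  have pX: "pmeas (gX k)" using X_grid_measurable k by (intro pmeas_grid_process) auto
  have pc: "pmeas (cut (\<tau> k) X)" using \<tau>_in[OF k] by (intro pmeas_cut[OF X_measurable]) auto
  have "psq (\<lambda>s \<omega>. grid_process \<theta> h k Y s \<omega> - cut (\<tau> k) X s \<omega>) \<le>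
    2 * psq (\<lambda>s \<omega>. grid_process \<theta> h k Y s \<omega> - gX k s \<omega>) + 2 * psq (\<lambda>s \<omega>. gX k s \<omega> - cut (\<tau> k) X s \<omega>)"
    by (rule psq_triangle[OF pY pX pc])
  also have "psq (\<lambda>s \<omega>. grid_process \<theta> h k Y s \<omega> - gX k s \<omega>) = ennreal h * (\<Sum>j<k. e j)"
  proof -
    have eq: "(\<lambda>s \<omega>. grid_process \<theta> h k Y s \<omega> - gX k s \<omega>) = grid_process \<theta> h k (\<lambda>j \<omega>. Y j \<omega> - X (\<tau> j) \<omega>)"
      by (auto simp: grid_process_def fun_eq_iff scaleR_diff_right sum_subtractf)
    have m': "(\<lambda>\<omega>. Y j \<omega> - X (\<tau> j) \<omega>) \<in> borel_measurable M" if "j < k" for j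
      using YX_measurable[of j] that k measurable_F_M by auto
    show ?thesis unfolding eq using psq_grid_process[of k "\<lambda>j \<omega>. Y j \<omega> - X (\<tau> j) \<omega>" h \<theta>] m' h
      by (simp add: e_def sum_distrib_left)
  qed
  also have "psq (\<lambda>s \<omega>. gX k s \<omega> - cut (\<tau> k) X s \<omega>) \<le> psq (\<lambda>s \<omega>. gX m s \<omega> - cut T X s \<omega>)"
    using \<tau>_in[OF k] by (intro psq_mono) (auto simp: grid_process_restrict[OF k] cut_def indicator_def)
  finally show ?thesis by (simp add: mult_left_mono)
qed

lemma drift_error:
  assumes k: "k \<le> m"
  shows "msq M (\<lambda>\<omega>. (\<Sum>j<k. B k j \<omega> *v Y j \<omega>) - path_int (drift (\<tau> k) X) \<omega>) \<le>
    ennreal (T * K\<^sup>2) * (2 * (ennreal h * (\<Sum>j<k. e j)) + 2 * psq (\<lambda>s \<omega>. gX m s \<omega> - cut T X s \<omega>))"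
proof -
  note t = \<tau>_in[OF k]
  note d = drift_props[OF X_L2F t]
  have pY: "pmeas (grid_process \<theta> h k Y)" using Y_measurable k by (intro pmeas_grid_process) auto
  let ?G = "\<lambda>s \<omega>. cut (\<tau> k) (A0 (\<tau> k)) s \<omega> *v grid_process \<theta> h k Y s \<omega>"
  have pG: "pmeas ?G" by (intro pmeas_mult cut_A0 t pY)
  have "psq (grid_process \<theta> h k Y) = (\<Sum>j<k. ennreal h * msq M (Y j))"
    using Y_measurable k h by (intro psq_grid_process) auto
  also have "\<dots> < \<infinity>" using Y_adapted k by (auto simp: ennreal_mult_less_top)
  finally have fY: "psq (grid_process \<theta> h k Y) < \<infinity>" .
  have "psq ?G \<le> ennreal (K\<^sup>2) * psq (grid_process \<theta> h k Y)" by (intro psq_mult_le cut_A0(2)[OF t] pY)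
  also have "\<dots> < \<infinity>" using fY by (simp add: ennreal_mult_less_top)
  finally have fG: "psq ?G < \<infinity>" .
  have sG: "supported T ?G" using t by (auto simp: supported_def cut_def indicator_def)
  have "msq M (\<lambda>\<omega>. (\<Sum>j<k. B k j \<omega> *v Y j \<omega>) - path_int (drift (\<tau> k) X) \<omega>) = msq M (\<lambda>\<omega>. path_int ?G \<omega> - path_int (drift (\<tau> k) X) \<omega>)"
    using drift_sum[OF k] by (intro msq_cong_AE AE_I2) simp
  also have "\<dots> \<le> ennreal T * psq (\<lambda>s \<omega>. ?G s \<omega> - drift (\<tau> k) X s \<omega>)"
    using T_pos by (intro path_int_dist pG fG sG d) auto
  also have "psq (\<lambda>s \<omega>. ?G s \<omega> - drift (\<tau> k) X s \<omega>) \<le> ennreal (K\<^sup>2) * psq (\<lambda>s \<omega>. grid_process \<theta> h k Y s \<omega> - cut (\<tau> k) X s \<omega>)"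
  proof -
    have pc: "pmeas (cut (\<tau> k) X)" using t by (intro pmeas_cut[OF X_measurable]) auto
    show ?thesis
      unfolding cut_mult matrix_vector_mult_diff_distrib[symmetric]
      using pY pc by (intro psq_mult_le cut_A0(2)[OF t]) (auto simp: pmeas_def)
  qed
  also have "psq (\<lambda>s \<omega>. grid_process \<theta> h k Y s \<omega> - cut (\<tau> k) X s \<omega>) \<le> 2 * (ennreal h * (\<Sum>j<k. e j)) + 2 * psq (\<lambda>s \<omega>. gX m s \<omega> - cut T X s \<omega>)"
    by (rule grid_error[OF k])
  finally show ?thesis using T_pos by (simp add: mult_left_mono ennreal_mult mult.assoc)
qed

text \<open>Orthogonality of the truncated increments, each of which has variance at most \<open>h\<close>.\<close>

lemma noise_error_propagated:
  assumes k: "k \<le> m"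
  shows "msq M (\<lambda>\<omega>. \<Sum>j<k. trunc c (dW j \<omega>) *\<^sub>R (a j \<omega> *v (Y j \<omega> - X (\<tau> j) \<omega>))) \<le> ennreal (h * K\<^sup>2) * (\<Sum>j<k. e j)"
    and "(\<lambda>\<omega>. \<Sum>j<k. trunc c (dW j \<omega>) *\<^sub>R (a j \<omega> *v (Y j \<omega> - X (\<tau> j) \<omega>))) \<in> borel_measurable M"
proof -
  define f where "f j \<omega> = a j \<omega> *v (Y j \<omega> - X (\<tau> j) \<omega>)" for j \<omega>
  have f: "f j \<in> borel_measurable (F (\<tau> j))" if "j < k" for j
    unfolding f_def[abs_def] using that k a_measurable YX_measurable by (intro measurable_matrix_vector) auto
  have fe: "msq M (f j) \<le> ennreal (K\<^sup>2) * e j" if "j < k" for j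
    unfolding f_def e_def using that k YX_measurable[of j] measurable_F_M
    by (intro msq_le_mult a_mult_le) auto
  have ff: "msq M (f j) < \<infinity>" if "j < k" for j
    using fe[OF that] e_finite[of j] that k by (auto simp: ennreal_mult_less_top intro: le_less_trans)
  have odd: "trunc c (- x) = - trunc c x" for x by (simp add: trunc_def)
  have len: "\<tau> (Suc j) - \<tau> j = h" for j by (simp add: \<tau>_def algebra_simps)
  note ti = trunc_increment[OF \<tau>_nonneg \<tau>_less c, unfolded len]
  have o: "(\<lambda>\<omega>. \<Sum>j<k. trunc c (W (\<tau> (Suc j)) \<omega> - W (\<tau> j) \<omega>) *\<^sub>R f j \<omega>) \<in> borel_measurable (F (\<tau> k))"
    "msq M (\<lambda>\<omega>. \<Sum>j<k. trunc c (W (\<tau> (Suc j)) \<omega> - W (\<tau> j) \<omega>) *\<^sub>R f j \<omega>) \<le> ennreal h * (\<Sum>j<k. msq M (f j))"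
    using h by (auto intro!: orthogonal_increments \<tau>_nonneg \<tau>_less f ff odd ti)
  show "(\<lambda>\<omega>. \<Sum>j<k. trunc c (dW j \<omega>) *\<^sub>R (a j \<omega> *v (Y j \<omega> - X (\<tau> j) \<omega>))) \<in> borel_measurable M"
    using measurable_F_M[OF o(1)] unfolding f_def dW_def .
  have "msq M (\<lambda>\<omega>. \<Sum>j<k. trunc c (dW j \<omega>) *\<^sub>R (a j \<omega> *v (Y j \<omega> - X (\<tau> j) \<omega>))) \<le> ennreal h * (\<Sum>j<k. msq M (f j))"
    using o(2) unfolding f_def dW_def .
  also have "\<dots> \<le> ennreal h * (\<Sum>j<k. ennreal (K\<^sup>2) * e j)" using fe by (intro mult_left_mono sum_mono) auto
  also have "\<dots> = ennreal (h * K\<^sup>2) * (\<Sum>j<k. e j)" using h by (simp add: sum_distrib_left[symmetric] ennreal_mult mult.assoc)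
  finally show "msq M (\<lambda>\<omega>. \<Sum>j<k. trunc c (dW j \<omega>) *\<^sub>R (a j \<omega> *v (Y j \<omega> - X (\<tau> j) \<omega>))) \<le> ennreal (h * K\<^sup>2) * (\<Sum>j<k. e j)" .
qed

text \<open>Each of at most \<open>T/h\<close> cells contributes \<open>O(h\<^sup>2)\<close>.\<close>

lemma noise_error_truncation:
  assumes k: "k \<le> m" and b: "0 \<le> b" "\<And>t. t \<in> {0..T} \<Longrightarrow> msq M (X t) \<le> ennreal b"
  shows "msq M (\<lambda>\<omega>. \<Sum>j<k. (trunc c (dW j \<omega>) - dW j \<omega>) *\<^sub>R (a j \<omega> *v X (\<tau> j) \<omega>)) \<le> ennreal (3 * T * K\<^sup>2 * b * h / c\<^sup>2)"
    and "(\<lambda>\<omega>. \<Sum>j<k. (trunc c (dW j \<omega>) - dW j \<omega>) *\<^sub>R (a j \<omega> *v X (\<tau> j) \<omega>)) \<in> borel_measurable M"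
proof -
  define f where "f j \<omega> = a j \<omega> *v X (\<tau> j) \<omega>" for j \<omega>
  have f: "f j \<in> borel_measurable (F (\<tau> j))" if "j < k" for j
    unfolding f_def[abs_def] using that k a_measurable X_adapted by (intro measurable_matrix_vector) auto
  have fe: "msq M (f j) \<le> ennreal (K\<^sup>2 * b)" if "j < k" for j
  proof -
    have "msq M (f j) \<le> ennreal (K\<^sup>2) * msq M (X (\<tau> j))"
      unfolding f_def using that k X_adapted[of j] measurable_F_M by (intro msq_le_mult a_mult_le) auto
    also have "\<dots> \<le> ennreal (K\<^sup>2) * ennreal b" using that k by (intro mult_left_mono b \<tau>_in) auto
    finally show ?thesis using b by (simp add: ennreal_mult)
  qed
  have ff: "msq M (f j) < \<infinity>" if "j < k" for j
    using fe[OF that] by (auto intro: le_less_trans)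
  define g where "g x = trunc c x - x" for x
  have gm: "g \<in> borel_measurable borel" unfolding g_def[abs_def] by measurable
  have odd: "g (- x) = - g x" for x by (simp add: g_def trunc_def)
  have len: "\<tau> (Suc j) - \<tau> j = h" for j by (simp add: \<tau>_def algebra_simps)
  note ti = trunc_increment[OF \<tau>_nonneg \<tau>_less c, folded g_def, unfolded len]
  have o: "(\<lambda>\<omega>. \<Sum>j<k. g (W (\<tau> (Suc j)) \<omega> - W (\<tau> j) \<omega>) *\<^sub>R f j \<omega>) \<in> borel_measurable (F (\<tau> k))"
    "msq M (\<lambda>\<omega>. \<Sum>j<k. g (W (\<tau> (Suc j)) \<omega> - W (\<tau> j) \<omega>) *\<^sub>R f j \<omega>) \<le> ennreal (3 * h\<^sup>2 / c\<^sup>2) * (\<Sum>j<k. msq M (f j))"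
    by (auto intro!: orthogonal_increments \<tau>_nonneg \<tau>_less f ff odd ti gm)
  show "(\<lambda>\<omega>. \<Sum>j<k. (trunc c (dW j \<omega>) - dW j \<omega>) *\<^sub>R (a j \<omega> *v X (\<tau> j) \<omega>)) \<in> borel_measurable M"
    using measurable_F_M[OF o(1)] unfolding f_def dW_def g_def .
  have "msq M (\<lambda>\<omega>. \<Sum>j<k. (trunc c (dW j \<omega>) - dW j \<omega>) *\<^sub>R (a j \<omega> *v X (\<tau> j) \<omega>)) \<le> ennreal (3 * h\<^sup>2 / c\<^sup>2) * (\<Sum>j<k. msq M (f j))"
    using o(2) unfolding f_def dW_def g_def .
  also have "\<dots> \<le> ennreal (3 * h\<^sup>2 / c\<^sup>2) * (\<Sum>j<k. ennreal (K\<^sup>2 * b))" using fe by (intro mult_left_mono sum_mono) auto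
  also have "(\<Sum>j<k. ennreal (K\<^sup>2 * b)) = ennreal (real k * (K\<^sup>2 * b))"
    using b by (subst sum_ennreal) auto
  also have "ennreal (3 * h\<^sup>2 / c\<^sup>2) * \<dots> = ennreal (3 * h\<^sup>2 / c\<^sup>2 * (real k * (K\<^sup>2 * b)))"
    using b by (subst ennreal_mult[symmetric]) auto
  also have "\<dots> \<le> ennreal (3 * T * K\<^sup>2 * b * h / c\<^sup>2)"
  proof (rule ennreal_leI)
    have "real k * h \<le> real m * h" using k h by (intro mult_right_mono) auto
    then have "real k * h \<le> T" using grid_end \<theta> by linarith
    then have "(3 * K\<^sup>2 * b * h / c\<^sup>2) * (real k * h) \<le> (3 * K\<^sup>2 * b * h / c\<^sup>2) * T"
      using b h by (intro mult_left_mono) auto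
    then show "3 * h\<^sup>2 / c\<^sup>2 * (real k * (K\<^sup>2 * b)) \<le> 3 * T * K\<^sup>2 * b * h / c\<^sup>2"
      by (simp add: power2_eq_square mult_ac)
  qed
  finally show "msq M (\<lambda>\<omega>. \<Sum>j<k. (trunc c (dW j \<omega>) - dW j \<omega>) *\<^sub>R (a j \<omega> *v X (\<tau> j) \<omega>)) \<le> ennreal (3 * T * K\<^sup>2 * b * h / c\<^sup>2)" .
qed

text \<open>The sum of untruncated increments is the Ito integral of a step process, so its distance to the
  integral of \<open>A1 X\<close> is controlled by the distance of the integrands.\<close>

lemma noise_error_sampling:
  assumes k: "k \<le> m" and I: "vec_ito (\<tau> k) (\<lambda>s \<omega>. A1 s \<omega> *v X s \<omega>) I"
  shows "msq M (\<lambda>\<omega>. (\<Sum>j<k. dW j \<omega> *\<^sub>R (a j \<omega> *v X (\<tau> j) \<omega>)) - I \<omega>) \<le> 16 * psq (\<lambda>s \<omega>. gaX m s \<omega> - noise T X s \<omega>)"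
    and "(\<lambda>\<omega>. \<Sum>j<k. dW j \<omega> *\<^sub>R (a j \<omega> *v X (\<tau> j) \<omega>)) \<in> borel_measurable M"
proof -
  define f where "f j \<omega> = a j \<omega> *v X (\<tau> j) \<omega>" for j \<omega>
  have f: "f j \<in> borel_measurable (F (\<tau> j))" if "j < k" for j
    unfolding f_def[abs_def] using that k a_measurable X_adapted by (intro measurable_matrix_vector) auto
  have ff: "msq M (f j) < \<infinity>" if "j < k" for j
  proof -
    have "msq M (f j) \<le> ennreal (K\<^sup>2) * msq M (X (\<tau> j))"
      unfolding f_def using that k X_adapted[of j] measurable_F_M by (intro msq_le_mult a_mult_le) auto
    also have "\<dots> < \<infinity>" using CF_D(2)[OF X \<tau>_in[of j]] that k by (simp add: ennreal_mult_less_top)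
    finally show ?thesis .
  qed
  have sd: "simple_data {..<k} \<tau> (\<lambda>j. \<tau> (Suc j)) (\<lambda>j \<omega>. f j \<omega> $ i)" for i
    unfolding simple_data_def using \<tau>_nonneg \<tau>_less f ff by (auto intro: less_imp_le msq_component_sqi)
  have "vec_ito_lim (grid_process \<theta> h k f) (\<lambda>\<omega>. \<Sum>j<k. dW j \<omega> *\<^sub>R f j \<omega>)"
    unfolding vec_ito_lim_def
  proof
    fix i
    have 1: "simple_process {..<k} \<tau> (\<lambda>j. \<tau> (Suc j)) (\<lambda>j \<omega>. f j \<omega> $ i) = (\<lambda>s \<omega>. grid_process \<theta> h k f s \<omega> $ i)"
      by (auto simp: simple_process_def grid_process_cell cell_def fun_eq_iff sum_component mult.commute)
    have 2: "simple_integral {..<k} \<tau> (\<lambda>j. \<tau> (Suc j)) (\<lambda>j \<omega>. f j \<omega> $ i) = (\<lambda>\<omega>. (\<Sum>j<k. dW j \<omega> *\<^sub>R f j \<omega>) $ i)"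
      by (auto simp: simple_integral_def dW_def fun_eq_iff sum_component mult.commute)
    show "ito_lim (\<lambda>s \<omega>. grid_process \<theta> h k f s \<omega> $ i) (\<lambda>\<omega>. (\<Sum>j<k. dW j \<omega> *\<^sub>R f j \<omega>) $ i)"
      using ito_lim_simple[OF sd[of i]] unfolding 1 2 .
  qed
  from vec_ito_lim_dist[OF this vec_ito_vec_ito_lim[OF I]]
  have "msq M (\<lambda>\<omega>. (\<Sum>j<k. dW j \<omega> *\<^sub>R f j \<omega>) - I \<omega>) \<le> 16 * psq (\<lambda>s \<omega>. grid_process \<theta> h k f s \<omega> - noise (\<tau> k) X s \<omega>)" .
  also have "psq (\<lambda>s \<omega>. grid_process \<theta> h k f s \<omega> - noise (\<tau> k) X s \<omega>) \<le> psq (\<lambda>s \<omega>. grid_process \<theta> h m f s \<omega> - noise T X s \<omega>)"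
    using \<tau>_in[OF k] by (intro psq_mono) (auto simp: grid_process_restrict[OF k] cut_def indicator_def)
  finally show "msq M (\<lambda>\<omega>. (\<Sum>j<k. dW j \<omega> *\<^sub>R (a j \<omega> *v X (\<tau> j) \<omega>)) - I \<omega>) \<le> 16 * psq (\<lambda>s \<omega>. gaX m s \<omega> - noise T X s \<omega>)"
    unfolding f_def by (simp add: mult_left_mono)
  show "(\<lambda>\<omega>. \<Sum>j<k. dW j \<omega> *\<^sub>R (a j \<omega> *v X (\<tau> j) \<omega>)) \<in> borel_measurable M"
    using measurable_F_M[OF f] dW_measurable(2) unfolding f_def by (intro borel_measurable_sum borel_measurable_scaleR) auto
qed

text \<open>Split the error into drift, propagated, truncation and sampling errors. The first two are
  bounded by \<open>h\<close> times the sum of earlier errors plus a small term, which calls for the discrete Gronwall lemma.\<close>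

theorem euler_error:
  assumes \<delta>: "0 \<le> \<delta>" "psq (\<lambda>s \<omega>. gX m s \<omega> - cut T X s \<omega>) \<le> ennreal \<delta>"
    and \<delta>': "0 \<le> \<delta>'" "psq (\<lambda>s \<omega>. gaX m s \<omega> - noise T X s \<omega>) \<le> ennreal \<delta>'"
    and b: "0 \<le> b" "\<And>t. t \<in> {0..T} \<Longrightarrow> msq M (X t) \<le> ennreal b" and k: "k \<le> m"
  shows "msq M (\<lambda>\<omega>. Y k \<omega> - X (\<tau> k) \<omega>) \<le>
    ennreal ((8 * T * K\<^sup>2 * \<delta> + 12 * T * K\<^sup>2 * b * h / c\<^sup>2 + 64 * \<delta>') * exp ((8 * T * K\<^sup>2 + 4 * K\<^sup>2) * T))"
proof -
  define L where "L = 8 * T * K\<^sup>2 + 4 * K\<^sup>2"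
  define E where "E = 8 * T * K\<^sup>2 * \<delta> + 12 * T * K\<^sup>2 * b * h / c\<^sup>2 + 64 * \<delta>'"
  have L: "0 \<le> L" using T_pos by (simp add: L_def)
  have E: "0 \<le> E" using T_pos \<delta> \<delta>' b h by (auto simp: E_def intro!: add_nonneg_nonneg)
  have rec: "e k \<le> ennreal (L * h) * (\<Sum>j<k. e j) + ennreal E" if k: "k \<le> m" for k
  proof -
    obtain I where I: "vec_ito (\<tau> k) (\<lambda>s \<omega>. A1 s \<omega> *v X s \<omega>) I"
      and Xk: "AE \<omega> in M. X (\<tau> k) \<omega> - \<phi> (\<tau> k) \<omega> = path_int (drift (\<tau> k) X) \<omega> + I \<omega>"
      using X_eq[OF \<tau>_in[OF k]] unfolding volt_def by blast
    have mI: "I \<in> borel_measurable M" using vec_ito_adapted[OF I \<tau>_nonneg] by (rule measurable_F_M)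
    define S0 where "S0 \<omega> = (\<Sum>j<k. B k j \<omega> *v Y j \<omega>) - path_int (drift (\<tau> k) X) \<omega>" for \<omega>
    define S1 where "S1 \<omega> = (\<Sum>j<k. trunc c (dW j \<omega>) *\<^sub>R (a j \<omega> *v (Y j \<omega> - X (\<tau> j) \<omega>)))" for \<omega>
    define S2 where "S2 \<omega> = (\<Sum>j<k. (trunc c (dW j \<omega>) - dW j \<omega>) *\<^sub>R (a j \<omega> *v X (\<tau> j) \<omega>))" for \<omega>
    define S3 where "S3 \<omega> = (\<Sum>j<k. dW j \<omega> *\<^sub>R (a j \<omega> *v X (\<tau> j) \<omega>)) - I \<omega>" for \<omega>
    have mS: "S0 \<in> borel_measurable M" "S1 \<in> borel_measurable M" "S2 \<in> borel_measurable M" "S3 \<in> borel_measurable M"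
    proof -
      have "(\<lambda>\<omega>. \<Sum>j<k. B k j \<omega> *v Y j \<omega>) \<in> borel_measurable M"
        using measurable_F_M[OF B_measurable[OF k]] Y_measurable k
        by (intro borel_measurable_sum measurable_matrix_vector) auto
      then show "S0 \<in> borel_measurable M"
        unfolding S0_def[abs_def] using measurable_F_M[OF drift_adapted[OF X_L2F \<tau>_in[OF k]]] by (rule borel_measurable_diff)
      show "S1 \<in> borel_measurable M" unfolding S1_def[abs_def] by (rule noise_error_propagated(2)[OF k])
      show "S2 \<in> borel_measurable M" unfolding S2_def[abs_def] by (rule noise_error_truncation(2)[OF k b])
      show "S3 \<in> borel_measurable M" unfolding S3_def[abs_def] using noise_error_sampling(2)[OF k I] mI by (rule borel_measurable_diff)
    qed
    have "e k = msq M (\<lambda>\<omega>. (S0 \<omega> + S1 \<omega>) + (S2 \<omega> + S3 \<omega>))"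
      unfolding e_def
    proof (rule msq_cong_AE, use Xk in eventually_elim)
      case (elim \<omega>)
      have "(\<Sum>j<k. B k j \<omega> *v Y j \<omega> + trunc c (dW j \<omega>) *\<^sub>R (a j \<omega> *v Y j \<omega>)) = (\<Sum>j<k. B k j \<omega> *v Y j \<omega>) + S1 \<omega> + S2 \<omega> + (S3 \<omega> + I \<omega>)"
        unfolding S1_def S2_def S3_def
        by (simp add: sum.distrib[symmetric] matrix_vector_mult_diff_distrib scaleR_diff_right scaleR_diff_left)
      then have "Y k \<omega> = \<phi> (\<tau> k) \<omega> + ((\<Sum>j<k. B k j \<omega> *v Y j \<omega>) + S1 \<omega> + S2 \<omega> + (S3 \<omega> + I \<omega>))"
        using Y_eq[of k \<omega>] by simp
      moreover have "X (\<tau> k) \<omega> = \<phi> (\<tau> k) \<omega> + path_int (drift (\<tau> k) X) \<omega> + I \<omega>"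
        using elim by (simp add: algebra_simps)
      ultimately have "Y k \<omega> - X (\<tau> k) \<omega> = (S0 \<omega> + S1 \<omega>) + (S2 \<omega> + S3 \<omega>)"
        unfolding S0_def by (simp add: algebra_simps)
      then show ?case by simp
    qed
    also have "\<dots> \<le> 4 * (msq M S0 + msq M S1 + (msq M S2 + msq M S3))" by (rule msq_add4_le[OF mS])
    also have "\<dots> \<le> 4 * (ennreal (T * K\<^sup>2) * (2 * (ennreal h * (\<Sum>j<k. e j)) + 2 * ennreal \<delta>) + ennreal (h * K\<^sup>2) * (\<Sum>j<k. e j)
        + (ennreal (3 * T * K\<^sup>2 * b * h / c\<^sup>2) + 16 * ennreal \<delta>'))"
    proof (intro mult_left_mono add_mono)
      have "msq M S0 \<le> ennreal (T * K\<^sup>2) * (2 * (ennreal h * (\<Sum>j<k. e j)) + 2 * psq (\<lambda>s \<omega>. gX m s \<omega> - cut T X s \<omega>))"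
        unfolding S0_def by (rule drift_error[OF k])
      also have "\<dots> \<le> ennreal (T * K\<^sup>2) * (2 * (ennreal h * (\<Sum>j<k. e j)) + 2 * ennreal \<delta>)"
        by (intro mult_left_mono add_left_mono \<delta>) auto
      finally show "msq M S0 \<le> ennreal (T * K\<^sup>2) * (2 * (ennreal h * (\<Sum>j<k. e j)) + 2 * ennreal \<delta>)" .
      show "msq M S1 \<le> ennreal (h * K\<^sup>2) * (\<Sum>j<k. e j)" unfolding S1_def by (rule noise_error_propagated(1)[OF k])
      show "msq M S2 \<le> ennreal (3 * T * K\<^sup>2 * b * h / c\<^sup>2)" unfolding S2_def by (rule noise_error_truncation(1)[OF k b])
      have "msq M S3 \<le> 16 * psq (\<lambda>s \<omega>. gaX m s \<omega> - noise T X s \<omega>)" unfolding S3_def by (rule noise_error_sampling(1)[OF k I])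
      also have "\<dots> \<le> 16 * ennreal \<delta>'" by (intro mult_left_mono \<delta>') auto
      finally show "msq M S3 \<le> 16 * ennreal \<delta>'" .
    qed auto
    also have "\<dots> = ennreal (L * h) * (\<Sum>j<k. e j) + ennreal E"
    proof -
      have "(\<Sum>j<k. e j) < top" using e_finite k by auto
      then obtain s where s: "(\<Sum>j<k. e j) = ennreal s" "0 \<le> s" by (cases "\<Sum>j<k. e j") auto
      have nn: "0 \<le> T * K\<^sup>2" "0 \<le> h * s" "0 \<le> h * K\<^sup>2" "0 \<le> 3 * T * K\<^sup>2 * b * h / c\<^sup>2" using T_pos h s b by auto
      have "4 * (ennreal (T * K\<^sup>2) * (2 * (ennreal h * ennreal s) + 2 * ennreal \<delta>) + ennreal (h * K\<^sup>2) * ennreal s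
        + (ennreal (3 * T * K\<^sup>2 * b * h / c\<^sup>2) + 16 * ennreal \<delta>'))
        = ennreal (4 * (T * K\<^sup>2 * (2 * (h * s) + 2 * \<delta>) + h * K\<^sup>2 * s + (3 * T * K\<^sup>2 * b * h / c\<^sup>2 + 16 * \<delta>')))"
        using nn s h \<delta>(1) \<delta>'(1)
        by (simp only: ennreal_mult[symmetric] ennreal_plus[symmetric] numeral_mult_ennreal mult_nonneg_nonneg add_nonneg_nonneg less_imp_le zero_le_numeral)
      also have "4 * (T * K\<^sup>2 * (2 * (h * s) + 2 * \<delta>) + h * K\<^sup>2 * s + (3 * T * K\<^sup>2 * b * h / c\<^sup>2 + 16 * \<delta>')) = L * h * s + E"
        by (simp add: L_def E_def algebra_simps)
      also have "ennreal (L * h * s + E) = ennreal (L * h) * ennreal s + ennreal E"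
        using L h s E by (simp only: ennreal_mult ennreal_plus mult_nonneg_nonneg less_imp_le)
      finally show ?thesis unfolding s(1) .
    qed
    finally show ?thesis .
  qed
  have "e k \<le> ennreal (E * (1 + L * h) ^ k)"
    by (rule discrete_gronwall[OF _ E rec k]) (use L h in auto)
  also have "\<dots> \<le> ennreal (E * exp (L * T))"
  proof (intro ennreal_leI mult_left_mono E)
    have "(1 + L * h) ^ k \<le> (exp (L * h)) ^ k" using L h by (intro power_mono exp_ge_add_one_self) (auto intro: add_nonneg_nonneg)
    also have "\<dots> = exp (L * (real k * h))" by (simp add: exp_of_nat_mult[symmetric] mult_ac)
    also have "\<dots> \<le> exp (L * T)"
    proof -
      have "real k * h \<le> real m * h" using k h by (intro mult_right_mono) auto
      then have "real k * h \<le> T" using grid_end \<theta> by linarith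
      then show ?thesis using L by (simp add: mult_left_mono)
    qed
    finally show "(1 + L * h) ^ k \<le> exp (L * T)" .
  qed
  finally show ?thesis unfolding e_def E_def L_def .
qed

end

section \<open>Comparison with noise\<close>

text \<open>All earlier values being nonnegative, monotonicity of \<open>\<phi>\<close> and of \<open>B\<close> in its first index bounds \<open>\<phi>\<close> and the
  terms with \<open>j < n\<close> in \<open>y (Suc n)\<close> together from below by \<open>y n\<close> itself. The new term \<open>j = n\<close> takes away at most \<open>y n / 2\<close> through the
  diagonal of \<open>B\<close> and at most \<open>y n / 2\<close> through \<open>\<alpha>\<close>.\<close>

lemma euler_recursion_nonneg:
  fixes y \<phi> :: "nat \<Rightarrow> real^'n" and B :: "nat \<Rightarrow> nat \<Rightarrow> real^'n^'n" and \<alpha> :: "nat \<Rightarrow> 'n \<Rightarrow> real"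
  assumes y: "\<And>k i. k \<le> m \<Longrightarrow> y k $ i = \<phi> k $ i + (\<Sum>j<k. (\<Sum>l\<in>UNIV. B k j $ i $ l * y j $ l) + \<alpha> j i * y j $ i)"
    and \<phi>: "\<And>i. 0 \<le> \<phi> 0 $ i" "\<And>k i. k < m \<Longrightarrow> \<phi> k $ i \<le> \<phi> (Suc k) $ i"
    and B_mono: "\<And>k j i l. k < m \<Longrightarrow> j < k \<Longrightarrow> B k j $ i $ l \<le> B (Suc k) j $ i $ l"
    and B_off: "\<And>k i l. k < m \<Longrightarrow> i \<noteq> l \<Longrightarrow> 0 \<le> B (Suc k) k $ i $ l"
    and B_small: "\<And>k i. k < m \<Longrightarrow> \<bar>B (Suc k) k $ i $ i\<bar> \<le> 1/2"
    and \<alpha>_small: "\<And>k i. k < m \<Longrightarrow> \<bar>\<alpha> k i\<bar> \<le> 1/2"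
    and k: "k \<le> m"
  shows "0 \<le> y k $ i"
  using k
proof (induction k arbitrary: i rule: less_induct)
  case (less k)
  show ?case
  proof (cases k)
    case 0
    then show ?thesis using y[of 0 i] \<phi>(1) by simp
  next
    case (Suc n)
    have n: "n < m" "n \<le> m" using Suc less(2) by auto
    have yn: "0 \<le> y j $ l" if "j \<le> n" for j l using less(1)[of j] that Suc less(2) by auto
    have "y n $ i = \<phi> n $ i + (\<Sum>j<n. (\<Sum>l\<in>UNIV. B n j $ i $ l * y j $ l) + \<alpha> j i * y j $ i)" by (rule y[OF n(2)])
    also have "\<dots> \<le> \<phi> (Suc n) $ i + (\<Sum>j<n. (\<Sum>l\<in>UNIV. B (Suc n) j $ i $ l * y j $ l) + \<alpha> j i * y j $ i)"
      using n yn by (intro add_mono \<phi> sum_mono add_right_mono mult_right_mono B_mono) auto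
    finally have 1: "y n $ i \<le> \<phi> (Suc n) $ i + (\<Sum>j<n. (\<Sum>l\<in>UNIV. B (Suc n) j $ i $ l * y j $ l) + \<alpha> j i * y j $ i)" .
    have 2: "- (1/2) * y n $ i \<le> (\<Sum>l\<in>UNIV. B (Suc n) n $ i $ l * y n $ l)"
    proof -
      have "- (1/2) * y n $ i \<le> B (Suc n) n $ i $ i * y n $ i"
        using B_small[OF n(1), of i] yn[of n i] by (intro mult_right_mono) auto
      also have "\<dots> \<le> B (Suc n) n $ i $ i * y n $ i + (\<Sum>l\<in>UNIV - {i}. B (Suc n) n $ i $ l * y n $ l)"
      proof -
        have "0 \<le> (\<Sum>l\<in>UNIV - {i}. B (Suc n) n $ i $ l * y n $ l)"
          using B_off[OF n(1)] yn[of n] by (intro sum_nonneg mult_nonneg_nonneg) auto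
        then show ?thesis by simp
      qed
      also have "\<dots> = (\<Sum>l\<in>UNIV. B (Suc n) n $ i $ l * y n $ l)" by (rule sum.remove[symmetric]) auto
      finally show ?thesis .
    qed
    have 3: "- (1/2) * y n $ i \<le> \<alpha> n i * y n $ i"
      using \<alpha>_small[OF n(1), of i] yn[of n i] by (intro mult_right_mono) auto
    have "y k $ i = \<phi> (Suc n) $ i + (\<Sum>j<n. (\<Sum>l\<in>UNIV. B (Suc n) j $ i $ l * y j $ l) + \<alpha> j i * y j $ i)
        + ((\<Sum>l\<in>UNIV. B (Suc n) n $ i $ l * y n $ l) + \<alpha> n i * y n $ i)"
      using y[of k i] less(2) unfolding Suc by simp
    then show ?thesis using 1 2 3 by linarith
  qed
qed

context volterra
begin

lemma nonneg_real_integral: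
  fixes G :: "real \<Rightarrow> 'a \<Rightarrow> real"
  assumes G: "pmeas G" and nn: "AE s in lborel. AE \<omega> in M. 0 \<le> G s \<omega>"
  shows "AE \<omega> in M. 0 \<le> (\<integral>s. G s \<omega> \<partial>lborel)"
proof -
  have "{x :: real. 0 \<le> x} \<in> sets borel" by measurable
  from AE_time_space_commute[OF G this nn] show ?thesis
    by eventually_elim (rule integral_nonneg_AE)
qed

text \<open>The sign condition is assumed for almost every pair \<open>(t, s)\<close> only, while the scheme evaluates the
  kernel at the countably many times of the grid. Sets of full measure are dense, and the kernel is continuous in \<open>t\<close>.\<close>

lemma offdiag_all_times:
  assumes coeff: "AE (t, s) in lborel. (t, s) \<in> Delta_star T \<longrightarrow> (AE \<omega> in M. A0 t s \<omega> \<in> offdiag_nonneg_matrices \<and> A1 s \<omega> \<in> diagonal_matrices)"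
  shows "AE s in lborel. \<forall>t. 0 \<le> s \<and> s \<le> t \<and> t \<le> T \<and> s < T \<longrightarrow> (AE \<omega> in M. A0 t s \<omega> \<in> offdiag_nonneg_matrices)"
    and "AE s in lborel. 0 \<le> s \<and> s < T \<longrightarrow> (AE \<omega> in M. A1 s \<omega> \<in> diagonal_matrices)"
proof -
  have pos: "\<exists>t. t \<in> {u<..<v} \<and> P t" if "AE t in lborel. P t" "u < v" for P and u v :: real
  proof (rule ccontr)
    assume "\<not> ?thesis"
    with that(1) have "AE t in lborel. t \<notin> {u<..<v}" by (auto elim!: eventually_mono)
    then have "{u<..<v} \<in> null_sets lborel" by (subst AE_iff_null_sets) auto
    then show False using that(2) by (auto simp: null_sets_def)
  qed
  have ae: "AE s in lborel. AE t in lborel. (t, s) \<in> Delta_star T \<longrightarrow> (AE \<omega> in M. A0 t s \<omega> \<in> offdiag_nonneg_matrices \<and> A1 s \<omega> \<in> diagonal_matrices)"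
    using AE_lborel_pairD(2)[OF coeff] by simp
  show "AE s in lborel. 0 \<le> s \<and> s < T \<longrightarrow> (AE \<omega> in M. A1 s \<omega> \<in> diagonal_matrices)"
    using ae
  proof eventually_elim
    case (elim s)
    show ?case
    proof
      assume s: "0 \<le> s \<and> s < T"
      then obtain t where "t \<in> {s<..<T}" "(t, s) \<in> Delta_star T \<longrightarrow> (AE \<omega> in M. A0 t s \<omega> \<in> offdiag_nonneg_matrices \<and> A1 s \<omega> \<in> diagonal_matrices)"
        using pos[OF elim, of s T] by blast
      then have "AE \<omega> in M. A0 t s \<omega> \<in> offdiag_nonneg_matrices \<and> A1 s \<omega> \<in> diagonal_matrices"
        using s by (auto simp: Delta_star_def)
      then show "AE \<omega> in M. A1 s \<omega> \<in> diagonal_matrices" by eventually_elim simp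
    qed
  qed
  show "AE s in lborel. \<forall>t. 0 \<le> s \<and> s \<le> t \<and> t \<le> T \<and> s < T \<longrightarrow> (AE \<omega> in M. A0 t s \<omega> \<in> offdiag_nonneg_matrices)"
    using ae
  proof eventually_elim
    case (elim s)
    show ?case
    proof (intro allI impI)
      fix t assume t: "0 \<le> s \<and> s \<le> t \<and> t \<le> T \<and> s < T"
      \<comment> \<open>A sequence of good times inside \<open>(s, T)\<close> that tends to \<open>t\<close>.\<close>
      have "\<forall>k::nat. \<exists>r. r \<in> {max s (t - 1 / real (Suc k))<..<min T (t + 1 / real (Suc k))} \<and>
        ((r, s) \<in> Delta_star T \<longrightarrow> (AE \<omega> in M. A0 r s \<omega> \<in> offdiag_nonneg_matrices \<and> A1 s \<omega> \<in> diagonal_matrices))"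
      proof
        fix k :: nat
        have gen: "max s (t - r) < min T (t + r)" if "0 < r" for r using t that by auto
        have "max s (t - 1 / real (Suc k)) < min T (t + 1 / real (Suc k))" by (rule gen) simp
        from pos[OF elim this] show "\<exists>r. r \<in> {max s (t - 1 / real (Suc k))<..<min T (t + 1 / real (Suc k))} \<and>
          ((r, s) \<in> Delta_star T \<longrightarrow> (AE \<omega> in M. A0 r s \<omega> \<in> offdiag_nonneg_matrices \<and> A1 s \<omega> \<in> diagonal_matrices))" .
      qed
      from choice[OF this] obtain u where u: "\<And>k. u k \<in> {max s (t - 1 / real (Suc k))<..<min T (t + 1 / real (Suc k))}"
        "\<And>k. (u k, s) \<in> Delta_star T \<longrightarrow> (AE \<omega> in M. A0 (u k) s \<omega> \<in> offdiag_nonneg_matrices \<and> A1 s \<omega> \<in> diagonal_matrices)" by blast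
      have uT: "u k \<in> {s..T}" for k using u(1)[of k] by auto
      have ae_u: "AE \<omega> in M. \<forall>k. A0 (u k) s \<omega> \<in> offdiag_nonneg_matrices"
      proof (subst AE_all_countable, intro allI)
        fix k
        have "(u k, s) \<in> Delta_star T" using uT[of k] t by (auto simp: Delta_star_def)
        with u(2)[of k] have "AE \<omega> in M. A0 (u k) s \<omega> \<in> offdiag_nonneg_matrices \<and> A1 s \<omega> \<in> diagonal_matrices" by blast
        then show "AE \<omega> in M. A0 (u k) s \<omega> \<in> offdiag_nonneg_matrices" by eventually_elim simp
      qed
      have lim: "u \<longlonglongrightarrow> t"
      proof -
        have 1: "(\<lambda>k. 1 / real (Suc k)) \<longlonglongrightarrow> 0" by (rule lim_1_over_n[THEN LIMSEQ_Suc])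
        have a: "(\<lambda>k. t - 1 / real (Suc k)) \<longlonglongrightarrow> t" using tendsto_diff[OF tendsto_const 1, of t] by simp
        have b: "(\<lambda>k. t + 1 / real (Suc k)) \<longlonglongrightarrow> t" using tendsto_add[OF tendsto_const 1, of t] by simp
        show ?thesis
          by (rule tendsto_sandwich[OF _ _ a b]) (use u(1) in \<open>auto intro!: always_eventually less_imp_le\<close>)
      qed
      show "AE \<omega> in M. A0 t s \<omega> \<in> offdiag_nonneg_matrices"
        using ae_u AE_space
      proof eventually_elim
        case (elim \<omega>)
        have cont: "continuous_on {s..T} (\<lambda>t. A0 t s \<omega>)"
          using adm t elim(2) unfolding admissible_coefficients_def by auto
        have l: "(\<lambda>k. A0 (u k) s \<omega>) \<longlonglongrightarrow> A0 t s \<omega>"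
          using t uT by (intro continuous_on_tendsto_compose[OF cont lim]) auto
        show ?case
          unfolding offdiag_nonneg_matrices_def
        proof (intro CollectI allI impI)
          fix i j :: 'n assume "i \<noteq> j"
          then have "0 \<le> A0 (u k) s \<omega> $ i $ j" for k using elim(1) by (auto simp: offdiag_nonneg_matrices_def)
          moreover have "(\<lambda>k. A0 (u k) s \<omega> $ i $ j) \<longlonglongrightarrow> A0 t s \<omega> $ i $ j" by (intro tendsto_vec_nth l)
          ultimately show "0 \<le> A0 t s \<omega> $ i $ j" by (intro LIMSEQ_le_const[of _ _ 0]) auto
        qed
      qed
    qed
  qed
qed

end

context euler_scheme
begin

lemma B_entry: "k \<le> m \<Longrightarrow> \<omega> \<in> space M \<Longrightarrow> B k j \<omega> $ i $ l = (\<integral>s. kern k j s \<omega> $ i $ l \<partial>lborel)"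
  unfolding B_def path_int_def
  using integral_bounded_linear[OF bounded_linear_compose[OF bounded_linear_vec_nth bounded_linear_vec_nth] kern_integrable] by simp

text \<open>The integrals of the kernel over the cells inherit monotonicity and signs from the kernel, almost surely and
  simultaneously for the finitely many cells; then \<open>euler_recursion_nonneg\<close> applies outcome by outcome.\<close>

theorem euler_nonneg:
  assumes coeff: "AE (t, s) in lborel. (t, s) \<in> Delta_star T \<longrightarrow> (AE \<omega> in M. A0 t s \<omega> \<in> offdiag_nonneg_matrices \<and> A1 s \<omega> \<in> diagonal_matrices)"
    and A0_mono: "\<And>s t t'. 0 \<le> s \<Longrightarrow> s \<le> t \<Longrightarrow> t \<le> t' \<Longrightarrow> t' \<le> T \<Longrightarrow> AE \<omega> in M. A0 t' s \<omega> - A0 t s \<omega> \<in> nonneg_matrices"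
    and \<phi>_mono: "\<And>t t'. 0 \<le> t \<Longrightarrow> t \<le> t' \<Longrightarrow> t' \<le> T \<Longrightarrow> AE \<omega> in M. \<phi> t \<omega> \<le> \<phi> t' \<omega> \<and> 0 \<le> \<phi> t \<omega>"
    and Kh: "K * h \<le> 1/2" and Kc: "c * K \<le> 1/2" and k: "k \<le> m"
  shows "AE \<omega> in M. 0 \<le> Y k \<omega>"
proof -
  have entry_measurable: "pmeas (\<lambda>s \<omega>. kern k j s \<omega> $ i $ l)" if "k \<le> m" for k j i l
    using kern_measurable[OF that] unfolding pmeas_def by measurable
  have 1: "AE \<omega> in M. B k j \<omega> $ i $ l \<le> B (Suc k) j \<omega> $ i $ l" if kj: "k < m" "j < k" for k j i l
  proof -
    have pd: "pmeas (\<lambda>s \<omega>. kern (Suc k) j s \<omega> $ i $ l - kern k j s \<omega> $ i $ l)"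
      using entry_measurable[of "Suc k"] entry_measurable[of k] kj unfolding pmeas_def by (intro borel_measurable_diff) auto
    have "AE \<omega> in M. 0 \<le> (\<integral>s. kern (Suc k) j s \<omega> $ i $ l - kern k j s \<omega> $ i $ l \<partial>lborel)"
    proof (rule nonneg_real_integral[OF pd], rule AE_I2)
      fix s :: real
      show "AE \<omega> in M. 0 \<le> kern (Suc k) j s \<omega> $ i $ l - kern k j s \<omega> $ i $ l"
      proof (cases "s \<in> cell j")
        case True
        have "\<tau> (Suc j) \<le> \<tau> k" "\<tau> k \<le> \<tau> (Suc k)" using kj by (auto intro: \<tau>_mono)
        moreover have "0 \<le> \<tau> j" "\<tau> (Suc k) \<le> T" using \<tau>_nonneg \<tau>_in[of "Suc k"] kj by auto
        ultimately have s: "0 \<le> s" "s \<le> \<tau> k" "\<tau> k \<le> \<tau> (Suc k)" "\<tau> (Suc k) \<le> T" using True by (auto simp: cell_def)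
        from A0_mono[OF s] show ?thesis
        proof eventually_elim
          case (elim \<omega>)
          then have "0 \<le> (A0 (\<tau> (Suc k)) s \<omega> - A0 (\<tau> k) s \<omega>) $ i $ l" unfolding nonneg_matrices_def by blast
          then show ?case using True s by (simp add: kern_def cut_def)
        qed
      qed (simp add: kern_def)
    qed
    then show ?thesis using AE_space
    proof eventually_elim
      case (elim \<omega>)
      have "integrable lborel (\<lambda>s. kern k' j s \<omega> $ i $ l)" if "k' \<le> m" for k'
        using integrable_bounded_linear[OF bounded_linear_compose[OF bounded_linear_vec_nth[of l] bounded_linear_vec_nth[of i]] kern_integrable[OF that elim(2)]]
        by simp
      then have "0 \<le> (\<integral>s. kern (Suc k) j s \<omega> $ i $ l \<partial>lborel) - (\<integral>s. kern k j s \<omega> $ i $ l \<partial>lborel)"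
        using elim(1) kj by (subst Bochner_Integration.integral_diff[symmetric]) auto
      then show ?case using B_entry[OF _ elim(2)] kj by simp
    qed
  qed
  have 2: "AE \<omega> in M. 0 \<le> B (Suc k) k \<omega> $ i $ l" if k: "k < m" and il: "i \<noteq> l" for k i l
  proof -
    have sk: "Suc k \<le> m" using k by simp
    have "AE \<omega> in M. 0 \<le> (\<integral>s. kern (Suc k) k s \<omega> $ i $ l \<partial>lborel)"
    proof (rule nonneg_real_integral[OF entry_measurable[OF sk]])
      have "AE s in lborel. s \<noteq> T" by (rule AE_lborel_singleton)
      with offdiag_all_times(1)[OF coeff]
      show "AE s in lborel. AE \<omega> in M. 0 \<le> kern (Suc k) k s \<omega> $ i $ l"
      proof eventually_elim
        case (elim s)
        show ?case
        proof (cases "s \<in> cell k")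
          case True
          have "0 \<le> \<tau> k" "\<tau> (Suc k) \<le> T" using \<tau>_nonneg \<tau>_in[OF sk] by auto
          then have s: "0 \<le> s" "s \<le> \<tau> (Suc k)" "\<tau> (Suc k) \<le> T" "s < T" using True elim(2) by (auto simp: cell_def)
          with elim(1) have "AE \<omega> in M. A0 (\<tau> (Suc k)) s \<omega> \<in> offdiag_nonneg_matrices" by blast
          then show ?thesis
            by eventually_elim (use True s il in \<open>auto simp: kern_def cut_def offdiag_nonneg_matrices_def\<close>)
        qed (simp add: kern_def)
      qed
    qed
    then show ?thesis using AE_space by eventually_elim (simp add: B_entry[OF sk])
  qed
  have 3: "AE \<omega> in M. \<phi> (\<tau> k) \<omega> \<le> \<phi> (\<tau> (Suc k)) \<omega>" if "k < m" for k
    using \<phi>_mono[of "\<tau> k" "\<tau> (Suc k)"] \<tau>_nonneg \<tau>_mono[of k "Suc k"] \<tau>_in[of "Suc k"] that by (auto elim: eventually_mono)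
  have 4: "AE \<omega> in M. 0 \<le> \<phi> (\<tau> 0) \<omega>"
    using \<phi>_mono[of "\<tau> 0" "\<tau> 0"] \<tau>_nonneg \<tau>_in[of 0] by (auto elim: eventually_mono)
  have all1: "AE \<omega> in M. \<forall>k j i l. k < m \<longrightarrow> j < k \<longrightarrow> B k j \<omega> $ i $ l \<le> B (Suc k) j \<omega> $ i $ l"
    using 1 by (simp add: AE_all_countable)
  have all2: "AE \<omega> in M. \<forall>k i l. k < m \<longrightarrow> i \<noteq> l \<longrightarrow> 0 \<le> B (Suc k) k \<omega> $ i $ l"
    using 2 by (simp add: AE_all_countable)
  have all3: "AE \<omega> in M. \<forall>k. k < m \<longrightarrow> \<phi> (\<tau> k) \<omega> \<le> \<phi> (\<tau> (Suc k)) \<omega>"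
    using 3 by (simp add: AE_all_countable)
  show ?thesis
    using all1 all2 all3 4 AE_space
  proof eventually_elim
    case (elim \<omega>)
    have w: "\<omega> \<in> space M" by (rule elim(5))
    have "0 \<le> Y k \<omega> $ i" for i
    proof (rule euler_recursion_nonneg[where m = m and \<phi> = "\<lambda>k. \<phi> (\<tau> k) \<omega>" and B = "\<lambda>k j. B k j \<omega>" and \<alpha> = "\<lambda>j i. trunc c (dW j \<omega>) * (A1 (\<tau> j) \<omega> $ i $ i)" and y = "\<lambda>k. Y k \<omega>"])
      show "Y k \<omega> $ i = \<phi> (\<tau> k) \<omega> $ i + (\<Sum>j<k. (\<Sum>l\<in>UNIV. B k j \<omega> $ i $ l * Y j \<omega> $ l) + trunc c (dW j \<omega>) * (A1 (\<tau> j) \<omega> $ i $ i) * Y j \<omega> $ i)" for k i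
        by (subst Y_eq) (simp add: sum_component a_def diag_part_vector mult.assoc, simp add: matrix_vector_mult_def)
      show "0 \<le> \<phi> (\<tau> 0) \<omega> $ i" for i using elim(4) by (simp add: less_eq_vec_def)
      show "\<phi> (\<tau> k) \<omega> $ i \<le> \<phi> (\<tau> (Suc k)) \<omega> $ i" if "k < m" for k i
        using elim(3) that by (simp add: less_eq_vec_def)
      show "B k j \<omega> $ i $ l \<le> B (Suc k) j \<omega> $ i $ l" if "k < m" "j < k" for k j i l using elim(1) that by blast
      show "0 \<le> B (Suc k) k \<omega> $ i $ l" if "k < m" "i \<noteq> l" for k i l using elim(2) that by blast
      show "\<bar>B (Suc k) k \<omega> $ i $ i\<bar> \<le> 1/2" if "k < m" for k i
        using order_trans[OF entry_le_norm B_le[OF _ w]] that Kh by (meson Suc_leI order_trans)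
      show "\<bar>trunc c (dW k \<omega>) * (A1 (\<tau> k) \<omega> $ i $ i)\<bar> \<le> 1/2" if "k < m" for k i
      proof -
        have "\<bar>trunc c (dW k \<omega>)\<bar> * \<bar>A1 (\<tau> k) \<omega> $ i $ i\<bar> \<le> c * K"
          using c \<tau>_in[of k] that order_trans[OF entry_le_norm A1_le[OF _ w]]
          by (intro mult_mono) (auto simp: trunc_def)
        then show ?thesis using Kc by (simp add: abs_mult)
      qed
    qed (rule k)
    then show ?case by (simp add: less_eq_vec_def)
  qed
qed

lemma grid_process_value: "j < m \<Longrightarrow> s \<in> cell j \<Longrightarrow> grid_process \<theta> h m x s \<omega> = x j \<omega>"
proof -
  assume j: "j < m" "s \<in> cell j"
  have d: "disjoint_family_on cell {..<m}"
    using grid_disjoint[of h \<theta> "{..<m}"] h unfolding cell_def \<tau>_def by simp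
  have n: "s \<notin> cell i" if "i \<in> {..<m} - {j}" for i
    using disjoint_family_onD[OF d, of i j] that j by auto
  show ?thesis
    unfolding grid_process_cell using j n by (subst sum.remove[of _ j]) (auto intro!: sum.neutral)
qed

lemma grid_process_outside: "(\<And>j. j < m \<Longrightarrow> s \<notin> cell j) \<Longrightarrow> grid_process \<theta> h m x s \<omega> = 0"
  unfolding grid_process_cell by (intro sum.neutral) auto

lemma cells_cover: "\<tau> 0 < s \<Longrightarrow> s \<le> \<tau> m \<Longrightarrow> \<exists>j<m. s \<in> cell j"
proof (rule ccontr)
  assume s: "\<tau> 0 < s" "s \<le> \<tau> m" and no: "\<not> (\<exists>j<m. s \<in> cell j)"
  then have "(\<Sum>i<m. indicator {\<theta> + real i * h<..\<theta> + real (Suc i) * h} s) = (0 :: real)"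
    by (intro sum.neutral) (auto simp: cell_def \<tau>_def)
  then show False using grid_indicator[where h = h and m = m and \<theta> = \<theta> and s = s] h s by (simp add: \<tau>_def)
qed

text \<open>On the cells the modulus of continuity of \<open>X\<close> bounds the error; the two uncovered ends have
  length at most \<open>h\<close> each.\<close>

lemma grid_X_error:
  assumes b: "0 \<le> b" "\<And>t. t \<in> {0..T} \<Longrightarrow> msq M (X t) \<le> ennreal b"
    and mod: "\<And>s t. s \<in> {0..T} \<Longrightarrow> t \<in> {0..T} \<Longrightarrow> \<bar>s - t\<bar> \<le> h \<Longrightarrow> msq M (\<lambda>\<omega>. X s \<omega> - X t \<omega>) \<le> ennreal \<epsilon>"
    and \<epsilon>: "0 \<le> \<epsilon>" and ends: "\<theta> \<le> h" "T - h \<le> \<tau> m"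
  shows "psq (\<lambda>s \<omega>. gX m s \<omega> - cut T X s \<omega>) \<le> ennreal (2 * h * b + T * \<epsilon>)"
proof -
  have p: "pmeas (\<lambda>s \<omega>. gX m s \<omega> - cut T X s \<omega>)"
    using pmeas_grid_process[of m "\<lambda>j. X (\<tau> j)" \<theta> h] X_grid_measurable pmeas_cut[OF X_measurable order_refl] by (simp add: pmeas_def)
  have "psq (\<lambda>s \<omega>. gX m s \<omega> - cut T X s \<omega>) \<le> (\<integral>\<^sup>+s. (ennreal b * indicator {0..h} s + ennreal b * indicator {T - h..T} s) + ennreal \<epsilon> * indicator {0..T} s \<partial>lborel)"
    unfolding psq_time[OF p]
  proof (rule nn_integral_mono)
    fix s
    show "msq M (\<lambda>\<omega>. gX m s \<omega> - cut T X s \<omega>) \<le> (ennreal b * indicator {0..h} s + ennreal b * indicator {T - h..T} s) + ennreal \<epsilon> * indicator {0..T} s"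
    proof (cases "\<exists>j<m. s \<in> cell j")
      case True
      then obtain j where j: "j < m" "s \<in> cell j" by blast
      have s: "s \<in> {0..T}" using cell_subset[OF j(1)] j(2) by blast
      have "\<bar>\<tau> j - s\<bar> \<le> h" using j(2) by (auto simp: cell_def \<tau>_def algebra_simps)
      then have "msq M (\<lambda>\<omega>. X (\<tau> j) \<omega> - X s \<omega>) \<le> ennreal \<epsilon>" using j(1) by (intro mod \<tau>_in s) auto
      then have "msq M (\<lambda>\<omega>. gX m s \<omega> - cut T X s \<omega>) \<le> ennreal \<epsilon> * indicator {0..T} s"
        using s by (simp add: grid_process_value[OF j] cut_def)
      also have "\<dots> \<le> (ennreal b * indicator {0..h} s + ennreal b * indicator {T - h..T} s) + ennreal \<epsilon> * indicator {0..T} s" by simp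
      finally show ?thesis .
    next
      case False
      then have g: "gX m s \<omega> = 0" for \<omega> by (intro grid_process_outside) blast
      show ?thesis
      proof (cases "s \<in> {0..T}")
        case True
        have "s \<le> \<tau> 0 \<or> \<tau> m < s" using cells_cover[of s] False by force
        then have "s \<in> {0..h} \<or> s \<in> {T - h..T}" using True ends by (auto simp: \<tau>_def)
        moreover have "msq M (\<lambda>\<omega>. gX m s \<omega> - cut T X s \<omega>) \<le> ennreal b"
          using b(2)[OF True] True by (simp add: g cut_def msq_def)
        ultimately show ?thesis by (auto simp: indicator_def add_increasing add_increasing2)
      qed (simp add: g cut_def)
    qed
  qed
  also have "\<dots> = ennreal (2 * h * b + T * \<epsilon>)"
    using h b \<epsilon> T_pos
    by (subst nn_integral_add, simp, simp, subst nn_integral_add, simp, simp)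
       (simp add: nn_integral_cmult_indicator ennreal_mult[symmetric] ennreal_plus[symmetric] mult.commute del: ennreal_plus)
  finally show ?thesis .
qed

text \<open>Sampling approximates \<open>A1\<close> only in mean square, and the product with the unbounded \<open>X\<close> is not controlled
  by that; so \<open>X\<close> is clipped at level \<open>R\<close>, and the remainder is paid for by the bound \<open>2 K\<close> on the difference of the coefficients.\<close>

lemma noise_coefficient_error:
  assumes diag: "AE s in lborel. 0 \<le> s \<and> s < T \<longrightarrow> (AE \<omega> in M. A1 s \<omega> \<in> diagonal_matrices)"
    and \<delta>: "0 \<le> \<delta>" "psq (\<lambda>s \<omega>. gX m s \<omega> - cut T X s \<omega>) \<le> ennreal \<delta>"
    and \<eta>: "0 \<le> \<eta>" "psq (\<lambda>s \<omega>. grid_process \<theta> h m a s \<omega> - cut T (\<lambda>s \<omega>. diag_part (A1 s \<omega>)) s \<omega>) \<le> ennreal \<eta>"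
    and \<zeta>: "0 \<le> \<zeta>" "psq (\<lambda>s \<omega>. cut T X s \<omega> - clip R (cut T X s \<omega>)) \<le> ennreal \<zeta>" and R: "0 \<le> R"
  shows "psq (\<lambda>s \<omega>. gaX m s \<omega> - noise T X s \<omega>) \<le> ennreal (4 * (K\<^sup>2 * \<delta> + R\<^sup>2 * \<eta> + 4 * K\<^sup>2 * \<zeta>))"
proof -
  define ga where "ga = grid_process \<theta> h m a"
  define H where "H = cut T (\<lambda>s \<omega>. diag_part (A1 s \<omega>))"
  have Hd: "H s \<omega> = diag_part (cut T A1 s \<omega>)" for s \<omega>
    by (auto simp: H_def cut_def indicator_def diag_part_def vec_eq_iff)
  have mA [measurable]: "(\<lambda>z. cut T A1 (fst z) (snd z)) \<in> borel_measurable (lborel \<Otimes>\<^sub>M M)"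
    using cut_A1(1)[OF order_refl] by (simp add: pmeas_def)
  have mX [measurable]: "(\<lambda>z. cut T X (fst z) (snd z)) \<in> borel_measurable (lborel \<Otimes>\<^sub>M M)"
    using pmeas_cut[OF X_measurable order_refl] by (simp add: pmeas_def)
  have mg [measurable]: "(\<lambda>z. gX m (fst z) (snd z)) \<in> borel_measurable (lborel \<Otimes>\<^sub>M M)"
    using pmeas_grid_process[of m "\<lambda>j. X (\<tau> j)" \<theta> h] X_grid_measurable by (simp add: pmeas_def)
  have ma [measurable]: "(\<lambda>z. ga (fst z) (snd z)) \<in> borel_measurable (lborel \<Otimes>\<^sub>M M)"
    using pmeas_grid_process[of m a \<theta> h] measurable_F_M[OF a_measurable] by (simp add: pmeas_def ga_def)
  have mH [measurable]: "(\<lambda>z. H (fst z) (snd z)) \<in> borel_measurable (lborel \<Otimes>\<^sub>M M)" unfolding Hd by measurable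
  have ga_le: "norm (ga s \<omega>) \<le> K" if "\<omega> \<in> space M" for s \<omega>
  proof (cases "\<exists>j<m. s \<in> cell j")
    case True
    then obtain j where j: "j < m" "s \<in> cell j" by blast
    then show ?thesis using a_le[of j \<omega>] that by (simp add: ga_def grid_process_value[OF j])
  next
    case False
    then show ?thesis using K_nonneg by (simp add: ga_def grid_process_outside)
  qed
  have H_le: "norm (H s \<omega>) \<le> K" if "\<omega> \<in> space M" for s \<omega>
    unfolding Hd by (rule order_trans[OF norm_diag_part_le cut_A1(2)[OF order_refl that]])
  have gaX: "gaX m s \<omega> = ga s \<omega> *v gX m s \<omega>" for s \<omega>
  proof (cases "\<exists>j<m. s \<in> cell j")
    case True
    then obtain j where j: "j < m" "s \<in> cell j" by blast
    then show ?thesis by (simp add: ga_def grid_process_value[OF j])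
  next
    case False
    then show ?thesis by (simp add: ga_def grid_process_outside)
  qed
  let ?f1 = "\<lambda>s \<omega>. ga s \<omega> *v (gX m s \<omega> - cut T X s \<omega>)"
  let ?f2 = "\<lambda>s \<omega>. (ga s \<omega> - H s \<omega>) *v clip R (cut T X s \<omega>)"
  let ?f3 = "\<lambda>s \<omega>. (ga s \<omega> - H s \<omega>) *v (cut T X s \<omega> - clip R (cut T X s \<omega>))"
  let ?f4 = "\<lambda>s \<omega>. H s \<omega> *v cut T X s \<omega> - noise T X s \<omega>"
  have dec: "gaX m s \<omega> - noise T X s \<omega> = (?f1 s \<omega> + ?f2 s \<omega>) + (?f3 s \<omega> + ?f4 s \<omega>)" for s \<omega>
    unfolding gaX by (simp add: matrix_vector_mult_diff_distrib matrix_vector_mult_diff_rdistrib)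
  have 4: "psq ?f4 = 0"
  proof -
    have p4: "pmeas ?f4" unfolding cut_mult pmeas_def by measurable
    have ne: "AE s in lborel. s \<noteq> T" by (rule AE_lborel_singleton)
    have "psq ?f4 = (\<integral>\<^sup>+s. 0 \<partial>(lborel :: real measure))"
      unfolding psq_time[OF p4]
    proof (rule nn_integral_cong_AE, use diag ne in eventually_elim)
      case (elim s)
      have "AE \<omega> in M. ?f4 s \<omega> = 0"
      proof (cases "s \<in> {0..T}")
        case True
        then have "AE \<omega> in M. A1 s \<omega> \<in> diagonal_matrices" using elim by auto
        then show ?thesis by eventually_elim (use True in \<open>simp add: H_def cut_def diag_part_diagonal\<close>)
      qed (simp add: H_def cut_def)
      then have "msq M (?f4 s) = msq M (\<lambda>_. 0 :: real^'n)" by (intro msq_cong_AE) auto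
      then show "msq M (?f4 s) = 0" by simp
    qed
    then show ?thesis by simp
  qed
  have "psq (\<lambda>s \<omega>. gaX m s \<omega> - noise T X s \<omega>) \<le> 4 * (psq ?f1 + psq ?f2 + (psq ?f3 + psq ?f4))"
    unfolding dec unfolding psq_def cut_mult
    by (rule msq_add4_le[of "\<lambda>z. ?f1 (fst z) (snd z)" "lborel \<Otimes>\<^sub>M M" "\<lambda>z. ?f2 (fst z) (snd z)" "\<lambda>z. ?f3 (fst z) (snd z)"
        "\<lambda>z. H (fst z) (snd z) *v cut T X (fst z) (snd z) - cut T A1 (fst z) (snd z) *v cut T X (fst z) (snd z)"]) measurable
  also have "\<dots> \<le> 4 * (ennreal (K\<^sup>2) * ennreal \<delta> + ennreal (R\<^sup>2) * ennreal \<eta> + (ennreal ((2 * K)\<^sup>2) * ennreal \<zeta> + 0))"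
  proof (intro mult_left_mono add_mono)
    have "psq ?f1 \<le> ennreal (K\<^sup>2) * psq (\<lambda>s \<omega>. gX m s \<omega> - cut T X s \<omega>)"
      by (rule psq_mult_le) (auto simp: ga_le pmeas_def)
    also have "\<dots> \<le> ennreal (K\<^sup>2) * ennreal \<delta>" by (intro mult_left_mono \<delta>) auto
    finally show "psq ?f1 \<le> ennreal (K\<^sup>2) * ennreal \<delta>" .
    have "psq ?f2 \<le> psq (\<lambda>s \<omega>. R *\<^sub>R (ga s \<omega> - H s \<omega>))"
    proof (rule psq_mono)
      fix s \<omega>
      have "norm (?f2 s \<omega>) \<le> norm (ga s \<omega> - H s \<omega>) * norm (clip R (cut T X s \<omega>))" by (rule norm_matrix_vector_le)
      also have "\<dots> \<le> norm (ga s \<omega> - H s \<omega>) * R" by (intro mult_left_mono norm_clip R) auto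
      finally show "norm (?f2 s \<omega>) \<le> norm (R *\<^sub>R (ga s \<omega> - H s \<omega>))" using R by (simp add: mult.commute)
    qed
    also have "\<dots> = ennreal (R\<^sup>2) * psq (\<lambda>s \<omega>. ga s \<omega> - H s \<omega>)"
      unfolding psq_def by (rule msq_cmult) measurable
    also have "\<dots> \<le> ennreal (R\<^sup>2) * ennreal \<eta>" using \<eta>(2) unfolding ga_def H_def by (intro mult_left_mono) auto
    finally show "psq ?f2 \<le> ennreal (R\<^sup>2) * ennreal \<eta>" .
    have "psq ?f3 \<le> ennreal ((2 * K)\<^sup>2) * psq (\<lambda>s \<omega>. cut T X s \<omega> - clip R (cut T X s \<omega>))"
    proof (rule psq_mult_le)
      show "norm (ga s \<omega> - H s \<omega>) \<le> 2 * K" if "\<omega> \<in> space M" for s \<omega>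
        using norm_triangle_ineq4[of "ga s \<omega>" "H s \<omega>"] ga_le[OF that, of s] H_le[OF that, of s] by linarith
      show "pmeas (\<lambda>s \<omega>. cut T X s \<omega> - clip R (cut T X s \<omega>))" unfolding pmeas_def by measurable
    qed
    also have "\<dots> \<le> ennreal ((2 * K)\<^sup>2) * ennreal \<zeta>" by (intro mult_left_mono \<zeta>) auto
    finally show "psq ?f3 \<le> ennreal ((2 * K)\<^sup>2) * ennreal \<zeta>" .
    show "psq ?f4 \<le> 0" using 4 by simp
  qed auto
  also have "\<dots> = ennreal (4 * (K\<^sup>2 * \<delta> + R\<^sup>2 * \<eta> + (2 * K)\<^sup>2 * \<zeta>))"
    using \<delta>(1) \<eta>(1) \<zeta>(1)
    by (simp only: ennreal_mult[symmetric] ennreal_plus[symmetric] numeral_mult_ennreal mult_nonneg_nonneg add_nonneg_nonneg zero_le_power2 add_0_right)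
  finally show ?thesis by (simp add: power_mult_distrib)
qed

end

context volterra
begin

text \<open>The parameters are chosen in the order: truncation level \<open>c\<close>, clipping level \<open>R\<close> of \<open>X\<close>, accuracy \<open>\<eta>\<close> of the
  sampled coefficient, which depends on \<open>R\<close>, and finally the grid. The offset \<open>\<theta>\<close> is the one that \<open>sampling_approximates\<close>
  provides for the diagonal part of \<open>A1\<close>.\<close>

theorem comparison_with_noise:
  fixes \<phi> X :: "real \<Rightarrow> 'a \<Rightarrow> real^'n"
  assumes coeff: "AE (t, s) in lborel. (t, s) \<in> Delta_star T \<longrightarrow> (AE \<omega> in M. A0 t s \<omega> \<in> offdiag_nonneg_matrices \<and> A1 s \<omega> \<in> diagonal_matrices)"
    and A0_mono: "\<And>s t t'. 0 \<le> s \<Longrightarrow> s \<le> t \<Longrightarrow> t \<le> t' \<Longrightarrow> t' \<le> T \<Longrightarrow> AE \<omega> in M. A0 t' s \<omega> - A0 t s \<omega> \<in> nonneg_matrices"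
    and \<phi>_mono: "\<And>t t'. 0 \<le> t \<Longrightarrow> t \<le> t' \<Longrightarrow> t' \<le> T \<Longrightarrow> AE \<omega> in M. \<phi> t \<omega> \<le> \<phi> t' \<omega> \<and> 0 \<le> \<phi> t \<omega>"
    and \<phi>: "\<phi> \<in> CF M W T" and X: "X \<in> CF M W T" and Xm: "measurable_process M T X"
    and X_eq: "\<And>t. t \<in> {0..T} \<Longrightarrow> volt X (\<lambda>\<omega>. X t \<omega> - \<phi> t \<omega>) t"
    and t: "t \<in> {0..T}"
  shows "AE \<omega> in M. 0 \<le> X t \<omega>"
proof -
  have XL: "X \<in> L2F M W T" using T_pos by (intro CF_L2F X Xm) auto
  obtain b0 where b0: "\<And>t. t \<in> {0..T} \<Longrightarrow> msq M (X t) \<le> ennreal b0" using CF_bounded[OF X] by blast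
  define b where "b = max b0 0"
  have b: "0 \<le> b" "\<And>t. t \<in> {0..T} \<Longrightarrow> msq M (X t) \<le> ennreal b"
    using b0 by (auto simp: b_def intro: order_trans ennreal_leI)
  \<comment> \<open>The diagonal noise contribution is then at most \<open>c * K \<le> 1/2\<close>, as \<open>euler_nonneg\<close> requires.\<close>
  define c where "c = 1 / (2 * (K + 1))"
  have c: "0 < c" "c * K \<le> 1/2" using K_nonneg by (auto simp: c_def divide_simps)
  define Q where "Q = exp ((8 * T * K\<^sup>2 + 4 * K\<^sup>2) * T)"
  have Q: "0 \<le> Q" by (simp add: Q_def)
  have main: "msq M (\<lambda>\<omega>. neg_part (X t \<omega>)) \<le> ennreal \<kappa>" if \<kappa>: "\<kappa> > 0" for \<kappa>
  proof -
    \<comment> \<open>\<open>G1\<close>, \<open>G2\<close>, \<open>G3\<close> and \<open>G4\<close> are the factors of \<open>\<delta>\<close>, \<open>h\<close>, \<open>\<eta>\<close> and \<open>\<zeta>\<close> in \<open>euler_error\<close>; each of these four gets the share \<open>\<mu>\<close>.\<close>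
    define G1 where "G1 = (8 * T * K\<^sup>2 + 256 * K\<^sup>2) * Q"
    define G2 where "G2 = 12 * T * K\<^sup>2 * b / c\<^sup>2 * Q"
    define G4 where "G4 = 1024 * K\<^sup>2 * Q"
    have G: "0 \<le> G1" "0 \<le> G2" "0 \<le> G4" using T_pos Q b by (auto simp: G1_def G2_def G4_def)
    define \<mu> where "\<mu> = \<kappa> / 16"
    have \<mu>: "\<mu> > 0" using \<kappa> by (simp add: \<mu>_def)
    have share: "0 < \<mu> / (g + 1)" "g * (\<mu> / (g + 1)) \<le> \<mu>" if "0 \<le> g" for g
    proof -
      show "0 < \<mu> / (g + 1)" using \<mu> that by simp
      have "g * \<mu> \<le> \<mu> * (g + 1)" using \<mu> by (simp add: algebra_simps)
      then show "g * (\<mu> / (g + 1)) \<le> \<mu>" using that by (simp add: pos_divide_le_eq)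
    qed
    define \<zeta> where "\<zeta> = \<mu> / (G4 + 1)"
    have \<zeta>: "0 < \<zeta>" using share(1)[OF G(3)] by (simp add: \<zeta>_def)
    from eventually_happens'[OF sequentially_bot ennreal_tendsto_0D[OF psq_clip_tendsto[OF L2F_D(3,4)[OF XL]] \<zeta>]]
    obtain R :: nat where R: "psq (\<lambda>s \<omega>. cut T X s \<omega> - clip (real R) (cut T X s \<omega>)) < ennreal \<zeta>" by blast
    define G3 where "G3 = 256 * (real R)\<^sup>2 * Q"
    have G3: "0 \<le> G3" using Q by (simp add: G3_def)
    define \<eta> where "\<eta> = \<mu> / (G3 + 1)"
    have \<eta>: "0 < \<eta>" using share(1)[OF G3] by (simp add: \<eta>_def)
    define \<delta> where "\<delta> = \<mu> / (G1 + 1)"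
    have \<delta>: "0 < \<delta>" using share(1)[OF G(1)] by (simp add: \<delta>_def)
    define \<epsilon> where "\<epsilon> = min (\<delta> / (2 * T)) (4 * \<mu>)"
    have \<epsilon>: "0 < \<epsilon>" "\<epsilon> \<le> 4 * \<mu>" "T * \<epsilon> \<le> \<delta> / 2"
    proof -
      show "0 < \<epsilon>" "\<epsilon> \<le> 4 * \<mu>" using \<delta> T_pos \<mu> by (auto simp: \<epsilon>_def)
      have "T * \<epsilon> \<le> T * (\<delta> / (2 * T))" using T_pos by (intro mult_left_mono) (auto simp: \<epsilon>_def)
      then show "T * \<epsilon> \<le> \<delta> / 2" using T_pos by simp
    qed
    from CF_uniform[OF X \<epsilon>(1)] obtain d where d: "d > 0"
      "\<And>s t. s \<in> {0..T} \<Longrightarrow> t \<in> {0..T} \<Longrightarrow> \<bar>s - t\<bar> < d \<Longrightarrow> msq M (\<lambda>\<omega>. X s \<omega> - X t \<omega>) \<le> ennreal \<epsilon>" by blast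
    define h0 where "h0 = min (min (d / 2) (\<delta> / (4 * b + 1))) (min (\<mu> / (G2 + 1)) (1 / (2 * (K + 1))))"
    have h0: "0 < h0" using d \<delta> b K_nonneg share(1)[OF G(2)] by (auto simp: h0_def)
    have HK: "norm (diag_part (A1 s \<omega>)) \<le> K" if "s \<in> {0..T}" "\<omega> \<in> space M" for s \<omega>
      by (rule order_trans[OF norm_diag_part_le A1_le[OF that]])
    have pH: "pmeas (cut T (\<lambda>s \<omega>. diag_part (A1 s \<omega>)))"
    proof -
      have [measurable]: "(\<lambda>z. cut T A1 (fst z) (snd z)) \<in> borel_measurable (lborel \<Otimes>\<^sub>M M)"
        using cut_A1(1)[OF order_refl] by (simp add: pmeas_def)
      have "cut T (\<lambda>s \<omega>. diag_part (A1 s \<omega>)) = (\<lambda>s \<omega>. diag_part (cut T A1 s \<omega>))"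
        by (auto simp: cut_def indicator_def diag_part_def vec_eq_iff fun_eq_iff)
      then show ?thesis unfolding pmeas_def by simp
    qed
    from sampling_approximates[OF pH T_pos K_nonneg HK \<eta>] obtain m0 where
      m0: "\<And>m. m0 \<le> m \<Longrightarrow> \<exists>\<theta>. 0 < \<theta> \<and> \<theta> \<le> T / real (Suc m) \<and>
        psq (\<lambda>s \<omega>. cut T (\<lambda>s \<omega>. diag_part (A1 s \<omega>)) s \<omega> - grid_process \<theta> (T / real (Suc m)) m (\<lambda>i \<omega>. diag_part (A1 (\<theta> + real i * (T / real (Suc m))) \<omega>)) s \<omega>) \<le> ennreal \<eta>"
      by blast
    obtain m1 :: nat where m1: "T / h0 < real m1" using reals_Archimedean2 by blast
    define m where "m = max m0 m1"
    define h where "h = T / real (Suc m)"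
    have h: "0 < h" "h \<le> h0" "real (Suc m) * h = T"
    proof -
      show "0 < h" using T_pos by (simp add: h_def)
      have "T / h0 < real (Suc m)" using m1 by (simp add: m_def)
      then show "h \<le> h0" using h0 unfolding h_def by (simp add: field_simps)
      show "real (Suc m) * h = T" by (simp add: h_def)
    qed
    have mh: "real m * h = T - h" using h(3) by (simp add: algebra_simps)
    have hb: "h \<le> d / 2" "h \<le> \<delta> / (4 * b + 1)" "h \<le> \<mu> / (G2 + 1)" "h \<le> 1 / (2 * (K + 1))" using h(2) by (auto simp: h0_def)
    obtain \<theta> where \<theta>: "0 < \<theta>" "\<theta> \<le> h" and samp:
      "psq (\<lambda>s \<omega>. cut T (\<lambda>s \<omega>. diag_part (A1 s \<omega>)) s \<omega> - grid_process \<theta> h m (\<lambda>i \<omega>. diag_part (A1 (\<theta> + real i * h) \<omega>)) s \<omega>) \<le> ennreal \<eta>"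
      using m0[of m] unfolding h_def[symmetric] by (auto simp: m_def)
    interpret E: euler_scheme M W T A0 A1 \<phi> X \<theta> h c m
    proof unfold_locales
      show "0 \<le> \<theta>" "\<theta> + real m * h \<le> T" using \<theta> mh by linarith+
    qed (fact \<phi> X Xm X_eq h(1) c(1))+
    have mod: "msq M (\<lambda>\<omega>. X s \<omega> - X t \<omega>) \<le> ennreal \<epsilon>" if "s \<in> {0..T}" "t \<in> {0..T}" "\<bar>s - t\<bar> \<le> h" for s t
      using that hb(1) d(1) by (intro d(2)) auto
    have Kh: "K * h \<le> 1/2"
    proof -
      have "K * h \<le> K * (1 / (2 * (K + 1)))" using hb(4) K_nonneg by (intro mult_left_mono) auto
      also have "\<dots> \<le> 1/2" using K_nonneg by (simp add: divide_simps)
      finally show ?thesis .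
    qed
    have Xerr: "psq (\<lambda>s \<omega>. E.gX m s \<omega> - cut T X s \<omega>) \<le> ennreal \<delta>"
    proof -
      have "psq (\<lambda>s \<omega>. E.gX m s \<omega> - cut T X s \<omega>) \<le> ennreal (2 * h * b + T * \<epsilon>)"
        using \<epsilon>(1) \<theta> mh by (intro E.grid_X_error b mod) (auto simp: E.\<tau>_def)
      also have "\<dots> \<le> ennreal \<delta>"
      proof (rule ennreal_leI)
        have "h * (4 * b + 1) \<le> \<delta>" using hb(2) b(1) by (simp add: pos_le_divide_eq add_nonneg_pos)
        then have "2 * h * b \<le> \<delta> / 2" using h(1) by (simp add: algebra_simps)
        then show "2 * h * b + T * \<epsilon> \<le> \<delta>" using \<epsilon>(3) by simp
      qed
      finally show ?thesis .
    qed
    have aerr: "psq (\<lambda>s \<omega>. grid_process \<theta> h m E.a s \<omega> - cut T (\<lambda>s \<omega>. diag_part (A1 s \<omega>)) s \<omega>) \<le> ennreal \<eta>"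
    proof -
      have "E.a = (\<lambda>i \<omega>. diag_part (A1 (\<theta> + real i * h) \<omega>))" by (simp add: fun_eq_iff E.a_def E.\<tau>_def)
      then show ?thesis using samp by (subst psq_minus_commute) simp
    qed
    define \<delta>' where "\<delta>' = 4 * (K\<^sup>2 * \<delta> + (real R)\<^sup>2 * \<eta> + 4 * K\<^sup>2 * \<zeta>)"
    have \<delta>': "0 \<le> \<delta>'" using \<delta> \<eta> \<zeta> by (simp add: \<delta>'_def)
    have nerr: "psq (\<lambda>s \<omega>. E.gaX m s \<omega> - noise T X s \<omega>) \<le> ennreal \<delta>'"
      unfolding \<delta>'_def using \<delta> \<eta> \<zeta> R
      by (intro E.noise_coefficient_error[OF offdiag_all_times(2)[OF coeff]] Xerr aerr) auto
    have total: "(8 * T * K\<^sup>2 * \<delta> + 12 * T * K\<^sup>2 * b * h / c\<^sup>2 + 64 * \<delta>') * Q \<le> 4 * \<mu>"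
    proof -
      have "(8 * T * K\<^sup>2 * \<delta> + 12 * T * K\<^sup>2 * b * h / c\<^sup>2 + 64 * \<delta>') * Q = G1 * \<delta> + G2 * h + G3 * \<eta> + G4 * \<zeta>"
        by (simp add: \<delta>'_def G1_def G2_def G3_def G4_def algebra_simps)
      moreover have "G1 * \<delta> \<le> \<mu>" unfolding \<delta>_def by (rule share(2)[OF G(1)])
      moreover have "G2 * h \<le> \<mu>" using mult_left_mono[OF hb(3) G(2)] share(2)[OF G(2)] by linarith
      moreover have "G3 * \<eta> \<le> \<mu>" unfolding \<eta>_def by (rule share(2)[OF G3])
      moreover have "G4 * \<zeta> \<le> \<mu>" unfolding \<zeta>_def by (rule share(2)[OF G(3)])
      ultimately show ?thesis by linarith
    qed
    define k where "k = min m (nat \<lfloor>t / h\<rfloor>)"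
    have k: "k \<le> m" by (simp add: k_def)
    \<comment> \<open>Some grid point is within \<open>h\<close> of \<open>t\<close>; near \<open>T\<close> it is the last one.\<close>
    have near: "\<bar>E.\<tau> k - t\<bar> \<le> h"
    proof (cases "nat \<lfloor>t / h\<rfloor> \<le> m")
      case True
      define f where "f = nat \<lfloor>t / h\<rfloor>"
      have "real f = real_of_int \<lfloor>t / h\<rfloor>" using t h by (simp add: f_def)
      then have "real f \<le> t / h" "t / h < real f + 1" by linarith+
      then have "real f * h \<le> t" "t < (real f + 1) * h" using h(1) by (auto simp: pos_le_divide_eq pos_divide_less_eq)
      then show ?thesis using True \<theta> by (simp add: k_def E.\<tau>_def f_def[symmetric] algebra_simps)
    next
      case False
      then have "real (Suc m) \<le> real (nat \<lfloor>t / h\<rfloor>)" by linarith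
      also have "real (nat \<lfloor>t / h\<rfloor>) \<le> t / h" using t h by simp
      finally have "real (Suc m) * h \<le> t" using h(1) by (simp add: pos_le_divide_eq)
      then have "t = T" using h(3) t by auto
      then show ?thesis using False \<theta> mh by (simp add: k_def E.\<tau>_def)
    qed
    have err: "msq M (\<lambda>\<omega>. E.Y k \<omega> - X (E.\<tau> k) \<omega>) \<le> ennreal (4 * \<mu>)"
      using E.euler_error[OF less_imp_le[OF \<delta>] Xerr \<delta>' nerr b k] total unfolding Q_def by (meson ennreal_leI order_trans)
    have Y0: "AE \<omega> in M. 0 \<le> E.Y k \<omega>"
      by (rule E.euler_nonneg[OF coeff A0_mono \<phi>_mono Kh c(2) k])
    have tk: "E.\<tau> k \<in> {0..T}" by (rule E.\<tau>_in[OF k])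
    \<comment> \<open>The distance from \<open>X t\<close> to a nonnegative vector is at least its negative part.\<close>
    have "msq M (\<lambda>\<omega>. neg_part (X t \<omega>)) \<le> msq M (\<lambda>\<omega>. E.Y k \<omega> - X t \<omega>)"
    proof (rule msq_mono_AE, use Y0 in eventually_elim)
      case (elim \<omega>)
      show ?case
      proof (rule norm_vec_mono)
        fix i
        have "0 \<le> E.Y k \<omega> $ i" using elim by (simp add: less_eq_vec_def)
        then show "\<bar>neg_part (X t \<omega>) $ i\<bar> \<le> \<bar>(E.Y k \<omega> - X t \<omega>) $ i\<bar>" by auto
      qed
    qed
    also have "\<dots> \<le> 2 * msq M (\<lambda>\<omega>. E.Y k \<omega> - X (E.\<tau> k) \<omega>) + 2 * msq M (\<lambda>\<omega>. X (E.\<tau> k) \<omega> - X t \<omega>)"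
      by (intro msq_triangle E.Y_measurable E.X_grid_measurable CF_D(4)[OF X] k t)
    also have "\<dots> \<le> 2 * ennreal (4 * \<mu>) + 2 * ennreal (4 * \<mu>)"
      using \<epsilon>(2) by (intro add_mono mult_left_mono err order_trans[OF mod[OF tk t near]] ennreal_leI) auto
    also have "\<dots> = ennreal \<kappa>"
      using \<mu> by (simp add: \<mu>_def numeral_mult_ennreal ennreal_plus[symmetric] del: ennreal_plus)
    finally show ?thesis .
  qed
  have "msq M (\<lambda>\<omega>. neg_part (X t \<omega>)) = 0"
  proof (rule ccontr)
    assume "msq M (\<lambda>\<omega>. neg_part (X t \<omega>)) \<noteq> 0"
    then have "0 < msq M (\<lambda>\<omega>. neg_part (X t \<omega>))" by (simp add: zero_less_iff_neq_zero)
    then obtain x where x: "0 < x" "x < msq M (\<lambda>\<omega>. neg_part (X t \<omega>))" using dense by blast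
    then have "x < top" by (metis order.strict_trans2 top_greatest)
    then have "0 < enn2real x" "ennreal (enn2real x) = x" using x(1) by (auto simp: enn2real_positive_iff)
    with main[of "enn2real x"] x(2) show False by simp
  qed
  moreover have "(\<lambda>\<omega>. neg_part (X t \<omega>)) \<in> borel_measurable M" using CF_D(4)[OF X t] by measurable
  ultimately have "AE \<omega> in M. neg_part (X t \<omega>) = 0" by (simp add: msq_eq_0_iff)
  then show ?thesis
  proof eventually_elim
    case (elim \<omega>)
    have "max 0 (- X t \<omega> $ i) = 0" for i using arg_cong[OF elim, of "\<lambda>v. v $ i"] by simp
    then have "0 \<le> X t \<omega> $ i" for i by (metis max.cobounded2 neg_le_0_iff_le)
    then show ?case by (simp add: less_eq_vec_def)
  qed
qed

end

theorem proposition2p9: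
  fixes M :: "'a measure" and W :: "real \<Rightarrow> 'a \<Rightarrow> real" and T :: real
    and A0 :: "real \<Rightarrow> real \<Rightarrow> 'a \<Rightarrow> real^'n^'n" and A1 :: "real \<Rightarrow> 'a \<Rightarrow> real^'n^'n"
  assumes "prob_space M" and "complete_measure M"
    and "standard_brownian_motion M W"
    and "T > 0"
    and "admissible_coefficients M W T A0 A1"
  shows
   "((AE (t, s) in lborel. (t, s) \<in> Delta_star T \<longrightarrow>
        (AE \<omega> in M. A0 t s \<omega> \<in> nonneg_matrices \<and> A1 s \<omega> = 0))
     \<longrightarrow>
     (\<forall>\<phi>\<in>L2F M W T.
        (AE t in lborel. t \<in> {0..T} \<longrightarrow> (AE \<omega> in M. 0 \<le> \<phi> t \<omega>)) \<longrightarrow>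
        (\<exists>X. L2F_solution M W T A0 A1 \<phi> X \<and>
           (\<forall>Y. L2F_solution M W T A0 A1 \<phi> Y \<longrightarrow>
              (AE t in lborel. t \<in> {0..T} \<longrightarrow> (AE \<omega> in M. Y t \<omega> = X t \<omega>))) \<and>
           (AE t in lborel. t \<in> {0..T} \<longrightarrow> (AE \<omega> in M. \<phi> t \<omega> \<le> X t \<omega> \<and> 0 \<le> \<phi> t \<omega>)))))
    \<and>
    ((AE (t, s) in lborel. (t, s) \<in> Delta_star T \<longrightarrow>
        (AE \<omega> in M. A0 t s \<omega> \<in> offdiag_nonneg_matrices \<and> A1 s \<omega> \<in> diagonal_matrices)) \<and>
     (\<exists>\<rho> :: real \<Rightarrow> real.
        continuous_on {0..T} \<rho> \<and> mono_on {0..T} \<rho> \<and> (\<forall>r\<in>{0..T}. 0 \<le> \<rho> r) \<and> \<rho> 0 = 0 \<and>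
        (\<forall>t\<in>{0..T}. \<forall>t'\<in>{0..T}. \<forall>s\<in>{0..min t t'}.
           AE \<omega> in M. norm (A0 t s \<omega> - A0 t' s \<omega>) \<le> \<rho> \<bar>t - t'\<bar>)) \<and>
     (\<forall>s t \<tau>. 0 \<le> s \<and> s \<le> t \<and> t \<le> \<tau> \<and> \<tau> \<le> T \<longrightarrow>
        (AE \<omega> in M. A0 \<tau> s \<omega> - A0 t s \<omega> \<in> nonneg_matrices))
     \<longrightarrow>
     (\<forall>\<phi>\<in>CF M W T.
        (\<forall>t \<tau>. 0 \<le> t \<and> t \<le> \<tau> \<and> \<tau> \<le> T \<longrightarrow>
           (AE \<omega> in M. \<phi> t \<omega> \<le> \<phi> \<tau> \<omega> \<and> 0 \<le> \<phi> t \<omega>)) \<longrightarrow>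
        (\<exists>X. CF_solution M W T A0 A1 \<phi> X \<and>
           (\<forall>Y. CF_solution M W T A0 A1 \<phi> Y \<longrightarrow>
              (\<forall>t\<in>{0..T}. AE \<omega> in M. Y t \<omega> = X t \<omega>)) \<and>
           (\<forall>t\<in>{0..T}. AE \<omega> in M. 0 \<le> X t \<omega>))))"
proof -
  interpret volterra M W T A0 A1
    by (intro volterra.intro brownian_setting.intro brownian_setting_axioms.intro volterra_axioms.intro assms)
  show ?thesis
  proof (intro conjI impI ballI)
    fix \<phi> :: "real \<Rightarrow> 'a \<Rightarrow> real^'n"
    assume coeff: "AE (t, s) in lborel. (t, s) \<in> Delta_star T \<longrightarrow> (AE \<omega> in M. A0 t s \<omega> \<in> nonneg_matrices \<and> A1 s \<omega> = 0)"
      and \<phi>: "\<phi> \<in> L2F M W T" and \<phi>0: "AE t in lborel. t \<in> {0..T} \<longrightarrow> (AE \<omega> in M. 0 \<le> \<phi> t \<omega>)"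
    obtain Z where Z: "(\<lambda>t \<omega>. \<phi> t \<omega> + Z t \<omega>) \<in> L2F M W T"
      "\<And>t. t \<in> {0..T} \<Longrightarrow> volt (\<lambda>t \<omega>. \<phi> t \<omega> + Z t \<omega>) (Z t) t"
      using volterra_solution_exists[OF \<phi>] by blast
    define X where "X t \<omega> = \<phi> t \<omega> + Z t \<omega>" for t \<omega>
    have X: "X \<in> L2F M W T" using Z(1) by (simp add: X_def[abs_def])
    have X_eq: "AE t in lborel. t \<in> {0..T} \<longrightarrow> volt X (\<lambda>\<omega>. X t \<omega> - \<phi> t \<omega>) t"
      using Z(2) by (simp add: X_def[abs_def])
    show "\<exists>X. L2F_solution M W T A0 A1 \<phi> X \<and>
           (\<forall>Y. L2F_solution M W T A0 A1 \<phi> Y \<longrightarrow>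
              (AE t in lborel. t \<in> {0..T} \<longrightarrow> (AE \<omega> in M. Y t \<omega> = X t \<omega>))) \<and>
           (AE t in lborel. t \<in> {0..T} \<longrightarrow> (AE \<omega> in M. \<phi> t \<omega> \<le> X t \<omega> \<and> 0 \<le> \<phi> t \<omega>))"
    proof (intro exI[of _ X] conjI allI impI)
      show "L2F_solution M W T A0 A1 \<phi> X"
        unfolding L2F_solution_def volterra_eq_at_iff using X X_eq by blast
      show "AE t in lborel. t \<in> {0..T} \<longrightarrow> (AE \<omega> in M. Y t \<omega> = X t \<omega>)" if "L2F_solution M W T A0 A1 \<phi> Y" for Y
        using that unfolding L2F_solution_def volterra_eq_at_iff
        by (intro volterra_solution_unique(2)[OF _ X _ X_eq]) auto
      show "AE t in lborel. t \<in> {0..T} \<longrightarrow> (AE \<omega> in M. \<phi> t \<omega> \<le> X t \<omega> \<and> 0 \<le> \<phi> t \<omega>)"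
        by (rule comparison_without_noise[OF coeff X \<phi>0 X_eq])
    qed
  next
    fix \<phi> :: "real \<Rightarrow> 'a \<Rightarrow> real^'n"
    assume hyp: "(AE (t, s) in lborel. (t, s) \<in> Delta_star T \<longrightarrow>
        (AE \<omega> in M. A0 t s \<omega> \<in> offdiag_nonneg_matrices \<and> A1 s \<omega> \<in> diagonal_matrices)) \<and>
     (\<exists>\<rho> :: real \<Rightarrow> real.
        continuous_on {0..T} \<rho> \<and> mono_on {0..T} \<rho> \<and> (\<forall>r\<in>{0..T}. 0 \<le> \<rho> r) \<and> \<rho> 0 = 0 \<and>
        (\<forall>t\<in>{0..T}. \<forall>t'\<in>{0..T}. \<forall>s\<in>{0..min t t'}.
           AE \<omega> in M. norm (A0 t s \<omega> - A0 t' s \<omega>) \<le> \<rho> \<bar>t - t'\<bar>)) \<and>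
     (\<forall>s t \<tau>. 0 \<le> s \<and> s \<le> t \<and> t \<le> \<tau> \<and> \<tau> \<le> T \<longrightarrow>
        (AE \<omega> in M. A0 \<tau> s \<omega> - A0 t s \<omega> \<in> nonneg_matrices))"
      and \<phi>: "\<phi> \<in> CF M W T"
      and \<phi>_mono: "\<forall>t \<tau>. 0 \<le> t \<and> t \<le> \<tau> \<and> \<tau> \<le> T \<longrightarrow> (AE \<omega> in M. \<phi> t \<omega> \<le> \<phi> \<tau> \<omega> \<and> 0 \<le> \<phi> t \<omega>)"
    obtain \<psi> where \<psi>: "\<psi> \<in> CF M W T" "measurable_process M T \<psi>" "\<And>t. t \<in> {0..T} \<Longrightarrow> AE \<omega> in M. \<psi> t \<omega> = \<phi> t \<omega>"
      using CF_measurable_modification[OF \<phi>] by blast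
    have \<psi>L: "\<psi> \<in> L2F M W T" using \<open>T > 0\<close> by (intro CF_L2F \<psi>) auto
    obtain Z where Z: "Z \<in> CF M W T" "(\<lambda>t \<omega>. \<psi> t \<omega> + Z t \<omega>) \<in> L2F M W T"
      "\<And>t. t \<in> {0..T} \<Longrightarrow> volt (\<lambda>t \<omega>. \<psi> t \<omega> + Z t \<omega>) (Z t) t"
      using volterra_solution_exists[OF \<psi>L] by blast
    define X where "X t \<omega> = \<psi> t \<omega> + Z t \<omega>" for t \<omega>
    have XL: "X \<in> L2F M W T" using Z(2) by (simp add: X_def[abs_def])
    have X: "X \<in> CF M W T" unfolding X_def[abs_def] by (rule CF_add[OF \<psi>(1) Z(1)])
    have Xm: "measurable_process M T X" by (rule L2F_D(1)[OF XL])
    have X_eq: "volt X (\<lambda>\<omega>. X t \<omega> - \<phi> t \<omega>) t" if t: "t \<in> {0..T}" for t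
    proof (rule volt_cong_AE)
      show "volt X (Z t) t" using Z(3)[OF t] by (simp add: X_def[abs_def])
      show "AE \<omega> in M. X t \<omega> - \<phi> t \<omega> = Z t \<omega>" using \<psi>(3)[OF t] by eventually_elim (simp add: X_def)
    qed
    show "\<exists>X. CF_solution M W T A0 A1 \<phi> X \<and>
           (\<forall>Y. CF_solution M W T A0 A1 \<phi> Y \<longrightarrow> (\<forall>t\<in>{0..T}. AE \<omega> in M. Y t \<omega> = X t \<omega>)) \<and>
           (\<forall>t\<in>{0..T}. AE \<omega> in M. 0 \<le> X t \<omega>)"
    proof (intro exI[of _ X] conjI allI impI ballI)
      show "CF_solution M W T A0 A1 \<phi> X"
        unfolding CF_solution_def volterra_eq_at_iff using X Xm X_eq by blast
      show "AE \<omega> in M. 0 \<le> X t \<omega>" if "t \<in> {0..T}" for t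
        using hyp \<phi>_mono by (intro comparison_with_noise[OF _ _ _ \<phi> X Xm X_eq that]) auto
      show "AE \<omega> in M. Y t \<omega> = X t \<omega>" if Y: "CF_solution M W T A0 A1 \<phi> Y" and t: "t \<in> {0..T}" for Y t
      proof -
        have YC: "Y \<in> CF M W T" and Ym: "measurable_process M T Y"
          and Y_eq: "\<And>t. t \<in> {0..T} \<Longrightarrow> volt Y (\<lambda>\<omega>. Y t \<omega> - \<phi> t \<omega>) t"
          using Y unfolding CF_solution_def volterra_eq_at_iff by auto
        have YL: "Y \<in> L2F M W T" using \<open>T > 0\<close> by (intro CF_L2F YC Ym) auto
        have "psq (\<lambda>s \<omega>. cut T Y s \<omega> - cut T X s \<omega>) = 0"
          by (rule volterra_solution_unique(1)[OF YL XL, of \<phi>]) (use X_eq Y_eq in auto)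
        from volt_AE_eq[OF YL XL this t Y_eq[OF t] X_eq[OF t]]
        show ?thesis by eventually_elim simp
      qed
    qed
  qed
qed

end
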